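(* Let $\mathbf{A}_N$ be an $N\times N$ random Hermitian non-negative definite matrix with $\mathbf{A}_N\overset{a.s.}{\longmapsto}A\in\mathcal{M}_{\mathrm{alg}}$, and let $\mathbf{W}_N(c_N)$ be an $N\times N$ Wishart-like random matrix independent of $\mathbf{A}_N$. If $c_N\to c\in(0,\infty)$ as $N\to\infty$, then $$\mathbf{B}_N=\mathbf{A}_N\times\mathbf{W}_N(c_N)\overset{a.s.}{\longmapsto}B\in\mathcal{M}_{\mathrm{alg}}.$$
   Context: For an $N\times N$ matrix $\mathbf{M}$ with real eigenvalues, let $F^{\mathbf{M}}(x)=\frac1N\#\{\text{eigenvalues of }\mathbf{M}\le x\}$ (counted with multiplicity). For a sequence of random matrices $\mathbf{A}_N$ of size $N\times N$ with real eigenvalues, $\mathbf{A}_N\overset{a.s.}{\longmapsto}A$ means that there is a non-random probability distribution function $F^A$ on $\mathbb{R}$ such that, almost surely, $F^{\mathbf{A}_N}(x)\to F^A(x)$ as $N\to\infty$ at every continuity point $x$ of $F^A$; here $A$ is only a symbol naming the limit. The Stieltjes transform of $F^A$ is $m_A(z)=\int\frac{1}{x-z}\,dF^A(x)$ for $z\in\mathbb{C}^+$ (the open upper half plane). The distribution $F^A$ is algebraic if there is a nonzero bivariate polynomial $L(m,z)$ with real coefficients such that $L(m_A(z),z)=0$ for all $z\in\mathbb{C}^+$. One writes $\mathbf{A}_N\overset{a.s.}{\longmapsto}A\in\mathcal{M}_{\mathrm{alg}}$ if $\mathbf{A}_N\overset{a.s.}{\longmapsto}A$ and $F^A$ is algebraic.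 A conclusion $\mathbf{B}_N\overset{a.s.}{\longmapsto}B\in\mathcal{M}_{\mathrm{alg}}$ asserts both that the limiting distribution $F^B$ exists and that it is algebraic. An $N\times L$ Gaussian-like random matrix is $\mathbf{G}_{N,L}=\frac{1}{\sqrt{L}}\mathbf{Y}_{N,L}$, where $\mathbf{Y}_{N,L}$ is an $N\times L$ matrix with i.i.d. (real or complex) entries of zero mean and unit variance, with all higher order moments bounded (uniformly in the dimensions). A Wishart-like random matrix is $\mathbf{W}_N(c_N)=\mathbf{G}_{N,L}\mathbf{G}_{N,L}'$ with $\mathbf{G}_{N,L}$ Gaussian-like and $c_N=N/L$; the prime $'$ denotes (conjugate) transpose. *)

theory Defs
  imports
    "HOL-Probability.Probability"
    "Jordan_Normal_Form.Char_Poly"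
    "Jordan_Normal_Form.Schur_Decomposition"
begin

text \<open>Measurability into this space is joint measurability of the entries; the type of
  matrices carries no topology in the library.\<close>

definition mat_borel :: "nat \<Rightarrow> nat \<Rightarrow> complex mat measure" where
  "mat_borel n m =
     vimage_algebra (carrier_mat n m)
       (\<lambda>M. \<lambda>p\<in>{..<n} \<times> {..<m}. M $$ p)
       (Pi\<^sub>M ({..<n} \<times> {..<m}) (\<lambda>_. borel))"

definition random_matrix :: "'w measure \<Rightarrow> nat \<Rightarrow> nat \<Rightarrow> ('w \<Rightarrow> complex mat) \<Rightarrow> bool" where
  "random_matrix P n m X \<longleftrightarrow> X \<in> P \<rightarrow>\<^sub>M mat_borel n m"

definition real_eigenvalues :: "complex mat \<Rightarrow> bool" where
  "real_eigenvalues M \<longleftrightarrow> (\<forall>l. eigenvalue M l \<longrightarrow> l \<in> \<real>)"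

text \<open>Multiplicities are algebraic. This is meant for matrices with real eigenvalues only:
  any other eigenvalue is not counted.\<close>

definition esd :: "complex mat \<Rightarrow> real \<Rightarrow> real" where
  "esd M x =
     real (\<Sum>t | t \<le> x \<and> eigenvalue M (complex_of_real t).
             Polynomial.order (complex_of_real t) (char_poly M)) / real (dim_row M)"

text \<open>A probability distribution function on the line is the \<open>cdf\<close> of a \<open>real_distribution\<close>,
  and \<open>weak_conv\<close> is pointwise convergence at its continuity points.\<close>

definition esd_limit :: "'w measure \<Rightarrow> (nat \<Rightarrow> 'w \<Rightarrow> complex mat) \<Rightarrow> real measure \<Rightarrow> bool" where
  "esd_limit P X \<mu> \<longleftrightarrow>
     (\<forall>N>0. random_matrix P N N (X N) \<and> (\<forall>\<omega>\<in>space P. real_eigenvalues (X N \<omega>))) \<and>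
     real_distribution \<mu> \<and>
     (AE \<omega> in P. weak_conv (\<lambda>N. esd (X N \<omega>)) (cdf \<mu>))"

definition stieltjes :: "real measure \<Rightarrow> complex \<Rightarrow> complex" where
  "stieltjes \<mu> z = (\<integral>x. 1 / (complex_of_real x - z) \<partial>\<mu>)"

text \<open>In \<open>L :: real poly poly\<close> the outer variable is \<open>m\<close> and the inner one is \<open>z\<close>.\<close>

definition bipoly :: "real poly poly \<Rightarrow> complex \<Rightarrow> complex \<Rightarrow> complex" where
  "bipoly L m z = poly (map_poly (\<lambda>p. poly (map_poly complex_of_real p) z) L) m"

definition algebraic_distributions :: "real measure set" where
  "algebraic_distributions =
     {\<mu>. real_distribution \<mu> \<and>
         (\<exists>L. L \<noteq> 0 \<and> (\<forall>z. Im z > 0 \<longrightarrow> bipoly L (stieltjes \<mu> z) z = 0))}"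

definition hermitian_nonneg_definite :: "nat \<Rightarrow> complex mat \<Rightarrow> bool" where
  "hermitian_nonneg_definite n M \<longleftrightarrow>
     M \<in> carrier_mat n n \<and> mat_adjoint M = M \<and>
     (\<forall>v\<in>carrier_vec n. 0 \<le> Re ((M *\<^sub>v v) \<bullet>c v))"

text \<open>Real entries are the special case of complex entries with values in \<open>\<real>\<close>. For each \<open>N\<close> the
  entries are i.i.d., but their law may depend on \<open>N\<close>; only the moment bounds are uniform in \<open>N\<close>.
  The case \<open>k = 1\<close> of the bounds makes the entries integrable, so the mean is a genuine one, and
  since it is zero the variance is the integral of the squared modulus.\<close>

definition gaussian_like ::
  "'w measure \<Rightarrow> (nat \<Rightarrow> nat) \<Rightarrow> (nat \<Rightarrow> 'w \<Rightarrow> complex mat) \<Rightarrow> bool" where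
  "gaussian_like P L G \<longleftrightarrow>
     (\<exists>Y :: nat \<Rightarrow> 'w \<Rightarrow> complex mat.
        (\<forall>N>0. L N > 0 \<and> random_matrix P N (L N) (Y N) \<and>
           prob_space.indep_vars P (\<lambda>_. borel) (\<lambda>p \<omega>. Y N \<omega> $$ p) ({..<N} \<times> {..<L N}) \<and>
           (\<forall>p\<in>{..<N} \<times> {..<L N}. \<forall>q\<in>{..<N} \<times> {..<L N}.
              distr P borel (\<lambda>\<omega>. Y N \<omega> $$ p) = distr P borel (\<lambda>\<omega>. Y N \<omega> $$ q)) \<and>
           (\<forall>p\<in>{..<N} \<times> {..<L N}.
              (\<integral>\<omega>. Y N \<omega> $$ p \<partial>P) = 0 \<and>
              (\<integral>\<omega>. (cmod (Y N \<omega> $$ p))\<^sup>2 \<partial>P) = 1) \<and>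
           (\<forall>\<omega>\<in>space P.
              G N \<omega> = complex_of_real (1 / sqrt (real (L N))) \<cdot>\<^sub>m Y N \<omega>)) \<and>
        (\<forall>k::nat. \<exists>C. \<forall>N>0. \<forall>p\<in>{..<N} \<times> {..<L N}.
           integrable P (\<lambda>\<omega>. cmod (Y N \<omega> $$ p) ^ k) \<and>
           (\<integral>\<omega>. cmod (Y N \<omega> $$ p) ^ k \<partial>P) \<le> C))"

definition wishart_like ::
  "'w measure \<Rightarrow> (nat \<Rightarrow> nat) \<Rightarrow> (nat \<Rightarrow> 'w \<Rightarrow> complex mat) \<Rightarrow> bool" where
  "wishart_like P L W \<longleftrightarrow>
     (\<exists>G. gaussian_like P L G \<and>
        (\<forall>N>0. \<forall>\<omega>\<in>space P. W N \<omega> = G N \<omega> * mat_adjoint (G N \<omega>)))"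

end

theory Submission
  imports Defs "HOL-Complex_Analysis.Complex_Analysis"
begin

text \<open>
  All computations take place at negative real points \<open>- x\<close>, where the resolvent of \<open>A W\<close> involves only
  nonnegative definite matrices. Put \<open>gam \<mu> y = \<integral> l / (y + l) \<partial>\<mu>\<close>. For every \<open>x > 0\<close> there is a unique
  \<open>v\<close> with \<open>v + c * gam F\<^sub>A (x / v) = 1\<close>, and the limit law is characterised by
  \<open>gam F\<^sub>B x = (1 - v) / c\<close>.

  Given a matrix \<open>A\<close> of bounded norm, removing one column of \<open>Y\<close> at a time by the Sherman--Morrison
  formula shows that \<open>1 - N / L + (x / L) * E tr (x + A W)\<^sup>-\<^sup>1\<close> solves this equation, with \<open>F\<^sub>A\<close>
  replaced by the spectral distribution of \<open>A\<close>, up to a small error. Discarding the large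
  eigenvalues of \<open>A\<close> reduces the general case to this one, and since the left-hand side of the
  equation has slope at least \<open>1\<close> in \<open>v\<close>, an approximate solution is close to the exact one.
  Bounded differences and the Borel--Cantelli lemma replace the expectation by the trace itself, and
  the values of \<open>gam\<close> at the positive rationals determine the limit law. Substituting
  \<open>m\<^sub>A(z / u) = u m\<^sub>B(z)\<close> with \<open>u = 1 - c - c z m\<^sub>B(z)\<close> into the polynomial of \<open>F\<^sub>A\<close> gives one for
  \<open>F\<^sub>B\<close>, first at the negative rationals and then everywhere by the identity theorem.
\<close>

section \<open>Nonnegative definite matrices\<close>

text \<open>Neither \<open>A\<close> nor the entries of \<open>Y\<close> are bounded, the law of the
  entries may change with \<open>N\<close>, and nothing is known about the joint law for different
  \<open>N\<close>. Almost sure convergence therefore has to come from tail bounds summable in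
  \<open>N\<close> that depend neither on the size of \<open>A\<close> nor on that of the entries:
  changing one column of \<open>Y\<close> moves the trace of the resolvent by at most
  \<open>1 / x\<close>, whatever the matrices are. Since this is uniform in \<open>A\<close>, Fubini
  handles the randomness of \<open>A\<close>, and the mean over \<open>W\<close> alone is studied
  for one realisation of \<open>A\<close> at a time.

  The equation for \<open>v\<close> comes from two traces. Separating the columns turns
  \<open>x\<close> times the trace of the resolvent into \<open>N - L\<close> plus the sum of
  \<open>1 / (1 + q j)\<close>, where the quadratic form \<open>q j\<close> in column
  \<open>j\<close> stays close to a constant \<open>t\<close>; so \<open>v = 1 / (1 + t)\<close>.
  For the matrix defining \<open>t\<close>, \<open>W\<close> may be replaced by \<open>v\<close>
  times the identity, which makes \<open>v * t\<close> close to
  \<open>c * gam F\<^sub>A (x / v)\<close>; the equation is \<open>v * (1 + t) = 1\<close>.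
  Monotonicity of \<open>gam\<close> on the positive reals takes the place of a stability analysis
  in the upper half plane.\<close>

abbreviation cinner :: "complex vec \<Rightarrow> complex vec \<Rightarrow> complex" (infix "\<diamondop>" 70) where
  "v \<diamondop> w \<equiv> scalar_prod v (conjugate w)"

lemma adjoint_dim [simp]: "dim_row (mat_adjoint M) = dim_col M" "dim_col (mat_adjoint M) = dim_row M"
  by (auto simp: mat_adjoint_def)

lemma adjoint_index [simp]:
  fixes M :: "complex mat"
  shows "i < dim_col M \<Longrightarrow> j < dim_row M \<Longrightarrow> mat_adjoint M $$ (i, j) = cnj (M $$ (j, i))"
  unfolding mat_adjoint_def by (subst mat_of_rows_index) simp_all

lemma adjoint_carrier [simp]: "mat_adjoint M \<in> carrier_mat m n \<longleftrightarrow> M \<in> carrier_mat n m"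
  unfolding carrier_mat_def by auto

lemma adjoint_mult:
  fixes X Y :: "complex mat"
  assumes "X \<in> carrier_mat n m" "Y \<in> carrier_mat m k"
  shows "mat_adjoint (X * Y) = mat_adjoint Y * mat_adjoint X"
  using assms by (intro eq_matI) (auto simp: scalar_prod_def mult.commute)

lemma adjoint_add:
  fixes X Y :: "complex mat"
  assumes "X \<in> carrier_mat n m" "Y \<in> carrier_mat n m"
  shows "mat_adjoint (X + Y) = mat_adjoint X + mat_adjoint Y"
  using assms by (intro eq_matI) auto

lemma adjoint_minus:
  fixes X Y :: "complex mat"
  assumes "X \<in> carrier_mat n m" "Y \<in> carrier_mat n m"
  shows "mat_adjoint (X - Y) = mat_adjoint X - mat_adjoint Y"
  using assms by (intro eq_matI) auto

lemma adjoint_smult: "mat_adjoint (c \<cdot>\<^sub>m X) = cnj c \<cdot>\<^sub>m mat_adjoint (X :: complex mat)"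
  by (intro eq_matI) auto

lemma adjoint_one [simp]: "mat_adjoint (1\<^sub>m n) = (1\<^sub>m n :: complex mat)"
  by (intro eq_matI) auto

lemma adjoint_adjoint [simp]: "mat_adjoint (mat_adjoint X) = (X :: complex mat)"
  by (rule eq_matI) simp_all

lemma smult_mult_vec:
  fixes X :: "complex mat"
  assumes "X \<in> carrier_mat n m" "v \<in> carrier_vec m"
  shows "(c \<cdot>\<^sub>m X) *\<^sub>v v = c \<cdot>\<^sub>v (X *\<^sub>v v)"
  using assms by (intro eq_vecI) (auto simp: scalar_prod_def sum_distrib_left mult.assoc)

lemma inner_sum: "v \<in> carrier_vec n \<Longrightarrow> w \<in> carrier_vec n \<Longrightarrow> v \<diamondop> w = (\<Sum>i<n. v $ i * cnj (w $ i))"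
  by (auto simp: scalar_prod_def atLeast0LessThan)

lemma inner_swap:
  "v \<in> carrier_vec n \<Longrightarrow> w \<in> carrier_vec n \<Longrightarrow> w \<diamondop> v = cnj (v \<diamondop> (w :: complex vec))"
  by (simp add: inner_sum mult.commute)

lemma mult_vec_index:
  "X \<in> carrier_mat n m \<Longrightarrow> v \<in> carrier_vec m \<Longrightarrow> i < n \<Longrightarrow> (X *\<^sub>v v) $ i = (\<Sum>j<m. X $$ (i, j) * v $ j)"
  by (auto simp: scalar_prod_def atLeast0LessThan)

lemma mult_mat_index:
  "X \<in> carrier_mat n m \<Longrightarrow> Y \<in> carrier_mat m k \<Longrightarrow> i < n \<Longrightarrow> j < k \<Longrightarrow>
    (X * Y) $$ (i, j) = (\<Sum>l<m. X $$ (i, l) * Y $$ (l, j))"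
  by (auto simp: scalar_prod_def atLeast0LessThan)

lemma inner_adjoint:
  fixes X :: "complex mat"
  assumes X: "X \<in> carrier_mat n m" and v: "v \<in> carrier_vec m" and w: "w \<in> carrier_vec n"
  shows "(X *\<^sub>v v) \<diamondop> w = v \<diamondop> (mat_adjoint X *\<^sub>v w)"
proof -
  have "(X *\<^sub>v v) \<diamondop> w = (\<Sum>i<n. (X *\<^sub>v v) $ i * cnj (w $ i))"
    using assms by (intro inner_sum) auto
  also have "\<dots> = (\<Sum>i<n. \<Sum>j<m. X $$ (i, j) * v $ j * cnj (w $ i))"
    using assms by (intro sum.cong) (auto simp: mult_vec_index[of _ n m] sum_distrib_right simp del: index_mult_mat_vec)
  also have "\<dots> = (\<Sum>j<m. \<Sum>i<n. X $$ (i, j) * v $ j * cnj (w $ i))"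
    by (rule sum.swap)
  also have "\<dots> = (\<Sum>j<m. v $ j * cnj ((mat_adjoint X *\<^sub>v w) $ j))"
    using assms by (intro sum.cong)
      (auto simp: mult_vec_index[of _ m n] sum_distrib_left mult_ac simp del: index_mult_mat_vec intro!: sum.cong)
  also have "\<dots> = v \<diamondop> (mat_adjoint X *\<^sub>v w)"
    using assms by (intro inner_sum[symmetric]) auto
  finally show ?thesis .
qed

lemma inner_add_left:
  "u \<in> carrier_vec n \<Longrightarrow> v \<in> carrier_vec n \<Longrightarrow> w \<in> carrier_vec n \<Longrightarrow>
    (u + v) \<diamondop> (w :: complex vec) = u \<diamondop> w + v \<diamondop> w"
  by (simp add: inner_sum[of _ n] sum.distrib distrib_right)

lemma inner_minus_left:
  "u \<in> carrier_vec n \<Longrightarrow> v \<in> carrier_vec n \<Longrightarrow> w \<in> carrier_vec n \<Longrightarrow>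
    (u - v) \<diamondop> (w :: complex vec) = u \<diamondop> w - v \<diamondop> w"
  by (simp add: inner_sum[of _ n] sum_subtractf left_diff_distrib)

lemma inner_minus_right:
  "u \<in> carrier_vec n \<Longrightarrow> v \<in> carrier_vec n \<Longrightarrow> w \<in> carrier_vec n \<Longrightarrow>
    w \<diamondop> (u - v) = w \<diamondop> u - w \<diamondop> v"
  by (simp add: inner_sum[of _ n] sum_subtractf right_diff_distrib)

lemma inner_smult_left:
  "u \<in> carrier_vec n \<Longrightarrow> w \<in> carrier_vec n \<Longrightarrow> (c \<cdot>\<^sub>v u) \<diamondop> (w :: complex vec) = c * (u \<diamondop> w)"
  by (simp add: inner_sum[of _ n] sum_distrib_left mult_ac)

lemma inner_smult_right:
  "u \<in> carrier_vec n \<Longrightarrow> w \<in> carrier_vec n \<Longrightarrow> u \<diamondop> (c \<cdot>\<^sub>v w :: complex vec) = cnj c * (u \<diamondop> w)"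
  by (simp add: inner_sum[of _ n] sum_distrib_left mult_ac)

definition vnorm2 :: "complex vec \<Rightarrow> real" where
  "vnorm2 v = (\<Sum>i<dim_vec v. (cmod (v $ i))\<^sup>2)"

lemma vnorm2_nonneg [simp]: "0 \<le> vnorm2 v"
  by (auto simp: vnorm2_def intro: sum_nonneg)

lemma inner_self: "v \<diamondop> v = complex_of_real (vnorm2 v)"
  by (subst inner_sum[of _ "dim_vec v"]) (simp_all add: vnorm2_def complex_norm_square del: of_real_power)

lemma vnorm2_eq_0: "v \<in> carrier_vec n \<Longrightarrow> vnorm2 v = 0 \<Longrightarrow> v = 0\<^sub>v n"
  unfolding vnorm2_def by (subst (asm) sum_nonneg_eq_0_iff) auto

definition qform :: "complex mat \<Rightarrow> complex vec \<Rightarrow> real" where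
  "qform M v = Re ((M *\<^sub>v v) \<diamondop> v)"

abbreviation "hnd \<equiv> hermitian_nonneg_definite"

lemma hndI:
  "M \<in> carrier_mat n n \<Longrightarrow> mat_adjoint M = M \<Longrightarrow> (\<And>v. v \<in> carrier_vec n \<Longrightarrow> 0 \<le> qform M v) \<Longrightarrow> hnd n M"
  by (auto simp: hermitian_nonneg_definite_def qform_def)

lemma hnd_carrier [dest]: "hnd n M \<Longrightarrow> M \<in> carrier_mat n n"
  and hnd_adjoint: "hnd n M \<Longrightarrow> mat_adjoint M = M"
  and hnd_qform: "hnd n M \<Longrightarrow> v \<in> carrier_vec n \<Longrightarrow> 0 \<le> qform M v"
  by (auto simp: hermitian_nonneg_definite_def qform_def)

lemma qform_of_real:
  assumes "M \<in> carrier_mat n n" "mat_adjoint M = M" "v \<in> carrier_vec n"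
  shows "(M *\<^sub>v v) \<diamondop> v = complex_of_real (qform M v)"
proof -
  have "(M *\<^sub>v v) \<diamondop> v = v \<diamondop> (M *\<^sub>v v)"
    using inner_adjoint[OF assms(1,3,3)] assms(2) by simp
  also have "\<dots> = cnj ((M *\<^sub>v v) \<diamondop> v)"
    using assms by (intro inner_swap) auto
  finally show ?thesis
    by (metis qform_def Reals_cnj_iff complex_is_Real_iff complex_eq_iff Re_complex_of_real Im_complex_of_real)
qed

lemma qform_add:
  "X \<in> carrier_mat n n \<Longrightarrow> Y \<in> carrier_mat n n \<Longrightarrow> v \<in> carrier_vec n \<Longrightarrow> qform (X + Y) v = qform X v + qform Y v"
  by (simp add: qform_def add_mult_distrib_mat_vec[of _ n n] inner_add_left[of _ n])

lemma qform_smult: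
  "X \<in> carrier_mat n n \<Longrightarrow> v \<in> carrier_vec n \<Longrightarrow> qform (complex_of_real c \<cdot>\<^sub>m X) v = c * qform X v"
  by (simp add: qform_def smult_mult_vec[of _ n n] inner_smult_left[of _ n])

lemma qform_conj:
  "X \<in> carrier_mat n m \<Longrightarrow> M \<in> carrier_mat m m \<Longrightarrow> v \<in> carrier_vec n \<Longrightarrow>
    qform (X * M * mat_adjoint X) v = qform M (mat_adjoint X *\<^sub>v v)"
  by (simp add: qform_def assoc_mult_mat_vec[of _ n m _ n] assoc_mult_mat_vec[of _ m m _ n]
      assoc_mult_mat[of _ n m _ m _ n] inner_adjoint[of X n m])

lemma qform_one [simp]: "v \<in> carrier_vec n \<Longrightarrow> qform (1\<^sub>m n) v = vnorm2 v"
  by (simp add: qform_def inner_self)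

lemma hnd_add:
  assumes "hnd n X" "hnd n Y"
  shows "hnd n (X + Y)"
proof -
  have "X \<in> carrier_mat n n" "Y \<in> carrier_mat n n" using assms by auto
  then show ?thesis
    using assms by (intro hndI) (simp_all add: adjoint_add[of _ n n] hnd_adjoint qform_add[of _ n] hnd_qform)
qed

lemma hnd_smult: "hnd n X \<Longrightarrow> 0 \<le> c \<Longrightarrow> hnd n (complex_of_real c \<cdot>\<^sub>m X)"
  by (rule hndI) (auto simp: adjoint_smult hnd_adjoint qform_smult[of _ n] hnd_carrier intro!: mult_nonneg_nonneg hnd_qform)

lemma hnd_conj:
  assumes "hnd m M" "X \<in> carrier_mat n m"
  shows "hnd n (X * M * mat_adjoint X)"
proof (rule hndI)
  have M: "M \<in> carrier_mat m m" using assms by auto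
  show "X * M * mat_adjoint X \<in> carrier_mat n n" using M assms by auto
  show "mat_adjoint (X * M * mat_adjoint X) = X * M * mat_adjoint X"
    using M assms hnd_adjoint[OF assms(1)]
    by (simp add: adjoint_mult[of X n m "M * mat_adjoint X" n] adjoint_mult[of M m m "mat_adjoint X" n]
        assoc_mult_mat[of X n m M m "mat_adjoint X" n])
  show "0 \<le> qform (X * M * mat_adjoint X) v" if "v \<in> carrier_vec n" for v
    using M assms that by (subst qform_conj[OF assms(2) M that]) (auto intro!: hnd_qform[OF assms(1)])
qed

lemma hnd_one: "hnd n (1\<^sub>m n)"
  by (rule hndI) auto

text \<open>The discriminant argument behind Cauchy-Schwarz, in the shape needed there:
  \<open>b\<close> is the squared modulus of a mixed form and so occurs in both nonconstant terms.
  The choice \<open>t = 1 / d\<close> gives the bound.\<close>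

lemma quadratic_nonneg_imp:
  fixes a b d :: real
  assumes "\<And>t. 0 \<le> a - 2 * t * b + t\<^sup>2 * b * d" "0 \<le> b" "0 \<le> d"
  shows "b \<le> a * d"
proof (cases "d = 0")
  case True
  have "b = 0"
  proof (rule ccontr)
    assume "b \<noteq> 0"
    \<comment> \<open>At this \<open>t\<close> the value \<open>a - 2 * t * b\<close> equals
      \<open>-1\<close>.\<close>
    then show False using assms(1)[of "(a + 1) / (2 * b)"] True by (simp add: field_simps)
  qed
  then show ?thesis using True by simp
next
  case False
  then have "d > 0" using assms by simp
  then show ?thesis using assms(1)[of "1 / d"] by (simp add: field_simps power2_eq_square)
qed

text \<open>Nonnegativity of the form at \<open>u - t \<beta> v\<close>, where
  \<open>\<beta>\<close> is the mixed form and \<open>t\<close> is real: the complex factor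
  \<open>\<beta>\<close> turns the cross terms into the real number
  \<open>- 2 * t * (cmod \<beta>)\<^sup>2\<close>.\<close>

lemma hnd_cauchy_schwarz:
  assumes K: "hnd n K" and u: "u \<in> carrier_vec n" and v: "v \<in> carrier_vec n"
  shows "(cmod ((K *\<^sub>v u) \<diamondop> v))\<^sup>2 \<le> qform K u * qform K v"
proof (rule quadratic_nonneg_imp)
  have KC: "K \<in> carrier_mat n n" using K by auto
  define \<beta> where "\<beta> = (K *\<^sub>v u) \<diamondop> v"
  have "(K *\<^sub>v v) \<diamondop> u = v \<diamondop> (K *\<^sub>v u)"
    using inner_adjoint[OF KC v u] hnd_adjoint[OF K] by simp
  also have "\<dots> = cnj \<beta>"
    unfolding \<beta>_def using KC u v by (intro inner_swap[of _ n]) auto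
  finally have b': "(K *\<^sub>v v) \<diamondop> u = cnj \<beta>" .
  show "0 \<le> qform K u - 2 * t * (cmod ((K *\<^sub>v u) \<diamondop> v))\<^sup>2 + t\<^sup>2 * (cmod ((K *\<^sub>v u) \<diamondop> v))\<^sup>2 * qform K v" for t
  proof -
    define s where "s = complex_of_real t * \<beta>"
    have "0 \<le> qform K (u - s \<cdot>\<^sub>v v)" using u v by (intro hnd_qform[OF K]) auto
    also have "qform K (u - s \<cdot>\<^sub>v v) = Re ((K *\<^sub>v u) \<diamondop> u - cnj s * \<beta> - s * (cnj \<beta> - cnj s * ((K *\<^sub>v v) \<diamondop> v)))"
      using KC u v
      by (simp add: qform_def mult_minus_distrib_mat_vec[of _ n n] mult_mat_vec[of _ n n] inner_minus_left[of _ n]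
          inner_minus_right[of _ n] inner_smult_left[of _ n] inner_smult_right[of _ n] b' \<beta>_def algebra_simps)
    finally have *: "0 \<le> Re ((K *\<^sub>v u) \<diamondop> u - cnj s * \<beta> - s * (cnj \<beta> - cnj s * ((K *\<^sub>v v) \<diamondop> v)))" .
    have "(K *\<^sub>v u) \<diamondop> u = of_real (qform K u)" "(K *\<^sub>v v) \<diamondop> v = of_real (qform K v)"
      using KC u v hnd_adjoint[OF K] by (auto intro: qform_of_real)
    with * b' show ?thesis
      unfolding \<beta>_def[symmetric] s_def cmod_power2
      by (simp add: algebra_simps power2_eq_square)
  qed
qed (use assms in \<open>auto intro: hnd_qform\<close>)

text \<open>This is \<open>K * K \<le> \<kappa> * K\<close> in the order of forms. For the pair
  \<open>v\<close>, \<open>K *\<^sub>v v\<close> the mixed form in Cauchy-Schwarz is the squared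
  norm of \<open>K *\<^sub>v v\<close>, and one such factor cancels.\<close>

lemma hnd_vnorm2_le:
  assumes K: "hnd n K" and le: "\<And>v. v \<in> carrier_vec n \<Longrightarrow> qform K v \<le> \<kappa> * vnorm2 v" and v: "v \<in> carrier_vec n"
  shows "vnorm2 (K *\<^sub>v v) \<le> \<kappa> * qform K v"
proof -
  have KC: "K \<in> carrier_mat n n" using K by auto
  let ?w = "K *\<^sub>v v"
  have w: "?w \<in> carrier_vec n" using KC v by auto
  have "(vnorm2 ?w)\<^sup>2 \<le> qform K v * qform K ?w"
    using hnd_cauchy_schwarz[OF K v w] by (simp add: inner_self)
  also have "\<dots> \<le> qform K v * (\<kappa> * vnorm2 ?w)"
    using le[OF w] hnd_qform[OF K v] by (intro mult_left_mono)
  finally have *: "vnorm2 ?w * vnorm2 ?w \<le> (\<kappa> * qform K v) * vnorm2 ?w"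
    by (simp add: power2_eq_square algebra_simps)
  show ?thesis
  proof (cases "vnorm2 ?w = 0")
    case True
    have "0 \<le> \<kappa> * vnorm2 v" using le[OF v] hnd_qform[OF K v] by linarith
    then have "0 \<le> \<kappa> \<or> vnorm2 v = 0" 
      using zero_le_mult_iff[of \<kappa> "vnorm2 v"] vnorm2_nonneg[of v] by (smt (verit))
    then have "0 \<le> \<kappa> * qform K v"
    proof
      assume "vnorm2 v = 0"
      then have "qform K v = 0" using le[OF v] hnd_qform[OF K v] by simp
      then show ?thesis by simp
    qed (use hnd_qform[OF K v] in auto)
    then show ?thesis using True by simp
  next
    case False
    then have "vnorm2 ?w > 0" by (simp add: less_le)
    then show ?thesis using * by (simp add: mult_le_cancel_right)
  qed
qed

lemma hnd_qform_eq_0: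
  assumes K: "hnd n K" and v: "v \<in> carrier_vec n" and 0: "qform K v = 0"
  shows "K *\<^sub>v v = 0\<^sub>v n"
proof -
  have w: "K *\<^sub>v v \<in> carrier_vec n" using K v by auto
  have "(vnorm2 (K *\<^sub>v v))\<^sup>2 \<le> 0"
    using hnd_cauchy_schwarz[OF K v w] 0 by (simp add: inner_self)
  then show ?thesis using w by (intro vnorm2_eq_0) auto
qed

text \<open>For an eigenvector \<open>v\<close> put \<open>w = W v\<close>. Pairing
  \<open>A w = l v\<close> with \<open>w\<close> gives
  \<open>\<langle>A w, w\<rangle> = l \<langle>W v, v\<rangle>\<close>, where both forms are real
  and nonnegative; if the one on the right vanishes, then \<open>W v = 0\<close> and so
  \<open>l = 0\<close>.\<close>

lemma eigenvalue_hnd_mult: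
  assumes A: "hnd n A" and W: "hnd n W" and ev: "eigenvalue (A * W) l"
  shows "l \<in> \<real>" "0 \<le> Re l"
proof -
  have AC: "A \<in> carrier_mat n n" and WC: "W \<in> carrier_mat n n" using A W by auto
  obtain v where v: "v \<in> carrier_vec n" "v \<noteq> 0\<^sub>v n" "A * W *\<^sub>v v = l \<cdot>\<^sub>v v"
    using ev AC WC by (auto simp: eigenvalue_def eigenvector_def)
  let ?w = "W *\<^sub>v v"
  have w: "?w \<in> carrier_vec n" using WC v by auto
  have eq: "A *\<^sub>v ?w = l \<cdot>\<^sub>v v" using v AC WC by (simp add: assoc_mult_mat_vec[of _ n n _ n])
  have "of_real (qform A ?w) = (A *\<^sub>v ?w) \<diamondop> ?w"
    using qform_of_real[OF AC hnd_adjoint[OF A] w] by simp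
  also have "\<dots> = l * (v \<diamondop> ?w)" using eq v w by (simp add: inner_smult_left[of _ n])
  also have "v \<diamondop> ?w = cnj (?w \<diamondop> v)" using v w by (intro inner_swap) auto
  also have "?w \<diamondop> v = of_real (qform W v)" using qform_of_real[OF WC hnd_adjoint[OF W] v(1)] .
  finally have *: "of_real (qform A ?w) = l * of_real (qform W v)" by simp
  have "l \<in> \<real> \<and> 0 \<le> Re l"
  proof (cases "qform W v = 0")
    case True
    then have "?w = 0\<^sub>v n" using W v by (intro hnd_qform_eq_0)
    moreover have "A *\<^sub>v 0\<^sub>v n = 0\<^sub>v n" using AC by (intro eq_vecI) auto
    ultimately have "l \<cdot>\<^sub>v v = 0\<^sub>v n" using eq by simp
    moreover obtain i where "i < n" "v $ i \<noteq> 0"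
      using v(1,2) by (metis carrier_vecD eq_vecI index_zero_vec(1,2))
    ultimately have "l * v $ i = 0"
      using v(1) by (metis carrier_vecD index_smult_vec(1) index_zero_vec(1))
    with \<open>v $ i \<noteq> 0\<close> have "l = 0" by simp
    then show ?thesis by simp
  next
    case False
    then have "qform W v > 0" using hnd_qform[OF W v(1)] by simp
    moreover from this have "l = of_real (qform A ?w / qform W v)" using * by (simp add: field_simps)
    ultimately show ?thesis using hnd_qform[OF A w] by simp
  qed
  then show "l \<in> \<real>" "0 \<le> Re l" by auto
qed

section \<open>Traces, Gram matrices and resolvents\<close>

definition mtrace :: "complex mat \<Rightarrow> complex" where
  "mtrace M = (\<Sum>i<dim_row M. M $$ (i, i))"

definition outer :: "complex vec \<Rightarrow> complex vec \<Rightarrow> complex mat" where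
  "outer u v = mat (dim_vec u) (dim_vec v) (\<lambda>(i, j). u $ i * cnj (v $ j))"

lemma mtrace_add: "X \<in> carrier_mat n n \<Longrightarrow> Y \<in> carrier_mat n n \<Longrightarrow> mtrace (X + Y) = mtrace X + mtrace Y"
  by (auto simp: mtrace_def sum.distrib)

lemma mtrace_minus: "X \<in> carrier_mat n n \<Longrightarrow> Y \<in> carrier_mat n n \<Longrightarrow> mtrace (X - Y) = mtrace X - mtrace Y"
  by (auto simp: mtrace_def sum_subtractf)

lemma mtrace_smult: "X \<in> carrier_mat n n \<Longrightarrow> mtrace (c \<cdot>\<^sub>m X) = c * mtrace X"
  by (auto simp: mtrace_def sum_distrib_left)

lemma mtrace_one: "mtrace (1\<^sub>m n) = of_nat n"
  by (simp add: mtrace_def)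

lemma mtrace_mult_commute:
  assumes "X \<in> carrier_mat n m" "Y \<in> carrier_mat m n"
  shows "mtrace (X * Y) = mtrace (Y * X)"
proof -
  have "mtrace (X * Y) = (\<Sum>i<n. \<Sum>j<m. X $$ (i, j) * Y $$ (j, i))"
    using assms by (auto simp: mtrace_def mult_mat_index[of _ n m _ n] simp del: index_mult_mat(1))
  also have "\<dots> = (\<Sum>j<m. \<Sum>i<n. X $$ (i, j) * Y $$ (j, i))" by (rule sum.swap)
  also have "\<dots> = mtrace (Y * X)"
    using assms by (auto simp: mtrace_def mult_mat_index[of _ m n _ m] mult.commute simp del: index_mult_mat(1))
  finally show ?thesis .
qed

lemma outer_carrier [simp]: "u \<in> carrier_vec n \<Longrightarrow> v \<in> carrier_vec m \<Longrightarrow> outer u v \<in> carrier_mat n m"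
  by (auto simp: outer_def)

lemma outer_dim [simp]: "dim_row (outer u v) = dim_vec u" "dim_col (outer u v) = dim_vec v"
  by (auto simp: outer_def)

lemma outer_index [simp]: "i < dim_vec u \<Longrightarrow> j < dim_vec v \<Longrightarrow> outer u v $$ (i, j) = u $ i * cnj (v $ j)"
  by (auto simp: outer_def)

lemma adjoint_outer: "mat_adjoint (outer u v) = outer v u"
  by (intro eq_matI) (auto simp: mult.commute)

lemma mult_outer:
  assumes "X \<in> carrier_mat n m" "u \<in> carrier_vec m" "v \<in> carrier_vec k"
  shows "X * outer u v = outer (X *\<^sub>v u) v"
proof (rule eq_matI)
  fix i j assume ij: "i < dim_row (outer (X *\<^sub>v u) v)" "j < dim_col (outer (X *\<^sub>v u) v)"
  then have "i < n" "j < k" using assms by auto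
  then have "(X * outer u v) $$ (i, j) = (\<Sum>l<m. X $$ (i, l) * outer u v $$ (l, j))"
    using assms by (intro mult_mat_index) auto
  also have "\<dots> = (X *\<^sub>v u) $ i * cnj (v $ j)"
    using assms \<open>i < n\<close> \<open>j < k\<close>
    by (auto simp: mult_vec_index[of _ n m] sum_distrib_right mult.assoc simp del: index_mult_mat_vec)
  finally show "(X * outer u v) $$ (i, j) = outer (X *\<^sub>v u) v $$ (i, j)"
    using ij by simp
qed (use assms in auto)

lemma outer_mult:
  assumes "X \<in> carrier_mat m n" "u \<in> carrier_vec k" "v \<in> carrier_vec m"
  shows "outer u v * X = outer u (mat_adjoint X *\<^sub>v v)"
proof -
  have "outer u v * X = mat_adjoint (mat_adjoint X * outer v u)"
    using assms by (simp add: adjoint_mult[of _ n m _ k] adjoint_outer)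
  also have "mat_adjoint X * outer v u = outer (mat_adjoint X *\<^sub>v v) u"
    using assms by (intro mult_outer) auto
  finally show ?thesis by (simp add: adjoint_outer)
qed

lemma mtrace_outer: "u \<in> carrier_vec n \<Longrightarrow> v \<in> carrier_vec n \<Longrightarrow> mtrace (outer u v) = u \<diamondop> v"
  by (auto simp: mtrace_def inner_sum[of _ n])

lemma outer_mult_vec:
  assumes "u \<in> carrier_vec n" "v \<in> carrier_vec m" "w \<in> carrier_vec m"
  shows "outer u v *\<^sub>v w = (w \<diamondop> v) \<cdot>\<^sub>v u"
proof (rule eq_vecI)
  fix i assume "i < dim_vec ((w \<diamondop> v) \<cdot>\<^sub>v u)"
  then have i: "i < n" using assms by simp
  have "(outer u v *\<^sub>v w) $ i = (\<Sum>j<m. outer u v $$ (i, j) * w $ j)"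
    using assms i by (intro mult_vec_index) auto
  also have "\<dots> = (\<Sum>j<m. (u $ i * cnj (v $ j)) * w $ j)"
    using assms i by (intro sum.cong) auto
  also have "\<dots> = (w \<diamondop> v) * u $ i"
    using assms by (simp add: inner_sum[of _ m] sum_distrib_left mult_ac)
  finally show "(outer u v *\<^sub>v w) $ i = ((w \<diamondop> v) \<cdot>\<^sub>v u) $ i" using assms i by simp
qed (use assms in auto)

lemma qform_outer:
  assumes "u \<in> carrier_vec n" "v \<in> carrier_vec n"
  shows "qform (outer u u) v = (cmod (v \<diamondop> u))\<^sup>2"
  using assms inner_swap[of v n u]
  by (simp add: qform_def outer_mult_vec[of _ n _ n] inner_smult_left[of _ n] complex_mult_cnj cmod_power2)

lemma hnd_outer: "u \<in> carrier_vec n \<Longrightarrow> hnd n (outer u u)"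
  by (rule hndI) (auto simp: adjoint_outer qform_outer)

text \<open>Indexing by a set makes deleting one column a set difference. The same construction
  describes \<open>W\<close> by its columns, \<open>A\<close> by its spectral decomposition, and the
  part of \<open>A\<close> with large eigenvalues.\<close>

definition gram :: "nat \<Rightarrow> 'i set \<Rightarrow> ('i \<Rightarrow> complex vec) \<Rightarrow> complex mat" where
  "gram n J g = mat n n (\<lambda>(i, k). \<Sum>j\<in>J. g j $ i * cnj (g j $ k))"

lemma gram_carrier [simp]: "gram n J g \<in> carrier_mat n n"
  by (simp add: gram_def)

lemma gram_insert:
  assumes "finite J" "j \<notin> J" "g j \<in> carrier_vec n"
  shows "gram n (insert j J) g = gram n J g + outer (g j) (g j)"
  using assms by (intro eq_matI) (auto simp: gram_def)

lemma gram_empty: "gram n {} g = 0\<^sub>m n n"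
  by (intro eq_matI) (auto simp: gram_def)

lemma hnd_zero: "hnd n (0\<^sub>m n n)"
proof (rule hndI)
  show "mat_adjoint (0\<^sub>m n n) = (0\<^sub>m n n :: complex mat)" by (rule eq_matI) auto
  fix v :: "complex vec" assume v: "v \<in> carrier_vec n"
  have "0\<^sub>m n n *\<^sub>v v = 0\<^sub>v n" using v by (intro eq_vecI) auto
  then show "0 \<le> qform (0\<^sub>m n n) v" using v by (simp add: qform_def)
qed auto

lemma hnd_gram:
  assumes "finite J" "\<And>j. j \<in> J \<Longrightarrow> g j \<in> carrier_vec n"
  shows "hnd n (gram n J g)"
  using assms by (induction J rule: finite_induct) (auto simp: gram_empty gram_insert hnd_zero intro!: hnd_add hnd_outer)

lemma mtrace_mult_gram:
  assumes "finite J" "\<And>j. j \<in> J \<Longrightarrow> g j \<in> carrier_vec n" and X: "X \<in> carrier_mat n n"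
  shows "mtrace (X * gram n J g) = (\<Sum>j\<in>J. (X *\<^sub>v g j) \<diamondop> g j)"
  using assms(1,2)
proof (induction J rule: finite_induct)
  case empty
  then show ?case using X by (simp add: gram_empty mtrace_def)
next
  case (insert j J)
  have "X * gram n (insert j J) g = X * gram n J g + outer (X *\<^sub>v g j) (g j)"
    using insert X by (simp add: gram_insert mult_add_distrib_mat[of _ n n _ n] mult_outer[of _ n n _ _ n])
  moreover have "mtrace (X * gram n J g + outer (X *\<^sub>v g j) (g j)) = mtrace (X * gram n J g) + mtrace (outer (X *\<^sub>v g j) (g j))"
    using insert X by (intro mtrace_add[of _ n]) auto
  moreover have "mtrace (outer (X *\<^sub>v g j) (g j)) = (X *\<^sub>v g j) \<diamondop> g j"
    using insert X by (intro mtrace_outer[of _ n]) auto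
  ultimately show ?case using insert by simp
qed

text \<open>The squared Frobenius norm, summed by columns because a left factor acts on each column
  separately.\<close>

definition frob2 :: "complex mat \<Rightarrow> real" where
  "frob2 M = (\<Sum>j<dim_col M. vnorm2 (col M j))"

lemma mult_unit_vec:
  "X \<in> carrier_mat n n \<Longrightarrow> j < n \<Longrightarrow> X *\<^sub>v unit_vec n j = col (X :: complex mat) j"
  by (intro eq_vecI) (auto simp: scalar_prod_right_unit[of j n])

lemma qform_unit_vec:
  assumes "X \<in> carrier_mat n n" "j < n"
  shows "qform X (unit_vec n j) = Re (X $$ (j, j))"
proof -
  have "col X j \<diamondop> unit_vec n j = (\<Sum>i<n. col X j $ i * cnj (unit_vec n j $ i))"
    using assms by (intro inner_sum) auto
  also have "\<dots> = (\<Sum>i<n. if i = j then X $$ (j, j) else 0)"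
    using assms by (intro sum.cong) (auto simp: unit_vec_def)
  finally show ?thesis using assms by (simp add: qform_def mult_unit_vec)
qed

lemma vnorm2_unit_vec: "j < n \<Longrightarrow> vnorm2 (unit_vec n j) = 1"
proof -
  assume "j < n"
  have "vnorm2 (unit_vec n j) = (\<Sum>i<n. if i = j then 1 else 0)"
    unfolding vnorm2_def using \<open>j < n\<close> by (intro sum.cong) (auto simp: unit_vec_def)
  then show ?thesis using \<open>j < n\<close> by simp
qed

lemma Re_mtrace:
  "X \<in> carrier_mat n n \<Longrightarrow> Re (mtrace X) = (\<Sum>i<n. qform X (unit_vec n i))"
  by (auto simp: mtrace_def qform_unit_vec)

lemma hnd_mtrace_nonneg: "hnd n X \<Longrightarrow> 0 \<le> Re (mtrace X)"
  by (subst Re_mtrace[of _ n]) (auto intro!: sum_nonneg hnd_qform)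

lemma mtrace_le:
  assumes "X \<in> carrier_mat n n" "\<And>v. v \<in> carrier_vec n \<Longrightarrow> qform X v \<le> \<kappa> * vnorm2 v"
  shows "Re (mtrace X) \<le> real n * \<kappa>"
proof -
  have "Re (mtrace X) \<le> (\<Sum>i<n. \<kappa>)"
    unfolding Re_mtrace[OF assms(1)]
    using assms(2)[of "unit_vec n i" for i] by (intro sum_mono) (metis lessThan_iff mult_cancel_left2 unit_vec_carrier vnorm2_unit_vec)
  then show ?thesis by simp
qed

lemma hnd_vnorm2_le':
  assumes K: "hnd n K" and le: "\<And>v. v \<in> carrier_vec n \<Longrightarrow> qform K v \<le> \<kappa> * vnorm2 v" and v: "v \<in> carrier_vec n"
    and "0 \<le> \<kappa>"
  shows "vnorm2 (K *\<^sub>v v) \<le> \<kappa>\<^sup>2 * vnorm2 v"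
  using hnd_vnorm2_le[OF K le v] mult_left_mono[OF le[OF v] \<open>0 \<le> \<kappa>\<close>] by (simp add: power2_eq_square mult.assoc)

lemma frob2_le:
  assumes K: "hnd n K" and le: "\<And>v. v \<in> carrier_vec n \<Longrightarrow> qform K v \<le> \<kappa> * vnorm2 v" and "0 \<le> \<kappa>"
  shows "frob2 K \<le> real n * \<kappa>\<^sup>2"
proof -
  have KC: "K \<in> carrier_mat n n" using K by auto
  have "frob2 K = (\<Sum>j<n. vnorm2 (K *\<^sub>v unit_vec n j))"
    using KC by (auto simp: frob2_def mult_unit_vec)
  also have "\<dots> \<le> (\<Sum>j<n. \<kappa>\<^sup>2)"
    using hnd_vnorm2_le'[OF K le, of "unit_vec n i" for i] \<open>0 \<le> \<kappa>\<close>
    by (intro sum_mono) (metis lessThan_iff mult_cancel_left2 unit_vec_carrier vnorm2_unit_vec)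
  finally show ?thesis by simp
qed

lemma frob2_mult_le:
  assumes E: "hnd n E" and le: "\<And>v. v \<in> carrier_vec n \<Longrightarrow> qform E v \<le> \<kappa> * vnorm2 v" and "0 \<le> \<kappa>"
    and K: "K \<in> carrier_mat n n"
  shows "frob2 (E * K) \<le> \<kappa>\<^sup>2 * frob2 K"
proof -
  have EC: "E \<in> carrier_mat n n" using E by auto
  have "frob2 (E * K) = (\<Sum>j<n. vnorm2 (E *\<^sub>v col K j))"
    using EC K by (simp add: frob2_def col_mult2[OF EC K] del: col_mult)
  also have "\<dots> \<le> (\<Sum>j<n. \<kappa>\<^sup>2 * vnorm2 (col K j))"
    using hnd_vnorm2_le'[OF E le] \<open>0 \<le> \<kappa>\<close> K by (intro sum_mono) auto
  finally show ?thesis using K by (simp add: frob2_def sum_distrib_left)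
qed

text \<open>The adjugate formula makes the entries rational functions of those of \<open>M\<close>,
  from which measurability is read off.\<close>

definition minv :: "complex mat \<Rightarrow> complex mat" where
  "minv M = (1 / det M) \<cdot>\<^sub>m adj_mat M"

lemma minv:
  assumes M: "M \<in> carrier_mat n n" and "det M \<noteq> 0"
  shows "minv M \<in> carrier_mat n n" "M * minv M = 1\<^sub>m n" "minv M * M = 1\<^sub>m n"
proof -
  show "minv M \<in> carrier_mat n n" using adj_mat(1)[OF M] by (simp add: minv_def)
  have one: "(1 / det M) \<cdot>\<^sub>m (det M \<cdot>\<^sub>m 1\<^sub>m n) = 1\<^sub>m n"
    using assms(2) by (intro eq_matI) auto
  show "M * minv M = 1\<^sub>m n" 
    unfolding minv_def by (subst mult_smult_distrib[OF M adj_mat(1)[OF M]]) (simp add: adj_mat(2)[OF M] one)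
  show "minv M * M = 1\<^sub>m n"
    unfolding minv_def by (subst mult_smult_assoc_mat[OF adj_mat(1)[OF M] M]) (simp add: adj_mat(3)[OF M] one)
qed

section \<open>The resolvent of a product of two nonnegative definite matrices\<close>

definition shift_mat :: "nat \<Rightarrow> real \<Rightarrow> complex mat \<Rightarrow> complex mat" where
  "shift_mat n x M = complex_of_real x \<cdot>\<^sub>m 1\<^sub>m n + M"

lemma shift_carrier [simp]: "M \<in> carrier_mat n n \<Longrightarrow> shift_mat n x M \<in> carrier_mat n n"
  by (simp add: shift_mat_def)

lemma det_shift_nonzero:
  assumes M: "M \<in> carrier_mat n n" and x: "x > 0"
    and ev: "\<And>l. eigenvalue M l \<Longrightarrow> 0 \<le> Re l"
  shows "det (shift_mat n x M) \<noteq> 0"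
proof
  assume "det (shift_mat n x M) = 0"
  moreover have "char_matrix M (- complex_of_real x) = shift_mat n x M"
    using M by (intro eq_matI) (auto simp: char_matrix_def shift_mat_def)
  ultimately have "eigenvalue M (- complex_of_real x)"
    using eigenvalue_det[OF M] by simp
  from ev[OF this] x show False by simp
qed

definition rsv :: "nat \<Rightarrow> real \<Rightarrow> complex mat \<Rightarrow> complex mat \<Rightarrow> complex mat" where
  "rsv n x A W = minv (shift_mat n x (A * W))"

text \<open>Although \<open>A * W\<close> is not Hermitian, \<open>krn n x A W = (x + A W)\<^sup>-\<^sup>1 A\<close> is Hermitian and dominated by
  \<open>A / x\<close>; for invertible \<open>A\<close> it equals \<open>(x A\<^sup>-\<^sup>1 + W)\<^sup>-\<^sup>1\<close>.\<close>

definition krn :: "nat \<Rightarrow> real \<Rightarrow> complex mat \<Rightarrow> complex mat \<Rightarrow> complex mat" where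
  "krn n x A W = rsv n x A W * A"

locale resolvent =
  fixes n :: nat and x :: real and A W :: "complex mat"
  assumes x: "x > 0" and A: "hnd n A" and W: "hnd n W"
begin

abbreviation "R \<equiv> rsv n x A W"
abbreviation "K \<equiv> krn n x A W"
abbreviation "R' \<equiv> mat_adjoint R"
abbreviation "X \<equiv> complex_of_real x"

lemma AC [simp]: "A \<in> carrier_mat n n" and WC [simp]: "W \<in> carrier_mat n n"
  using A W by auto

lemma mulC [simp]: "Y \<in> carrier_mat n n \<Longrightarrow> Z \<in> carrier_mat n n \<Longrightarrow> Y * Z \<in> carrier_mat n n"
  for Y Z :: "complex mat"
  by (rule mult_carrier_mat)

lemma mul_assoc [simp]:
  "Y \<in> carrier_mat n n \<Longrightarrow> Z \<in> carrier_mat n n \<Longrightarrow> V \<in> carrier_mat n n \<Longrightarrow> Y * Z * V = Y * (Z * V)"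
  for Y Z V :: "complex mat"
  by (rule assoc_mult_mat)

lemma one_mul [simp]: "Y \<in> carrier_mat n n \<Longrightarrow> 1\<^sub>m n * Y = Y" "Y \<in> carrier_mat n n \<Longrightarrow> Y * 1\<^sub>m n = Y"
  for Y :: "complex mat"
  by auto

lemma R_props:
  shows RC [simp]: "R \<in> carrier_mat n n"
    and shift_mult_R: "shift_mat n x (A * W) * R = 1\<^sub>m n"
    and R_mult_shift: "R * shift_mat n x (A * W) = 1\<^sub>m n"
proof -
  have "det (shift_mat n x (A * W)) \<noteq> 0"
    using eigenvalue_hnd_mult[OF A W] x by (intro det_shift_nonzero) auto
  from minv[OF shift_carrier[OF mult_carrier_mat[OF AC WC]] this]
  show "R \<in> carrier_mat n n" "shift_mat n x (A * W) * R = 1\<^sub>m n" "R * shift_mat n x (A * W) = 1\<^sub>m n"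
    by (auto simp: rsv_def)
qed

lemma KC [simp]: "K \<in> carrier_mat n n"
  by (simp add: krn_def mult_carrier_mat[of _ n n _ n])

lemma R_uniq: "Y \<in> carrier_mat n n \<Longrightarrow> shift_mat n x (A * W) * Y = 1\<^sub>m n \<Longrightarrow> Y = R"
proof -
  assume Y: "Y \<in> carrier_mat n n" and *: "shift_mat n x (A * W) * Y = 1\<^sub>m n"
  have "Y = (R * shift_mat n x (A * W)) * Y" using Y R_mult_shift by simp
  also have "\<dots> = R * (shift_mat n x (A * W) * Y)"
    using Y by (intro assoc_mult_mat[of _ n n _ n _ n]) auto
  finally show "Y = R" using * by simp
qed

lemma xR_KW: "X \<cdot>\<^sub>m R + K * W = 1\<^sub>m n"
proof -
  have "R * shift_mat n x (A * W) = X \<cdot>\<^sub>m R + R * (A * W)"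
    unfolding shift_mat_def
    by (simp add: mult_add_distrib_mat[of _ n n _ n] mult_smult_distrib[of _ n n _ n] del: assoc_mult_mat)
  also have "R * (A * W) = K * W"
    unfolding krn_def by (simp add: assoc_mult_mat[of R n n A n W n])
  finally show ?thesis using R_mult_shift by simp
qed

text \<open>The push-through identity \<open>(x + A W) A = A (x + W A)\<close>: multiplication by
  the inverses moves \<open>A\<close> from the right of \<open>R\<close> to the left of its
  adjoint.\<close>

lemma K_eq: "K = A * R'" and K_adj: "mat_adjoint K = K"
proof -
  let ?M = "shift_mat n x (A * W)"
  have M: "?M \<in> carrier_mat n n" by simp
  have adjM: "mat_adjoint ?M = shift_mat n x (W * A)"
    by (simp add: shift_mat_def adjoint_add[of _ n n] adjoint_smult adjoint_mult[of _ n n _ n] hnd_adjoint[OF A] hnd_adjoint[OF W])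
  have MA: "?M * A = A * mat_adjoint ?M"
    unfolding adjM unfolding shift_mat_def
    by (simp add: mult_add_distrib_mat[of _ n n _ n] add_mult_distrib_mat[of _ n n _ _ n]
        mult_smult_distrib[of _ n n _ n] mult_smult_assoc_mat[of _ n n _ n])
  have adjM1: "mat_adjoint ?M * R' = 1\<^sub>m n"
    using arg_cong[OF R_mult_shift, of mat_adjoint] by (simp add: adjoint_mult[OF RC M])
  have M': "mat_adjoint ?M \<in> carrier_mat n n" by simp
  have "K = R * A * (mat_adjoint ?M * R')" by (simp add: adjM1 krn_def)
  also have "\<dots> = R * (A * mat_adjoint ?M) * R'"
    using M' by (simp add: assoc_mult_mat[of _ n n _ n _ n])
  also have "\<dots> = (R * ?M) * (A * R')"
    unfolding MA[symmetric] using M by (simp add: assoc_mult_mat[of _ n n _ n _ n])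
  finally show K: "K = A * R'" by (simp add: R_mult_shift)
  show "mat_adjoint K = K" 
    by (subst (2) K) (simp add: krn_def adjoint_mult[of _ n n _ n] hnd_adjoint[OF A])
qed

lemma xR'_WK: "X \<cdot>\<^sub>m R' + W * K = 1\<^sub>m n"
  using arg_cong[OF xR_KW, of mat_adjoint]
  by (simp add: adjoint_add[of _ n n] adjoint_smult adjoint_mult[of _ n n _ n] K_adj hnd_adjoint[OF W])

text \<open>Writing \<open>A R'\<close> as \<open>R (x + A W) A R'\<close> presents \<open>K\<close>
  as the congruence of \<open>x A + A W A\<close> by \<open>R\<close>, and congruences preserve
  nonnegative definiteness.\<close>

lemma hnd_K: "hnd n K"
proof -
  have "A = A * (X \<cdot>\<^sub>m R' + W * K)" by (simp add: xR'_WK)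
  also have "\<dots> = X \<cdot>\<^sub>m K + A * W * K"
    by (simp add: mult_add_distrib_mat[of _ n n _ n] mult_smult_distrib[of _ n n _ n] K_eq[symmetric])
  finally have eq: "A = X \<cdot>\<^sub>m K + A * W * K" .
  have "R * (X \<cdot>\<^sub>m A + A * W * mat_adjoint A) * R' = R * (shift_mat n x (A * W) * A) * R'"
    unfolding shift_mat_def hnd_adjoint[OF A]
    by (simp add: add_mult_distrib_mat[of _ n n _ _ n] mult_smult_assoc_mat[of _ n n _ n])
  also have "\<dots> = (R * shift_mat n x (A * W)) * A * R'" 
    by (simp add: assoc_mult_mat[of _ n n _ n _ n])
  finally have "K = R * (X \<cdot>\<^sub>m A + A * W * mat_adjoint A) * R'"
    by (simp add: R_mult_shift K_eq)
  then show ?thesis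
    using A W x by (metis hnd_add hnd_conj hnd_smult AC RC less_imp_le)
qed

lemma hnd_RK: "hnd n (R * K)"
proof -
  have "R * K = R * A * R'" by (subst K_eq) simp
  then show ?thesis using hnd_conj[OF A RC] by simp
qed

lemma K_minus_xRK: "K = X \<cdot>\<^sub>m (R * K) + K * W * K"
proof -
  have "K = (X \<cdot>\<^sub>m R + K * W) * K" by (simp add: xR_KW)
  then show ?thesis 
    by (simp add: add_mult_distrib_mat[of _ n n _ _ n] mult_smult_assoc_mat[of _ n n _ n])
qed

text \<open>There are two expansions, \<open>A = x K + K W A\<close> and
  \<open>A = x K + A W K\<close>. Inserting the second into the first presents
  \<open>A - x K\<close> as a sum of nonnegative definite matrices, which is why \<open>K\<close> is
  at most \<open>A / x\<close>.\<close>

lemma A_eq: "A = X \<cdot>\<^sub>m K + (X \<cdot>\<^sub>m (K * W * K) + (K * W) * A * mat_adjoint (K * W))"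
proof -
  have 1: "A = X \<cdot>\<^sub>m K + K * W * A"
  proof -
    have "A = (X \<cdot>\<^sub>m R + K * W) * A" by (simp add: xR_KW)
    then show ?thesis 
      by (simp add: add_mult_distrib_mat[of _ n n _ _ n] mult_smult_assoc_mat[of _ n n _ n] krn_def[symmetric])
  qed
  have 2: "A = X \<cdot>\<^sub>m K + A * (W * K)"
  proof -
    have "A = A * (X \<cdot>\<^sub>m R' + W * K)" by (simp add: xR'_WK)
    then show ?thesis
      by (simp add: mult_add_distrib_mat[of _ n n _ n] mult_smult_distrib[of _ n n _ n] K_eq[symmetric])
  qed
  have "K * W * A = K * W * (X \<cdot>\<^sub>m K + A * (W * K))" using 2 by simp
  also have "\<dots> = X \<cdot>\<^sub>m (K * W * K) + K * W * (A * (W * K))"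
    by (simp add: mult_add_distrib_mat[of _ n n _ n] mult_smult_distrib[of _ n n _ n])
  also have "W * K = mat_adjoint (K * W)"
    by (simp add: adjoint_mult[of _ n n _ n] K_adj hnd_adjoint[OF W])
  finally have 3: "K * W * A = X \<cdot>\<^sub>m (K * W * K) + K * W * (A * mat_adjoint (K * W))" .
  have "A = X \<cdot>\<^sub>m K + (X \<cdot>\<^sub>m (K * W * K) + K * W * (A * mat_adjoint (K * W)))"
    using 1 unfolding 3 .
  also have "K * W * (A * mat_adjoint (K * W)) = K * W * A * mat_adjoint (K * W)" by simp
  finally show ?thesis .
qed

lemma hnd_KWK: "hnd n (K * W * K)"
  using hnd_conj[OF W KC] K_adj by simp

lemma qform_RK: 
  assumes v: "v \<in> carrier_vec n"
  shows "0 \<le> qform (R * K) v" "x * qform (R * K) v \<le> qform K v"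
proof -
  show "0 \<le> qform (R * K) v" using hnd_RK v by (rule hnd_qform)
  have "qform K v = x * qform (R * K) v + qform (K * W * K) v"
    by (subst K_minus_xRK) (simp add: qform_add[of _ n] qform_smult[of _ n] v del: assoc_mult_mat)
  then show "x * qform (R * K) v \<le> qform K v" using hnd_qform[OF hnd_KWK v] by simp
qed

lemma qform_K_le:
  assumes v: "v \<in> carrier_vec n"
  shows "x * qform K v \<le> qform A v"
proof -
  have "qform A v = x * qform K v + (x * qform (K * W * K) v + qform ((K * W) * A * mat_adjoint (K * W)) v)"
    by (subst A_eq) (simp add: qform_add[of _ n] qform_smult[of _ n] v del: assoc_mult_mat)
  moreover have "0 \<le> qform ((K * W) * A * mat_adjoint (K * W)) v"
    by (intro hnd_qform[of n] hnd_conj[OF A] v) simp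
  ultimately show ?thesis using hnd_qform[OF hnd_KWK v] x by (smt (verit) mult_nonneg_nonneg)
qed

lemma mtrace_R: "of_real x * mtrace R = of_nat n - mtrace (K * W)"
  using arg_cong[OF xR_KW, of mtrace] by (simp add: mtrace_add[of _ n] mtrace_smult[of _ n] mtrace_one algebra_simps)

end

section \<open>Rank-one updates of the resolvent\<close>

context resolvent
begin

lemma mul_vecC [simp]: "Y \<in> carrier_mat n n \<Longrightarrow> v \<in> carrier_vec n \<Longrightarrow> Y *\<^sub>v v \<in> carrier_vec n"
  for Y :: "complex mat"
  by (rule mult_mat_vec_carrier)

lemma mul_vec_assoc: "Y \<in> carrier_mat n n \<Longrightarrow> Z \<in> carrier_mat n n \<Longrightarrow> v \<in> carrier_vec n \<Longrightarrow>
    Y * Z *\<^sub>v v = Y *\<^sub>v (Z *\<^sub>v v)"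
  for Y Z :: "complex mat"
  by (rule assoc_mult_mat_vec)

lemma shift_mult_K: "shift_mat n x (A * W) * K = A"
proof -
  have "shift_mat n x (A * W) * K = shift_mat n x (A * W) * R * A"
    unfolding krn_def by (rule assoc_mult_mat[of _ n n _ n _ n, symmetric]) auto
  then show ?thesis by (simp add: shift_mult_R)
qed

context
  fixes g :: "complex vec"
  assumes g [simp]: "g \<in> carrier_vec n"
begin

abbreviation "q \<equiv> qform K g"
abbreviation "s \<equiv> 1 / (1 + q)"
abbreviation "W1 \<equiv> W + outer g g"

lemma q_nonneg: "0 \<le> q"
  using hnd_K g by (rule hnd_qform)

lemma resolvent_update: "resolvent n x A W1"
  using x A W by unfold_locales (auto intro!: hnd_add hnd_outer)

text \<open>Sherman-Morrison for the perturbation \<open>outer (A *\<^sub>v g) g\<close> of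
  \<open>A * W\<close>. The right-hand side is checked to be a right inverse, which identifies it by
  \<open>R_uniq\<close>.\<close>

lemma rsv_update: "rsv n x A W1 = R - complex_of_real s \<cdot>\<^sub>m outer (K *\<^sub>v g) (R' *\<^sub>v g)"
proof -
  let ?S = "complex_of_real s"
  let ?M = "shift_mat n x (A * W)"
  define Y where "Y = R - ?S \<cdot>\<^sub>m outer (K *\<^sub>v g) (R' *\<^sub>v g)"
  have M: "?M \<in> carrier_mat n n" by simp
  have Y [simp]: "Y \<in> carrier_mat n n" unfolding Y_def by (intro minus_carrier_mat) auto
  have M1: "shift_mat n x (A * W1) = ?M + outer (A *\<^sub>v g) g"
    unfolding shift_mat_def
    by (simp add: mult_add_distrib_mat[of A n n W n "outer g g"] mult_outer[of A n n g g n]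
        assoc_add_mat[of _ n n])
  have "?M * Y = 1\<^sub>m n - ?S \<cdot>\<^sub>m (?M * outer (K *\<^sub>v g) (R' *\<^sub>v g))"
    unfolding Y_def using M
    by (simp add: mult_minus_distrib_mat[of _ n n _ n] mult_smult_distrib[of _ n n _ n] shift_mult_R)
  also have "?M * outer (K *\<^sub>v g) (R' *\<^sub>v g) = outer (A *\<^sub>v g) (R' *\<^sub>v g)"
    using M by (simp add: mult_outer[of _ n n _ _ n] mul_vec_assoc[symmetric] shift_mult_K del: assoc_mult_mat_vec)
  finally have 1: "?M * Y = 1\<^sub>m n - ?S \<cdot>\<^sub>m outer (A *\<^sub>v g) (R' *\<^sub>v g)" .
  have adjY: "mat_adjoint Y = R' - ?S \<cdot>\<^sub>m outer (R' *\<^sub>v g) (K *\<^sub>v g)"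
    unfolding Y_def by (subst adjoint_minus[of _ n n]) (auto simp: adjoint_smult adjoint_outer)
  have gK: "g \<diamondop> (K *\<^sub>v g) = complex_of_real q"
  proof -
    have "g \<diamondop> (K *\<^sub>v g) = cnj ((K *\<^sub>v g) \<diamondop> g)" by (rule inner_swap[of _ n]) auto
    then show ?thesis using qform_of_real[OF KC K_adj g] by simp
  qed
  have sq: "1 - ?S * complex_of_real q = ?S"
  proof -
    have "1 - s * q = s" using q_nonneg by (simp add: field_simps)
    then show ?thesis by (metis of_real_1 of_real_diff of_real_mult)
  qed
  have "mat_adjoint Y *\<^sub>v g = R' *\<^sub>v g - (?S * complex_of_real q) \<cdot>\<^sub>v (R' *\<^sub>v g)"
    unfolding adjY
    by (simp add: minus_mult_distrib_mat_vec[of _ n n] smult_mult_vec[of _ n n] outer_mult_vec[of _ n _ n] gK smult_smult_assoc)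
  also have "\<dots> = (1 - ?S * complex_of_real q) \<cdot>\<^sub>v (R' *\<^sub>v g)"
    by (intro eq_vecI) (auto simp: algebra_simps)
  finally have adjYg: "mat_adjoint Y *\<^sub>v g = ?S \<cdot>\<^sub>v (R' *\<^sub>v g)" unfolding sq .
  have "outer (A *\<^sub>v g) g * Y = outer (A *\<^sub>v g) (?S \<cdot>\<^sub>v (R' *\<^sub>v g))"
    by (subst outer_mult[of _ n n _ n]) (auto simp: adjYg)
  also have "\<dots> = ?S \<cdot>\<^sub>m outer (A *\<^sub>v g) (R' *\<^sub>v g)"
    by (intro eq_matI) (auto simp: carrier_matD[OF AC] carrier_matD[OF RC])
  finally have 2: "outer (A *\<^sub>v g) g * Y = ?S \<cdot>\<^sub>m outer (A *\<^sub>v g) (R' *\<^sub>v g)" .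
  have "shift_mat n x (A * W1) * Y = ?M * Y + outer (A *\<^sub>v g) g * Y"
    unfolding M1 using M by (intro add_mult_distrib_mat[of _ n n _ _ n]) auto
  also have "\<dots> = 1\<^sub>m n"
    unfolding 1 2 by (intro eq_matI) (auto simp: carrier_matD[OF AC] carrier_matD[OF RC])
  finally show ?thesis
    using resolvent.R_uniq[OF resolvent_update Y] Y_def by simp
qed

lemma krn_update: "krn n x A W1 = K - complex_of_real s \<cdot>\<^sub>m outer (K *\<^sub>v g) (K *\<^sub>v g)"
proof -
  have "krn n x A W1 = R * A - complex_of_real s \<cdot>\<^sub>m (outer (K *\<^sub>v g) (R' *\<^sub>v g) * A)"
    unfolding krn_def[of n x A W1] rsv_update
    by (simp add: minus_mult_distrib_mat[of _ n n _ _ n] mult_smult_assoc_mat[of _ n n _ n])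
  also have "outer (K *\<^sub>v g) (R' *\<^sub>v g) * A = outer (K *\<^sub>v g) (A * R' *\<^sub>v g)"
    by (simp add: outer_mult[of _ n n _ n] hnd_adjoint[OF A] mul_vec_assoc)
  finally show ?thesis unfolding K_eq[symmetric] by (simp add: krn_def)
qed

text \<open>The updated kernel sends \<open>g\<close> to a scalar multiple of its image under the
  old kernel. Since the old kernel does not involve \<open>g\<close>, this separates a random column
  from the matrix that it is paired with.\<close>

lemma krn_update_vec: "krn n x A W1 *\<^sub>v g = complex_of_real s \<cdot>\<^sub>v (K *\<^sub>v g)"
proof -
  have Kg: "(K *\<^sub>v g) \<diamondop> g = complex_of_real q"
    using qform_of_real[OF KC K_adj g] .
  have gK: "g \<diamondop> (K *\<^sub>v g) = complex_of_real q"
    using inner_swap[of "K *\<^sub>v g" n g] Kg by simp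
  have sq: "1 - complex_of_real s * complex_of_real q = complex_of_real s"
  proof -
    have "1 - s * q = s" using q_nonneg by (simp add: field_simps)
    then show ?thesis by (metis of_real_1 of_real_diff of_real_mult)
  qed
  have "krn n x A W1 *\<^sub>v g = K *\<^sub>v g - (complex_of_real s * complex_of_real q) \<cdot>\<^sub>v (K *\<^sub>v g)"
    unfolding krn_update
    by (simp add: minus_mult_distrib_mat_vec[of _ n n] smult_mult_vec[of _ n n] outer_mult_vec[of _ n _ n] gK smult_smult_assoc)
  also have "\<dots> = (1 - complex_of_real s * complex_of_real q) \<cdot>\<^sub>v (K *\<^sub>v g)"
    by (intro eq_vecI) (auto simp: algebra_simps)
  finally show ?thesis unfolding sq .
qed

lemma mtrace_rsv_update:
  "Re (mtrace (rsv n x A W1)) = Re (mtrace R) - s * qform (R * K) g"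
proof -
  have "mtrace (rsv n x A W1) = mtrace R - complex_of_real s * ((K *\<^sub>v g) \<diamondop> (R' *\<^sub>v g))"
    unfolding rsv_update
    by (subst mtrace_minus[of _ n]) (auto simp: mtrace_smult[of _ n] mtrace_outer[of _ n])
  also have "(K *\<^sub>v g) \<diamondop> (R' *\<^sub>v g) = (R * K *\<^sub>v g) \<diamondop> g"
    using inner_adjoint[of R n n "K *\<^sub>v g" g] by (simp add: mul_vec_assoc)
  finally show ?thesis unfolding qform_def by simp
qed

text \<open>The decrement is \<open>s * qform (R * K) g\<close> with
  \<open>x * qform (R * K) g \<le> q\<close> and \<open>s * q \<le> 1\<close>, so the size of
  \<open>g\<close>, \<open>A\<close> and \<open>W\<close> cancels out.\<close>

lemma mtrace_rsv_update_bounds: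
  "0 \<le> Re (mtrace R) - Re (mtrace (rsv n x A W1))"
  "Re (mtrace R) - Re (mtrace (rsv n x A W1)) \<le> 1 / x"
proof -
  have "s * (x * qform (R * K) g) \<le> s * q"
    using qform_RK[OF g] q_nonneg by (intro mult_left_mono) auto
  also have "s * q \<le> 1" using q_nonneg by (simp add: field_simps)
  finally have "x * (s * qform (R * K) g) \<le> 1" by (simp add: algebra_simps)
  then show "Re (mtrace R) - Re (mtrace (rsv n x A W1)) \<le> 1 / x"
    unfolding mtrace_rsv_update using x by (simp add: pos_le_divide_eq mult.commute del: times_divide_eq_left)
  show "0 \<le> Re (mtrace R) - Re (mtrace (rsv n x A W1))"
    unfolding mtrace_rsv_update using qform_RK(1)[OF g] q_nonneg by simp
qed

lemma mtrace_mult_krn_update: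
  assumes E: "E \<in> carrier_mat n n"
  shows "Re (mtrace (E * krn n x A W1)) = Re (mtrace (E * K)) - s * qform E (K *\<^sub>v g)"
proof -
  have "E * krn n x A W1 = E * K - complex_of_real s \<cdot>\<^sub>m outer (E *\<^sub>v (K *\<^sub>v g)) (K *\<^sub>v g)"
    unfolding krn_update using E
    by (simp add: mult_minus_distrib_mat[of _ n n _ n] mult_smult_distrib[of _ n n _ n] mult_outer[of _ n n _ _ n])
  then have "mtrace (E * krn n x A W1) = mtrace (E * K) - complex_of_real s * ((E *\<^sub>v (K *\<^sub>v g)) \<diamondop> (K *\<^sub>v g))"
    using E by (simp add: mtrace_minus[of _ n] mtrace_smult[of _ n] mtrace_outer[of _ n])
  then show ?thesis unfolding qform_def by simp
qed

text \<open>The decrement is \<open>s * qform E (K *\<^sub>v g)\<close>. The squared norm of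
  \<open>K *\<^sub>v g\<close> is at most \<open>\<kappa> * q\<close>, and
  \<open>s = 1 / (1 + q)\<close> absorbs \<open>q\<close>.\<close>

lemma mtrace_mult_krn_update_bounds:
  assumes E: "hnd n E" and Ele: "\<And>v. v \<in> carrier_vec n \<Longrightarrow> qform E v \<le> e * vnorm2 v" and e: "0 \<le> e"
    and Kle: "\<And>v. v \<in> carrier_vec n \<Longrightarrow> qform K v \<le> \<kappa> * vnorm2 v" and k: "0 \<le> \<kappa>"
  shows "0 \<le> Re (mtrace (E * K)) - Re (mtrace (E * krn n x A W1))"
    "Re (mtrace (E * K)) - Re (mtrace (E * krn n x A W1)) \<le> e * \<kappa>"
proof -
  have EC: "E \<in> carrier_mat n n" using E by auto
  have w: "K *\<^sub>v g \<in> carrier_vec n" by simp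
  show "0 \<le> Re (mtrace (E * K)) - Re (mtrace (E * krn n x A W1))"
    unfolding mtrace_mult_krn_update[OF EC] using hnd_qform[OF E w] q_nonneg by simp
  have "qform E (K *\<^sub>v g) \<le> e * vnorm2 (K *\<^sub>v g)" by (rule Ele[OF w])
  also have "\<dots> \<le> e * (\<kappa> * q)"
    using hnd_vnorm2_le[OF hnd_K Kle g] e by (intro mult_left_mono)
  finally have "s * qform E (K *\<^sub>v g) \<le> s * (e * (\<kappa> * q))"
    using q_nonneg by (intro mult_left_mono) auto
  also have "\<dots> = (e * \<kappa>) * (s * q)" by simp
  also have "\<dots> \<le> (e * \<kappa>) * 1"
    using e k q_nonneg by (intro mult_left_mono) (auto simp: field_simps)
  finally show "Re (mtrace (E * K)) - Re (mtrace (E * krn n x A W1)) \<le> e * \<kappa>"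
    unfolding mtrace_mult_krn_update[OF EC] by simp
qed

end

text \<open>The resolvent identity for kernels. Expanding \<open>K\<close> on its right by the
  relation for \<open>V\<close>, and the kernel of \<open>V\<close> on its left by the relation for
  \<open>W\<close>, produces the same first term, both being \<open>x\<close> times
  \<open>R * A * V.R'\<close>.\<close>

lemma krn_diff:
  assumes V: "hnd n V"
  shows "K - krn n x A V = K * (V - W) * krn n x A V"
proof -
  interpret V: resolvent n x A V using x A V by unfold_locales
  let ?E = "krn n x A V"
  have E [simp]: "?E \<in> carrier_mat n n" by (rule V.KC)
  have "K = K * (X \<cdot>\<^sub>m V.R' + V * ?E)" by (simp add: V.xR'_WK)
  also have "\<dots> = X \<cdot>\<^sub>m (K * V.R') + K * V * ?E"
    by (simp add: mult_add_distrib_mat[of _ n n _ n] mult_smult_distrib[of _ n n _ n])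
  finally have 1: "K = X \<cdot>\<^sub>m (K * V.R') + K * V * ?E" .
  have "?E = (X \<cdot>\<^sub>m R + K * W) * ?E" by (simp add: xR_KW)
  also have "\<dots> = X \<cdot>\<^sub>m (R * ?E) + K * W * ?E"
    by (simp add: add_mult_distrib_mat[of _ n n _ _ n] mult_smult_assoc_mat[of _ n n _ n])
  also have "R * ?E = K * V.R'"
    unfolding V.K_eq krn_def[of n x A W] by simp
  finally have 2: "?E = X \<cdot>\<^sub>m (K * V.R') + K * W * ?E" .
  have "K - ?E = (X \<cdot>\<^sub>m (K * V.R') + K * V * ?E) - (X \<cdot>\<^sub>m (K * V.R') + K * W * ?E)"
    using 1 2 by simp
  also have "\<dots> = K * V * ?E - K * W * ?E"
    by (intro eq_matI) (auto simp: carrier_matD[OF V.KC] carrier_matD[OF KC] simp del: index_mult_mat(1))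
  also have "\<dots> = K * (V - W) * ?E"
    by (simp add: mult_minus_distrib_mat[of _ n n _ n] minus_mult_distrib_mat[of _ n n _ _ n] del: mul_assoc)
  finally show ?thesis .
qed

end

lemma gram_remove:
  assumes "finite J" "j \<in> J" "g j \<in> carrier_vec n"
  shows "gram n J g = gram n (J - {j}) g + outer (g j) (g j)"
  using gram_insert[of "J - {j}" j g n] assms by (simp add: insert_absorb)

text \<open>By \<open>x R + K W = 1\<close>, the trace of \<open>x R\<close> is \<open>n\<close>
  minus the sum of the forms of \<open>K\<close> in the columns. By \<open>krn_update_vec\<close>
  each of these is \<open>q / (1 + q) = 1 - 1 / (1 + q)\<close>, with \<open>q\<close> formed by the
  kernel without that column.\<close>

lemma mtrace_rsv_gram:
  assumes x: "x > 0" and A: "hnd n A" and J: "finite J" and g: "\<And>j. j \<in> J \<Longrightarrow> g j \<in> carrier_vec n"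
  shows "x * Re (mtrace (rsv n x A (gram n J g))) =
    real n - real (card J) + (\<Sum>j\<in>J. 1 / (1 + qform (krn n x A (gram n (J - {j}) g)) (g j)))"
proof -
  interpret resolvent n x A "gram n J g" using x A hnd_gram[OF J g] by unfold_locales
  have eq: "Re ((K *\<^sub>v g j) \<diamondop> g j) = 1 - 1 / (1 + qform (krn n x A (gram n (J - {j}) g)) (g j))" if j: "j \<in> J" for j
  proof -
    interpret j: resolvent n x A "gram n (J - {j}) g"
      using x A hnd_gram[of "J - {j}" g n] J g by unfold_locales auto
    have gj: "g j \<in> carrier_vec n" using g j by auto
    have "K *\<^sub>v g j = complex_of_real (1 / (1 + qform j.K (g j))) \<cdot>\<^sub>v (j.K *\<^sub>v g j)"
      using j.krn_update_vec[OF gj] gram_remove[OF J j, of g, OF gj] by simp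
    then have "Re ((K *\<^sub>v g j) \<diamondop> g j) = 1 / (1 + qform j.K (g j)) * qform j.K (g j)"
      using gj by (simp add: inner_smult_left[of _ n] qform_def)
    also have "\<dots> = 1 - 1 / (1 + qform j.K (g j))"
      using j.q_nonneg[OF gj] by (simp add: field_simps)
    finally show ?thesis .
  qed
  have "of_real x * mtrace R = of_nat n - (\<Sum>j\<in>J. (K *\<^sub>v g j) \<diamondop> g j)"
    unfolding mtrace_R by (subst mtrace_mult_gram[OF J g]) auto
  then have "x * Re (mtrace R) = real n - (\<Sum>j\<in>J. Re ((K *\<^sub>v g j) \<diamondop> g j))"
    by (auto dest: arg_cong[of _ _ Re])
  also have "(\<Sum>j\<in>J. Re ((K *\<^sub>v g j) \<diamondop> g j)) = (\<Sum>j\<in>J. 1 - 1 / (1 + qform (krn n x A (gram n (J - {j}) g)) (g j)))"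
    using eq by (intro sum.cong) auto
  finally show ?thesis by (simp add: sum_subtractf)
qed

text \<open>The resolvent identity compares \<open>W\<close> with \<open>\<theta>\<close> times the
  identity, and each column is again separated from the kernel. In the mean the sum will cancel the
  term with \<open>\<theta>\<close>, once \<open>1 / (1 + q)\<close> is close to
  \<open>\<theta>\<close>.\<close>

lemma mtrace_krn_gram:
  assumes x: "x > 0" and A: "hnd n A" and J: "finite J" and g: "\<And>j. j \<in> J \<Longrightarrow> g j \<in> carrier_vec n"
    and \<theta>: "0 \<le> \<theta>" and E_def: "E = krn n x A (complex_of_real \<theta> \<cdot>\<^sub>m 1\<^sub>m n)"
  shows "Re (mtrace (krn n x A (gram n J g))) - Re (mtrace E) =
    \<theta> * Re (mtrace (E * krn n x A (gram n J g))) -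
    (\<Sum>j\<in>J. Re ((E * krn n x A (gram n (J - {j}) g) *\<^sub>v g j) \<diamondop> g j) /
      (1 + qform (krn n x A (gram n (J - {j}) g)) (g j)))"
proof -
  interpret resolvent n x A "gram n J g" using x A hnd_gram[OF J g] by unfold_locales
  have V: "hnd n (complex_of_real \<theta> \<cdot>\<^sub>m 1\<^sub>m n)" by (intro hnd_smult hnd_one \<theta>)
  interpret V: resolvent n x A "complex_of_real \<theta> \<cdot>\<^sub>m 1\<^sub>m n" using x A V by unfold_locales
  have E [simp]: "E \<in> carrier_mat n n" unfolding E_def by (rule V.KC)
  have eq: "Re ((E * K *\<^sub>v g j) \<diamondop> g j) = Re ((E * krn n x A (gram n (J - {j}) g) *\<^sub>v g j) \<diamondop> g j) /
      (1 + qform (krn n x A (gram n (J - {j}) g)) (g j))" if j: "j \<in> J" for j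
  proof -
    interpret j: resolvent n x A "gram n (J - {j}) g"
      using x A hnd_gram[of "J - {j}" g n] J g by unfold_locales auto
    have gj [simp]: "g j \<in> carrier_vec n" using g j by auto
    have "K *\<^sub>v g j = complex_of_real (1 / (1 + qform j.K (g j))) \<cdot>\<^sub>v (j.K *\<^sub>v g j)"
      using j.krn_update_vec[OF gj] gram_remove[OF J j, of g, OF gj] by simp
    then have "E *\<^sub>v (K *\<^sub>v g j) = complex_of_real (1 / (1 + qform j.K (g j))) \<cdot>\<^sub>v (E *\<^sub>v (j.K *\<^sub>v g j))"
      by (simp add: mult_mat_vec[OF E])
    then show ?thesis
      by (simp add: mul_vec_assoc[of E _ "g j"] inner_smult_left[of _ n])
  qed
  have "K - E = K * (complex_of_real \<theta> \<cdot>\<^sub>m 1\<^sub>m n - gram n J g) * E"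
    using krn_diff[OF V] E_def by simp
  also have "\<dots> = complex_of_real \<theta> \<cdot>\<^sub>m (K * E) - K * gram n J g * E"
    by (simp add: mult_minus_distrib_mat[of _ n n _ n] minus_mult_distrib_mat[of _ n n _ _ n]
        mult_smult_assoc_mat[of _ n n _ n] mult_smult_distrib[of _ n n _ n])
  finally have "mtrace K - mtrace E = complex_of_real \<theta> * mtrace (K * E) - mtrace (K * gram n J g * E)"
    by (metis (no_types, lifting) E KC V.mulC gram_carrier mtrace_minus mtrace_smult smult_carrier_mat)
  also have "mtrace (K * E) = mtrace (E * K)" by (rule mtrace_mult_commute[of _ n n]) auto
  also have "mtrace (K * gram n J g * E) = mtrace (E * K * gram n J g)"
    by (subst mtrace_mult_commute[of _ n n]) auto
  also have "\<dots> = (\<Sum>j\<in>J. (E * K *\<^sub>v g j) \<diamondop> g j)"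
    by (rule mtrace_mult_gram[OF J g]) auto
  finally have "Re (mtrace K) - Re (mtrace E) = \<theta> * Re (mtrace (E * K)) - (\<Sum>j\<in>J. Re ((E * K *\<^sub>v g j) \<diamondop> g j))"
    by (auto dest: arg_cong[of _ _ Re])
  also have "(\<Sum>j\<in>J. Re ((E * K *\<^sub>v g j) \<diamondop> g j)) = (\<Sum>j\<in>J. Re ((E * krn n x A (gram n (J - {j}) g) *\<^sub>v g j) \<diamondop> g j) /
      (1 + qform (krn n x A (gram n (J - {j}) g)) (g j)))"
    using eq by (intro sum.cong) auto
  finally show ?thesis .
qed

section \<open>Empirical spectral distributions\<close>

text \<open>The entries of \<open>V\<close> below the diagonal vanish, so a diagonal entry of
  \<open>U * V\<close> is the product of the two diagonal entries.\<close>

lemma upper_triangular_inverse_diag: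
  fixes U V :: "complex mat"
  assumes U: "U \<in> carrier_mat n n" and V: "V \<in> carrier_mat n n" and ut: "upper_triangular U"
    and nz: "\<And>i. i < n \<Longrightarrow> U $$ (i, i) \<noteq> 0" and inv: "U * V = 1\<^sub>m n" and i: "i < n"
  shows "V $$ (i, i) = 1 / U $$ (i, i)"
proof -
  have entry: "(\<Sum>k<n. U $$ (i, k) * V $$ (k, j)) = (if i = j then 1 else 0)" if "i < n" "j < n" for i j
    using mult_mat_index[OF U V that] inv that by simp
  have low: "V $$ (i, j) = 0" if "j < i" "i < n" for i j
    using that
  \<comment> \<open>The induction runs from the last row upwards: row \<open>i\<close> of
    \<open>U * V\<close> involves only the rows \<open>k \<ge> i\<close> of
    \<open>V\<close>.\<close>
  proof (induction "n - i" arbitrary: i rule: less_induct)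
    case less
    have "(\<Sum>k<n. U $$ (i, k) * V $$ (k, j)) = (\<Sum>k<n. if k = i then U $$ (i, i) * V $$ (i, j) else 0)"
    proof (rule sum.cong[OF refl])
      fix k assume k: "k \<in> {..<n}"
      consider "k < i" | "k = i" | "i < k" by linarith
      then show "U $$ (i, k) * V $$ (k, j) = (if k = i then U $$ (i, i) * V $$ (i, j) else 0)"
      proof cases
        case 1
        then show ?thesis using ut U less.prems by auto
      next
        case 3
        then have "V $$ (k, j) = 0" using less k by (intro less.hyps) auto
        then show ?thesis using 3 by simp
      qed simp
    qed
    then show ?case using entry[of i j] less.prems nz[of i] by simp
  qed
  have "(\<Sum>k<n. U $$ (i, k) * V $$ (k, i)) = (\<Sum>k<n. if k = i then U $$ (i, i) * V $$ (i, i) else 0)"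
  proof (rule sum.cong[OF refl])
    fix k assume k: "k \<in> {..<n}"
    consider "k < i" | "k = i" | "i < k" by linarith
    then show "U $$ (i, k) * V $$ (k, i) = (if k = i then U $$ (i, i) * V $$ (i, i) else 0)"
    proof cases
      case 1
      then show ?thesis using ut U i by auto
    next
      case 3
      then show ?thesis using low[of i k] k by simp
    qed simp
  qed
  then show ?thesis using entry[OF i i] i nz[OF i] by (simp add: field_simps)
qed

lemma schur_triangular:
  fixes M :: "complex mat"
  assumes M: "M \<in> carrier_mat n n" and cp: "char_poly M = (\<Prod>a\<leftarrow>as. [:- a, 1:])"
  obtains B P Q where "B \<in> carrier_mat n n" "P \<in> carrier_mat n n" "Q \<in> carrier_mat n n"
    "P * Q = 1\<^sub>m n" "Q * P = 1\<^sub>m n" "M = P * B * Q" "upper_triangular B" "diag_mat B = as"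
proof -
  obtain B P Q where s: "schur_decomposition M as = (B, P, Q)" by (cases "schur_decomposition M as") auto
  from schur_decomposition[OF M cp s]
  have w: "similar_mat_wit M B P Q" and ut: "upper_triangular B" and dg: "diag_mat B = as" by auto
  from similar_mat_witD2[OF M w] ut dg show ?thesis by (intro that[of B P Q]) auto
qed

lemma mtrace_similar:
  assumes "B \<in> carrier_mat n n" "P \<in> carrier_mat n n" "Q \<in> carrier_mat n n" "Q * P = 1\<^sub>m n"
  shows "mtrace (P * B * Q) = mtrace B"
proof -
  have "mtrace (P * B * Q) = mtrace (Q * (P * B))"
    using assms by (intro mtrace_mult_commute[of _ n n]) auto
  also have "Q * (P * B) = (Q * P) * B"
    using assms by (intro assoc_mult_mat[of _ n n _ n _ n, symmetric]) auto
  finally show ?thesis using assms by simp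
qed

lemma mtrace_diag: "B \<in> carrier_mat n n \<Longrightarrow> mtrace B = sum_list (diag_mat B)"
  by (simp add: mtrace_def diag_mat_def interv_sum_list_conv_sum_set_nat atLeast0LessThan)

lemma mtrace_eq_sum_eigenvalues:
  fixes M :: "complex mat"
  assumes M: "M \<in> carrier_mat n n" and cp: "char_poly M = (\<Prod>a\<leftarrow>as. [:- a, 1:])"
  shows "mtrace M = sum_list as"
  using schur_triangular[OF assms] by (metis mtrace_similar mtrace_diag)

text \<open>The matrix of interest, \<open>A * W\<close>, is in general not normal. A Schur
  triangular form is enough: the trace sees only the diagonal, and the inverse of a triangular
  matrix has the reciprocal diagonal.\<close>

lemma mtrace_minv_shift:
  fixes M :: "complex mat"
  assumes M: "M \<in> carrier_mat n n" and cp: "char_poly M = (\<Prod>a\<leftarrow>as. [:- a, 1:])"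
    and nz: "\<And>a. a \<in> set as \<Longrightarrow> complex_of_real y + a \<noteq> 0"
  shows "mtrace (minv (shift_mat n y M)) = (\<Sum>a\<leftarrow>as. 1 / (complex_of_real y + a))"
proof -
  obtain B P Q where B: "B \<in> carrier_mat n n" and P: "P \<in> carrier_mat n n" and Q: "Q \<in> carrier_mat n n"
    and PQ: "P * Q = 1\<^sub>m n" and QP: "Q * P = 1\<^sub>m n" and eq: "M = P * B * Q"
    and ut: "upper_triangular B" and dg: "diag_mat B = as"
    by (rule schur_triangular[OF M cp])
  let ?S = "shift_mat n y B"
  have S: "?S \<in> carrier_mat n n" using B by simp
  have utS: "upper_triangular ?S"
  proof (rule upper_triangularI)
    fix i j assume "j < i" "i < dim_row ?S"
    then show "?S $$ (i, j) = 0"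
      using upper_triangularD[OF ut, of j i] B by (auto simp: shift_mat_def)
  qed
  have len: "length as = n" using dg B by (auto simp: diag_mat_def)
  have dgi: "?S $$ (i, i) = complex_of_real y + as ! i" if "i < n" for i
    using that B dg by (auto simp: shift_mat_def diag_mat_def)
  have nzi: "?S $$ (i, i) \<noteq> 0" if "i < n" for i
    using nz[of "as ! i"] that len dgi by auto
  have "det ?S = prod_list (diag_mat ?S)" by (rule det_upper_triangular[OF utS S])
  also have "\<dots> \<noteq> 0" using nzi S by (auto simp: diag_mat_def prod_list_zero_iff)
  finally have detS: "det ?S \<noteq> 0" .
  have V: "minv ?S \<in> carrier_mat n n" "?S * minv ?S = 1\<^sub>m n" using minv[OF S detS] by auto
  have shM: "shift_mat n y M = P * ?S * Q"
  proof -
    have "P * ?S * Q = (complex_of_real y \<cdot>\<^sub>m P + P * B) * Q"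
      using P B unfolding shift_mat_def
      by (simp add: mult_add_distrib_mat[of _ n n _ n] mult_smult_distrib[of _ n n _ n])
    also have "\<dots> = complex_of_real y \<cdot>\<^sub>m (P * Q) + P * B * Q"
      using P B Q
      by (simp add: add_mult_distrib_mat[of _ n n _ _ n] mult_smult_assoc_mat[of _ n n _ n] del: assoc_mult_mat)
    finally show ?thesis unfolding PQ eq[symmetric] by (simp add: shift_mat_def)
  qed
  have shMC: "shift_mat n y M \<in> carrier_mat n n" using M by simp
  have "det (shift_mat n y M) = det P * det ?S * det Q"
    unfolding shM using P Q S by (simp add: det_mult[of _ n] del: assoc_mult_mat)
  moreover have "det P * det Q = 1" using PQ P Q by (metis det_mult det_one)
  ultimately have detM: "det (shift_mat n y M) \<noteq> 0" using detS by auto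
  have minvM: "minv (shift_mat n y M) \<in> carrier_mat n n" "minv (shift_mat n y M) * shift_mat n y M = 1\<^sub>m n"
    using minv[OF shMC detM] by auto
  have right: "shift_mat n y M * (P * minv ?S * Q) = 1\<^sub>m n"
  proof -
    have "shift_mat n y M * (P * minv ?S * Q) = P * (?S * ((Q * P) * (minv ?S * Q)))"
      unfolding shM using P Q S V
      by (simp add: assoc_mult_mat[of _ n n _ n _ n] mult_carrier_mat[of _ n n _ n])
    also have "\<dots> = P * ((?S * minv ?S) * Q)"
      unfolding QP using P Q S V(1)
      by (simp add: assoc_mult_mat[of _ n n _ n _ n] mult_carrier_mat[of _ n n _ n] left_mult_one_mat[of _ n n])
    also have "\<dots> = 1\<^sub>m n" unfolding V(2) using P Q by (simp add: left_mult_one_mat[of _ n n] PQ)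
    finally show ?thesis .
  qed
  have PVQ: "P * minv ?S * Q \<in> carrier_mat n n" using P Q V by auto
  have "minv (shift_mat n y M) = minv (shift_mat n y M) * (shift_mat n y M * (P * minv ?S * Q))"
    unfolding right using minvM by simp
  also have "\<dots> = (minv (shift_mat n y M) * shift_mat n y M) * (P * minv ?S * Q)"
    by (rule assoc_mult_mat[OF minvM(1) shMC PVQ, symmetric])
  also have "\<dots> = P * minv ?S * Q" unfolding minvM(2) using PVQ by (rule left_mult_one_mat)
  finally have "mtrace (minv (shift_mat n y M)) = mtrace (minv ?S)"
    using mtrace_similar[OF V(1) P Q QP] by simp
  also have "\<dots> = (\<Sum>i<n. 1 / (complex_of_real y + as ! i))"
    using V(1) upper_triangular_inverse_diag[OF S V(1) utS nzi V(2)] dgi by (simp add: mtrace_def)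
  also have "\<dots> = (\<Sum>a\<leftarrow>as. 1 / (complex_of_real y + a))"
    using len by (simp add: sum_list_sum_nth atLeast0LessThan)
  finally show ?thesis .
qed

lemma order_prod_linear:
  "Polynomial.order t (\<Prod>a\<leftarrow>as. [:- a, 1:]) = count_list as (t :: complex)"
proof (induction as)
  case (Cons a as)
  have nz: "(\<Prod>a\<leftarrow>as. [:- a, 1:]) \<noteq> (0 :: complex poly)" by (auto simp: prod_list_zero_iff)
  have lin: "Polynomial.order t [:- a, 1:] = (if a = t then 1 else 0)"
  proof (cases "a = t")
    case True
    then show ?thesis using order_power_n_n[of t 1] by simp
  next
    case False
    then show ?thesis by (auto intro: order_0I)
  qed
  have "Polynomial.order t ([:- a, 1:] * (\<Prod>a\<leftarrow>as. [:- a, 1:])) =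
      Polynomial.order t [:- a, 1:] + Polynomial.order t (\<Prod>a\<leftarrow>as. [:- a, 1:])"
    by (rule order_mult) (use nz in \<open>simp only: mult_eq_0_iff, auto\<close>)
  then show ?case using Cons lin by simp
qed simp

lemma eigenvalue_iff_list:
  fixes M :: "complex mat"
  assumes M: "M \<in> carrier_mat n n" and cp: "char_poly M = (\<Prod>a\<leftarrow>as. [:- a, 1:])"
  shows "eigenvalue M l \<longleftrightarrow> l \<in> set as"
  unfolding eigenvalue_root_char_poly[OF M] cp by (induction as) (auto simp: poly_prod_list algebra_simps)

lemma real_spectrum_list:
  assumes M: "M \<in> carrier_mat n n" and re: "real_eigenvalues M"
  obtains rs where "length rs = n" "char_poly M = (\<Prod>a\<leftarrow>map complex_of_real rs. [:- a, 1:])"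
proof -
  obtain as where as: "char_poly M = (\<Prod>a\<leftarrow>as. [:- a, 1:])" "length as = n"
    using char_poly_factorized[OF M] by auto
  have "set as \<subseteq> \<real>"
    using re eigenvalue_iff_list[OF M as(1)] by (auto simp: real_eigenvalues_def)
  then have "map complex_of_real (map Re as) = as"
    by (auto intro!: map_idI)
  then show ?thesis using as by (intro that[of "map Re as"]) (simp_all del: map_map)
qed

lemma sum_count_filter:
  assumes "finite T" "set xs \<inter> Collect P \<subseteq> T" "T \<subseteq> Collect P"
  shows "(\<Sum>t\<in>T. count_list xs t) = length (filter P xs)"
proof -
  have "(\<Sum>t\<in>T. count_list xs t) = (\<Sum>t\<in>T. count_list (filter P xs) t)"
    using assms(3) by (intro sum.cong refl) (induction xs, auto)
  also have "\<dots> = length (filter P xs)"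
    using assms by (intro sum_count_set) auto
  finally show ?thesis .
qed

lemma esd_list:
  assumes M: "M \<in> carrier_mat n n" and cp: "char_poly M = (\<Prod>a\<leftarrow>map complex_of_real rs. [:- a, 1:])"
  shows "esd M x = real (length (filter (\<lambda>r. r \<le> x) rs)) / real n"
proof -
  have ev: "eigenvalue M (complex_of_real t) \<longleftrightarrow> t \<in> set rs" for t
    using eigenvalue_iff_list[OF M cp, of "complex_of_real t"] by auto
  have ord: "Polynomial.order (complex_of_real t) (char_poly M) = count_list rs t" for t
    unfolding cp order_prod_linear by (induction rs) auto
  have "(\<Sum>t | t \<le> x \<and> t \<in> set rs. count_list rs t) = length (filter (\<lambda>r. r \<le> x) rs)"
    by (rule sum_count_filter) (auto intro: finite_subset[of _ "set rs"])
  then show ?thesis using M by (simp add: esd_def ev ord)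
qed

text \<open>Sampling an index rather than a value keeps multiplicities. For the empty list this is
  still some probability measure, so \<open>real_distribution_emp\<close> holds for every
  list.\<close>

definition emp :: "real list \<Rightarrow> real measure" where
  "emp rs = distr (measure_pmf (pmf_of_set {..<length rs})) borel (\<lambda>i. rs ! i)"

lemma real_distribution_emp: "real_distribution (emp rs)"
  unfolding emp_def by (rule prob_space.real_distribution_distr[OF prob_space_measure_pmf]) simp

lemma integral_emp:
  fixes f :: "real \<Rightarrow> 'a::{banach,second_countable_topology}"
  assumes "rs \<noteq> []" and [measurable]: "f \<in> borel_measurable borel"
  shows "integral\<^sup>L (emp rs) f = (\<Sum>i<length rs. f (rs ! i)) /\<^sub>R real (length rs)"
proof -
  have "integral\<^sup>L (emp rs) f = measure_pmf.expectation (pmf_of_set {..<length rs}) (\<lambda>i. f (rs ! i))"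
    unfolding emp_def by (subst integral_distr) auto
  also have "\<dots> = (\<Sum>i<length rs. f (rs ! i)) /\<^sub>R real (length rs)"
    using assms(1)
    by (subst integral_measure_pmf[of "{..<length rs}"])
      (auto simp: lessThan_empty_iff scaleR_sum_right divide_inverse split: if_splits intro!: sum.cong)
  finally show ?thesis .
qed

lemma measure_emp:
  assumes "rs \<noteq> []" "S \<in> sets borel"
  shows "measure (emp rs) S = real (length (filter (\<lambda>r. r \<in> S) rs)) / real (length rs)"
proof -
  have "measure (emp rs) S = measure_pmf.prob (pmf_of_set {..<length rs}) {i. rs ! i \<in> S}"
    unfolding emp_def using assms by (subst measure_distr) (auto simp: vimage_def)
  also have "\<dots> = real (card ({..<length rs} \<inter> {i. rs ! i \<in> S})) / real (length rs)"
    using assms by (subst measure_pmf_of_set) (auto simp: lessThan_empty_iff)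
  also have "{..<length rs} \<inter> {i. rs ! i \<in> S} = {i. i < length rs \<and> rs ! i \<in> S}" by auto
  finally show ?thesis by (simp add: length_filter_conv_card)
qed

lemma cdf_emp:
  assumes M: "M \<in> carrier_mat n n" and cp: "char_poly M = (\<Prod>a\<leftarrow>map complex_of_real rs. [:- a, 1:])"
    and "length rs = n" "n > 0"
  shows "cdf (emp rs) = esd M"
proof
  fix x
  have "rs \<noteq> []" using assms by auto
  then have "cdf (emp rs) x = real (length (filter (\<lambda>r. r \<in> {..x}) rs)) / real (length rs)"
    unfolding cdf_def by (rule measure_emp) auto
  then show "cdf (emp rs) x = esd M x" using esd_list[OF M cp] assms(3) by simp
qed

section \<open>The spectral theorem\<close>

lemma eigenvalueI:
  fixes M :: "complex mat"
  assumes "M \<in> carrier_mat n n" "v \<in> carrier_vec n" "v \<noteq> 0\<^sub>v n" "M *\<^sub>v v = l \<cdot>\<^sub>v v"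
  shows "eigenvalue M l"
  using assms by (auto simp: eigenvalue_def eigenvector_def)

lemma eigenvalueE:
  fixes M :: "complex mat"
  assumes "M \<in> carrier_mat n n" "eigenvalue M l"
  obtains v where "v \<in> carrier_vec n" "v \<noteq> 0\<^sub>v n" "M *\<^sub>v v = l \<cdot>\<^sub>v v"
  using assms by (auto simp: eigenvalue_def eigenvector_def)

text \<open>For Hermitian \<open>C\<close> the trace of \<open>C * C\<close> is the squared
  Frobenius norm. It is also the sum of the eigenvalues of \<open>C * C\<close>, which are squares
  of eigenvalues of \<open>C\<close>.\<close>

lemma hermitian_eq_0:
  fixes C :: "complex mat"
  assumes C: "C \<in> carrier_mat n n" and adj: "mat_adjoint C = C" and ev: "\<And>l. eigenvalue C l \<Longrightarrow> l = 0"
  shows "C = 0\<^sub>m n n"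
proof -
  have CC: "C * C \<in> carrier_mat n n" using C by auto
  have ev2: "l = 0" if ev_l: "eigenvalue (C * C) l" for l
  proof -
    obtain v where v: "v \<in> carrier_vec n" "v \<noteq> 0\<^sub>v n" "C * C *\<^sub>v v = l \<cdot>\<^sub>v v"
      by (rule eigenvalueE[OF CC ev_l])
    \<comment> \<open>The factorisation \<open>C * C - l = (C - \<nu>) (C + \<nu>)\<close> is
      applied to \<open>v\<close>: with \<open>w = (C + \<nu>) v\<close>, either
      \<open>w = 0\<close> and \<open>- \<nu>\<close> is an eigenvalue of \<open>C\<close>, or
      \<open>w\<close> is an eigenvector for \<open>\<nu>\<close>.\<close>
    define \<nu> where "\<nu> = csqrt l"
    have \<nu>2: "\<nu> * \<nu> = l" by (simp add: \<nu>_def flip: power2_eq_square)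
    define w where "w = C *\<^sub>v v + \<nu> \<cdot>\<^sub>v v"
    have w: "w \<in> carrier_vec n" using C v by (simp add: w_def)
    have "\<nu> = 0"
    proof (cases "w = 0\<^sub>v n")
      case True
      have "C *\<^sub>v v = (- \<nu>) \<cdot>\<^sub>v v"
      proof (rule eq_vecI)
        fix i assume "i < dim_vec ((- \<nu>) \<cdot>\<^sub>v v)"
        then have i: "i < n" using v by simp
        have "w $ i = 0" using True i by simp
        then show "(C *\<^sub>v v) $ i = ((- \<nu>) \<cdot>\<^sub>v v) $ i"
          using i v C by (simp add: w_def add_eq_0_iff del: index_mult_mat_vec)
      qed (use C v in auto)
      from ev[OF eigenvalueI[OF C v(1,2) this]] show ?thesis by simp
    next
      case False
      have "C *\<^sub>v w = l \<cdot>\<^sub>v v + \<nu> \<cdot>\<^sub>v (C *\<^sub>v v)"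
        using C v by (simp add: w_def mult_add_distrib_mat_vec[of _ n n] mult_mat_vec[of _ n n])
      also have "\<dots> = \<nu> \<cdot>\<^sub>v w"
        using C v by (intro eq_vecI) (auto simp: w_def \<nu>2[symmetric] algebra_simps simp del: index_mult_mat_vec)
      finally show ?thesis by (rule ev[OF eigenvalueI[OF C w False]])
    qed
    then show "l = 0" using \<nu>2 by simp
  qed
  obtain as where as: "char_poly (C * C) = (\<Prod>a\<leftarrow>as. [:- a, 1:])"
    using char_poly_factorized[OF CC] by auto
  have "\<forall>a\<in>set as. a = 0" using ev2 eigenvalue_iff_list[OF CC as] by auto
  then have "sum_list as = 0" by (induction as) auto
  then have 0: "mtrace (C * C) = 0" using mtrace_eq_sum_eigenvalues[OF CC as] by simp
  have "mtrace (C * C) = (\<Sum>i<n. \<Sum>j<n. C $$ (i, j) * C $$ (j, i))"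
    using C by (simp add: mtrace_def mult_mat_index[OF C C] del: index_mult_mat(1))
  also have "\<dots> = (\<Sum>i<n. \<Sum>j<n. complex_of_real ((cmod (C $$ (i, j)))\<^sup>2))"
  proof (intro sum.cong refl)
    fix i j assume "i \<in> {..<n}" "j \<in> {..<n}"
    then have "C $$ (j, i) = cnj (C $$ (i, j))" using adjoint_index[of j C i] C adj by auto
    then show "C $$ (i, j) * C $$ (j, i) = complex_of_real ((cmod (C $$ (i, j)))\<^sup>2)"
      by (simp add: complex_norm_square del: of_real_power)
  qed
  also have "\<dots> = complex_of_real (\<Sum>i<n. \<Sum>j<n. (cmod (C $$ (i, j)))\<^sup>2)" by simp
  finally have "(\<Sum>i<n. \<Sum>j<n. (cmod (C $$ (i, j)))\<^sup>2) = 0" using 0 by (metis of_real_eq_0_iff)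
  then have row: "\<forall>i\<in>{..<n}. (\<Sum>j<n. (cmod (C $$ (i, j)))\<^sup>2) = 0"
    using sum_nonneg_eq_0_iff[of "{..<n}" "\<lambda>i. \<Sum>j<n. (cmod (C $$ (i, j)))\<^sup>2"] by (simp add: sum_nonneg)
  have "C $$ (i, j) = 0" if "i < n" "j < n" for i j
    using row that sum_nonneg_eq_0_iff[of "{..<n}" "\<lambda>j. (cmod (C $$ (i, j)))\<^sup>2"] by auto
  then show ?thesis using C by (intro eq_matI) auto
qed

lemma gram_mult_vec:
  assumes "finite J" "\<And>j. j \<in> J \<Longrightarrow> g j \<in> carrier_vec n" "v \<in> carrier_vec n" "i < n"
  shows "(gram n J g *\<^sub>v v) $ i = (\<Sum>j\<in>J. (v \<diamondop> g j) * g j $ i)"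
proof -
  have "(gram n J g *\<^sub>v v) $ i = (\<Sum>k<n. (\<Sum>j\<in>J. g j $ i * cnj (g j $ k)) * v $ k)"
    using assms by (subst mult_vec_index[of _ n n]) (auto simp: gram_def)
  also have "\<dots> = (\<Sum>k<n. \<Sum>j\<in>J. v $ k * cnj (g j $ k) * g j $ i)"
    by (simp add: sum_distrib_left sum_distrib_right mult_ac)
  also have "\<dots> = (\<Sum>j\<in>J. \<Sum>k<n. v $ k * cnj (g j $ k) * g j $ i)" by (rule sum.swap)
  also have "\<dots> = (\<Sum>j\<in>J. (v \<diamondop> g j) * g j $ i)"
    using assms by (intro sum.cong) (auto simp: inner_sum[of _ n] sum_distrib_right)
  finally show ?thesis .
qed

lemma qform_gram:
  assumes "finite J" "\<And>j. j \<in> J \<Longrightarrow> g j \<in> carrier_vec n" "v \<in> carrier_vec n"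
  shows "qform (gram n J g) v = (\<Sum>j\<in>J. (cmod (v \<diamondop> g j))\<^sup>2)"
  using assms(1,2)
proof (induction J rule: finite_induct)
  case empty
  have "0\<^sub>m n n *\<^sub>v v = 0\<^sub>v n" using assms(3) by (intro eq_vecI) auto
  then show ?case using assms(3) by (simp add: gram_empty qform_def)
next
  case (insert j J)
  then show ?case using assms(3) by (simp add: gram_insert qform_add[of _ n] qform_outer[of _ n])
qed

definition eigensystem :: "nat \<Rightarrow> complex mat \<Rightarrow> nat \<Rightarrow> (nat \<Rightarrow> complex vec) \<Rightarrow> (nat \<Rightarrow> real) \<Rightarrow> bool" where
  "eigensystem n A k u \<tau> \<longleftrightarrow>
     (\<forall>i<k. u i \<in> carrier_vec n \<and> 0 \<le> \<tau> i \<and> A *\<^sub>v u i = complex_of_real (\<tau> i) \<cdot>\<^sub>v u i) \<and>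
     (\<forall>i<k. \<forall>j<k. u i \<diamondop> u j = (if i = j then 1 else 0))"

text \<open>Deflation: subtracting \<open>D\<close>, which has eigenvalue
  \<open>\<tau> i + 1\<close> at \<open>u i\<close>, moves all known eigenvectors to the eigenvalue
  \<open>-1\<close>. An eigenvector of \<open>B = A - D\<close> for any other eigenvalue is
  orthogonal to every \<open>u i\<close>, hence annihilated by \<open>D\<close>, hence an
  eigenvector of \<open>A\<close>. Such an eigenvalue exists, for otherwise \<open>A + 1 = D\<close>
  would be invertible although \<open>D\<close> is built from only \<open>k < n\<close>
  vectors.\<close>

lemma eigensystem_extend:
  assumes A: "hnd n A" and es: "eigensystem n A k u \<tau>" and k: "k < n"
  shows "\<exists>u \<tau>. eigensystem n A (Suc k) u \<tau>"
proof -
  have AC: "A \<in> carrier_mat n n" using A by auto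
  have uC: "u i \<in> carrier_vec n" and \<tau>0: "0 \<le> \<tau> i" and Au: "A *\<^sub>v u i = complex_of_real (\<tau> i) \<cdot>\<^sub>v u i" if "i < k" for i
    using es that by (auto simp: eigensystem_def)
  have on: "u i \<diamondop> u j = (if i = j then 1 else 0)" if "i < k" "j < k" for i j
    using es that by (auto simp: eigensystem_def)
  define g where "g i = complex_of_real (sqrt (\<tau> i + 1)) \<cdot>\<^sub>v u i" for i
  have gC: "g i \<in> carrier_vec n" if "i < k" for i using uC[OF that] by (simp add: g_def)
  define D where "D = gram n {..<k} g"
  have DC: "D \<in> carrier_mat n n" by (simp add: D_def)
  have sq: "complex_of_real (sqrt (\<tau> i + 1)) * complex_of_real (sqrt (\<tau> i + 1)) = complex_of_real (\<tau> i + 1)" if "i < k" for i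
    using \<tau>0[OF that] by (simp flip: of_real_mult)
  have Du: "D *\<^sub>v u j = complex_of_real (\<tau> j + 1) \<cdot>\<^sub>v u j" if j: "j < k" for j
  proof (rule eq_vecI)
    fix i assume "i < dim_vec (complex_of_real (\<tau> j + 1) \<cdot>\<^sub>v u j)"
    then have i: "i < n" using uC[OF j] by simp
    have "(D *\<^sub>v u j) $ i = (\<Sum>l<k. (u j \<diamondop> g l) * g l $ i)"
      unfolding D_def using i gC uC[OF j] by (intro gram_mult_vec) auto
    also have "\<dots> = (\<Sum>l<k. if l = j then complex_of_real (\<tau> j + 1) * u j $ i else 0)"
    proof (rule sum.cong[OF refl])
      fix l assume l: "l \<in> {..<k}"
      then have "(u j \<diamondop> g l) * g l $ i = (complex_of_real (sqrt (\<tau> l + 1)) * complex_of_real (sqrt (\<tau> l + 1))) * (u j \<diamondop> u l) * u l $ i"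
        using uC[OF j] uC[of l] i unfolding g_def by (simp add: inner_smult_right[of _ n])
      then show "(u j \<diamondop> g l) * g l $ i = (if l = j then complex_of_real (\<tau> j + 1) * u j $ i else 0)"
        using on[OF j, of l] l sq[of l] by auto
    qed
    also have "\<dots> = complex_of_real (\<tau> j + 1) * u j $ i" using j by simp
    finally show "(D *\<^sub>v u j) $ i = (complex_of_real (\<tau> j + 1) \<cdot>\<^sub>v u j) $ i" using i uC[OF j] by simp
  qed (use DC uC[OF j] in auto)
  define B where "B = A - D"
  have BC: "B \<in> carrier_mat n n" unfolding B_def using DC by (rule minus_carrier_mat)
  have hD: "hnd n D" unfolding D_def using gC by (intro hnd_gram) auto
  have Badj: "mat_adjoint B = B"
    unfolding B_def using AC DC by (simp add: adjoint_minus[of _ n n] hnd_adjoint[OF A] hnd_adjoint[OF hD])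
  have Bu: "B *\<^sub>v u i = - (1::complex) \<cdot>\<^sub>v u i" if i: "i < k" for i
    unfolding B_def using AC DC uC[OF i]
    by (intro eq_vecI) (auto simp: minus_mult_distrib_mat_vec[of _ n n] Au[OF i] Du[OF i] algebra_simps)
  have "\<exists>l. eigenvalue B l \<and> l \<noteq> - 1"
  proof (rule ccontr)
    assume neg: "\<not> ?thesis"
    have one: "hnd n (1\<^sub>m n)" by (rule hnd_one)
    have "B + 1\<^sub>m n = 0\<^sub>m n n"
    proof (rule hermitian_eq_0)
      show "B + 1\<^sub>m n \<in> carrier_mat n n" using BC by simp
      show "mat_adjoint (B + 1\<^sub>m n) = B + 1\<^sub>m n" using BC Badj by (simp add: adjoint_add[of _ n n])
      fix l assume "eigenvalue (B + 1\<^sub>m n) l"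
      then obtain v where v: "v \<in> carrier_vec n" "v \<noteq> 0\<^sub>v n" "(B + 1\<^sub>m n) *\<^sub>v v = l \<cdot>\<^sub>v v"
        using BC by (auto simp: eigenvalue_def eigenvector_def)
      have "B *\<^sub>v v = (l - 1) \<cdot>\<^sub>v v"
      proof (rule eq_vecI)
        fix i assume "i < dim_vec ((l - 1) \<cdot>\<^sub>v v)"
        then have i: "i < n" using v by simp
        have "((B + 1\<^sub>m n) *\<^sub>v v) $ i = (B *\<^sub>v v) $ i + v $ i"
          using BC v(1) i by (simp add: add_mult_distrib_mat_vec[of _ n n] del: index_mult_mat_vec)
        then show "(B *\<^sub>v v) $ i = ((l - 1) \<cdot>\<^sub>v v) $ i"
          using v i by (simp add: algebra_simps del: index_mult_mat_vec)
      qed (use BC v in auto)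
      from eigenvalueI[OF BC v(1,2) this] neg show "l = 0" by auto
    qed
    then have sh: "shift_mat n 1 A = D"
    proof -
      assume eq: "B + 1\<^sub>m n = 0\<^sub>m n n"
      show ?thesis
      proof (rule eq_matI)
        fix i j assume "i < dim_row D" "j < dim_col D"
        then have ij: "i < n" "j < n" using DC by auto
        have "(B + 1\<^sub>m n) $$ (i, j) = 0" unfolding eq using ij by simp
        then show "shift_mat n 1 A $$ (i, j) = D $$ (i, j)"
          using ij AC DC by (auto simp: shift_mat_def B_def add_eq_0_iff2 algebra_simps split: if_splits)
      qed (use AC DC in \<open>auto simp: shift_mat_def\<close>)
    qed
    \<comment> \<open>Here \<open>R\<close> is the inverse of \<open>1 + A\<close>, which equals
      \<open>D\<close>. The trace of \<open>R * D\<close> is therefore \<open>n\<close>; computed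
      vector by vector it is \<open>k\<close>.\<close>
    interpret resolvent n 1 A "1\<^sub>m n" using A one by unfold_locales auto
    have RD: "R * D = 1\<^sub>m n" using R_mult_shift sh AC by simp
    have "mtrace (R * D) = (\<Sum>j<k. (R *\<^sub>v g j) \<diamondop> g j)"
      unfolding D_def using gC by (intro mtrace_mult_gram) auto
    also have "\<dots> = (\<Sum>j<k. 1)"
    proof (rule sum.cong[OF refl])
      fix j assume "j \<in> {..<k}"
      then have j: "j < k" by simp
      have "u j = R * D *\<^sub>v u j" using RD uC[OF j] by simp
      also have "\<dots> = R *\<^sub>v (D *\<^sub>v u j)" using DC uC[OF j] by (intro mul_vec_assoc) auto
      also have "\<dots> = complex_of_real (\<tau> j + 1) \<cdot>\<^sub>v (R *\<^sub>v u j)"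
        unfolding Du[OF j] using uC[OF j] by (simp add: mult_mat_vec[of _ n n])
      finally have uj: "u j = complex_of_real (\<tau> j + 1) \<cdot>\<^sub>v (R *\<^sub>v u j)" .
      have "(R *\<^sub>v g j) \<diamondop> g j = (complex_of_real (sqrt (\<tau> j + 1)) * complex_of_real (sqrt (\<tau> j + 1))) * ((R *\<^sub>v u j) \<diamondop> u j)"
        unfolding g_def using uC[OF j]
        by (simp add: mult_mat_vec[of _ n n] inner_smult_left[of _ n] inner_smult_right[of _ n])
      also have "\<dots> = (complex_of_real (\<tau> j + 1) \<cdot>\<^sub>v (R *\<^sub>v u j)) \<diamondop> u j"
        unfolding sq[OF j] using uC[OF j] by (simp add: inner_smult_left[of _ n])
      also have "\<dots> = 1" unfolding uj[symmetric] using on[OF j j] by simp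
      finally show "(R *\<^sub>v g j) \<diamondop> g j = 1" .
    qed
    finally have "complex_of_nat n = of_nat k" unfolding RD mtrace_one by simp
    then show False using k by simp
  qed
  then obtain l where l: "eigenvalue B l" "l \<noteq> - 1" by auto
  then obtain v where v: "v \<in> carrier_vec n" "v \<noteq> 0\<^sub>v n" "B *\<^sub>v v = l \<cdot>\<^sub>v v"
    using BC by (auto simp: eigenvalue_def eigenvector_def)
  have orth: "v \<diamondop> u i = 0" if i: "i < k" for i
  proof -
    have "l * (v \<diamondop> u i) = (B *\<^sub>v v) \<diamondop> u i" using v uC[OF i] by (simp add: inner_smult_left[of _ n])
    also have "\<dots> = v \<diamondop> (B *\<^sub>v u i)" using inner_adjoint[OF BC v(1) uC[OF i]] Badj by simp
    also have "\<dots> = - (v \<diamondop> u i)" unfolding Bu[OF i] using v uC[OF i] by (simp add: inner_smult_right[of _ n])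
    finally have "(l + 1) * (v \<diamondop> u i) = 0" by (simp add: algebra_simps)
    then show ?thesis using l(2) by (simp add: add_eq_0_iff2)
  qed
  have Dv: "(D *\<^sub>v v) $ i = 0" if "i < n" for i
  proof -
    have "(D *\<^sub>v v) $ i = (\<Sum>j<k. (v \<diamondop> g j) * g j $ i)"
      unfolding D_def using that gC v by (intro gram_mult_vec) auto
    also have "\<dots> = 0" using orth uC v by (intro sum.neutral) (auto simp: g_def inner_smult_right[of _ n])
    finally show ?thesis .
  qed
  have Av: "A *\<^sub>v v = l \<cdot>\<^sub>v v"
  proof (rule eq_vecI)
    fix i assume "i < dim_vec (l \<cdot>\<^sub>v v)"
    then have i: "i < n" using v by simp
    have "(B *\<^sub>v v) $ i = (A *\<^sub>v v) $ i - (D *\<^sub>v v) $ i"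
      unfolding B_def using AC DC v(1) i by (simp add: minus_mult_distrib_mat_vec[of _ n n] del: index_mult_mat_vec)
    then show "(A *\<^sub>v v) $ i = (l \<cdot>\<^sub>v v) $ i" using v(3) Dv[OF i] by simp
  qed (use AC v in auto)
  have "eigenvalue (A * 1\<^sub>m n) l" using eigenvalueI[OF AC v(1,2) Av] AC by simp
  from eigenvalue_hnd_mult[OF A hnd_one this] have lr: "l = complex_of_real (Re l)" "0 \<le> Re l"
    by auto
  have vpos: "vnorm2 v > 0"
    using vnorm2_eq_0[OF v(1)] v(2) vnorm2_nonneg[of v] by (auto simp: less_le)
  define r where "r = 1 / sqrt (vnorm2 v)"
  define w where "w = complex_of_real r \<cdot>\<^sub>v v"
  have wC: "w \<in> carrier_vec n" using v by (simp add: w_def)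
  have Aw: "A *\<^sub>v w = complex_of_real (Re l) \<cdot>\<^sub>v w"
    unfolding w_def using AC v Av lr(1) by (simp add: mult_mat_vec[OF AC v(1)] smult_smult_assoc mult.commute)
  have ww: "w \<diamondop> w = 1"
  proof -
    have "w \<diamondop> w = complex_of_real (r * r * vnorm2 v)"
      unfolding w_def using v by (simp add: inner_smult_left[of _ n] inner_smult_right[of _ n] inner_self[of v])
    also have "r * r * vnorm2 v = 1"
      using vpos by (simp add: r_def field_simps)
    finally show ?thesis by simp
  qed
  have wu: "w \<diamondop> u i = 0" "u i \<diamondop> w = 0" if "i < k" for i
  proof -
    show "w \<diamondop> u i = 0" unfolding w_def using orth[OF that] v uC[OF that] by (simp add: inner_smult_left[of _ n])
    then show "u i \<diamondop> w = 0" using inner_swap[OF wC uC[OF that]] by simp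
  qed
  have "eigensystem n A (Suc k) (u(k := w)) (\<tau>(k := Re l))"
    unfolding eigensystem_def using uC \<tau>0 Au on wC Aw ww wu lr by (auto simp: less_Suc_eq)
  then show ?thesis by blast
qed

lemma eigensystem_exists:
  assumes A: "hnd n A" and "k \<le> n"
  shows "\<exists>u \<tau>. eigensystem n A k u \<tau>"
  using assms(2)
proof (induction k)
  case 0
  then show ?case by (auto simp: eigensystem_def)
next
  case (Suc k)
  then show ?case using eigensystem_extend[OF A] by auto
qed

text \<open>A left inverse of a square matrix is also a right inverse: orthonormality says
  \<open>mat_adjoint U * U = 1\<close>, and \<open>U * mat_adjoint U\<close> is the Gram
  matrix.\<close>

lemma orthonormal_gram_eq_one:
  assumes u: "\<And>i. i < n \<Longrightarrow> u i \<in> carrier_vec n"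
    and on: "\<And>i j. i < n \<Longrightarrow> j < n \<Longrightarrow> u i \<diamondop> u j = (if i = j then 1 else 0)"
  shows "gram n {..<n} u = 1\<^sub>m n"
proof -
  define U where "U = mat n n (\<lambda>(a, i). u i $ a)"
  have U: "U \<in> carrier_mat n n" by (simp add: U_def)
  have UU: "mat_adjoint U * U = 1\<^sub>m n"
  proof (rule eq_matI)
    fix i j assume "i < dim_row (1\<^sub>m n :: complex mat)" "j < dim_col (1\<^sub>m n :: complex mat)"
    then have ij: "i < n" "j < n" by auto
    have "(mat_adjoint U * U) $$ (i, j) = (\<Sum>l<n. mat_adjoint U $$ (i, l) * U $$ (l, j))"
      using U ij by (intro mult_mat_index) auto
    also have "\<dots> = (\<Sum>l<n. u j $ l * cnj (u i $ l))"
    proof (rule sum.cong[OF refl])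
      fix l assume "l \<in> {..<n}"
      then have "mat_adjoint U $$ (i, l) = cnj (U $$ (l, i))" "U $$ (l, i) = u i $ l" "U $$ (l, j) = u j $ l"
        using U ij by (auto simp: U_def)
      then show "mat_adjoint U $$ (i, l) * U $$ (l, j) = u j $ l * cnj (u i $ l)"
        by (simp only: mult.commute)
    qed
    also have "\<dots> = u j \<diamondop> u i"
      using u ij by (intro inner_sum[symmetric]) auto
    finally show "(mat_adjoint U * U) $$ (i, j) = 1\<^sub>m n $$ (i, j)" using on ij by auto
  qed (use U in auto)
  have "mat_adjoint U \<in> carrier_mat n n" using U by simp
  from mat_mult_left_right_inverse[OF this U UU] have "U * mat_adjoint U = 1\<^sub>m n" .
  moreover have "U * mat_adjoint U = gram n {..<n} u"
  proof (rule eq_matI)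
    fix i j assume "i < dim_row (gram n {..<n} u)" "j < dim_col (gram n {..<n} u)"
    then have ij: "i < n" "j < n" by (auto simp: gram_def)
    have "(U * mat_adjoint U) $$ (i, j) = (\<Sum>l<n. U $$ (i, l) * mat_adjoint U $$ (l, j))"
      using U ij by (intro mult_mat_index) auto
    also have "\<dots> = (\<Sum>l<n. u l $ i * cnj (u l $ j))"
    proof (rule sum.cong[OF refl])
      fix l assume "l \<in> {..<n}"
      then have "mat_adjoint U $$ (l, j) = cnj (U $$ (j, l))" "U $$ (i, l) = u l $ i" "U $$ (j, l) = u l $ j"
        using U ij by (auto simp: U_def)
      then show "U $$ (i, l) * mat_adjoint U $$ (l, j) = u l $ i * cnj (u l $ j)"
        by simp
    qed
    also have "\<dots> = gram n {..<n} u $$ (i, j)"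
      using ij by (simp add: gram_def)
    finally show "(U * mat_adjoint U) $$ (i, j) = gram n {..<n} u $$ (i, j)" .
  qed (use U in \<open>auto simp: gram_def\<close>)
  ultimately show ?thesis by simp
qed

lemma spectral_theorem:
  assumes A: "hnd n A"
  obtains u \<tau> where "\<And>i. i < n \<Longrightarrow> u i \<in> carrier_vec n" "\<And>i. i < n \<Longrightarrow> 0 \<le> (\<tau> i :: real)"
    "\<And>i j. i < n \<Longrightarrow> j < n \<Longrightarrow> u i \<diamondop> u j = (if i = j then 1 else 0)"
    "A = gram n {..<n} (\<lambda>i. complex_of_real (sqrt (\<tau> i)) \<cdot>\<^sub>v u i)"
proof -
  have AC: "A \<in> carrier_mat n n" using A by auto
  obtain u \<tau> where es: "eigensystem n A n u \<tau>" using eigensystem_exists[OF A order_refl] by auto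
  have uC: "u i \<in> carrier_vec n" and \<tau>0: "0 \<le> \<tau> i" and Au: "A *\<^sub>v u i = complex_of_real (\<tau> i) \<cdot>\<^sub>v u i" if "i < n" for i
    using es that by (auto simp: eigensystem_def)
  have on: "u i \<diamondop> u j = (if i = j then 1 else 0)" if "i < n" "j < n" for i j
    using es that by (auto simp: eigensystem_def)
  have ud: "dim_vec (u i) = n" if "i < n" for i using uC[OF that] by simp
  have one: "gram n {..<n} u = 1\<^sub>m n" using uC on by (rule orthonormal_gram_eq_one)
  have "A = gram n {..<n} (\<lambda>i. complex_of_real (sqrt (\<tau> i)) \<cdot>\<^sub>v u i)" (is "_ = ?G")
  proof (rule eq_matI)
    fix i j assume "i < dim_row ?G" "j < dim_col ?G"
    then have ij: "i < n" "j < n" by (auto simp: gram_def)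
    have "A $$ (i, j) = (A * gram n {..<n} u) $$ (i, j)" unfolding one using AC by simp
    also have "\<dots> = (\<Sum>l<n. A $$ (i, l) * gram n {..<n} u $$ (l, j))"
      using AC ij by (intro mult_mat_index) auto
    also have "\<dots> = (\<Sum>l<n. \<Sum>m<n. A $$ (i, l) * u m $ l * cnj (u m $ j))"
      using ij by (auto simp: gram_def sum_distrib_left mult_ac intro!: sum.cong)
    also have "\<dots> = (\<Sum>m<n. \<Sum>l<n. A $$ (i, l) * u m $ l * cnj (u m $ j))" by (rule sum.swap)
    also have "\<dots> = (\<Sum>m<n. (A *\<^sub>v u m) $ i * cnj (u m $ j))"
      using AC ij uC by (intro sum.cong refl) (simp add: mult_vec_index[of _ n n] sum_distrib_right del: index_mult_mat_vec)
    also have "\<dots> = (\<Sum>m<n. (complex_of_real (sqrt (\<tau> m)) * complex_of_real (sqrt (\<tau> m))) * u m $ i * cnj (u m $ j))"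
      using ij ud \<tau>0 by (intro sum.cong refl) (simp add: Au flip: of_real_mult)
    also have "\<dots> = ?G $$ (i, j)"
      using ij ud by (auto simp: gram_def mult_ac intro!: sum.cong)
    finally show "A $$ (i, j) = ?G $$ (i, j)" .
  qed (use AC in \<open>auto simp: gram_def\<close>)
  with uC \<tau>0 on show ?thesis by (intro that[of u \<tau>])
qed

text \<open>The matrix is unitarily similar to a diagonal one. Indices outside \<open>S\<close> stay
  in the list as zeros, so that truncation keeps the number of eigenvalues.\<close>

lemma spectral_truncation_char_poly:
  assumes uC: "\<And>i. i < n \<Longrightarrow> u i \<in> carrier_vec n"
    and \<tau>0: "\<And>i. i < n \<Longrightarrow> 0 \<le> (\<tau> i :: real)"
    and on: "\<And>i j. i < n \<Longrightarrow> j < n \<Longrightarrow> u i \<diamondop> u j = (if i = j then 1 else 0)"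
    and S: "S \<subseteq> {..<n}"
  shows "char_poly (gram n S (\<lambda>i. complex_of_real (sqrt (\<tau> i)) \<cdot>\<^sub>v u i)) =
    (\<Prod>a\<leftarrow>map complex_of_real (map (\<lambda>i. if i \<in> S then \<tau> i else 0) [0..<n]). [:- a, 1:])"
proof -
  let ?d = "\<lambda>i. if i \<in> S then \<tau> i else 0"
  let ?G = "gram n S (\<lambda>i. complex_of_real (sqrt (\<tau> i)) \<cdot>\<^sub>v u i)"
  have ud: "dim_vec (u i) = n" if "i < n" for i using uC[OF that] by simp
  define U where "U = mat n n (\<lambda>(a, i). u i $ a)"
  define D where "D = mat n n (\<lambda>(i, j). if i = j then complex_of_real (?d i) else 0)"
  have U: "U \<in> carrier_mat n n" and D: "D \<in> carrier_mat n n" by (auto simp: U_def D_def)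
  have "U * mat_adjoint U = gram n {..<n} u"
  proof (rule eq_matI)
    fix i j assume "i < dim_row (gram n {..<n} u)" "j < dim_col (gram n {..<n} u)"
    then have ij: "i < n" "j < n" by (auto simp: gram_def)
    have "(U * mat_adjoint U) $$ (i, j) = (\<Sum>l<n. U $$ (i, l) * mat_adjoint U $$ (l, j))"
      using U ij by (intro mult_mat_index) auto
    also have "\<dots> = (\<Sum>l<n. u l $ i * cnj (u l $ j))"
    proof (rule sum.cong[OF refl])
      fix l assume "l \<in> {..<n}"
      then have "mat_adjoint U $$ (l, j) = cnj (U $$ (j, l))" "U $$ (i, l) = u l $ i" "U $$ (j, l) = u l $ j"
        using U ij by (auto simp: U_def)
      then show "U $$ (i, l) * mat_adjoint U $$ (l, j) = u l $ i * cnj (u l $ j)"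
        by simp
    qed
    also have "\<dots> = gram n {..<n} u $$ (i, j)"
      using ij by (simp add: gram_def)
    finally show "(U * mat_adjoint U) $$ (i, j) = gram n {..<n} u $$ (i, j)" .
  qed (use U in \<open>auto simp: gram_def\<close>)
  then have UU: "U * mat_adjoint U = 1\<^sub>m n" using orthonormal_gram_eq_one[OF uC on] by simp
  have "mat_adjoint U \<in> carrier_mat n n" using U by simp
  from mat_mult_left_right_inverse[OF U this UU] have UU': "mat_adjoint U * U = 1\<^sub>m n" .
  have "?G = U * D * mat_adjoint U"
  proof (rule eq_matI)
    fix i j assume "i < dim_row (U * D * mat_adjoint U)" "j < dim_col (U * D * mat_adjoint U)"
    then have ij: "i < n" "j < n" using U D by auto
    have UD: "(U * D) $$ (i, l) = u l $ i * complex_of_real (?d l)" if l: "l < n" for l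
    proof -
      have "(U * D) $$ (i, l) = (\<Sum>m<n. U $$ (i, m) * D $$ (m, l))"
        using U D ij l by (intro mult_mat_index) auto
      also have "\<dots> = (\<Sum>m<n. if m = l then u l $ i * complex_of_real (?d l) else 0)"
        using U D ij l by (intro sum.cong refl) (auto simp: U_def D_def)
      finally show ?thesis using l by simp
    qed
    have "(U * D * mat_adjoint U) $$ (i, j) = (\<Sum>l<n. (U * D) $$ (i, l) * mat_adjoint U $$ (l, j))"
      using U D ij by (intro mult_mat_index) auto
    also have "\<dots> = (\<Sum>l<n. if l \<in> S then complex_of_real (\<tau> l) * u l $ i * cnj (u l $ j) else 0)"
      using ij U by (intro sum.cong refl) (simp add: UD, auto simp: U_def)
    also have "\<dots> = (\<Sum>l\<in>S. complex_of_real (\<tau> l) * u l $ i * cnj (u l $ j))"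
      using S by (subst sum.inter_restrict[symmetric]) (auto simp: Int_absorb1)
    also have "\<dots> = (\<Sum>l\<in>S. (complex_of_real (sqrt (\<tau> l)) * complex_of_real (sqrt (\<tau> l))) * u l $ i * cnj (u l $ j))"
      using S \<tau>0 by (intro sum.cong refl) (auto simp flip: of_real_mult)
    also have "\<dots> = ?G $$ (i, j)"
      using ij ud S by (auto simp: gram_def mult_ac subset_eq intro!: sum.cong)
    finally show "?G $$ (i, j) = (U * D * mat_adjoint U) $$ (i, j)" by simp
  qed (use U D in \<open>auto simp: gram_def\<close>)
  from similar_matI[OF _ UU UU' this] have "similar_mat ?G D" using U D by simp
  then have "char_poly ?G = char_poly D" by (rule char_poly_similar)
  also have "\<dots> = (\<Prod>a\<leftarrow>diag_mat D. [:- a, 1:])"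
    by (rule char_poly_upper_triangular[OF D]) (auto simp: D_def)
  also have "diag_mat D = map complex_of_real (map ?d [0..<n])"
    by (auto simp: diag_mat_def D_def)
  finally show ?thesis .
qed

text \<open>In the orthonormal basis the form is a weighted sum of squared coordinates; extending
  the sum to the whole basis gives Parseval's identity.\<close>

lemma spectral_truncation_le:
  assumes uC: "\<And>i. i < n \<Longrightarrow> u i \<in> carrier_vec n"
    and \<tau>0: "\<And>i. i < n \<Longrightarrow> 0 \<le> (\<tau> i :: real)"
    and on: "\<And>i j. i < n \<Longrightarrow> j < n \<Longrightarrow> u i \<diamondop> u j = (if i = j then 1 else 0)"
    and S: "S \<subseteq> {..<n}" and le: "\<And>i. i \<in> S \<Longrightarrow> \<tau> i \<le> b" and b: "0 \<le> b" and v: "v \<in> carrier_vec n"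
  shows "qform (gram n S (\<lambda>i. complex_of_real (sqrt (\<tau> i)) \<cdot>\<^sub>v u i)) v \<le> b * vnorm2 v"
proof -
  have fS: "finite S" using S finite_subset by blast
  have "qform (gram n S (\<lambda>i. complex_of_real (sqrt (\<tau> i)) \<cdot>\<^sub>v u i)) v = (\<Sum>i\<in>S. \<tau> i * (cmod (v \<diamondop> u i))\<^sup>2)"
    using S uC v \<tau>0 fS
    by (subst qform_gram) (auto simp: inner_smult_right[of _ n] norm_mult power_mult_distrib subset_eq intro!: sum.cong)
  also have "\<dots> \<le> (\<Sum>i\<in>S. b * (cmod (v \<diamondop> u i))\<^sup>2)"
    using le by (intro sum_mono mult_right_mono) auto
  also have "\<dots> \<le> (\<Sum>i<n. b * (cmod (v \<diamondop> u i))\<^sup>2)"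
    using S b by (intro sum_mono2) auto
  also have "\<dots> = b * qform (gram n {..<n} u) v"
    using uC v by (subst qform_gram) (auto simp: sum_distrib_left)
  also have "\<dots> = b * vnorm2 v" using v by (simp add: orthonormal_gram_eq_one[OF uC on])
  finally show ?thesis .
qed

section \<open>Bounded differences\<close>

lemma fun_upd_space_PiM:
  assumes "C \<in> space (PiM I M)" "y \<in> space (M j)"
  shows "C(j := y) \<in> space (PiM (insert j I) M)"
  using assms by (auto simp: space_PiM PiE_def extensional_def)

text \<open>McDiarmid's inequality in exponential form, by integrating out one coordinate at a time.
  The partial mean \<open>h\<close> inherits the bounded differences; given the other coordinates,
  \<open>f\<close> stays within \<open>c\<close> of \<open>h\<close>, and Hoeffding's lemma
  contributes one factor \<open>exp (l\<^sup>2 * c\<^sup>2 / 2)\<close>.\<close>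

lemma bounded_difference_mgf:
  fixes M :: "'i \<Rightarrow> 'a measure" and f :: "('i \<Rightarrow> 'a) \<Rightarrow> real"
  assumes "\<And>i. prob_space (M i)" and "finite I"
    and "f \<in> borel_measurable (PiM I M)"
    and "\<And>C. C \<in> space (PiM I M) \<Longrightarrow> \<bar>f C\<bar> \<le> B"
    and "\<And>C j y z. C \<in> space (PiM I M) \<Longrightarrow> j \<in> I \<Longrightarrow> y \<in> space (M j) \<Longrightarrow> z \<in> space (M j) \<Longrightarrow>
      \<bar>f (C(j := y)) - f (C(j := z))\<bar> \<le> c"
    and "0 \<le> c" "0 < l"
  shows "(\<integral>\<^sup>+C. ennreal (exp (l * (f C - integral\<^sup>L (PiM I M) f))) \<partial>PiM I M)
    \<le> ennreal (exp (l\<^sup>2 * c\<^sup>2 * real (card I) / 2))"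
  using assms(2-5)
proof (induction I arbitrary: f rule: finite_induct)
  case empty
  interpret product_prob_space M by (intro product_prob_spaceI assms(1))
  have [simp]: "integral\<^sup>L (PiM {} M) f = f (\<lambda>_. undefined)"
    by (simp add: PiM_empty lebesgue_integral_count_space_finite)
  show ?case
    by (simp add: PiM_empty nn_integral_count_space_finite lebesgue_integral_count_space_finite)
next
  case (insert j I)
  interpret Mj: prob_space "M j" by (rule assms(1))
  interpret product_prob_space M by (intro product_prob_spaceI assms(1))
  interpret PI: prob_space "PiM I M" by (intro prob_space_PiM assms(1))
  interpret PJ: prob_space "PiM (insert j I) M" by (intro prob_space_PiM assms(1))
  note [measurable] = insert.prems(1)
  have upd: "C(j := y) \<in> space (PiM (insert j I) M)" if "C \<in> space (PiM I M)" "y \<in> space (M j)" for C y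
    using that by (rule fun_upd_space_PiM)
  have fmeas2: "(\<lambda>(C, y). f (C(j := y))) \<in> borel_measurable (PiM I M \<Otimes>\<^sub>M M j)"
    using measurable_comp[OF measurable_add_dim insert.prems(1)] by (simp add: comp_def case_prod_unfold)
  note [measurable] = fmeas2
  have fmeas1 [measurable]: "(\<lambda>y. f (C(j := y))) \<in> borel_measurable (M j)" if "C \<in> space (PiM I M)" for C
    using measurable_comp[OF measurable_component_update[OF that insert.hyps(2)] insert.prems(1)] by (simp add: comp_def)
  define h where "h C = (\<integral>y. f (C(j := y)) \<partial>M j)" for C
  have hm [measurable]: "h \<in> borel_measurable (PiM I M)"
    unfolding h_def by measurable
  have fint: "integrable (PiM (insert j I) M) f"
    using insert.prems(2) by (intro PJ.integrable_const_bound[of _ B]) auto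
  have fint1: "integrable (M j) (\<lambda>y. f (C(j := y)))" if C: "C \<in> space (PiM I M)" for C
    using insert.prems(2) upd[OF C] C by (intro Mj.integrable_const_bound[of _ B]) auto
  have Eh: "integral\<^sup>L (PiM (insert j I) M) f = integral\<^sup>L (PiM I M) h"
    unfolding h_def by (rule product_integral_insert[OF insert.hyps(1,2) fint])
  have hB: "\<bar>h C\<bar> \<le> B" if C: "C \<in> space (PiM I M)" for C
  proof -
    have "norm (h C) \<le> (\<integral>y. norm (f (C(j := y))) \<partial>M j)" unfolding h_def by (rule integral_norm_bound)
    also have "\<dots> \<le> (\<integral>y. B \<partial>M j)"
      using insert.prems(2) upd[OF C] fint1[OF C] by (intro integral_mono) auto
    finally show ?thesis by (simp add: Mj.prob_space)
  qed
  have hc: "\<bar>h (C(i := y)) - h (C(i := z))\<bar> \<le> c"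
    if C: "C \<in> space (PiM I M)" and i: "i \<in> I" and y: "y \<in> space (M i)" and z: "z \<in> space (M i)" for C i y z
  proof -
    have ij: "i \<noteq> j" using i insert.hyps by auto
    have Cy: "C(i := y) \<in> space (PiM I M)" "C(i := z) \<in> space (PiM I M)"
      using fun_upd_space_PiM[OF C y] fun_upd_space_PiM[OF C z] i by (auto simp: insert_absorb)
    have "h (C(i := y)) - h (C(i := z)) = (\<integral>w. f (C(i := y, j := w)) - f (C(i := z, j := w)) \<partial>M j)"
      unfolding h_def using fint1[OF Cy(1)] fint1[OF Cy(2)] by (rule Bochner_Integration.integral_diff[symmetric])
    also have "norm \<dots> \<le> (\<integral>w. norm (f (C(i := y, j := w)) - f (C(i := z, j := w))) \<partial>M j)"
      by (rule integral_norm_bound)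
    also have "\<dots> \<le> (\<integral>w. c \<partial>M j)"
    proof (rule integral_mono)
      show "integrable (M j) (\<lambda>w. norm (f (C(i := y, j := w)) - f (C(i := z, j := w))))"
        using fint1[OF Cy(1)] fint1[OF Cy(2)] by auto
      fix w assume w: "w \<in> space (M j)"
      show "norm (f (C(i := y, j := w)) - f (C(i := z, j := w))) \<le> c"
        unfolding fun_upd_twist[OF ij] real_norm_def
        by (rule insert.prems(3)[OF upd[OF C w] insertI2[OF i] y z])
    qed auto
    finally show ?thesis by (simp add: Mj.prob_space)
  qed
  define e where "e = integral\<^sup>L (PiM I M) h"
  have inner: "(\<integral>\<^sup>+y. ennreal (exp (l * (f (C(j := y)) - e))) \<partial>M j) \<le>
      ennreal (exp (l * (h C - e))) * ennreal (exp (l\<^sup>2 * c\<^sup>2 / 2))" if C: "C \<in> space (PiM I M)" for C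
  proof -
    have bnd: "\<bar>f (C(j := y)) - h C\<bar> \<le> c" if y: "y \<in> space (M j)" for y
    proof -
      have "f (C(j := y)) - h C = (\<integral>w. f (C(j := y)) - f (C(j := w)) \<partial>M j)"
        unfolding h_def using fint1[OF C] by (subst Bochner_Integration.integral_diff) (auto simp: Mj.prob_space)
      also have "norm \<dots> \<le> (\<integral>w. norm (f (C(j := y)) - f (C(j := w))) \<partial>M j)"
        by (rule integral_norm_bound)
      also have "\<dots> \<le> (\<integral>w. c \<partial>M j)"
      proof (rule integral_mono)
        show "integrable (M j) (\<lambda>w. norm (f (C(j := y)) - f (C(j := w))))"
          using fint1[OF C] by auto
        fix w assume w: "w \<in> space (M j)"
        show "norm (f (C(j := y)) - f (C(j := w))) \<le> c"
          unfolding real_norm_def by (rule insert.prems(3)[OF upd[OF C y] insertI1 y w, unfolded fun_upd_upd])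
      qed auto
      finally show ?thesis by (simp add: Mj.prob_space)
    qed
    interpret X: interval_bounded_random_variable "M j" "\<lambda>y. f (C(j := y))" "h C - c" "h C + c"
    proof
      show "AE x in M j. f (C(j := x)) \<in> {h C - c..h C + c}"
      proof (rule AE_I2)
        fix x assume "x \<in> space (M j)"
        then show "f (C(j := x)) \<in> {h C - c..h C + c}" using bnd[of x] by (auto simp: abs_le_iff)
      qed
    qed (use fmeas1[OF C] in simp)
    have "(\<integral>\<^sup>+y. ennreal (exp (l * (f (C(j := y)) - e))) \<partial>M j) =
        (\<integral>\<^sup>+y. ennreal (exp (l * (h C - e))) * ennreal (exp (l * (f (C(j := y)) - h C))) \<partial>M j)"
      by (intro nn_integral_cong) (simp flip: ennreal_mult' exp_add add: algebra_simps)
    also have "\<dots> = ennreal (exp (l * (h C - e))) * (\<integral>\<^sup>+y. ennreal (exp (l * (f (C(j := y)) - h C))) \<partial>M j)"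
      using fmeas1[OF C] by (intro nn_integral_cmult) auto
    also have "\<dots> \<le> ennreal (exp (l * (h C - e))) * ennreal (exp (l\<^sup>2 * c\<^sup>2 / 2))"
    proof (rule mult_left_mono)
      \<comment> \<open>The interval around \<open>h C\<close> has length \<open>2 * c\<close>,
        which turns the \<open>8\<close> of Hoeffding's lemma into \<open>2\<close>.\<close>
      have "l\<^sup>2 * (h C + c - (h C - c))\<^sup>2 / 8 = l\<^sup>2 * c\<^sup>2 / 2" by (simp add: power2_eq_square)
      then show "(\<integral>\<^sup>+y. ennreal (exp (l * (f (C(j := y)) - h C))) \<partial>M j) \<le> ennreal (exp (l\<^sup>2 * c\<^sup>2 / 2))"
        using X.Hoeffdings_lemma_nn_integral[OF \<open>0 < l\<close>] unfolding h_def by presburger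
    qed simp
    finally show ?thesis .
  qed
  have "(\<integral>\<^sup>+C. ennreal (exp (l * (f C - integral\<^sup>L (PiM (insert j I) M) f))) \<partial>PiM (insert j I) M) =
      (\<integral>\<^sup>+C. (\<integral>\<^sup>+y. ennreal (exp (l * (f (C(j := y)) - e))) \<partial>M j) \<partial>PiM I M)"
    unfolding Eh e_def[symmetric] by (rule product_nn_integral_insert[OF insert.hyps(1,2)]) measurable
  also have "\<dots> \<le> (\<integral>\<^sup>+C. ennreal (exp (l * (h C - e))) * ennreal (exp (l\<^sup>2 * c\<^sup>2 / 2)) \<partial>PiM I M)"
    by (intro nn_integral_mono inner)
  also have "\<dots> = (\<integral>\<^sup>+C. ennreal (exp (l * (h C - e))) \<partial>PiM I M) * ennreal (exp (l\<^sup>2 * c\<^sup>2 / 2))"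
    by (intro nn_integral_multc) measurable
  also have "\<dots> \<le> ennreal (exp (l\<^sup>2 * c\<^sup>2 * real (card I) / 2)) * ennreal (exp (l\<^sup>2 * c\<^sup>2 / 2))"
    unfolding e_def by (intro mult_right_mono insert.IH hm hB hc) auto
  also have "\<dots> = ennreal (exp (l\<^sup>2 * c\<^sup>2 * real (card (insert j I)) / 2))"
    using insert.hyps by (simp flip: ennreal_mult' exp_add add: algebra_simps add_divide_distrib)
  finally show ?case .
qed

lemma bounded_difference_tail_upper:
  fixes M :: "'i \<Rightarrow> 'a measure" and f :: "('i \<Rightarrow> 'a) \<Rightarrow> real"
  assumes M: "\<And>i. prob_space (M i)" and I: "finite I" "I \<noteq> {}"
    and f [measurable]: "f \<in> borel_measurable (PiM I M)"
    and B: "\<And>C. C \<in> space (PiM I M) \<Longrightarrow> \<bar>f C\<bar> \<le> B"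
    and diff: "\<And>C j y z. C \<in> space (PiM I M) \<Longrightarrow> j \<in> I \<Longrightarrow> y \<in> space (M j) \<Longrightarrow> z \<in> space (M j) \<Longrightarrow>
      \<bar>f (C(j := y)) - f (C(j := z))\<bar> \<le> c"
    and c: "0 < c" and \<epsilon>: "0 < \<epsilon>"
  shows "emeasure (PiM I M) {C \<in> space (PiM I M). \<epsilon> \<le> f C - integral\<^sup>L (PiM I M) f}
    \<le> ennreal (exp (- \<epsilon>\<^sup>2 / (2 * c\<^sup>2 * real (card I))))"
proof -
  define n where "n = real (card I)"
  have n: "n > 0" using I by (auto simp: n_def card_gt_0_iff)
  \<comment> \<open>The minimiser of the Chernoff exponent
    \<open>- l * \<epsilon> + l\<^sup>2 * c\<^sup>2 * n / 2\<close>.\<close>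
  define l where "l = \<epsilon> / (c\<^sup>2 * n)"
  have l: "l > 0" using c \<epsilon> n by (simp add: l_def)
  let ?e = "integral\<^sup>L (PiM I M) f"
  have "{C \<in> space (PiM I M). \<epsilon> \<le> f C - ?e} =
      {C \<in> space (PiM I M). 1 \<le> ennreal (exp (- l * \<epsilon>)) * ennreal (exp (l * (f C - ?e)))}"
  proof (intro Collect_cong conj_cong refl)
    fix C
    have "1 \<le> ennreal (exp (- l * \<epsilon>)) * ennreal (exp (l * (f C - ?e))) \<longleftrightarrow> 1 \<le> exp (- l * \<epsilon> + l * (f C - ?e))"
      by (simp flip: ennreal_mult' exp_add add: ennreal_ge_1)
    also have "\<dots> \<longleftrightarrow> 0 \<le> l * (f C - ?e - \<epsilon>)" by (simp add: algebra_simps)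
    also have "\<dots> \<longleftrightarrow> \<epsilon> \<le> f C - ?e" using l by (simp add: zero_le_mult_iff)
    finally show "\<epsilon> \<le> f C - ?e \<longleftrightarrow> 1 \<le> ennreal (exp (- l * \<epsilon>)) * ennreal (exp (l * (f C - ?e)))" by simp
  qed
  also have "emeasure (PiM I M) \<dots> \<le> ennreal (exp (- l * \<epsilon>)) * (\<integral>\<^sup>+C. ennreal (exp (l * (f C - ?e))) \<partial>PiM I M)"
    using nn_integral_Markov_inequality[where u = "\<lambda>C. ennreal (exp (l * (f C - ?e)))" and M = "PiM I M"
        and A = "space (PiM I M)" and c = "ennreal (exp (- l * \<epsilon>))"]
    by (simp add: nn_set_integral_space)
  also have "\<dots> \<le> ennreal (exp (- l * \<epsilon>)) * ennreal (exp (l\<^sup>2 * c\<^sup>2 * n / 2))"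
    unfolding n_def using bounded_difference_mgf[OF M I(1) f B diff _ l] c by (intro mult_left_mono) auto
  also have "\<dots> = ennreal (exp (- l * \<epsilon> + l\<^sup>2 * c\<^sup>2 * n / 2))"
    by (simp flip: ennreal_mult' exp_add)
  also have "- l * \<epsilon> + l\<^sup>2 * c\<^sup>2 * n / 2 = - \<epsilon>\<^sup>2 / (2 * c\<^sup>2 * n)"
    using c n by (simp add: l_def field_simps power2_eq_square)
  finally show ?thesis by (simp add: n_def)
qed

lemma bounded_difference_tail:
  fixes M :: "'i \<Rightarrow> 'a measure" and f :: "('i \<Rightarrow> 'a) \<Rightarrow> real"
  assumes M: "\<And>i. prob_space (M i)" and I: "finite I" "I \<noteq> {}"
    and f [measurable]: "f \<in> borel_measurable (PiM I M)"
    and B: "\<And>C. C \<in> space (PiM I M) \<Longrightarrow> \<bar>f C\<bar> \<le> B"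
    and diff: "\<And>C j y z. C \<in> space (PiM I M) \<Longrightarrow> j \<in> I \<Longrightarrow> y \<in> space (M j) \<Longrightarrow> z \<in> space (M j) \<Longrightarrow>
      \<bar>f (C(j := y)) - f (C(j := z))\<bar> \<le> c"
    and c: "0 < c" and \<epsilon>: "0 < \<epsilon>"
  shows "emeasure (PiM I M) {C \<in> space (PiM I M). \<epsilon> \<le> \<bar>f C - integral\<^sup>L (PiM I M) f\<bar>}
    \<le> ennreal (2 * exp (- \<epsilon>\<^sup>2 / (2 * c\<^sup>2 * real (card I))))"
proof -
  let ?e = "integral\<^sup>L (PiM I M) f"
  let ?b = "exp (- \<epsilon>\<^sup>2 / (2 * c\<^sup>2 * real (card I)))"
  have "{C \<in> space (PiM I M). \<epsilon> \<le> \<bar>f C - ?e\<bar>} =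
      {C \<in> space (PiM I M). \<epsilon> \<le> f C - ?e} \<union> {C \<in> space (PiM I M). \<epsilon> \<le> - f C - integral\<^sup>L (PiM I M) (\<lambda>C. - f C)}"
    using \<epsilon> by (auto simp: abs_if)
  also have "emeasure (PiM I M) \<dots> \<le> emeasure (PiM I M) {C \<in> space (PiM I M). \<epsilon> \<le> f C - ?e} +
      emeasure (PiM I M) {C \<in> space (PiM I M). \<epsilon> \<le> - f C - integral\<^sup>L (PiM I M) (\<lambda>C. - f C)}"
    by (intro emeasure_subadditive) measurable
  also have "\<dots> \<le> ennreal ?b + ennreal ?b"
    using B diff
    by (intro add_mono bounded_difference_tail_upper[OF M I _ _ _ c \<epsilon>, where B = B]) (auto simp: abs_minus_commute)
  also have "\<dots> = ennreal (2 * ?b)" by (simp flip: ennreal_plus)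
  finally show ?thesis .
qed

text \<open>Follows from the exponential moments by
  \<open>y\<^sup>2 \<le> 2 * (exp y + exp (- y))\<close>, where \<open>y\<close> is \<open>l\<close>
  times the deviation and \<open>l = 1 / (c * sqrt n)\<close>. For this \<open>l\<close> both
  exponential moments are at most \<open>exp (1 / 2) \<le> 2\<close>, and \<open>2 * (2 + 2)\<close>
  is the constant \<open>8\<close>.\<close>

lemma bounded_difference_variance:
  fixes M :: "'i \<Rightarrow> 'a measure" and f :: "('i \<Rightarrow> 'a) \<Rightarrow> real"
  assumes M: "\<And>i. prob_space (M i)" and I: "finite I" "I \<noteq> {}"
    and f [measurable]: "f \<in> borel_measurable (PiM I M)"
    and B: "\<And>C. C \<in> space (PiM I M) \<Longrightarrow> \<bar>f C\<bar> \<le> B"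
    and diff: "\<And>C j y z. C \<in> space (PiM I M) \<Longrightarrow> j \<in> I \<Longrightarrow> y \<in> space (M j) \<Longrightarrow> z \<in> space (M j) \<Longrightarrow>
      \<bar>f (C(j := y)) - f (C(j := z))\<bar> \<le> c"
    and c: "0 < c"
  shows "(\<integral>\<^sup>+C. ennreal ((f C - integral\<^sup>L (PiM I M) f)\<^sup>2) \<partial>PiM I M) \<le> ennreal (8 * c\<^sup>2 * real (card I))"
proof -
  define n where "n = real (card I)"
  have n: "n > 0" using I by (auto simp: n_def card_gt_0_iff)
  define l where "l = 1 / (c * sqrt n)"
  have l: "l > 0" using c n by (simp add: l_def)
  have l2: "l\<^sup>2 = 1 / (c\<^sup>2 * n)" using n c by (simp add: l_def power_divide power_mult_distrib)
  let ?e = "integral\<^sup>L (PiM I M) f"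
  have pt: "y\<^sup>2 \<le> 2 * (exp y + exp (- y))" for y :: real
  proof -
    have "t\<^sup>2 / 2 \<le> exp t" if "0 \<le> t" for t :: real
      using exp_lower_Taylor_quadratic[OF that] that by linarith
    from this[of "\<bar>y\<bar>"] have "y\<^sup>2 / 2 \<le> exp \<bar>y\<bar>" by simp
    moreover have "exp \<bar>y\<bar> \<le> exp y + exp (- y)" by (cases "y \<ge> 0") (auto intro: add_increasing)
    ultimately have "y\<^sup>2 / 2 \<le> exp y + exp (- y)" by (rule order_trans)
    then show ?thesis by (simp add: field_simps)
  qed
  have eneg: "integral\<^sup>L (PiM I M) (\<lambda>C. - f C) = - ?e" by simp
  have mgf: "(\<integral>\<^sup>+C. ennreal (exp (l * (f C - ?e))) \<partial>PiM I M) \<le> ennreal (exp (1 / 2))"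
    using bounded_difference_mgf[OF M I(1) f B diff _ l] c n l2 unfolding n_def[symmetric] by simp
  have mgf': "(\<integral>\<^sup>+C. ennreal (exp (- (l * (f C - ?e)))) \<partial>PiM I M) \<le> ennreal (exp (1 / 2))"
  proof -
    have "(\<integral>\<^sup>+C. ennreal (exp (l * (- f C - integral\<^sup>L (PiM I M) (\<lambda>C. - f C)))) \<partial>PiM I M) \<le> ennreal (exp (l\<^sup>2 * c\<^sup>2 * real (card I) / 2))"
      using c l B diff by (intro bounded_difference_mgf[OF M I(1), where B = B]) (auto simp: abs_minus_commute)
    moreover have "l * (- f C - integral\<^sup>L (PiM I M) (\<lambda>C. - f C)) = - (l * (f C - ?e))" for C
      unfolding eneg by (simp add: algebra_simps)
    ultimately show ?thesis using c n l2 unfolding n_def[symmetric] by simp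
  qed
  have "(\<integral>\<^sup>+C. ennreal ((f C - ?e)\<^sup>2) \<partial>PiM I M) \<le>
      (\<integral>\<^sup>+C. ennreal (2 * c\<^sup>2 * n) * (ennreal (exp (l * (f C - ?e))) + ennreal (exp (- (l * (f C - ?e))))) \<partial>PiM I M)"
  proof (rule nn_integral_mono)
    fix C
    have "(f C - ?e)\<^sup>2 = (c\<^sup>2 * n) * (l * (f C - ?e))\<^sup>2"
      using c n by (simp add: power_mult_distrib l2)
    also have "\<dots> \<le> (c\<^sup>2 * n) * (2 * (exp (l * (f C - ?e)) + exp (- (l * (f C - ?e)))))"
      using n by (intro mult_left_mono pt) auto
    finally have "(f C - ?e)\<^sup>2 \<le> (2 * c\<^sup>2 * n) * (exp (l * (f C - ?e)) + exp (- (l * (f C - ?e))))"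
      by (simp add: algebra_simps)
    then show "ennreal ((f C - ?e)\<^sup>2) \<le> ennreal (2 * c\<^sup>2 * n) * (ennreal (exp (l * (f C - ?e))) + ennreal (exp (- (l * (f C - ?e)))))"
      using n by (simp flip: ennreal_plus ennreal_mult')
  qed
  also have "\<dots> = ennreal (2 * c\<^sup>2 * n) * ((\<integral>\<^sup>+C. ennreal (exp (l * (f C - ?e))) \<partial>PiM I M) +
      (\<integral>\<^sup>+C. ennreal (exp (- (l * (f C - ?e)))) \<partial>PiM I M))"
    by (subst nn_integral_cmult, measurable, subst nn_integral_add) auto
  also have "\<dots> \<le> ennreal (2 * c\<^sup>2 * n) * (ennreal (exp (1 / 2)) + ennreal (exp (1 / 2)))"
    by (intro mult_left_mono add_mono mgf mgf') auto
  also have "\<dots> = ennreal (2 * c\<^sup>2 * n * (2 * exp (1 / 2)))"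
    using n by (simp flip: ennreal_plus ennreal_mult')
  also have "\<dots> \<le> ennreal (8 * c\<^sup>2 * n)"
  proof (rule ennreal_leI)
    have "exp (1 / 2) \<le> (1 + (1/2) + (1/2)\<^sup>2 :: real)" by (rule exp_bound) auto
    also have "\<dots> \<le> 2" by (simp add: power2_eq_square)
    finally have "exp (1 / 2) \<le> (2 :: real)" .
    then have "(2 * c\<^sup>2 * n) * (2 * exp (1 / 2)) \<le> (2 * c\<^sup>2 * n) * (2 * 2)"
      using n by (intro mult_left_mono) auto
    then show "2 * c\<^sup>2 * n * (2 * exp (1 / 2)) \<le> 8 * c\<^sup>2 * n" by simp
  qed
  finally show ?thesis by (simp add: n_def)
qed

section \<open>Second moments of linear and quadratic forms in independent variables\<close>

lemma borel_measurable_cnj [measurable]: "cnj \<in> borel_measurable borel"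
  by (intro borel_measurable_continuous_onI continuous_intros)

lemma nn_integral_ennreal_le:
  fixes f :: "'a \<Rightarrow> real"
  assumes "integrable M f" "\<And>x. 0 \<le> f x" "integral\<^sup>L M f \<le> b"
  shows "(\<integral>\<^sup>+x. ennreal (f x) \<partial>M) \<le> ennreal b"
  using assms by (subst nn_integral_eq_integral) (auto intro: ennreal_leI)

text \<open>The constant \<open>C4\<close> is a parameter separate from \<open>\<nu>\<close>, so
  that one value can serve the laws for all \<open>N\<close>.\<close>

locale unit_variable = prob_space \<nu> for \<nu> :: "complex measure" +
  fixes C4 :: real
  assumes sets_eq [measurable_cong]: "sets \<nu> = sets borel"
    and int1 [simp]: "integrable \<nu> (\<lambda>z. z)" and int2: "integrable \<nu> (\<lambda>z. (cmod z)\<^sup>2)" and int4: "integrable \<nu> (\<lambda>z. (cmod z) ^ 4)"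
    and mean: "(\<integral>z. z \<partial>\<nu>) = 0" and var: "(\<integral>z. (cmod z)\<^sup>2 \<partial>\<nu>) = 1" and mom4: "(\<integral>z. (cmod z) ^ 4 \<partial>\<nu>) \<le> C4"
begin

lemma linear_second_moment:
  "(\<integral>\<^sup>+z. ennreal ((cmod (s + a * z))\<^sup>2) \<partial>\<nu>) \<le> ennreal ((cmod s)\<^sup>2 + (cmod a)\<^sup>2)"
proof (rule nn_integral_ennreal_le)
  define r where "r z = Re (cnj s * a * z)" for z
  have eq: "(cmod (s + a * z))\<^sup>2 = (cmod s)\<^sup>2 + 2 * r z + (cmod a)\<^sup>2 * (cmod z)\<^sup>2" for z
    unfolding cmod_power2 r_def by (simp add: power2_eq_square algebra_simps)
  have i1: "integrable \<nu> r" unfolding r_def by (intro integrable_Re integrable_mult_right int1)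
  have "integral\<^sup>L \<nu> r = Re (\<integral>z. cnj s * a * z \<partial>\<nu>)"
    unfolding r_def by (intro integral_Re integrable_mult_right int1)
  also have "(\<integral>z. cnj s * a * z \<partial>\<nu>) = 0" by (simp add: mean)
  finally have m1: "integral\<^sup>L \<nu> r = 0" by simp
  show "integrable \<nu> (\<lambda>z. (cmod (s + a * z))\<^sup>2)"
    unfolding eq using i1 int2 by (intro Bochner_Integration.integrable_add integrable_mult_right) auto
  show "(\<integral>z. (cmod (s + a * z))\<^sup>2 \<partial>\<nu>) \<le> (cmod s)\<^sup>2 + (cmod a)\<^sup>2"
    unfolding eq using i1 int2 by (simp add: m1 var prob_space)
qed simp

lemma integrable_cnj: "integrable \<nu> (\<lambda>z. cnj z)"
  using int1 by (simp add: complex_integrable_cnj)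

text \<open>This is the change of a centred quadratic form with value \<open>q\<close> when a
  variable \<open>z\<close> is added. It has mean zero, so its cross term with \<open>q\<close>
  disappears. Its own three summands are correlated through the mean of \<open>z\<^sup>2\<close> and
  third moments, which need not vanish; they are separated by \<open>(a + b + c)\<^sup>2 \<le> 3 *
  (a\<^sup>2 + b\<^sup>2 + c\<^sup>2)\<close>.\<close>

lemma quadratic_increment:
  "integrable \<nu> (\<lambda>z. m * (complex_of_real ((cmod z)\<^sup>2) - 1) + cnj z * \<alpha> + z * \<beta>)"
  "(\<integral>z. m * (complex_of_real ((cmod z)\<^sup>2) - 1) + cnj z * \<alpha> + z * \<beta> \<partial>\<nu>) = 0"
  "(\<integral>\<^sup>+z. ennreal ((cmod (q + (m * (complex_of_real ((cmod z)\<^sup>2) - 1) + cnj z * \<alpha> + z * \<beta>)))\<^sup>2) \<partial>\<nu>)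
    \<le> ennreal ((cmod q)\<^sup>2 + 3 * (C4 * (cmod m)\<^sup>2 + (cmod \<alpha>)\<^sup>2 + (cmod \<beta>)\<^sup>2))"
proof -
  define d where "d z = m * (complex_of_real ((cmod z)\<^sup>2) - 1) + cnj z * \<alpha> + z * \<beta>" for z
  have i2: "integrable \<nu> (\<lambda>z. complex_of_real ((cmod z)\<^sup>2))"
    using int2 by (rule integrable_of_real)
  show dint: "integrable \<nu> (\<lambda>z. m * (complex_of_real ((cmod z)\<^sup>2) - 1) + cnj z * \<alpha> + z * \<beta>)"
    using i2 integrable_cnj int1
    by (intro Bochner_Integration.integrable_add integrable_mult_right integrable_mult_left Bochner_Integration.integrable_diff) auto
  have "(\<integral>z. complex_of_real ((cmod z)\<^sup>2) - 1 \<partial>\<nu>) = 0"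
    using i2 var by (subst Bochner_Integration.integral_diff) (auto simp: prob_space simp del: of_real_power)
  then show dmean: "(\<integral>z. m * (complex_of_real ((cmod z)\<^sup>2) - 1) + cnj z * \<alpha> + z * \<beta> \<partial>\<nu>) = 0"
    using i2 integrable_cnj int1 by (simp add: mean del: of_real_power)
  have dm [measurable]: "d \<in> borel_measurable \<nu>" unfolding d_def by measurable
  have bound: "(cmod (d z))\<^sup>2 \<le> 3 * ((cmod m)\<^sup>2 * ((cmod z)\<^sup>2 - 1)\<^sup>2 + (cmod \<alpha>)\<^sup>2 * (cmod z)\<^sup>2 + (cmod \<beta>)\<^sup>2 * (cmod z)\<^sup>2)" for z
  proof -
    have "cmod (d z) \<le> cmod (m * (complex_of_real ((cmod z)\<^sup>2) - 1)) + cmod (cnj z * \<alpha>) + cmod (z * \<beta>)"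
      unfolding d_def by (intro order_trans[OF norm_triangle_ineq] add_mono norm_triangle_ineq order_refl)
    moreover have "complex_of_real ((cmod z)\<^sup>2) - 1 = complex_of_real ((cmod z)\<^sup>2 - 1)" by simp
    ultimately have "cmod (d z) \<le> cmod m * \<bar>(cmod z)\<^sup>2 - 1\<bar> + cmod z * cmod \<alpha> + cmod z * cmod \<beta>"
      by (metis (no_types, lifting) norm_mult norm_of_real complex_mod_cnj)
    then have "(cmod (d z))\<^sup>2 \<le> (cmod m * \<bar>(cmod z)\<^sup>2 - 1\<bar> + cmod z * cmod \<alpha> + cmod z * cmod \<beta>)\<^sup>2"
      by (rule power_mono) simp
    also have "\<dots> \<le> 3 * ((cmod m * \<bar>(cmod z)\<^sup>2 - 1\<bar>)\<^sup>2 + (cmod z * cmod \<alpha>)\<^sup>2 + (cmod z * cmod \<beta>)\<^sup>2)"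
    proof -
      have "(a + b + c)\<^sup>2 \<le> 3 * (a\<^sup>2 + b\<^sup>2 + c\<^sup>2)" for a b c :: real
      proof -
        have "3 * (a\<^sup>2 + b\<^sup>2 + c\<^sup>2) - (a + b + c)\<^sup>2 = (a - b)\<^sup>2 + (b - c)\<^sup>2 + (a - c)\<^sup>2"
          by (simp add: power2_eq_square algebra_simps)
        then show ?thesis by (smt (verit) zero_le_power2)
      qed
      then show ?thesis .
    qed
    finally show ?thesis by (simp add: power_mult_distrib mult_ac)
  qed
  have i4: "integrable \<nu> (\<lambda>z. ((cmod z)\<^sup>2 - 1)\<^sup>2)"
  proof -
    have "((cmod z)\<^sup>2 - 1)\<^sup>2 = (cmod z) ^ 4 - 2 * (cmod z)\<^sup>2 + 1" for z :: complex
      by (simp add: power2_eq_square algebra_simps power4_eq_xxxx)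
    then show ?thesis using int2 int4 by auto
  qed
  have m4: "(\<integral>z. ((cmod z)\<^sup>2 - 1)\<^sup>2 \<partial>\<nu>) \<le> C4"
  proof -
    have "((cmod z)\<^sup>2 - 1)\<^sup>2 = (cmod z) ^ 4 - 2 * (cmod z)\<^sup>2 + 1" for z :: complex
      by (simp add: power2_eq_square algebra_simps power4_eq_xxxx)
    then have "(\<integral>z. ((cmod z)\<^sup>2 - 1)\<^sup>2 \<partial>\<nu>) = (\<integral>z. (cmod z) ^ 4 \<partial>\<nu>) - 2 * 1 + 1"
      using int2 int4 by (simp add: var prob_space)
    then show ?thesis using mom4 by simp
  qed
  let ?U = "\<lambda>z. 3 * ((cmod m)\<^sup>2 * ((cmod z)\<^sup>2 - 1)\<^sup>2 + (cmod \<alpha>)\<^sup>2 * (cmod z)\<^sup>2 + (cmod \<beta>)\<^sup>2 * (cmod z)\<^sup>2)"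
  have U: "integrable \<nu> ?U" using i4 int2 by auto
  have d2: "integrable \<nu> (\<lambda>z. (cmod (d z))\<^sup>2)"
    by (rule Bochner_Integration.integrable_bound[OF U]) (use bound in \<open>auto simp: order_trans[OF bound]\<close>)
  have "(\<integral>z. (cmod (d z))\<^sup>2 \<partial>\<nu>) \<le> integral\<^sup>L \<nu> ?U"
    using d2 U bound by (intro integral_mono)
  also have "\<dots> = 3 * ((cmod m)\<^sup>2 * (\<integral>z. ((cmod z)\<^sup>2 - 1)\<^sup>2 \<partial>\<nu>) + (cmod \<alpha>)\<^sup>2 + (cmod \<beta>)\<^sup>2)"
    using i4 int2 by (simp add: var)
  also have "\<dots> \<le> 3 * ((cmod m)\<^sup>2 * C4 + (cmod \<alpha>)\<^sup>2 + (cmod \<beta>)\<^sup>2)"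
    using m4 by (intro mult_left_mono add_mono) auto
  finally have d2le: "(\<integral>z. (cmod (d z))\<^sup>2 \<partial>\<nu>) \<le> 3 * (C4 * (cmod m)\<^sup>2 + (cmod \<alpha>)\<^sup>2 + (cmod \<beta>)\<^sup>2)"
    by (simp add: mult.commute)
  define r where "r z = Re (cnj q * d z)" for z
  have eq: "(cmod (q + d z))\<^sup>2 = (cmod q)\<^sup>2 + 2 * r z + (cmod (d z))\<^sup>2" for z
    unfolding cmod_power2 r_def by (simp add: power2_eq_square algebra_simps)
  have dint': "integrable \<nu> d" and dmean': "integral\<^sup>L \<nu> d = 0"
    using dint dmean unfolding d_def by auto
  have i1: "integrable \<nu> r" unfolding r_def by (intro integrable_Re integrable_mult_right dint')
  have "integral\<^sup>L \<nu> r = Re (\<integral>z. cnj q * d z \<partial>\<nu>)"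
    unfolding r_def by (intro integral_Re integrable_mult_right dint')
  also have "(\<integral>z. cnj q * d z \<partial>\<nu>) = 0" using dmean' by simp
  finally have m1: "integral\<^sup>L \<nu> r = 0" by simp
  have "(\<integral>\<^sup>+z. ennreal ((cmod (q + d z))\<^sup>2) \<partial>\<nu>)
    \<le> ennreal ((cmod q)\<^sup>2 + 3 * (C4 * (cmod m)\<^sup>2 + (cmod \<alpha>)\<^sup>2 + (cmod \<beta>)\<^sup>2))"
  proof (rule nn_integral_ennreal_le)
    show "integrable \<nu> (\<lambda>z. (cmod (q + d z))\<^sup>2)"
      unfolding eq using i1 d2 by (intro Bochner_Integration.integrable_add integrable_mult_right) auto
    show "(\<integral>z. (cmod (q + d z))\<^sup>2 \<partial>\<nu>) \<le> (cmod q)\<^sup>2 + 3 * (C4 * (cmod m)\<^sup>2 + (cmod \<alpha>)\<^sup>2 + (cmod \<beta>)\<^sup>2)"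
      unfolding eq using i1 d2 d2le by (simp add: m1 prob_space)
  qed simp
  then show "(\<integral>\<^sup>+z. ennreal ((cmod (q + (m * (complex_of_real ((cmod z)\<^sup>2) - 1) + cnj z * \<alpha> + z * \<beta>)))\<^sup>2) \<partial>\<nu>)
    \<le> ennreal ((cmod q)\<^sup>2 + 3 * (C4 * (cmod m)\<^sup>2 + (cmod \<alpha>)\<^sup>2 + (cmod \<beta>)\<^sup>2))"
    unfolding d_def .
qed

end

text \<open>The quadratic form of \<open>M\<close> in \<open>y\<close> minus the trace of
  \<open>M\<close>, which is its mean for independent centred variables of unit variance.
  Subtracting the trace entry by entry suits an induction on \<open>I\<close>.\<close>

definition centred_form :: "nat set \<Rightarrow> (nat \<Rightarrow> nat \<Rightarrow> complex) \<Rightarrow> (nat \<Rightarrow> complex) \<Rightarrow> complex" where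
  "centred_form I M y = (\<Sum>i\<in>I. \<Sum>k\<in>I. M i k * (cnj (y i) * y k - (if i = k then 1 else 0)))"

locale unit_variables =
  fixes \<nu> :: "nat \<Rightarrow> complex measure" and C4 :: real
  assumes uv: "\<And>i. unit_variable (\<nu> i) C4"
begin

lemma prob: "prob_space (\<nu> i)"
  using uv[of i] by (rule unit_variable.axioms)

lemma sets_\<nu> [measurable_cong]: "sets (\<nu> i) = sets borel"
  using uv[of i] by (rule unit_variable.sets_eq)

lemma C4_nonneg: "0 \<le> C4"
proof -
  interpret unit_variable "\<nu> 0" C4 by (rule uv)
  have "0 \<le> (\<integral>z. (cmod z) ^ 4 \<partial>\<nu> 0)" by simp
  then show ?thesis using mom4 by linarith
qed

sublocale product_prob_space \<nu>
  by (intro product_prob_spaceI prob)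

lemma linear_moment:
  assumes "finite I"
  shows "(\<integral>\<^sup>+y. ennreal ((cmod (\<Sum>k\<in>I. a k * y k))\<^sup>2) \<partial>PiM I \<nu>) \<le> ennreal (\<Sum>k\<in>I. (cmod (a k))\<^sup>2)"
  using assms
proof (induction I rule: finite_induct)
  case empty
  then show ?case by (simp add: PiM_empty nn_integral_count_space_finite)
next
  case (insert j I)
  interpret j: unit_variable "\<nu> j" C4 by (rule uv)
  interpret PI: prob_space "PiM I \<nu>" by (intro prob_space_PiM prob)
  have upd: "(\<Sum>k\<in>insert j I. a k * (y(j := z)) k) = (\<Sum>k\<in>I. a k * y k) + a j * z" for y z
  proof -
    have "(\<Sum>k\<in>I. a k * (y(j := z)) k) = (\<Sum>k\<in>I. a k * y k)"
      using insert by (intro sum.cong) auto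
    then show ?thesis using insert by simp
  qed
  have "(\<integral>\<^sup>+y. ennreal ((cmod (\<Sum>k\<in>insert j I. a k * y k))\<^sup>2) \<partial>PiM (insert j I) \<nu>) =
      (\<integral>\<^sup>+y. (\<integral>\<^sup>+z. ennreal ((cmod (\<Sum>k\<in>insert j I. a k * (y(j := z)) k))\<^sup>2) \<partial>\<nu> j) \<partial>PiM I \<nu>)"
    by (rule product_nn_integral_insert[OF insert(1,2)]) measurable
  also have "\<dots> \<le> (\<integral>\<^sup>+y. ennreal ((cmod (\<Sum>k\<in>I. a k * y k))\<^sup>2 + (cmod (a j))\<^sup>2) \<partial>PiM I \<nu>)"
    unfolding upd by (intro nn_integral_mono j.linear_second_moment)
  also have "\<dots> = (\<integral>\<^sup>+y. ennreal ((cmod (\<Sum>k\<in>I. a k * y k))\<^sup>2) \<partial>PiM I \<nu>) + ennreal ((cmod (a j))\<^sup>2)"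
    by (simp add: ennreal_plus nn_integral_add PI.emeasure_space_1)
  also have "\<dots> \<le> ennreal (\<Sum>k\<in>I. (cmod (a k))\<^sup>2) + ennreal ((cmod (a j))\<^sup>2)"
    by (intro add_mono insert.IH) auto
  also have "\<dots> = ennreal (\<Sum>k\<in>insert j I. (cmod (a k))\<^sup>2)"
    using insert by (simp add: add.commute sum_nonneg flip: ennreal_plus)
  finally show ?case .
qed

lemma centred_form_insert:
  assumes "finite I" "j \<notin> I"
  shows "centred_form (insert j I) M (y(j := z)) = centred_form I M y +
    (M j j * (complex_of_real ((cmod z)\<^sup>2) - 1) + cnj z * (\<Sum>k\<in>I. M j k * y k) + z * (\<Sum>i\<in>I. M i j * cnj (y i)))"
proof -
  have ne: "k \<noteq> j" if "k \<in> I" for k using that assms by auto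
  have 1: "(\<Sum>k\<in>insert j I. M j k * (cnj ((y(j := z)) j) * (y(j := z)) k - (if j = k then 1 else 0))) =
      M j j * (complex_of_real ((cmod z)\<^sup>2) - 1) + cnj z * (\<Sum>k\<in>I. M j k * y k)"
  proof -
    have "(\<Sum>k\<in>I. M j k * (cnj ((y(j := z)) j) * (y(j := z)) k - (if j = k then 1 else 0))) = cnj z * (\<Sum>k\<in>I. M j k * y k)"
      unfolding sum_distrib_left using ne by (intro sum.cong) auto
    moreover have "cnj z * z = complex_of_real ((cmod z)\<^sup>2)" by (metis complex_norm_square mult.commute)
    ultimately show ?thesis using assms by simp
  qed
  have 2: "(\<Sum>k\<in>insert j I. M i k * (cnj ((y(j := z)) i) * (y(j := z)) k - (if i = k then 1 else 0))) =
      z * (M i j * cnj (y i)) + (\<Sum>k\<in>I. M i k * (cnj (y i) * y k - (if i = k then 1 else 0)))" if i: "i \<in> I" for i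
  proof -
    have "(\<Sum>k\<in>I. M i k * (cnj ((y(j := z)) i) * (y(j := z)) k - (if i = k then 1 else 0))) =
        (\<Sum>k\<in>I. M i k * (cnj (y i) * y k - (if i = k then 1 else 0)))"
      using ne i by (intro sum.cong) auto
    then show ?thesis using assms ne[OF i] by simp
  qed
  define V where "V = centred_form (insert j I) M (y(j := z))"
  have "V = (\<Sum>k\<in>insert j I. M j k * (cnj ((y(j := z)) j) * (y(j := z)) k - (if j = k then 1 else 0))) +
      (\<Sum>i\<in>I. \<Sum>k\<in>insert j I. M i k * (cnj ((y(j := z)) i) * (y(j := z)) k - (if i = k then 1 else 0)))"
    unfolding V_def centred_form_def using assms by (rule sum.insert)
  also have "(\<Sum>i\<in>I. \<Sum>k\<in>insert j I. M i k * (cnj ((y(j := z)) i) * (y(j := z)) k - (if i = k then 1 else 0))) =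
      z * (\<Sum>i\<in>I. M i j * cnj (y i)) + centred_form I M y"
    unfolding centred_form_def sum_distrib_left sum.distrib[symmetric] using 2 by (intro sum.cong) auto
  finally show ?thesis unfolding 1 V_def[symmetric] by (simp add: algebra_simps)
qed

lemma centred_form_measurable [measurable]:
  "finite I \<Longrightarrow> centred_form I M \<in> borel_measurable (PiM I \<nu>)"
  unfolding centred_form_def by measurable

text \<open>Variables are added one at a time. Each increment has mean zero given the earlier
  variables, so the second moments add up; the new row and column of \<open>M\<close> enter through
  linear forms in the earlier variables, whose second moments are the sums of their squared
  coefficients.\<close>

lemma centred_form_second_moment:
  assumes "finite I"
  shows "(\<integral>\<^sup>+y. ennreal ((cmod (centred_form I M y))\<^sup>2) \<partial>PiM I \<nu>)
    \<le> ennreal (3 * (C4 + 1) * (\<Sum>i\<in>I. \<Sum>k\<in>I. (cmod (M i k))\<^sup>2))"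
  using assms
proof (induction I rule: finite_induct)
  case empty
  then show ?case by (simp add: PiM_empty nn_integral_count_space_finite centred_form_def)
next
  case (insert j I)
  interpret j: unit_variable "\<nu> j" C4 by (rule uv)
  interpret PI: prob_space "PiM I \<nu>" by (intro prob_space_PiM prob)
  note [measurable] = centred_form_measurable[OF insert(1)] centred_form_measurable[OF finite.insertI[OF insert(1)]]
  let ?\<alpha> = "\<lambda>y. \<Sum>k\<in>I. M j k * y k" and ?\<beta> = "\<lambda>y. \<Sum>i\<in>I. M i j * cnj (y i)"
  let ?a = "\<Sum>k\<in>I. (cmod (M j k))\<^sup>2" and ?b = "\<Sum>i\<in>I. (cmod (M i j))\<^sup>2" and ?m = "(cmod (M j j))\<^sup>2"
  let ?S = "\<Sum>i\<in>I. \<Sum>k\<in>I. (cmod (M i k))\<^sup>2"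
  have \<beta>: "cmod (?\<beta> y) = cmod (\<Sum>i\<in>I. cnj (M i j) * y i)" for y
  proof -
    have "?\<beta> y = cnj (\<Sum>i\<in>I. cnj (M i j) * y i)" by simp
    then show ?thesis by (metis complex_mod_cnj)
  qed
  have "(\<integral>\<^sup>+y. ennreal ((cmod (centred_form (insert j I) M y))\<^sup>2) \<partial>PiM (insert j I) \<nu>) =
      (\<integral>\<^sup>+y. (\<integral>\<^sup>+z. ennreal ((cmod (centred_form (insert j I) M (y(j := z))))\<^sup>2) \<partial>\<nu> j) \<partial>PiM I \<nu>)"
    by (rule product_nn_integral_insert[OF insert(1,2)]) measurable
  also have "\<dots> \<le> (\<integral>\<^sup>+y. ennreal ((cmod (centred_form I M y))\<^sup>2 + 3 * (C4 * ?m + (cmod (?\<alpha> y))\<^sup>2 + (cmod (?\<beta> y))\<^sup>2)) \<partial>PiM I \<nu>)"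
    unfolding centred_form_insert[OF insert(1,2)] by (intro nn_integral_mono j.quadratic_increment(3))
  also have "\<dots> = (\<integral>\<^sup>+y. ennreal ((cmod (centred_form I M y))\<^sup>2) + (ennreal (3 * C4 * ?m) +
      (ennreal 3 * ennreal ((cmod (?\<alpha> y))\<^sup>2) + ennreal 3 * ennreal ((cmod (?\<beta> y))\<^sup>2))) \<partial>PiM I \<nu>)"
    using C4_nonneg
    by (intro nn_integral_cong) (simp flip: ennreal_plus ennreal_mult' add: algebra_simps del: ennreal_numeral)
  also have "\<dots> = (\<integral>\<^sup>+y. ennreal ((cmod (centred_form I M y))\<^sup>2) \<partial>PiM I \<nu>) + (ennreal (3 * C4 * ?m) +
      (ennreal 3 * (\<integral>\<^sup>+y. ennreal ((cmod (?\<alpha> y))\<^sup>2) \<partial>PiM I \<nu>) + ennreal 3 * (\<integral>\<^sup>+y. ennreal ((cmod (?\<beta> y))\<^sup>2) \<partial>PiM I \<nu>)))"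
    by (simp add: nn_integral_add nn_integral_cmult PI.emeasure_space_1 del: ennreal_numeral)
  also have "\<dots> \<le> ennreal (3 * (C4 + 1) * ?S) + (ennreal (3 * C4 * ?m) + (ennreal 3 * ennreal ?a + ennreal 3 * ennreal ?b))"
    unfolding \<beta> using linear_moment[OF insert(1), of "M j"] linear_moment[OF insert(1), of "\<lambda>i. cnj (M i j)"]
    by (intro add_mono insert.IH mult_left_mono order_refl) auto
  also have "\<dots> = ennreal (3 * (C4 + 1) * ?S + (3 * C4 * ?m + (3 * ?a + 3 * ?b)))"
    using C4_nonneg by (simp flip: ennreal_plus ennreal_mult' add: sum_nonneg del: ennreal_numeral)
  also have "\<dots> \<le> ennreal (3 * (C4 + 1) * (?S + (?m + ?a + ?b)))"
  proof (rule ennreal_leI)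
    have "0 \<le> ?m" "0 \<le> C4 * ?a" "0 \<le> C4 * ?b" using C4_nonneg by (auto simp: sum_nonneg)
    then show "3 * (C4 + 1) * ?S + (3 * C4 * ?m + (3 * ?a + 3 * ?b)) \<le> 3 * (C4 + 1) * (?S + (?m + ?a + ?b))"
      by (simp add: algebra_simps)
  qed
  also have "?S + (?m + ?a + ?b) = (\<Sum>i\<in>insert j I. \<Sum>k\<in>insert j I. (cmod (M i k))\<^sup>2)"
    using insert by (simp add: sum.distrib algebra_simps)
  finally show ?case .
qed

lemma integrable_centred_form:
  assumes "finite I"
  shows "integrable (PiM I \<nu>) (centred_form I M)"
proof -
  have sq: "(\<lambda>y. (centred_form I M y)\<^sup>2) \<in> borel_measurable (PiM I \<nu>)"
    by (intro borel_measurable_power centred_form_measurable assms)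
  have "(\<integral>\<^sup>+y. ennreal (norm (centred_form I M y ^ 2)) \<partial>PiM I \<nu>) < \<infinity>"
    using le_less_trans[OF centred_form_second_moment[OF assms, of M] ennreal_less_top] by (simp add: norm_power)
  from integrableI_bounded[OF sq this] show ?thesis
    by (rule finite_measure.square_integrable_imp_integrable[OF prob_space.finite_measure[OF prob_space_PiM[OF prob]]
        centred_form_measurable[OF assms]])
qed

lemma integral_centred_form:
  assumes "finite I"
  shows "integral\<^sup>L (PiM I \<nu>) (centred_form I M) = 0"
  using assms
proof (induction I rule: finite_induct)
  case empty
  then show ?case by (simp add: centred_form_def)
next
  case (insert j I)
  interpret j: unit_variable "\<nu> j" C4 by (rule uv)
  have "integral\<^sup>L (PiM (insert j I) \<nu>) (centred_form (insert j I) M) =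
      (\<integral>y. (\<integral>z. centred_form (insert j I) M (y(j := z)) \<partial>\<nu> j) \<partial>PiM I \<nu>)"
    using insert by (intro product_integral_insert integrable_centred_form) auto
  also have "\<dots> = (\<integral>y. centred_form I M y \<partial>PiM I \<nu>)"
  proof (rule Bochner_Integration.integral_cong[OF refl])
    fix y
    have "(\<integral>z. centred_form (insert j I) M (y(j := z)) \<partial>\<nu> j) = (\<integral>z. centred_form I M y \<partial>\<nu> j) + 0"
      unfolding centred_form_insert[OF insert(1,2)]
      by (subst Bochner_Integration.integral_add[OF _ j.quadratic_increment(1)])
        (rule finite_measure.integrable_const[OF prob_space.finite_measure[OF prob]], unfold j.quadratic_increment(2), rule refl)
    then show "(\<integral>z. centred_form (insert j I) M (y(j := z)) \<partial>\<nu> j) = centred_form I M y"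
      by (simp add: prob_space.prob_space[OF prob])
  qed
  finally show ?case using insert.IH by simp
qed

end

section \<open>Measurability of matrix-valued functions\<close>

text \<open>Entrywise measurability is the working form of measurability into
  \<open>mat_borel\<close>; \<open>mat_measurable_iff\<close> identifies the two.\<close>

definition mat_measurable :: "'w measure \<Rightarrow> nat \<Rightarrow> nat \<Rightarrow> ('w \<Rightarrow> complex mat) \<Rightarrow> bool" where
  "mat_measurable M n m X \<longleftrightarrow> (\<forall>w\<in>space M. X w \<in> carrier_mat n m) \<and>
     (\<forall>i<n. \<forall>j<m. (\<lambda>w. X w $$ (i, j)) \<in> borel_measurable M)"

lemma mat_measurableI:
  "(\<And>w. w \<in> space M \<Longrightarrow> X w \<in> carrier_mat n m) \<Longrightarrow>
    (\<And>i j. i < n \<Longrightarrow> j < m \<Longrightarrow> (\<lambda>w. X w $$ (i, j)) \<in> borel_measurable M) \<Longrightarrow> mat_measurable M n m X"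
  by (auto simp: mat_measurable_def)

lemma mat_measurableD:
  "mat_measurable M n m X \<Longrightarrow> w \<in> space M \<Longrightarrow> X w \<in> carrier_mat n m"
  "mat_measurable M n m X \<Longrightarrow> i < n \<Longrightarrow> j < m \<Longrightarrow> (\<lambda>w. X w $$ (i, j)) \<in> borel_measurable M"
  by (auto simp: mat_measurable_def)

lemma mat_measurable_const: "A \<in> carrier_mat n m \<Longrightarrow> mat_measurable M n m (\<lambda>_. A)"
  by (auto simp: mat_measurable_def)

lemma mat_measurable_mult:
  assumes X: "mat_measurable M n m X" and Y: "mat_measurable M m k Y"
  shows "mat_measurable M n k (\<lambda>w. X w * Y w)"
proof (rule mat_measurableI)
  show "X w * Y w \<in> carrier_mat n k" if "w \<in> space M" for w
    using mat_measurableD(1)[OF X that] mat_measurableD(1)[OF Y that] by (rule mult_carrier_mat)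
  fix i j assume ij: "i < n" "j < k"
  have "(\<lambda>w. \<Sum>l<m. X w $$ (i, l) * Y w $$ (l, j)) \<in> borel_measurable M"
    using mat_measurableD(2)[OF X] mat_measurableD(2)[OF Y] ij
    by (intro borel_measurable_sum borel_measurable_times) auto
  also have "?this \<longleftrightarrow> (\<lambda>w. (X w * Y w) $$ (i, j)) \<in> borel_measurable M"
    using mat_measurableD(1)[OF X] mat_measurableD(1)[OF Y] ij
    by (intro measurable_cong mult_mat_index[symmetric]) auto
  finally show "(\<lambda>w. (X w * Y w) $$ (i, j)) \<in> borel_measurable M" .
qed

lemma mat_measurable_add:
  assumes X: "mat_measurable M n m X" and Y: "mat_measurable M n m Y"
  shows "mat_measurable M n m (\<lambda>w. X w + Y w)"
proof (rule mat_measurableI)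
  show "X w + Y w \<in> carrier_mat n m" if "w \<in> space M" for w
    using mat_measurableD(1)[OF X that] mat_measurableD(1)[OF Y that] by simp
  fix i j assume ij: "i < n" "j < m"
  have "(\<lambda>w. X w $$ (i, j) + Y w $$ (i, j)) \<in> borel_measurable M"
    using mat_measurableD(2)[OF X] mat_measurableD(2)[OF Y] ij by (intro borel_measurable_add) auto
  also have "?this \<longleftrightarrow> (\<lambda>w. (X w + Y w) $$ (i, j)) \<in> borel_measurable M"
  proof (rule measurable_cong)
    fix w assume "w \<in> space M"
    from mat_measurableD(1)[OF X this] mat_measurableD(1)[OF Y this] ij
    show "X w $$ (i, j) + Y w $$ (i, j) = (X w + Y w) $$ (i, j)" by simp
  qed
  finally show "(\<lambda>w. (X w + Y w) $$ (i, j)) \<in> borel_measurable M" .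
qed

lemma mat_measurable_smult:
  assumes f: "f \<in> borel_measurable M" and X: "mat_measurable M n m X"
  shows "mat_measurable M n m (\<lambda>w. f w \<cdot>\<^sub>m X w)"
proof (rule mat_measurableI)
  show "f w \<cdot>\<^sub>m X w \<in> carrier_mat n m" if "w \<in> space M" for w
    using mat_measurableD(1)[OF X that] by simp
  fix i j assume ij: "i < n" "j < m"
  have "(\<lambda>w. f w * X w $$ (i, j)) \<in> borel_measurable M"
    using mat_measurableD(2)[OF X] f ij by (intro borel_measurable_times) auto
  also have "?this \<longleftrightarrow> (\<lambda>w. (f w \<cdot>\<^sub>m X w) $$ (i, j)) \<in> borel_measurable M"
  proof (rule measurable_cong)
    fix w assume "w \<in> space M"
    from mat_measurableD(1)[OF X this] ij
    show "f w * X w $$ (i, j) = (f w \<cdot>\<^sub>m X w) $$ (i, j)" by simp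
  qed
  finally show "(\<lambda>w. (f w \<cdot>\<^sub>m X w) $$ (i, j)) \<in> borel_measurable M" .
qed

text \<open>By the Leibniz formula the determinant is a polynomial in the entries.\<close>

lemma det_measurable:
  assumes X: "mat_measurable M n n X"
  shows "(\<lambda>w. det (X w)) \<in> borel_measurable M"
proof -
  have "(\<lambda>w. \<Sum>p | p permutes {0..<n}. signof p * (\<Prod>i = 0..<n. X w $$ (i, p i))) \<in> borel_measurable M"
    using mat_measurableD(2)[OF X]
    by (intro borel_measurable_sum borel_measurable_times borel_measurable_prod borel_measurable_const)
      (metis atLeast0LessThan lessThan_iff mem_Collect_eq permutes_in_image)
  also have "?this \<longleftrightarrow> (\<lambda>w. det (X w)) \<in> borel_measurable M"
  proof (rule measurable_cong)
    fix w assume "w \<in> space M"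
    from det_def'[OF mat_measurableD(1)[OF X this]]
    show "(\<Sum>p | p permutes {0..<n}. signof p * (\<Prod>i = 0..<n. X w $$ (i, p i))) = det (X w)" ..
  qed
  finally show ?thesis .
qed

lemma mat_measurable_adj_mat:
  assumes X: "mat_measurable M n n X"
  shows "mat_measurable M n n (\<lambda>w. adj_mat (X w))"
proof (rule mat_measurableI)
  show "adj_mat (X w) \<in> carrier_mat n n" if "w \<in> space M" for w
    by (rule adj_mat(1)[OF mat_measurableD(1)[OF X that]])
  fix i j assume ij: "i < n" "j < n"
  have del: "mat_measurable M (n - 1) (n - 1) (\<lambda>w. mat_delete (X w) j i)"
  proof (rule mat_measurableI)
    show "mat_delete (X w) j i \<in> carrier_mat (n - 1) (n - 1)" if "w \<in> space M" for w
      using mat_measurableD(1)[OF X that] by (rule mat_delete_carrier)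
    fix k l assume kl: "k < n - 1" "l < n - 1"
    have "(\<lambda>w. X w $$ (if k < j then k else Suc k, if l < i then l else Suc l)) \<in> borel_measurable M"
      using kl by (intro mat_measurableD(2)[OF X]) auto
    also have "?this \<longleftrightarrow> (\<lambda>w. mat_delete (X w) j i $$ (k, l)) \<in> borel_measurable M"
    proof (rule measurable_cong)
      fix w assume "w \<in> space M"
      from mat_measurableD(1)[OF X this] kl
      show "X w $$ (if k < j then k else Suc k, if l < i then l else Suc l) = mat_delete (X w) j i $$ (k, l)"
        by (simp add: mat_delete_def)
    qed
    finally show "(\<lambda>w. mat_delete (X w) j i $$ (k, l)) \<in> borel_measurable M" .
  qed
  have "(\<lambda>w. (- 1) ^ (j + i) * det (mat_delete (X w) j i)) \<in> borel_measurable M"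
    using det_measurable[OF del] by (intro borel_measurable_times borel_measurable_const)
  also have "?this \<longleftrightarrow> (\<lambda>w. adj_mat (X w) $$ (i, j)) \<in> borel_measurable M"
  proof (rule measurable_cong)
    fix w assume "w \<in> space M"
    from mat_measurableD(1)[OF X this] ij
    show "(- 1) ^ (j + i) * det (mat_delete (X w) j i) = adj_mat (X w) $$ (i, j)"
      by (simp add: adj_mat_def cofactor_def)
  qed
  finally show "(\<lambda>w. adj_mat (X w) $$ (i, j)) \<in> borel_measurable M" .
qed

lemma mat_measurable_minv:
  assumes X: "mat_measurable M n n X"
  shows "mat_measurable M n n (\<lambda>w. minv (X w))"
  unfolding minv_def using det_measurable[OF X]
  by (intro mat_measurable_smult mat_measurable_adj_mat X borel_measurable_divide) auto

lemma mat_measurable_rsv: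
  assumes "mat_measurable M n n A" "mat_measurable M n n W"
  shows "mat_measurable M n n (\<lambda>w. rsv n x (A w) (W w))"
  unfolding rsv_def shift_mat_def
  by (rule mat_measurable_minv[OF mat_measurable_add[OF mat_measurable_const mat_measurable_mult[OF assms]]]) simp

lemma mat_measurable_krn:
  assumes "mat_measurable M n n A" "mat_measurable M n n W"
  shows "mat_measurable M n n (\<lambda>w. krn n x (A w) (W w))"
  unfolding krn_def by (rule mat_measurable_mult[OF mat_measurable_rsv[OF assms] assms(1)])

lemma mtrace_measurable:
  assumes X: "mat_measurable M n n X"
  shows "(\<lambda>w. mtrace (X w)) \<in> borel_measurable M"
proof -
  have "(\<lambda>w. \<Sum>i<n. X w $$ (i, i)) \<in> borel_measurable M"
    using mat_measurableD(2)[OF X] by (intro borel_measurable_sum) auto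
  also have "?this \<longleftrightarrow> (\<lambda>w. mtrace (X w)) \<in> borel_measurable M"
  proof (rule measurable_cong)
    fix w assume "w \<in> space M"
    from mat_measurableD(1)[OF X this]
    show "(\<Sum>i<n. X w $$ (i, i)) = mtrace (X w)" by (simp add: mtrace_def)
  qed
  finally show ?thesis .
qed

lemma form_measurable:
  fixes g :: "'w \<Rightarrow> complex vec"
  assumes X: "mat_measurable M n n X" and g: "\<And>w. w \<in> space M \<Longrightarrow> g w \<in> carrier_vec n"
    "\<And>i. i < n \<Longrightarrow> (\<lambda>w. g w $ i) \<in> borel_measurable M"
  shows "(\<lambda>w. (X w *\<^sub>v g w) \<diamondop> g w) \<in> borel_measurable M"
proof -
  have "(\<lambda>w. \<Sum>i<n. (\<Sum>k<n. X w $$ (i, k) * g w $ k) * cnj (g w $ i)) \<in> borel_measurable M"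
    using mat_measurableD(2)[OF X] g(2)
    by (intro borel_measurable_sum borel_measurable_times measurable_compose[OF _ borel_measurable_cnj]) auto
  also have "?this \<longleftrightarrow> (\<lambda>w. (X w *\<^sub>v g w) \<diamondop> g w) \<in> borel_measurable M"
  proof (rule measurable_cong)
    fix w assume w: "w \<in> space M"
    have XC: "X w \<in> carrier_mat n n" by (rule mat_measurableD(1)[OF X w])
    have "(X w *\<^sub>v g w) \<diamondop> g w = (\<Sum>i<n. (X w *\<^sub>v g w) $ i * cnj (g w $ i))"
      using XC g(1)[OF w] by (intro inner_sum) auto
    also have "\<dots> = (\<Sum>i<n. (\<Sum>k<n. X w $$ (i, k) * g w $ k) * cnj (g w $ i))"
      using mult_vec_index[OF XC g(1)[OF w]] by (intro sum.cong) auto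
    finally show "(\<Sum>i<n. (\<Sum>k<n. X w $$ (i, k) * g w $ k) * cnj (g w $ i)) = (X w *\<^sub>v g w) \<diamondop> g w" ..
  qed
  finally show ?thesis .
qed

lemma mat_measurable_iff: "X \<in> M \<rightarrow>\<^sub>M mat_borel n m \<longleftrightarrow> mat_measurable M n m X"
proof
  have sp: "space (mat_borel n m) = carrier_mat n m"
    unfolding mat_borel_def by (rule space_vimage_algebra)
  {
    assume X: "X \<in> M \<rightarrow>\<^sub>M mat_borel n m"
    show "mat_measurable M n m X"
    proof (rule mat_measurableI)
      show "X w \<in> carrier_mat n m" if "w \<in> space M" for w
        using measurable_space[OF X that] sp by simp
      fix i j assume ij: "i < n" "j < m"
      have "(\<lambda>M. \<lambda>p\<in>{..<n} \<times> {..<m}. M $$ p) \<in> mat_borel n m \<rightarrow>\<^sub>M Pi\<^sub>M ({..<n} \<times> {..<m}) (\<lambda>_. borel)"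
        unfolding mat_borel_def by (rule measurable_vimage_algebra1) (auto simp: space_PiM)
      from measurable_compose[OF X this]
      have "(\<lambda>w. \<lambda>p\<in>{..<n} \<times> {..<m}. X w $$ p) \<in> M \<rightarrow>\<^sub>M Pi\<^sub>M ({..<n} \<times> {..<m}) (\<lambda>_. borel)" .
      from measurable_compose[OF this measurable_component_singleton, of "(i, j)"] ij
      show "(\<lambda>w. X w $$ (i, j)) \<in> borel_measurable M" by simp
    qed
  next
    assume X: "mat_measurable M n m X"
    show "X \<in> M \<rightarrow>\<^sub>M mat_borel n m"
      unfolding mat_borel_def
    proof (rule measurable_vimage_algebra2)
      show "X \<in> space M \<rightarrow> carrier_mat n m" using mat_measurableD(1)[OF X] by auto
      show "(\<lambda>w. \<lambda>p\<in>{..<n} \<times> {..<m}. X w $$ p) \<in> M \<rightarrow>\<^sub>M Pi\<^sub>M ({..<n} \<times> {..<m}) (\<lambda>_. borel)"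
        using mat_measurableD(2)[OF X] by (intro measurable_restrict) auto
    qed
  }
qed

lemma mat_measurable_compose:
  assumes "mat_measurable N n m X" "f \<in> M \<rightarrow>\<^sub>M N"
  shows "mat_measurable M n m (\<lambda>w. X (f w))"
  using assms unfolding mat_measurable_iff[symmetric] by (rule measurable_compose[rotated])

section \<open>The approximate fixed point for bounded matrices\<close>

lemma frob2_eq:
  assumes "X \<in> carrier_mat n n"
  shows "frob2 X = (\<Sum>i<n. \<Sum>k<n. (cmod (X $$ (i, k)))\<^sup>2)"
proof -
  have "frob2 X = (\<Sum>k<n. \<Sum>i<n. (cmod (X $$ (i, k)))\<^sup>2)"
    using assms by (simp add: frob2_def vnorm2_def)
  then show ?thesis by (simp add: sum.swap[of "\<lambda>i k. (cmod (X $$ (i, k)))\<^sup>2"])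
qed

text \<open>Cauchy-Schwarz on the diagonal entries.\<close>

lemma mtrace_sq_le_frob2:
  assumes X: "X \<in> carrier_mat n n"
  shows "(Re (mtrace X))\<^sup>2 \<le> real n * frob2 X"
proof -
  have "(Re (mtrace X))\<^sup>2 = (\<Sum>i<n. Re (X $$ (i, i)))\<^sup>2" using X by (simp add: mtrace_def)
  also have "\<dots> \<le> (\<Sum>i<n. (1::real)\<^sup>2) * (\<Sum>i<n. (Re (X $$ (i, i)))\<^sup>2)"
    using Cauchy_Schwarz_ineq_sum[of "\<lambda>_. 1" "\<lambda>i. Re (X $$ (i, i))" "{..<n}"] by simp
  also have "(\<Sum>i<n. (Re (X $$ (i, i)))\<^sup>2) \<le> frob2 X"
    unfolding frob2_eq[OF X]
  proof (rule sum_mono)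
    fix i assume i: "i \<in> {..<n}"
    have "(Re (X $$ (i, i)))\<^sup>2 \<le> (cmod (X $$ (i, i)))\<^sup>2" by (metis abs_Re_le_cmod abs_ge_zero power2_abs power_mono)
    also have "\<dots> \<le> (\<Sum>k<n. (cmod (X $$ (i, k)))\<^sup>2)"
      using i by (intro member_le_sum) auto
    finally show "(Re (X $$ (i, i)))\<^sup>2 \<le> (\<Sum>k<n. (cmod (X $$ (i, k)))\<^sup>2)" .
  qed
  then have "(\<Sum>i<n. (1::real)\<^sup>2) * (\<Sum>i<n. (Re (X $$ (i, i)))\<^sup>2) \<le> (\<Sum>i<n. (1::real)\<^sup>2) * frob2 X"
    by (intro mult_left_mono) auto
  finally show ?thesis by simp
qed

text \<open>\<open>Q j\<close> is the law of the \<open>j\<close>-th column of the unnormalised matrix \<open>Y\<close>. Independence inside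
  a column enters only through the second moment of centred quadratic forms.\<close>

locale column_model =
  fixes N L :: nat and Q :: "nat \<Rightarrow> (nat \<Rightarrow> complex) measure" and C3 :: real
  assumes N: "N > 0" and L: "L > 0"
    and Q: "\<And>j. prob_space (Q j)"
    and sets_Q: "\<And>j. sets (Q j) = sets (PiM {..<N} (\<lambda>_. borel))"
    and cf_int: "\<And>j M. integrable (Q j) (centred_form {..<N} M)"
    and cf_mean: "\<And>j M. integral\<^sup>L (Q j) (centred_form {..<N} M) = 0"
    and cf_second: "\<And>j M. (\<integral>\<^sup>+y. ennreal ((cmod (centred_form {..<N} M y))\<^sup>2) \<partial>Q j) \<le>
      ennreal (C3 * (\<Sum>i<N. \<Sum>k<N. (cmod (M i k))\<^sup>2))"
    and C3: "0 \<le> C3"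
begin

sublocale product_prob_space Q "{..<L}"
  by (intro product_prob_spaceI Q)

abbreviation "PP \<equiv> PiM {..<L} Q"

definition column :: "(nat \<Rightarrow> nat \<Rightarrow> complex) \<Rightarrow> nat \<Rightarrow> complex vec" where
  "column C j = vec N (\<lambda>i. C j i / complex_of_real (sqrt (real L)))"

lemma column_carrier [simp]: "column C j \<in> carrier_vec N"
  by (simp add: column_def)

lemma entry_measurable:
  assumes "j \<in> I" "i < N"
  shows "(\<lambda>C. C j i) \<in> borel_measurable (PiM I Q)"
proof -
  have "(\<lambda>y. y i) \<in> borel_measurable (Q j)"
    using assms by (subst measurable_cong_sets[OF sets_Q refl]) auto
  from measurable_compose[OF measurable_component_singleton[OF assms(1), of Q] this] show ?thesis .
qed

definition WW :: "nat set \<Rightarrow> (nat \<Rightarrow> nat \<Rightarrow> complex) \<Rightarrow> complex mat" where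
  "WW J C = gram N J (column C)"

lemma hnd_WW: "finite J \<Longrightarrow> hnd N (WW J C)"
  unfolding WW_def by (intro hnd_gram) auto

lemma WW_measurable:
  assumes "J \<subseteq> I"
  shows "mat_measurable (PiM I Q) N N (WW J)"
proof (rule mat_measurableI)
  show "WW J C \<in> carrier_mat N N" for C by (simp add: WW_def)
  fix i k assume ik: "i < N" "k < N"
  have "(\<lambda>C. \<Sum>j\<in>J. (C j i / complex_of_real (sqrt (real L))) * cnj (C j k / complex_of_real (sqrt (real L))))
      \<in> borel_measurable (PiM I Q)"
    using assms ik
    by (intro borel_measurable_sum borel_measurable_times borel_measurable_divide borel_measurable_const
        measurable_compose[OF _ borel_measurable_cnj] entry_measurable) auto
  then show "(\<lambda>C. WW J C $$ (i, k)) \<in> borel_measurable (PiM I Q)"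
    using ik by (simp add: WW_def gram_def column_def)
qed

lemma WW_cong: "(\<And>j. j \<in> J \<Longrightarrow> C j = C' j) \<Longrightarrow> WW J C = WW J C'"
  by (auto simp: WW_def gram_def column_def intro!: cong_mat sum.cong)

text \<open>Each of the two occurrences of the column carries a factor \<open>1 / sqrt L\<close>, so
  the form is centred at the trace divided by \<open>L\<close>.\<close>

lemma form_column:
  assumes X: "X \<in> carrier_mat N N"
  shows "(X *\<^sub>v column C j) \<diamondop> column C j - mtrace X / of_nat L =
    centred_form {..<N} (\<lambda>i k. X $$ (i, k)) (C j) / of_nat L"
proof -
  have sq: "complex_of_real (sqrt (real L)) * complex_of_real (sqrt (real L)) = of_nat L"
    by (simp flip: of_real_mult)
  have "(X *\<^sub>v column C j) \<diamondop> column C j = (\<Sum>i<N. (X *\<^sub>v column C j) $ i * cnj (column C j $ i))"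
    using X by (intro inner_sum) auto
  also have "\<dots> = (\<Sum>i<N. \<Sum>k<N. X $$ (i, k) * column C j $ k * cnj (column C j $ i))"
    using X by (intro sum.cong refl) (simp add: mult_vec_index[of _ N N] sum_distrib_right del: index_mult_mat_vec)
  also have "\<dots> = (\<Sum>i<N. \<Sum>k<N. X $$ (i, k) * (cnj (C j i) * C j k) / of_nat L)"
    by (intro sum.cong refl) (simp add: column_def field_simps flip: sq)
  finally have 1: "(X *\<^sub>v column C j) \<diamondop> column C j = (\<Sum>i<N. \<Sum>k<N. X $$ (i, k) * (cnj (C j i) * C j k)) / of_nat L"
    by (simp add: sum_divide_distrib)
  have "mtrace X = (\<Sum>i<N. \<Sum>k<N. X $$ (i, k) * (if i = k then 1 else 0))"
    using X by (simp add: mtrace_def if_distrib cong: if_cong)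
  then show ?thesis
    unfolding 1 by (simp add: centred_form_def right_diff_distrib sum_subtractf diff_divide_distrib)
qed

end

section \<open>Leave-one-out estimates for a bounded matrix\<close>

text \<open>The bound on \<open>A\<close> is written as \<open>x * \<kappa>\<close> so that all
  kernels, being at most \<open>A / x\<close>, are bounded by \<open>\<kappa>\<close>.\<close>

locale column_core = column_model +
  fixes x \<kappa> :: real and A :: "complex mat"
  assumes x: "x > 0" and A: "hnd N A" and k: "\<kappa> > 0"
    and A_le: "\<And>v. v \<in> carrier_vec N \<Longrightarrow> qform A v \<le> x * \<kappa> * vnorm2 v"
begin

lemma AC [simp]: "A \<in> carrier_mat N N" using A by auto

definition "RR J C = rsv N x A (WW J C)"
definition "KK J C = krn N x A (WW J C)"

lemma resolvent_WW: "finite J \<Longrightarrow> resolvent N x A (WW J C)"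
  using x A hnd_WW by unfold_locales

lemma KK_carrier [simp]: "finite J \<Longrightarrow> KK J C \<in> carrier_mat N N"
  unfolding KK_def by (rule resolvent.KC[OF resolvent_WW])

lemma hnd_KK: "finite J \<Longrightarrow> hnd N (KK J C)"
  unfolding KK_def by (rule resolvent.hnd_K[OF resolvent_WW])

lemma krn_le:
  assumes "hnd N W" "v \<in> carrier_vec N"
  shows "qform (krn N x A W) v \<le> \<kappa> * vnorm2 v"
proof -
  interpret resolvent N x A W using x A assms(1) by unfold_locales
  have "x * qform (krn N x A W) v \<le> x * (\<kappa> * vnorm2 v)"
    using qform_K_le[OF assms(2)] A_le[OF assms(2)] by simp
  then show ?thesis using x by simp
qed

lemma KK_le: "finite J \<Longrightarrow> v \<in> carrier_vec N \<Longrightarrow> qform (KK J C) v \<le> \<kappa> * vnorm2 v"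
  unfolding KK_def by (intro krn_le hnd_WW)

lemma KK_cong: "(\<And>j. j \<in> J \<Longrightarrow> C j = C' j) \<Longrightarrow> KK J C = KK J C'"
  unfolding KK_def using WW_cong[of J C C'] by simp

lemma KK_measurable: "J \<subseteq> I \<Longrightarrow> mat_measurable (PiM I Q) N N (KK J)"
  unfolding KK_def by (intro mat_measurable_krn mat_measurable_const WW_measurable) auto

lemma WW_remove: "finite J \<Longrightarrow> j \<in> J \<Longrightarrow> WW J C = WW (J - {j}) C + outer (column C j) (column C j)"
  unfolding WW_def by (intro gram_remove) auto

lemma mtrace_mult_KK_remove:
  assumes J: "finite J" "j \<in> J" and E: "hnd N E" "\<And>v. v \<in> carrier_vec N \<Longrightarrow> qform E v \<le> e * vnorm2 v" "0 \<le> e"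
  shows "0 \<le> Re (mtrace (E * KK (J - {j}) C)) - Re (mtrace (E * KK J C))"
    "Re (mtrace (E * KK (J - {j}) C)) - Re (mtrace (E * KK J C)) \<le> e * \<kappa>"
proof -
  interpret resolvent N x A "WW (J - {j}) C" using J by (intro resolvent_WW) auto
  have le: "\<And>v. v \<in> carrier_vec N \<Longrightarrow> qform K v \<le> \<kappa> * vnorm2 v"
    using KK_le[of "J - {j}" _ C] J by (simp add: KK_def)
  show "0 \<le> Re (mtrace (E * KK (J - {j}) C)) - Re (mtrace (E * KK J C))"
    "Re (mtrace (E * KK (J - {j}) C)) - Re (mtrace (E * KK J C)) \<le> e * \<kappa>"
    using mtrace_mult_krn_update_bounds[OF column_carrier E le, of C j] k
    by (simp_all add: KK_def WW_remove[OF J] less_imp_le)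
qed

lemma mtrace_KK_remove:
  assumes J: "finite J" "j \<in> J"
  shows "0 \<le> Re (mtrace (KK (J - {j}) C)) - Re (mtrace (KK J C))"
    "Re (mtrace (KK (J - {j}) C)) - Re (mtrace (KK J C)) \<le> \<kappa>"
  using mtrace_mult_KK_remove[OF J hnd_one, of 1 C] J by (auto simp: left_mult_one_mat[of _ N N])

abbreviation "J0 \<equiv> {..<L}"
abbreviation "Jr j \<equiv> {..<L} - {j}"

lemma KK_remove_upd: "KK (Jr j) (C(j := y)) = KK (Jr j) C"
  by (rule KK_cong) auto

text \<open>\<open>\<theta>\<close> is the value predicted for every \<open>1 / (1 + q j)\<close>, since \<open>q j\<close> concentrates around \<open>t\<close>.
  Hence \<open>W\<close> acts like \<open>\<theta> \<cdot> 1\<close>, and \<open>E\<close> is the deterministic equivalent of \<open>KK J0\<close>.\<close>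

definition "T C = Re (mtrace (KK J0 C)) / real L"
definition "t = integral\<^sup>L PP T"
definition "\<theta> = 1 / (1 + t)"
definition "E = krn N x A (complex_of_real \<theta> \<cdot>\<^sub>m 1\<^sub>m N)"
definition "q j C = qform (KK (Jr j) C) (column C j)"
definition "p j C = Re ((E * KK (Jr j) C *\<^sub>v column C j) \<diamondop> column C j)"

lemma T_measurable [measurable]: "T \<in> borel_measurable PP"
  unfolding T_def using mtrace_measurable[OF KK_measurable[of J0 J0]] by measurable

lemma T_bounds: "0 \<le> T C" "T C \<le> real N * \<kappa> / real L"
proof -
  show "0 \<le> T C" unfolding T_def using hnd_mtrace_nonneg[OF hnd_KK[of J0 C]] by simp
  show "T C \<le> real N * \<kappa> / real L"
    unfolding T_def using mtrace_le[OF KK_carrier[of J0 C] KK_le[of J0 _ C]] by (intro divide_right_mono) auto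
qed

lemma T_int: "integrable PP T"
  using T_bounds by (intro P.integrable_const_bound[of _ "real N * \<kappa> / real L"]) (auto simp: abs_of_nonneg)

lemma t_nonneg: "0 \<le> t"
  unfolding t_def using T_bounds by simp

lemma \<theta>_bounds: "0 < \<theta>" "\<theta> \<le> 1" "\<theta> * (1 + t) = 1"
  unfolding \<theta>_def using t_nonneg by auto

lemma T_remove: "\<bar>Re (mtrace (KK (Jr j) C)) / real L - T C\<bar> \<le> \<kappa> / real L" if "j < L"
  using mtrace_KK_remove[of J0 j C] that L unfolding T_def
  by (simp add: diff_divide_distrib[symmetric] abs_of_nonneg divide_right_mono)

lemma T_diff:
  assumes "j < L"
  shows "\<bar>T (C(j := y)) - T (C(j := z))\<bar> \<le> \<kappa> / real L"
proof -
  have u: "0 \<le> Re (mtrace (KK (Jr j) C)) - Re (mtrace (KK J0 (C(j := y))))"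
    "Re (mtrace (KK (Jr j) C)) - Re (mtrace (KK J0 (C(j := y)))) \<le> \<kappa>" for y
    using mtrace_KK_remove[of J0 j "C(j := y)"] assms by (auto simp: KK_remove_upd)
  have "\<bar>Re (mtrace (KK J0 (C(j := y)))) - Re (mtrace (KK J0 (C(j := z))))\<bar> \<le> \<kappa>"
    using u[of y] u[of z] by linarith
  then show ?thesis using L unfolding T_def
    by (simp add: diff_divide_distrib[symmetric] divide_right_mono abs_divide)
qed

text \<open>One column changes \<open>T\<close> by at most \<open>\<kappa> / L\<close>, so the
  \<open>L\<close> columns together produce a variance of order \<open>1 / L\<close>.\<close>

lemma T_variance: "(\<integral>\<^sup>+C. ennreal ((T C - t)\<^sup>2) \<partial>PP) \<le> ennreal (8 * \<kappa>\<^sup>2 / real L)"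
proof -
  have "(\<integral>\<^sup>+C. ennreal ((T C - t)\<^sup>2) \<partial>PP) \<le> ennreal (8 * (\<kappa> / real L)\<^sup>2 * real (card J0))"
    unfolding t_def
  proof (rule bounded_difference_variance[OF Q _ _ T_measurable])
    show "\<bar>T C\<bar> \<le> real N * \<kappa> / real L" for C using T_bounds[of C] by simp
    show "\<bar>T (C(j := y)) - T (C(j := z))\<bar> \<le> \<kappa> / real L" if "j \<in> J0" for C j y z
      using that T_diff by auto
  qed (use L k in auto)
  also have "8 * (\<kappa> / real L)\<^sup>2 * real (card J0) = 8 * \<kappa>\<^sup>2 / real L"
    using L by (simp add: power2_eq_square)
  finally show ?thesis .
qed

text \<open>The matrix \<open>X\<close> does not involve column \<open>j\<close>. With the other
  columns fixed it is constant, and the bound for centred forms under the law of column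
  \<open>j\<close> applies before the other columns are integrated.\<close>

lemma form_second_moment:
  assumes j: "j < L" and X: "mat_measurable (PiM (Jr j) Q) N N X"
    and Xc: "\<And>C y. X (C(j := y)) = X C" and XC: "\<And>C. X C \<in> carrier_mat N N" and fr: "\<And>C. frob2 (X C) \<le> F"
  shows "(\<integral>\<^sup>+C. ennreal ((Re ((X C *\<^sub>v column C j) \<diamondop> column C j) - Re (mtrace (X C)) / real L)\<^sup>2) \<partial>PP)
    \<le> ennreal (C3 * F / (real L)\<^sup>2)"
proof -
  have ins: "insert j (Jr j) = J0" using j by auto
  \<comment> \<open>Measurability is given on the product without coordinate \<open>j\<close>; as
    \<open>X\<close> ignores that coordinate, it carries over to the full product.\<close>
  have XM: "mat_measurable PP N N X"
  proof -
    have "mat_measurable PP N N (\<lambda>C. X (restrict C (Jr j)))"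
      by (rule mat_measurable_compose[OF X]) (auto intro: measurable_restrict_subset)
    also have "?this \<longleftrightarrow> mat_measurable PP N N X"
    proof -
      have "X (restrict C (Jr j)) = X C" if C: "C \<in> space PP" for C
      proof -
        have "C = (restrict C (Jr j))(j := C j)"
          using C j by (auto simp: space_PiM PiE_def extensional_def restrict_def)
        then show ?thesis by (metis Xc)
      qed
      then show ?thesis unfolding mat_measurable_def
        by (intro conj_cong all_cong imp_cong refl ball_cong measurable_cong) auto
    qed
    finally show ?thesis .
  qed
  have gm: "(\<lambda>C. column C j $ i) \<in> borel_measurable PP" if "i < N" for i
    using that entry_measurable[of j J0 i] j by (simp add: column_def)
  have fm: "(\<lambda>C. (X C *\<^sub>v column C j) \<diamondop> column C j) \<in> borel_measurable PP"
    by (rule form_measurable[OF XM]) (auto intro: gm)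
  note [measurable] = fm mtrace_measurable[OF XM]
  have pt: "(Re ((X C *\<^sub>v column C j) \<diamondop> column C j) - Re (mtrace (X C)) / real L)\<^sup>2 \<le>
      (1 / (real L)\<^sup>2) * (cmod (centred_form {..<N} (\<lambda>i k. X C $$ (i, k)) (C j)))\<^sup>2" for C
  proof -
    have "Re ((X C *\<^sub>v column C j) \<diamondop> column C j) - Re (mtrace (X C)) / real L =
        Re (centred_form {..<N} (\<lambda>i k. X C $$ (i, k)) (C j)) / real L"
      using arg_cong[OF form_column[OF XC[of C], of C j], of Re] by simp
    then have "(Re ((X C *\<^sub>v column C j) \<diamondop> column C j) - Re (mtrace (X C)) / real L)\<^sup>2 =
        (1 / (real L)\<^sup>2) * (Re (centred_form {..<N} (\<lambda>i k. X C $$ (i, k)) (C j)))\<^sup>2"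
      by (simp add: power_divide)
    also have "\<dots> \<le> (1 / (real L)\<^sup>2) * (cmod (centred_form {..<N} (\<lambda>i k. X C $$ (i, k)) (C j)))\<^sup>2"
      by (intro mult_left_mono) (auto intro: power2_le_iff_abs_le[THEN iffD2] simp: abs_Re_le_cmod)
    finally show ?thesis .
  qed
  define H where "H C = ennreal ((Re ((X C *\<^sub>v column C j) \<diamondop> column C j) - Re (mtrace (X C)) / real L)\<^sup>2)" for C
  have Hm: "H \<in> borel_measurable PP" unfolding H_def by measurable
  have "integral\<^sup>N PP H = (\<integral>\<^sup>+C. (\<integral>\<^sup>+y. H (C(j := y)) \<partial>Q j) \<partial>PiM (Jr j) Q)"
    using product_nn_integral_insert[of "Jr j" j H, unfolded ins, OF _ _ Hm] by simp
  also have "\<dots> \<le> (\<integral>\<^sup>+C. (\<integral>\<^sup>+y. ennreal ((1 / (real L)\<^sup>2)) * ennreal ((cmod (centred_form {..<N} (\<lambda>i k. X C $$ (i, k)) y))\<^sup>2) \<partial>Q j) \<partial>PiM (Jr j) Q)"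
  proof (intro nn_integral_mono)
    fix C y
    have "H (C(j := y)) \<le> ennreal ((1 / (real L)\<^sup>2) * (cmod (centred_form {..<N} (\<lambda>i k. X C $$ (i, k)) y))\<^sup>2)"
      unfolding H_def using pt[of "C(j := y)"] by (intro ennreal_leI) (simp add: Xc)
    then show "H (C(j := y)) \<le> ennreal ((1 / (real L)\<^sup>2)) * ennreal ((cmod (centred_form {..<N} (\<lambda>i k. X C $$ (i, k)) y))\<^sup>2)"
      by (subst ennreal_mult'[symmetric]) simp_all
  qed
  also have "\<dots> \<le> (\<integral>\<^sup>+C. ennreal (C3 * F / (real L)\<^sup>2) \<partial>PiM (Jr j) Q)"
  proof (rule nn_integral_mono)
    fix C
    have "(\<integral>\<^sup>+y. ennreal ((1 / (real L)\<^sup>2)) * ennreal ((cmod (centred_form {..<N} (\<lambda>i k. X C $$ (i, k)) y))\<^sup>2) \<partial>Q j) =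
        ennreal ((1 / (real L)\<^sup>2)) * (\<integral>\<^sup>+y. ennreal ((cmod (centred_form {..<N} (\<lambda>i k. X C $$ (i, k)) y))\<^sup>2) \<partial>Q j)"
      using borel_measurable_integrable[OF cf_int[of j "\<lambda>i k. X C $$ (i, k)"]] by (intro nn_integral_cmult) measurable
    also have "\<dots> \<le> ennreal ((1 / (real L)\<^sup>2)) * ennreal (C3 * F)"
    proof (rule mult_left_mono)
      have "C3 * (\<Sum>i<N. \<Sum>k<N. (cmod (X C $$ (i, k)))\<^sup>2) \<le> C3 * F"
        using fr[of C] C3 unfolding frob2_eq[OF XC] by (intro mult_left_mono)
      then show "(\<integral>\<^sup>+y. ennreal ((cmod (centred_form {..<N} (\<lambda>i k. X C $$ (i, k)) y))\<^sup>2) \<partial>Q j) \<le> ennreal (C3 * F)"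
        using cf_second[of j "\<lambda>i k. X C $$ (i, k)"] by (meson ennreal_leI order_trans)
    qed simp
    finally show "(\<integral>\<^sup>+y. ennreal ((1 / (real L)\<^sup>2)) * ennreal ((cmod (centred_form {..<N} (\<lambda>i k. X C $$ (i, k)) y))\<^sup>2) \<partial>Q j) \<le>
        ennreal (C3 * F / (real L)\<^sup>2)"
      by (simp flip: ennreal_mult')
  qed
  also have "\<dots> = ennreal (C3 * F / (real L)\<^sup>2)"
    by (simp add: prob_space.emeasure_space_1[OF prob_space_PiM[OF Q]])
  finally show ?thesis unfolding H_def .
qed

lemma form_mean:
  assumes j: "j < L" and X: "mat_measurable PP N N X"
    and Xc: "\<And>C y. X (C(j := y)) = X C" and XC: "\<And>C. X C \<in> carrier_mat N N"
    and int: "integrable PP (\<lambda>C. Re ((X C *\<^sub>v column C j) \<diamondop> column C j) - Re (mtrace (X C)) / real L)"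
  shows "(\<integral>C. Re ((X C *\<^sub>v column C j) \<diamondop> column C j) - Re (mtrace (X C)) / real L \<partial>PP) = 0"
proof -
  have ins: "insert j (Jr j) = J0" using j by auto
  define f where "f C = Re ((X C *\<^sub>v column C j) \<diamondop> column C j) - Re (mtrace (X C)) / real L" for C
  have f: "f C = Re (centred_form {..<N} (\<lambda>i k. X C $$ (i, k)) (C j)) / real L" for C
    unfolding f_def using arg_cong[OF form_column[OF XC[of C], of C j], of Re] by simp
  have "integral\<^sup>L PP f = (\<integral>C. (\<integral>y. f (C(j := y)) \<partial>Q j) \<partial>PiM (Jr j) Q)"
    using product_integral_insert[of "Jr j" j f, unfolded ins] int unfolding f_def[symmetric] by simp
  also have "\<dots> = (\<integral>C. 0 \<partial>PiM (Jr j) Q)"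
  proof (rule Bochner_Integration.integral_cong[OF refl])
    fix C
    have "(\<integral>y. f (C(j := y)) \<partial>Q j) = (\<integral>y. Re (centred_form {..<N} (\<lambda>i k. X C $$ (i, k)) y) \<partial>Q j) / real L"
      unfolding f Xc by simp
    also have "(\<integral>y. Re (centred_form {..<N} (\<lambda>i k. X C $$ (i, k)) y) \<partial>Q j) = Re (integral\<^sup>L (Q j) (centred_form {..<N} (\<lambda>i k. X C $$ (i, k))))"
      by (rule integral_Re[OF cf_int])
    also have "\<dots> / real L = 0" by (simp add: cf_mean)
    finally show "(\<integral>y. f (C(j := y)) \<partial>Q j) = 0" .
  qed
  also have "\<dots> = 0" by simp
  finally show ?thesis unfolding f_def .
qed

lemma PP_prob [simp]: "measure PP (space PP) = 1"
  by (rule prob_space.prob_space[OF prob_space_PiM[OF Q]])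

lemma abs_mean_le: "(\<And>j. j < L \<Longrightarrow> \<bar>f j\<bar> \<le> b) \<Longrightarrow> \<bar>(\<Sum>j<L. f j) / real L\<bar> \<le> (b :: real)"
proof -
  assume b: "\<And>j. j < L \<Longrightarrow> \<bar>f j\<bar> \<le> b"
  have "\<bar>\<Sum>j<L. f j\<bar> \<le> (\<Sum>j<L. \<bar>f j\<bar>)" by (rule sum_abs)
  also have "\<dots> \<le> (\<Sum>j<L. b)" using b by (intro sum_mono) auto
  also have "\<dots> = real L * b" by simp
  finally show ?thesis using L by (simp add: abs_divide pos_divide_le_eq mult.commute)
qed

lemma second_moment_bound:
  assumes [measurable]: "f \<in> borel_measurable PP" and le: "(\<integral>\<^sup>+C. ennreal ((f C)\<^sup>2) \<partial>PP) \<le> ennreal b" and b: "0 \<le> b"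
  shows "integrable PP (\<lambda>C. (f C)\<^sup>2)" "(\<integral>C. (f C)\<^sup>2 \<partial>PP) \<le> b" "integrable PP f"
proof -
  show i: "integrable PP (\<lambda>C. (f C)\<^sup>2)"
    using le_less_trans[OF le ennreal_less_top] by (intro integrableI_bounded) auto
  have "ennreal (\<integral>C. (f C)\<^sup>2 \<partial>PP) \<le> ennreal b"
    using le i by (subst (asm) nn_integral_eq_integral) auto
  then show "(\<integral>C. (f C)\<^sup>2 \<partial>PP) \<le> b" using b by (simp add: ennreal_le_iff)
  show "integrable PP f"
    by (rule finite_measure.square_integrable_imp_integrable[OF prob_space.finite_measure[OF prob_space_PiM[OF Q]] _ i]) simp
qed

lemma hnd_E: "hnd N E" and E_carrier [simp]: "E \<in> carrier_mat N N"
  and E_le: "v \<in> carrier_vec N \<Longrightarrow> qform E v \<le> \<kappa> * vnorm2 v"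
proof -
  have V: "hnd N (complex_of_real \<theta> \<cdot>\<^sub>m 1\<^sub>m N)" using \<theta>_bounds by (intro hnd_smult hnd_one) auto
  then interpret V: resolvent N x A "complex_of_real \<theta> \<cdot>\<^sub>m 1\<^sub>m N" using x A by unfold_locales
  show "hnd N E" "E \<in> carrier_mat N N" unfolding E_def by (auto intro: V.hnd_K)
  show "qform E v \<le> \<kappa> * vnorm2 v" if "v \<in> carrier_vec N" unfolding E_def by (rule krn_le[OF V that])
qed

text \<open>\<open>D\<close> bounds the mean square of \<open>q j - t\<close>; its summands stem
  from the fluctuation of the form in column \<open>j\<close>, from deleting that column in the
  trace, and from the variance of \<open>T\<close>. \<open>G\<close> bounds the mean square of
  \<open>p j\<close>, by fluctuation and squared trace. When \<open>N / L\<close> is bounded,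
  \<open>D\<close> is of order \<open>1 / L\<close> and \<open>G\<close> stays bounded.\<close>

definition "D = 3 * (C3 * (real N * \<kappa>\<^sup>2) / (real L)\<^sup>2 + (\<kappa> / real L)\<^sup>2 + 8 * \<kappa>\<^sup>2 / real L)"
definition "G = 2 * (C3 * (\<kappa>\<^sup>2 * (real N * \<kappa>\<^sup>2)) / (real L)\<^sup>2 + (real N * \<kappa>\<^sup>2 / real L)\<^sup>2)"

lemma D_pos: "0 < D"
proof -
  have "0 < 8 * \<kappa>\<^sup>2 / real L" using k L by simp
  moreover have "0 \<le> C3 * (real N * \<kappa>\<^sup>2) / (real L)\<^sup>2" using C3 by simp
  ultimately show ?thesis
    unfolding D_def by (intro mult_pos_pos add_nonneg_pos add_nonneg_nonneg) auto
qed

lemma column_measurable: "j < L \<Longrightarrow> i < N \<Longrightarrow> (\<lambda>C. column C j $ i) \<in> borel_measurable PP"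
  using entry_measurable[of j J0 i] by (simp add: column_def)

lemma Kr_measurable: "mat_measurable PP N N (KK (Jr j))"
  by (rule KK_measurable) auto

lemma EK_measurable: "J \<subseteq> I \<Longrightarrow> mat_measurable (PiM I Q) N N (\<lambda>C. E * KK J C)"
  using mat_measurable_mult[OF mat_measurable_const[OF E_carrier] KK_measurable] .

lemma q_measurable: "j < L \<Longrightarrow> q j \<in> borel_measurable PP"
  unfolding q_def qform_def
  using form_measurable[OF Kr_measurable, of "\<lambda>C. column C j" j] column_measurable by simp

lemma p_measurable: "j < L \<Longrightarrow> p j \<in> borel_measurable PP"
  unfolding p_def
  using form_measurable[OF EK_measurable[of "Jr j" J0], of "\<lambda>C. column C j"] column_measurable by simp

lemma tr_measurable [measurable]: "(\<lambda>C. Re (mtrace (KK (Jr j) C))) \<in> borel_measurable PP"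
  using mtrace_measurable[OF Kr_measurable[of j]] by measurable

lemma trE_measurable:
  "J \<subseteq> J0 \<Longrightarrow> (\<lambda>C. Re (mtrace (E * KK J C))) \<in> borel_measurable PP"
  using mtrace_measurable[OF EK_measurable[of J J0]] by measurable

lemma q_nonneg: "0 \<le> q j C"
  unfolding q_def by (intro hnd_qform[OF hnd_KK]) auto

lemma frob2_KK_le: "finite J \<Longrightarrow> frob2 (KK J C) \<le> real N * \<kappa>\<^sup>2"
  using k by (intro frob2_le[OF hnd_KK KK_le]) auto

lemma frob2_EKK_le: "finite J \<Longrightarrow> frob2 (E * KK J C) \<le> \<kappa>\<^sup>2 * (real N * \<kappa>\<^sup>2)"
  using k by (intro order_trans[OF frob2_mult_le[OF hnd_E E_le]] mult_left_mono frob2_KK_le) auto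

lemma q_deviation:
  assumes j: "j < L"
  shows "integrable PP (\<lambda>C. (q j C - t)\<^sup>2)" "(\<integral>C. (q j C - t)\<^sup>2 \<partial>PP) \<le> D"
proof -
  note [measurable] = q_measurable[OF j]
  let ?u = "\<lambda>C. q j C - Re (mtrace (KK (Jr j) C)) / real L"
  have 1: "(\<integral>\<^sup>+C. ennreal ((?u C)\<^sup>2) \<partial>PP) \<le> ennreal (C3 * (real N * \<kappa>\<^sup>2) / (real L)\<^sup>2)"
    unfolding q_def qform_def using j
    by (intro form_second_moment KK_measurable frob2_KK_le KK_remove_upd KK_carrier) auto
  have "(\<integral>\<^sup>+C. ennreal ((q j C - t)\<^sup>2) \<partial>PP) \<le>
      (\<integral>\<^sup>+C. ennreal 3 * (ennreal ((?u C)\<^sup>2) + (ennreal ((\<kappa> / real L)\<^sup>2) + ennreal ((T C - t)\<^sup>2))) \<partial>PP)"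
  proof (rule nn_integral_mono)
    fix C
    have sq3: "(a + b + c)\<^sup>2 \<le> 3 * (a\<^sup>2 + (b\<^sup>2 + c\<^sup>2))" for a b c :: real
    proof -
      have "3 * (a\<^sup>2 + (b\<^sup>2 + c\<^sup>2)) - (a + b + c)\<^sup>2 = (a - b)\<^sup>2 + (b - c)\<^sup>2 + (a - c)\<^sup>2"
        by (simp add: power2_eq_square algebra_simps)
      then show ?thesis by (smt (verit) zero_le_power2)
    qed
    have "(q j C - t)\<^sup>2 = (?u C + (Re (mtrace (KK (Jr j) C)) / real L - T C) + (T C - t))\<^sup>2" by simp
    also have "\<dots> \<le> 3 * ((?u C)\<^sup>2 + ((Re (mtrace (KK (Jr j) C)) / real L - T C)\<^sup>2 + (T C - t)\<^sup>2))" by (rule sq3)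
    also have "(Re (mtrace (KK (Jr j) C)) / real L - T C)\<^sup>2 \<le> (\<kappa> / real L)\<^sup>2"
      using T_remove[OF j, of C] k L by (simp add: abs_le_square_iff[symmetric])
    finally have le: "(q j C - t)\<^sup>2 \<le> 3 * ((?u C)\<^sup>2 + ((\<kappa> / real L)\<^sup>2 + (T C - t)\<^sup>2))" by simp
    show "ennreal ((q j C - t)\<^sup>2) \<le> ennreal 3 * (ennreal ((?u C)\<^sup>2) + (ennreal ((\<kappa> / real L)\<^sup>2) + ennreal ((T C - t)\<^sup>2)))"
      using ennreal_leI[OF le] by (simp flip: ennreal_plus ennreal_mult' del: ennreal_numeral)
  qed
  also have "\<dots> = ennreal 3 * ((\<integral>\<^sup>+C. ennreal ((?u C)\<^sup>2) \<partial>PP) + (ennreal ((\<kappa> / real L)\<^sup>2) + (\<integral>\<^sup>+C. ennreal ((T C - t)\<^sup>2) \<partial>PP)))"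
    by (subst nn_integral_cmult, measurable, subst nn_integral_add, measurable, subst nn_integral_add, measurable)
      (simp add: prob_space.emeasure_space_1[OF prob_space_PiM[OF Q]])
  also have "\<dots> \<le> ennreal 3 * (ennreal (C3 * (real N * \<kappa>\<^sup>2) / (real L)\<^sup>2) + (ennreal ((\<kappa> / real L)\<^sup>2) + ennreal (8 * \<kappa>\<^sup>2 / real L)))"
    by (intro mult_left_mono add_mono 1 T_variance order_refl) auto
  also have "\<dots> = ennreal D"
    using C3 by (simp add: D_def algebra_simps flip: ennreal_plus ennreal_mult' del: ennreal_numeral)
  finally have le: "(\<integral>\<^sup>+C. ennreal ((q j C - t)\<^sup>2) \<partial>PP) \<le> ennreal D" .
  have m: "(\<lambda>C. q j C - t) \<in> borel_measurable PP" by measurable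
  from second_moment_bound[OF m le] D_pos
  show "integrable PP (\<lambda>C. (q j C - t)\<^sup>2)" "(\<integral>C. (q j C - t)\<^sup>2 \<partial>PP) \<le> D" by auto
qed

lemma p_moments:
  assumes j: "j < L"
  shows "integrable PP (\<lambda>C. p j C - Re (mtrace (E * KK (Jr j) C)) / real L)"
    "(\<integral>C. p j C - Re (mtrace (E * KK (Jr j) C)) / real L \<partial>PP) = 0"
    "integrable PP (\<lambda>C. (p j C)\<^sup>2)" "(\<integral>C. (p j C)\<^sup>2 \<partial>PP) \<le> G"
proof -
  note [measurable] = p_measurable[OF j] trE_measurable[of "Jr j"]
  let ?P = "\<lambda>C. Re (mtrace (E * KK (Jr j) C)) / real L"
  let ?u = "\<lambda>C. p j C - ?P C"
  have um: "?u \<in> borel_measurable PP" by measurable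
  have EKc: "E * KK (Jr j) C \<in> carrier_mat N N" for C by (intro mult_carrier_mat[of _ N N]) auto
  have 1: "(\<integral>\<^sup>+C. ennreal ((?u C)\<^sup>2) \<partial>PP) \<le> ennreal (C3 * (\<kappa>\<^sup>2 * (real N * \<kappa>\<^sup>2)) / (real L)\<^sup>2)"
    unfolding p_def using j EKc
    by (intro form_second_moment EK_measurable frob2_EKK_le) (auto simp: KK_remove_upd)
  have nn: "0 \<le> C3 * (\<kappa>\<^sup>2 * (real N * \<kappa>\<^sup>2)) / (real L)\<^sup>2" using C3 by simp
  note u = second_moment_bound[OF um 1 nn]
  show int: "integrable PP ?u" by (rule u(3))
  show "(\<integral>C. ?u C \<partial>PP) = 0"
    using int unfolding p_def
    by (intro form_mean[OF j]) (auto intro: EKc EK_measurable simp: KK_remove_upd)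
  have P2: "(?P C)\<^sup>2 \<le> (real N * \<kappa>\<^sup>2 / real L)\<^sup>2" for C
  proof -
    have "(Re (mtrace (E * KK (Jr j) C)))\<^sup>2 \<le> real N * (\<kappa>\<^sup>2 * (real N * \<kappa>\<^sup>2))"
      using mtrace_sq_le_frob2[OF EKc] mult_left_mono[OF frob2_EKK_le[of "Jr j" C], of "real N"] by (smt (verit) finite_Diff finite_lessThan of_nat_0_le_iff)
    also have "\<dots> = (real N * \<kappa>\<^sup>2)\<^sup>2" by (simp add: power2_eq_square)
    finally show ?thesis by (simp add: power_divide divide_right_mono)
  qed
  have le: "(p j C)\<^sup>2 \<le> 2 * ((?u C)\<^sup>2 + (real N * \<kappa>\<^sup>2 / real L)\<^sup>2)" for C
  proof -
    have "(a + b)\<^sup>2 \<le> 2 * (a\<^sup>2 + b\<^sup>2)" for a b :: real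
    proof -
      have "2 * (a\<^sup>2 + b\<^sup>2) - (a + b)\<^sup>2 = (a - b)\<^sup>2" by (simp add: power2_eq_square algebra_simps)
      then show ?thesis by (smt (verit) zero_le_power2)
    qed
    from this[of "?u C" "?P C"] show ?thesis using P2[of C] by simp
  qed
  have Ui: "integrable PP (\<lambda>C. 2 * ((?u C)\<^sup>2 + (real N * \<kappa>\<^sup>2 / real L)\<^sup>2))"
    using u(1) by auto
  show i: "integrable PP (\<lambda>C. (p j C)\<^sup>2)"
    by (rule Bochner_Integration.integrable_bound[OF Ui]) (use le in \<open>auto simp: order_trans[OF le]\<close>)
  have "(\<integral>C. (p j C)\<^sup>2 \<partial>PP) \<le> (\<integral>C. 2 * ((?u C)\<^sup>2 + (real N * \<kappa>\<^sup>2 / real L)\<^sup>2) \<partial>PP)"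
    using i Ui le by (intro integral_mono)
  also have "\<dots> = 2 * ((\<integral>C. (?u C)\<^sup>2 \<partial>PP) + (real N * \<kappa>\<^sup>2 / real L)\<^sup>2)"
    using u(1) by (simp add: prob_space.prob_space[OF prob_space_PiM[OF Q]])
  also have "\<dots> \<le> G" unfolding G_def using u(2) by simp
  finally show "(\<integral>C. (p j C)\<^sup>2 \<partial>PP) \<le> G" .
qed

text \<open>The function \<open>r \<mapsto> 1 / (1 + r)\<close> is 1-Lipschitz on the nonnegative
  reals.\<close>

lemma inv_deviation: "\<bar>1 / (1 + q j C) - \<theta>\<bar> \<le> \<bar>q j C - t\<bar>"
proof -
  have "1 / (1 + q j C) - \<theta> = (t - q j C) / ((1 + q j C) * (1 + t))"
    unfolding \<theta>_def using q_nonneg[of j C] t_nonneg by (simp add: field_simps)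
  also have "\<bar>\<dots>\<bar> = \<bar>q j C - t\<bar> / ((1 + q j C) * (1 + t))"
    using q_nonneg[of j C] t_nonneg by (simp add: abs_divide abs_minus_commute abs_mult)
  also have "\<dots> \<le> \<bar>q j C - t\<bar> / 1"
  proof (rule divide_left_mono)
    have "1 * 1 \<le> (1 + q j C) * (1 + t)" using q_nonneg[of j C] t_nonneg by (intro mult_mono) auto
    then show "1 \<le> (1 + q j C) * (1 + t)" by simp
  qed (use q_nonneg[of j C] t_nonneg in \<open>auto intro!: mult_pos_pos add_pos_nonneg\<close>)
  finally show ?thesis by simp
qed

lemma weighted_am_gm: "0 < (s::real) \<Longrightarrow> \<bar>a\<bar> * \<bar>b\<bar> \<le> (s * a\<^sup>2 + b\<^sup>2 / s) / 2"
proof -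
  assume s: "0 < s"
  have "0 \<le> (s * \<bar>a\<bar> - \<bar>b\<bar>)\<^sup>2 / s" using s by simp
  also have "\<dots> = s * a\<^sup>2 + b\<^sup>2 / s - 2 * (\<bar>a\<bar> * \<bar>b\<bar>)"
    using s by (simp add: power2_diff power_mult_distrib diff_divide_distrib add_divide_distrib power2_eq_square[of s])
  finally show ?thesis by simp
qed

text \<open>The weighted arithmetic-geometric mean inequality plays the role of Cauchy-Schwarz for
  integrals. The weight \<open>sqrt D\<close> balances the mean square of \<open>f\<close> against
  that of \<open>q j - t\<close>, which is at most \<open>D\<close>.\<close>

lemma p_inv_deviation:
  assumes j: "j < L" and [measurable]: "f \<in> borel_measurable PP"
    and fi: "integrable PP (\<lambda>C. (f C)\<^sup>2)" and fle: "(\<integral>C. (f C)\<^sup>2 \<partial>PP) \<le> g"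
  shows "integrable PP (\<lambda>C. f C * (\<theta> - 1 / (1 + q j C)))"
    "\<bar>\<integral>C. f C * (\<theta> - 1 / (1 + q j C)) \<partial>PP\<bar> \<le> sqrt D * (g + 1) / 2"
proof -
  note [measurable] = q_measurable[OF j]
  define s where "s = sqrt D"
  have s: "s > 0" "s * s = D" using D_pos by (auto simp: s_def)
  let ?U = "\<lambda>C. (s * (f C)\<^sup>2 + (q j C - t)\<^sup>2 / s) / 2"
  have le: "\<bar>f C * (\<theta> - 1 / (1 + q j C))\<bar> \<le> ?U C" for C
  proof -
    have "\<bar>f C * (\<theta> - 1 / (1 + q j C))\<bar> \<le> \<bar>f C\<bar> * \<bar>q j C - t\<bar>"
      using inv_deviation[of j C] by (simp add: abs_mult mult_left_mono abs_minus_commute)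
    also have "\<dots> \<le> ?U C" by (rule weighted_am_gm[OF s(1)])
    finally show ?thesis .
  qed
  have Ui: "integrable PP ?U" using fi q_deviation(1)[OF j] by auto
  show i: "integrable PP (\<lambda>C. f C * (\<theta> - 1 / (1 + q j C)))"
  proof (rule Bochner_Integration.integrable_bound[OF Ui])
    show "AE C in PP. norm (f C * (\<theta> - 1 / (1 + q j C))) \<le> norm (?U C)"
      unfolding real_norm_def by (intro AE_I2 order_trans[OF le abs_ge_self])
  qed measurable
  have "\<bar>\<integral>C. f C * (\<theta> - 1 / (1 + q j C)) \<partial>PP\<bar> \<le> (\<integral>C. \<bar>f C * (\<theta> - 1 / (1 + q j C))\<bar> \<partial>PP)"
    by (rule integral_abs_bound)
  also have "\<dots> \<le> integral\<^sup>L PP ?U"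
    using i Ui le by (intro integral_mono) auto
  also have "\<dots> = (s * (\<integral>C. (f C)\<^sup>2 \<partial>PP) + (\<integral>C. (q j C - t)\<^sup>2 \<partial>PP) / s) / 2"
    using fi q_deviation(1)[OF j] by simp
  also have "\<dots> \<le> (s * g + D / s) / 2"
    using fle q_deviation(2)[OF j] s by (intro divide_right_mono add_mono mult_left_mono) auto
  also have "D / s = s" using s by (simp add: field_simps)
  finally show "\<bar>\<integral>C. f C * (\<theta> - 1 / (1 + q j C)) \<partial>PP\<bar> \<le> sqrt D * (g + 1) / 2"
    by (simp add: s_def algebra_simps)
qed

text \<open>By \<open>mtrace_rsv_gram\<close> the quantity compared with \<open>\<theta>\<close> is
  the average over \<open>j\<close> of the means of \<open>1 / (1 + q j)\<close>, each of which is
  within \<open>sqrt D\<close> of \<open>\<theta>\<close>.\<close>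

lemma mean_trace_rsv:
  "\<bar>1 - real N / real L + x * (\<integral>C. Re (mtrace (RR J0 C)) \<partial>PP) / real L - \<theta>\<bar> \<le> sqrt D"
proof -
  have i: "integrable PP (\<lambda>C. 1 / (1 + q j C))" and b: "\<bar>(\<integral>C. 1 / (1 + q j C) \<partial>PP) - \<theta>\<bar> \<le> sqrt D" if j: "j < L" for j
  proof -
    note u = p_inv_deviation[OF j, of "\<lambda>_. 1" 1]
    have eq: "(\<lambda>C. 1 / (1 + q j C)) = (\<lambda>C. \<theta> - 1 * (\<theta> - 1 / (1 + q j C)))" by simp
    show "integrable PP (\<lambda>C. 1 / (1 + q j C))"
      unfolding eq using u(1) by (intro Bochner_Integration.integrable_diff) auto
    have "(\<integral>C. 1 / (1 + q j C) \<partial>PP) = \<theta> - (\<integral>C. 1 * (\<theta> - 1 / (1 + q j C)) \<partial>PP)"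
      unfolding eq using u(1) by (subst Bochner_Integration.integral_diff) auto
    then show "\<bar>(\<integral>C. 1 / (1 + q j C) \<partial>PP) - \<theta>\<bar> \<le> sqrt D"
      using u(2) by simp
  qed
  have "x * Re (mtrace (RR J0 C)) = real N - real L + (\<Sum>j<L. 1 / (1 + q j C))" for C
    using mtrace_rsv_gram[OF x A, of J0 "column C"] by (simp add: RR_def q_def KK_def WW_def)
  then have "x * (\<integral>C. Re (mtrace (RR J0 C)) \<partial>PP) = (\<integral>C. real N - real L + (\<Sum>j<L. 1 / (1 + q j C)) \<partial>PP)"
    by (simp flip: integral_mult_right_zero)
  also have "\<dots> = real N - real L + (\<Sum>j<L. (\<integral>C. 1 / (1 + q j C) \<partial>PP))"
    using i by (subst Bochner_Integration.integral_add) (auto intro!: Bochner_Integration.integral_sum)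
  finally have eq: "x * (\<integral>C. Re (mtrace (RR J0 C)) \<partial>PP) = real N - real L + (\<Sum>j<L. (\<integral>C. 1 / (1 + q j C) \<partial>PP))" .
  have "1 - real N / real L + x * (\<integral>C. Re (mtrace (RR J0 C)) \<partial>PP) / real L - \<theta> =
      (\<Sum>j<L. (\<integral>C. 1 / (1 + q j C) \<partial>PP) - \<theta>) / real L"
    unfolding eq using L by (simp add: sum_subtractf field_simps)
  also have "\<bar>\<dots>\<bar> \<le> sqrt D" by (rule abs_mean_le[OF b])
  finally show ?thesis .
qed

text \<open>By \<open>mtrace_krn_gram\<close> the difference is the mean of an average of the
  \<open>?Z j\<close>. Only the means of the \<open>?Z j\<close> have to be small, and
  \<open>p j\<close> has the same mean as the trace of \<open>E * KK (Jr j)\<close> divided by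
  \<open>L\<close>.\<close>

lemma mean_trace_krn:
  "\<bar>t - Re (mtrace E) / real L\<bar> \<le> \<kappa>\<^sup>2 / real L + sqrt D * (G + 1) / 2"
proof -
  let ?P = "\<lambda>C. Re (mtrace (E * KK J0 C)) / real L"
  let ?Pj = "\<lambda>j C. Re (mtrace (E * KK (Jr j) C)) / real L"
  let ?Z = "\<lambda>j C. \<theta> * ?P C - p j C / (1 + q j C)"
  have Z: "integrable PP (?Z j)" "\<bar>integral\<^sup>L PP (?Z j)\<bar> \<le> \<kappa>\<^sup>2 / real L + sqrt D * (G + 1) / 2" if j: "j < L" for j
  proof -
    note [measurable] = q_measurable[OF j] p_measurable[OF j] trE_measurable[of "Jr j"] trE_measurable[of J0]
    have dif: "\<bar>?P C - ?Pj j C\<bar> \<le> \<kappa>\<^sup>2 / real L" for C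
    proof -
      have "\<bar>Re (mtrace (E * KK J0 C)) - Re (mtrace (E * KK (Jr j) C))\<bar> \<le> \<kappa>\<^sup>2"
        using mtrace_mult_KK_remove[OF _ _ hnd_E E_le, of J0 j C] j k by (auto simp: power2_eq_square)
      then show ?thesis using L by (simp add: diff_divide_distrib[symmetric] abs_divide divide_right_mono)
    qed
    have i1: "integrable PP (\<lambda>C. ?P C - ?Pj j C)"
      using dif by (intro finite_measure.integrable_const_bound[OF prob_space.finite_measure[OF prob_space_PiM[OF Q]], where B = "\<kappa>\<^sup>2 / real L"]) auto
    have "\<bar>\<integral>C. ?P C - ?Pj j C \<partial>PP\<bar> \<le> (\<integral>C. \<bar>?P C - ?Pj j C\<bar> \<partial>PP)" by (rule integral_abs_bound)
    also have "\<dots> \<le> (\<integral>C. \<kappa>\<^sup>2 / real L \<partial>PP)"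
      using i1 dif by (intro integral_mono) auto
    finally have b1: "\<bar>\<integral>C. ?P C - ?Pj j C \<partial>PP\<bar> \<le> \<kappa>\<^sup>2 / real L" by simp
    note pm = p_moments[OF j]
    note pd = p_inv_deviation[OF j p_measurable[OF j] pm(3,4)]
    \<comment> \<open>Three errors: deleting column \<open>j\<close> in the kernel, the centred
      form, which has mean zero, and the deviation of \<open>1 / (1 + q j)\<close> from
      \<open>\<theta>\<close>.\<close>
    have eq: "?Z j = (\<lambda>C. \<theta> * (?P C - ?Pj j C) + (- \<theta>) * (p j C - ?Pj j C) + p j C * (\<theta> - 1 / (1 + q j C)))"
      by (rule ext) (simp add: algebra_simps)
    show "integrable PP (?Z j)" unfolding eq using i1 pm(1) pd(1) by auto
    have "integral\<^sup>L PP (?Z j) = \<theta> * (\<integral>C. ?P C - ?Pj j C \<partial>PP) + (- \<theta>) * (\<integral>C. p j C - ?Pj j C \<partial>PP) +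
        (\<integral>C. p j C * (\<theta> - 1 / (1 + q j C)) \<partial>PP)"
      unfolding eq using i1 pm(1) pd(1)
      by (subst Bochner_Integration.integral_add, simp, simp, subst Bochner_Integration.integral_add) (simp_all only: integral_mult_right_zero integrable_mult_right)
    also have "\<dots> = \<theta> * (\<integral>C. ?P C - ?Pj j C \<partial>PP) + (\<integral>C. p j C * (\<theta> - 1 / (1 + q j C)) \<partial>PP)"
      unfolding pm(2) by simp
    finally have Zeq: "integral\<^sup>L PP (?Z j) = \<theta> * (\<integral>C. ?P C - ?Pj j C \<partial>PP) + (\<integral>C. p j C * (\<theta> - 1 / (1 + q j C)) \<partial>PP)" .
    have tri: "\<bar>\<theta> * a + b\<bar> \<le> \<theta> * \<bar>a\<bar> + \<bar>b\<bar>" for a b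
      using abs_triangle_ineq[of "\<theta> * a" b] \<theta>_bounds(1) by (simp add: abs_mult)
    have "\<bar>integral\<^sup>L PP (?Z j)\<bar> \<le> \<theta> * \<bar>\<integral>C. ?P C - ?Pj j C \<partial>PP\<bar> + \<bar>\<integral>C. p j C * (\<theta> - 1 / (1 + q j C)) \<partial>PP\<bar>"
      unfolding Zeq by (rule tri)
    also have "\<dots> \<le> 1 * (\<kappa>\<^sup>2 / real L) + sqrt D * (G + 1) / 2"
      using \<theta>_bounds b1 pd(2) by (intro add_mono mult_mono) auto
    finally show "\<bar>integral\<^sup>L PP (?Z j)\<bar> \<le> \<kappa>\<^sup>2 / real L + sqrt D * (G + 1) / 2" by simp
  qed
  have main: "T C - Re (mtrace E) / real L = (\<Sum>j<L. ?Z j C) / real L" for C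
  proof -
    have "Re (mtrace (KK J0 C)) - Re (mtrace E) = \<theta> * Re (mtrace (E * KK J0 C)) - (\<Sum>j<L. p j C / (1 + q j C))"
      using mtrace_krn_gram[OF x A _ _ _ E_def, of J0 "column C"] \<theta>_bounds(1)
      by (simp add: KK_def q_def p_def WW_def)
    also have "\<dots> = (\<Sum>j<L. ?Z j C)" using L by (simp add: sum_subtractf)
    finally show ?thesis using L by (simp add: T_def diff_divide_distrib[symmetric])
  qed
  have "t - Re (mtrace E) / real L = (\<integral>C. T C - Re (mtrace E) / real L \<partial>PP)"
    unfolding t_def using T_int by (subst Bochner_Integration.integral_diff) auto
  also have "\<dots> = (\<Sum>j<L. integral\<^sup>L PP (?Z j)) / real L"
    unfolding main using Z(1) by (subst integral_divide_zero, subst Bochner_Integration.integral_sum) auto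
  also have "\<bar>\<dots>\<bar> \<le> \<kappa>\<^sup>2 / real L + sqrt D * (G + 1) / 2" by (rule abs_mean_le[OF Z(2)])
  finally show ?thesis .
qed

text \<open>Since \<open>x + \<theta> A = \<theta> (y + A)\<close> with
  \<open>y = x / \<theta>\<close>, the resolvent belonging to \<open>E\<close> is a scaled resolvent
  of \<open>A\<close>. Its trace is a sum over the eigenvalues of \<open>A\<close>, and
  \<open>mtrace_R\<close> converts it into the trace of \<open>E\<close>.\<close>

lemma mtrace_E:
  assumes cp: "char_poly A = (\<Prod>a\<leftarrow>map complex_of_real ls. [:- a, 1:])" and ls: "\<And>l. l \<in> set ls \<Longrightarrow> 0 \<le> l"
  shows "\<theta> * Re (mtrace E) = (\<Sum>l\<leftarrow>ls. \<theta> * l / (x + \<theta> * l))"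
proof -
  have \<theta>: "\<theta> > 0" by (rule \<theta>_bounds)
  let ?V = "complex_of_real \<theta> \<cdot>\<^sub>m 1\<^sub>m N"
  have V: "hnd N ?V" using \<theta> by (intro hnd_smult hnd_one) auto
  interpret V: resolvent N x A ?V using x A V by unfold_locales
  define y where "y = x / \<theta>"
  have y: "y > 0" using x \<theta> by (simp add: y_def)
  have AV: "A * ?V = complex_of_real \<theta> \<cdot>\<^sub>m A" by (simp add: mult_smult_distrib[of _ N N _ N])
  have sh: "shift_mat N x (A * ?V) = complex_of_real \<theta> \<cdot>\<^sub>m shift_mat N y A"
    unfolding AV using \<theta> by (intro eq_matI) (auto simp: shift_mat_def y_def algebra_simps carrier_matD[OF AC])
  have "det (shift_mat N y A) \<noteq> 0"
    using eigenvalue_hnd_mult[OF A hnd_one[of N]] y by (intro det_shift_nonzero[OF AC]) auto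
  note mi = minv[OF shift_carrier[OF AC] this]
  have mC: "complex_of_real (1 / \<theta>) \<cdot>\<^sub>m minv (shift_mat N y A) \<in> carrier_mat N N"
    using mi(1) by simp
  have "shift_mat N x (A * ?V) * (complex_of_real (1 / \<theta>) \<cdot>\<^sub>m minv (shift_mat N y A)) = 1\<^sub>m N"
  proof -
    have "shift_mat N x (A * ?V) * (complex_of_real (1 / \<theta>) \<cdot>\<^sub>m minv (shift_mat N y A)) =
        complex_of_real \<theta> \<cdot>\<^sub>m (complex_of_real (1 / \<theta>) \<cdot>\<^sub>m (shift_mat N y A * minv (shift_mat N y A)))"
      unfolding sh
      by (simp only: mult_smult_assoc_mat[OF shift_carrier[OF AC] mC] mult_smult_distrib[OF shift_carrier[OF AC] mi(1)])
    also have "\<dots> = 1\<^sub>m N" unfolding mi(2) using \<theta> by (intro eq_matI) auto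
    finally show ?thesis .
  qed
  then have R: "V.R = complex_of_real (1 / \<theta>) \<cdot>\<^sub>m minv (shift_mat N y A)"
    using mi(1) by (intro V.R_uniq[symmetric]) auto
  have "mtrace (minv (shift_mat N y A)) = (\<Sum>a\<leftarrow>map complex_of_real ls. 1 / (complex_of_real y + a))"
  proof (rule mtrace_minv_shift[OF AC cp])
    fix a assume "a \<in> set (map complex_of_real ls)"
    then obtain l where l: "a = complex_of_real l" "0 \<le> l" using ls by auto
    then have "complex_of_real y + a = complex_of_real (y + l)" by simp
    then show "complex_of_real y + a \<noteq> 0" using l y by (simp del: of_real_add)
  qed
  also have "\<dots> = complex_of_real (\<Sum>l\<leftarrow>ls. 1 / (y + l))"
    by (induction ls) auto
  finally have tR: "Re (mtrace V.R) = (1 / \<theta>) * (\<Sum>l\<leftarrow>ls. 1 / (y + l))"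
    unfolding R using mi(1) by (simp add: mtrace_smult[of _ N])
  have len: "length ls = N"
    using degree_monic_char_poly[OF AC] degree_linear_factors[of uminus "map complex_of_real ls"] cp by simp
  have "Re (mtrace (E * ?V)) = \<theta> * Re (mtrace E)"
    by (simp add: mult_smult_distrib[of _ N N _ N] mtrace_smult[of _ N] right_mult_one_mat[of _ N N])
  moreover have "x * Re (mtrace V.R) = real N - Re (mtrace (E * ?V))"
    using arg_cong[OF V.mtrace_R, of Re] by (simp add: E_def)
  ultimately have "\<theta> * Re (mtrace E) = real (length ls) - x * ((1 / \<theta>) * (\<Sum>l\<leftarrow>ls. 1 / (y + l)))"
    using tR len by simp
  also have "\<dots> = (\<Sum>l\<leftarrow>ls. \<theta> * l / (x + \<theta> * l))"
    using ls
  proof (induction ls)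
    case (Cons l ls)
    have l: "0 \<le> l" using Cons.prems by simp
    have pos: "x + \<theta> * l > 0" using x \<theta> l by (simp add: add_pos_nonneg)
    have "1 - x * ((1 / \<theta>) * (1 / (y + l))) = \<theta> * l / (x + \<theta> * l)"
    proof -
      have "\<theta> * (y + l) = x + \<theta> * l" using \<theta> by (simp add: y_def algebra_simps)
      then have "(1 / \<theta>) * (1 / (y + l)) = 1 / (x + \<theta> * l)" by simp
      then show ?thesis using pos by (simp add: field_simps)
    qed
    then show ?case using Cons by (simp add: algebra_simps)
  qed simp
  finally show ?thesis .
qed

text \<open>The witness is \<open>\<theta>\<close>: multiplying the approximation of
  \<open>t\<close> by \<open>\<theta>\<close> and using \<open>\<theta> * (1 + t) = 1\<close> gives
  the equation.\<close>

lemma approximate_fixed_point: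
  assumes cp: "char_poly A = (\<Prod>a\<leftarrow>map complex_of_real ls. [:- a, 1:])" and ls: "\<And>l. l \<in> set ls \<Longrightarrow> 0 \<le> l"
  shows "\<exists>v. 0 < v \<and> v \<le> 1 \<and>
    \<bar>1 - real N / real L + x * (\<integral>C. Re (mtrace (RR J0 C)) \<partial>PP) / real L - v\<bar> \<le> sqrt D \<and>
    \<bar>v + (\<Sum>l\<leftarrow>ls. v * l / (x + v * l)) / real L - 1\<bar> \<le> \<kappa>\<^sup>2 / real L + sqrt D * (G + 1) / 2"
proof (intro exI[of _ \<theta>] conjI \<theta>_bounds mean_trace_rsv)
  have "\<theta> + (\<Sum>l\<leftarrow>ls. \<theta> * l / (x + \<theta> * l)) / real L - 1 = \<theta> + \<theta> * Re (mtrace E) / real L - \<theta> * (1 + t)"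
    using mtrace_E[OF cp ls] \<theta>_bounds(3) by simp
  also have "\<dots> = - \<theta> * (t - Re (mtrace E) / real L)" by (simp add: algebra_simps)
  finally have "\<bar>\<theta> + (\<Sum>l\<leftarrow>ls. \<theta> * l / (x + \<theta> * l)) / real L - 1\<bar> = \<theta> * \<bar>t - Re (mtrace E) / real L\<bar>"
    using \<theta>_bounds(1) by (simp add: abs_mult)
  also have "\<dots> \<le> 1 * (\<kappa>\<^sup>2 / real L + sqrt D * (G + 1) / 2)"
    using \<theta>_bounds mean_trace_krn by (intro mult_mono) auto
  finally show "\<bar>\<theta> + (\<Sum>l\<leftarrow>ls. \<theta> * l / (x + \<theta> * l)) / real L - 1\<bar> \<le> \<kappa>\<^sup>2 / real L + sqrt D * (G + 1) / 2" by simp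
qed

end

section \<open>Truncation of large eigenvalues\<close>

text \<open>The quantities \<open>D\<close> and \<open>G\<close> outside their locale, with explicit
  arguments so that limits in \<open>N\<close> can be taken.\<close>

definition err_D :: "real \<Rightarrow> real \<Rightarrow> nat \<Rightarrow> nat \<Rightarrow> real" where
  "err_D C3 \<kappa> N L = 3 * (C3 * (real N * \<kappa>\<^sup>2) / (real L)\<^sup>2 + (\<kappa> / real L)\<^sup>2 + 8 * \<kappa>\<^sup>2 / real L)"

definition err_G :: "real \<Rightarrow> real \<Rightarrow> nat \<Rightarrow> nat \<Rightarrow> real" where
  "err_G C3 \<kappa> N L = 2 * (C3 * (\<kappa>\<^sup>2 * (real N * \<kappa>\<^sup>2)) / (real L)\<^sup>2 + (real N * \<kappa>\<^sup>2 / real L)\<^sup>2)"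

lemma Re_mtrace_adjoint: "X \<in> carrier_mat n n \<Longrightarrow> Re (mtrace (mat_adjoint X)) = Re (mtrace X)"
  by (auto simp: mtrace_def)

text \<open>The adjoint of \<open>x + A W\<close> is \<open>x + W A\<close>. Exchanging the factors
  thus preserves the real part of the trace, and low-rank changes of \<open>A\<close> reduce to the
  updates of \<open>W\<close> already treated.\<close>

lemma (in resolvent) rsv_swap: "rsv n x W A = mat_adjoint R"
proof -
  let ?M = "shift_mat n x (A * W)"
  have M: "?M \<in> carrier_mat n n" by simp
  interpret S: resolvent n x W A using x A W by unfold_locales
  have adjM: "mat_adjoint ?M = shift_mat n x (W * A)"
    by (simp add: shift_mat_def adjoint_add[of _ n n] adjoint_smult adjoint_mult[of _ n n _ n] hnd_adjoint[OF A] hnd_adjoint[OF W])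
  have "mat_adjoint ?M * R' = 1\<^sub>m n"
    using arg_cong[OF R_mult_shift, of mat_adjoint] by (simp add: adjoint_mult[OF RC M])
  then show ?thesis unfolding adjM by (intro S.R_uniq[symmetric]) auto
qed

lemma spectral_theorem_ex:
  assumes A: "hnd n A"
  shows "\<exists>u \<tau>. (\<forall>i<n. u i \<in> carrier_vec n) \<and> (\<forall>i<n. 0 \<le> (\<tau> i :: real)) \<and>
    (\<forall>i<n. \<forall>j<n. u i \<diamondop> u j = (if i = j then 1 else 0)) \<and>
    A = gram n {..<n} (\<lambda>i. complex_of_real (sqrt (\<tau> i)) \<cdot>\<^sub>v u i)"
  by (rule spectral_theorem[OF A]) blast

text \<open>After the two factors are exchanged, each rank-one term lowers the trace by at most
  \<open>1 / x\<close>. Only the number of terms counts, not their size, which is what makes large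
  eigenvalues harmless.\<close>

lemma mtrace_rsv_add_outers:
  assumes x: "x > 0" and A: "hnd n A" and W: "hnd n W" and T: "finite T" and g: "\<And>i. i \<in> T \<Longrightarrow> g i \<in> carrier_vec n"
  shows "0 \<le> Re (mtrace (rsv n x A W)) - Re (mtrace (rsv n x (A + gram n T g) W))"
    "Re (mtrace (rsv n x A W)) - Re (mtrace (rsv n x (A + gram n T g) W)) \<le> real (card T) / x"
proof -
  have swap: "Re (mtrace (rsv n x A W)) = Re (mtrace (rsv n x W A))" if "hnd n A" for A
  proof -
    interpret resolvent n x A W using x that W by unfold_locales
    show ?thesis unfolding rsv_swap by (simp add: Re_mtrace_adjoint[of _ n])
  qed
  have hT: "hnd n (A + gram n T g)" using A T g by (intro hnd_add hnd_gram)
  have "0 \<le> Re (mtrace (rsv n x W A)) - Re (mtrace (rsv n x W (A + gram n T g))) \<and>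
    Re (mtrace (rsv n x W A)) - Re (mtrace (rsv n x W (A + gram n T g))) \<le> real (card T) / x"
    using T g
  proof (induction T rule: finite_induct)
    case empty
    have "A \<in> carrier_mat n n" using A by auto
    then show ?case by (simp add: gram_empty)
  next
    case (insert i T)
    have "A \<in> carrier_mat n n" using A by auto
    then have eq: "A + gram n (insert i T) g = (A + gram n T g) + outer (g i) (g i)"
      using insert by (simp add: gram_insert assoc_add_mat[of _ n n])
    interpret resolvent n x W "A + gram n T g"
      using x W A insert by unfold_locales (auto intro!: hnd_add hnd_gram)
    note u = mtrace_rsv_update_bounds[of "g i", folded eq]
    have "real (card (insert i T)) / x = real (card T) / x + 1 / x"
      using insert by (simp add: add_divide_distrib)
    then show ?case using insert.IH u insert.prems by auto
  qed
  then show "0 \<le> Re (mtrace (rsv n x A W)) - Re (mtrace (rsv n x (A + gram n T g) W))"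
    "Re (mtrace (rsv n x A W)) - Re (mtrace (rsv n x (A + gram n T g) W)) \<le> real (card T) / x"
    unfolding swap[OF A] swap[OF hT] by auto
qed

context column_model
begin

definition "tr_rsv x A C = Re (mtrace (rsv N x A (WW {..<L} C)))"

text \<open>By \<open>mtrace_rsv_gram\<close> this is the mean of the average of the numbers
  \<open>1 / (1 + q j)\<close>, the counterpart at finite \<open>N\<close> of the solution
  \<open>v\<close>.\<close>

definition "mean_v x A = 1 - real N / real L + x * (\<integral>C. tr_rsv x A C \<partial>PP) / real L"

text \<open>Read off from \<open>mtrace_rsv_gram\<close>, whose summands lie between
  \<open>0\<close> and \<open>1\<close>.\<close>

lemma tr_rsv_bound:
  assumes x: "x > 0" and A: "hnd N A"
  shows "\<bar>tr_rsv x A C\<bar> \<le> (real N + real L) / x"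
proof -
  have q: "0 \<le> qform (krn N x A (gram N ({..<L} - {j}) (column C))) (column C j)" for j
  proof -
    interpret resolvent N x A "gram N ({..<L} - {j}) (column C)"
      using x A by unfold_locales (auto intro: hnd_gram)
    show ?thesis by (intro hnd_qform[OF hnd_K]) simp
  qed
  let ?s = "\<Sum>j<L. 1 / (1 + qform (krn N x A (gram N ({..<L} - {j}) (column C))) (column C j))"
  have le1: "1 / (1 + r) \<le> 1" if "0 \<le> r" for r :: real using that by (simp add: divide_le_eq_1)
  have "?s \<le> (\<Sum>j<L. 1)" by (intro sum_mono le1 q)
  moreover have "0 \<le> ?s" using q by (intro sum_nonneg) auto
  moreover have "x * tr_rsv x A C = real N - real L + ?s"
    using mtrace_rsv_gram[OF x A, of "{..<L}" "column C"] by (simp add: tr_rsv_def WW_def)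
  ultimately have "\<bar>x * tr_rsv x A C\<bar> \<le> real N + real L" by (auto simp: abs_le_iff)
  then show ?thesis using x by (simp add: abs_mult pos_le_divide_eq mult.commute)
qed

lemma tr_rsv_measurable: "A \<in> carrier_mat N N \<Longrightarrow> tr_rsv x A \<in> borel_measurable PP"
  unfolding tr_rsv_def
  using mtrace_measurable[OF mat_measurable_rsv[OF mat_measurable_const WW_measurable[of "{..<L}" "{..<L}"]]] by measurable

lemma tr_rsv_integrable: "x > 0 \<Longrightarrow> hnd N A \<Longrightarrow> integrable PP (tr_rsv x A)"
  using tr_rsv_measurable tr_rsv_bound
  by (intro finite_measure.integrable_const_bound[OF prob_space.finite_measure[OF prob_space_PiM[OF Q]], where B = "(real N + real L) / x"]) auto

text \<open>Both values lie in the interval of length \<open>1 / x\<close> just below the trace for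
  the matrix without column \<open>j\<close>.\<close>

lemma tr_rsv_diff:
  assumes x: "x > 0" and A: "hnd N A" and j: "j < L"
  shows "\<bar>tr_rsv x A (C(j := y)) - tr_rsv x A (C(j := z))\<bar> \<le> 1 / x"
proof -
  have u: "0 \<le> Re (mtrace (rsv N x A (WW ({..<L} - {j}) C))) - tr_rsv x A (C(j := y))"
    "Re (mtrace (rsv N x A (WW ({..<L} - {j}) C))) - tr_rsv x A (C(j := y)) \<le> 1 / x" for y
  proof -
    interpret resolvent N x A "WW ({..<L} - {j}) C"
      using x A hnd_WW by unfold_locales auto
    have eq: "WW {..<L} (C(j := y)) = WW ({..<L} - {j}) C + outer (column (C(j := y)) j) (column (C(j := y)) j)"
    proof -
      have "WW {..<L} (C(j := y)) = WW ({..<L} - {j}) (C(j := y)) + outer (column (C(j := y)) j) (column (C(j := y)) j)"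
        unfolding WW_def using j by (intro gram_remove) auto
      also have "WW ({..<L} - {j}) (C(j := y)) = WW ({..<L} - {j}) C" by (rule WW_cong) auto
      finally show ?thesis .
    qed
    show "0 \<le> Re (mtrace (rsv N x A (WW ({..<L} - {j}) C))) - tr_rsv x A (C(j := y))"
      "Re (mtrace (rsv N x A (WW ({..<L} - {j}) C))) - tr_rsv x A (C(j := y)) \<le> 1 / x"
      unfolding tr_rsv_def eq using mtrace_rsv_update_bounds[OF column_carrier] by auto
  qed
  show ?thesis using u[of y] u[of z] by linarith
qed

lemma tr_rsv_concentration:
  assumes x: "x > 0" and A: "hnd N A" and \<epsilon>: "\<epsilon> > 0"
  shows "emeasure PP {C \<in> space PP. \<epsilon> \<le> \<bar>tr_rsv x A C - integral\<^sup>L PP (tr_rsv x A)\<bar>}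
    \<le> ennreal (2 * exp (- (\<epsilon> * x)\<^sup>2 / (2 * real L)))"
proof -
  have "emeasure PP {C \<in> space PP. \<epsilon> \<le> \<bar>tr_rsv x A C - integral\<^sup>L PP (tr_rsv x A)\<bar>}
    \<le> ennreal (2 * exp (- \<epsilon>\<^sup>2 / (2 * (1 / x)\<^sup>2 * real (card {..<L}))))"
  proof (rule bounded_difference_tail[OF Q])
    show "tr_rsv x A \<in> borel_measurable PP" using A by (intro tr_rsv_measurable) auto
    show "\<bar>tr_rsv x A C\<bar> \<le> (real N + real L) / x" for C by (rule tr_rsv_bound[OF x A])
    show "\<bar>tr_rsv x A (C(j := y)) - tr_rsv x A (C(j := z))\<bar> \<le> 1 / x" if "j \<in> {..<L}" for C j y z
      using that by (intro tr_rsv_diff[OF x A]) auto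
  qed (use x \<epsilon> L in auto)
  also have "- \<epsilon>\<^sup>2 / (2 * (1 / x)\<^sup>2 * real (card {..<L})) = - (\<epsilon> * x)\<^sup>2 / (2 * real L)"
    using x by (simp add: power_divide power_mult_distrib)
  finally show ?thesis .
qed

text \<open>Discarding the eigenvalues of \<open>A\<close> above \<open>b\<close> changes \<open>A\<close> by a matrix whose rank is their number;
  this is the source of the terms with \<open>filter\<close>.\<close>

lemma truncated_fixed_point:
  assumes A: "hnd N A"
  obtains ls where "length ls = N" "char_poly A = (\<Prod>a\<leftarrow>map complex_of_real ls. [:- a, 1:])"
    "\<And>l. l \<in> set ls \<Longrightarrow> 0 \<le> l"
    "\<And>x b. x > 0 \<Longrightarrow> b > 0 \<Longrightarrow> \<exists>v. 0 < v \<and> v \<le> 1 \<and>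
      \<bar>mean_v x A - v\<bar> \<le> sqrt (err_D C3 (b / x) N L) + real (length (filter (\<lambda>l. b < l) ls)) / real L \<and>
      \<bar>v + (\<Sum>l\<leftarrow>ls. v * l / (x + v * l)) / real L - 1\<bar> \<le>
        (b / x)\<^sup>2 / real L + sqrt (err_D C3 (b / x) N L) * (err_G C3 (b / x) N L + 1) / 2 +
        real (length (filter (\<lambda>l. b < l) ls)) / real L"
proof -
  note hA = A
  from A obtain u \<tau> where uC: "\<And>i. i < N \<Longrightarrow> u i \<in> carrier_vec N" and \<tau>0: "\<And>i. i < N \<Longrightarrow> 0 \<le> (\<tau> i :: real)"
    and on: "\<And>i j. i < N \<Longrightarrow> j < N \<Longrightarrow> u i \<diamondop> u j = (if i = j then 1 else 0)"
    and Aeq: "A = gram N {..<N} (\<lambda>i. complex_of_real (sqrt (\<tau> i)) \<cdot>\<^sub>v u i)"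
    using spectral_theorem_ex by blast
  let ?g = "\<lambda>i. complex_of_real (sqrt (\<tau> i)) \<cdot>\<^sub>v u i"
  define ls where "ls = map \<tau> [0..<N]"
  have gC: "?g i \<in> carrier_vec N" if "i < N" for i using uC[OF that] by simp
  have cp: "char_poly A = (\<Prod>a\<leftarrow>map complex_of_real ls. [:- a, 1:])"
  proof -
    have eqmap: "map (\<lambda>i. if i \<in> {..<N} then \<tau> i else 0) [0..<N] = ls" unfolding ls_def by (rule map_cong) auto
    show ?thesis
      using spectral_truncation_char_poly[of N u \<tau>, OF uC \<tau>0 on order_refl] unfolding eqmap Aeq[symmetric] .
  qed
  have main: "\<exists>v. 0 < v \<and> v \<le> 1 \<and>
      \<bar>mean_v x A - v\<bar> \<le> sqrt (err_D C3 (b / x) N L) + real (length (filter (\<lambda>l. b < l) ls)) / real L \<and>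
      \<bar>v + (\<Sum>l\<leftarrow>ls. v * l / (x + v * l)) / real L - 1\<bar> \<le>
        (b / x)\<^sup>2 / real L + sqrt (err_D C3 (b / x) N L) * (err_G C3 (b / x) N L + 1) / 2 +
        real (length (filter (\<lambda>l. b < l) ls)) / real L" if x: "x > 0" and b: "b > 0" for x b
  proof -
    define S where "S = {i. i < N \<and> \<tau> i \<le> b}"
    define Tb where "Tb = {i. i < N \<and> b < \<tau> i}"
    have ST: "S \<subseteq> {..<N}" "finite S" "finite Tb" "S \<inter> Tb = {}" "S \<union> Tb = {..<N}"
      by (auto simp: S_def Tb_def)
    have kT: "card Tb = length (filter (\<lambda>l. b < l) ls)"
      unfolding ls_def length_filter_conv_card Tb_def by (rule arg_cong[of _ _ card]) auto
    define A' where "A' = gram N S ?g"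
    define ls' where "ls' = map (\<lambda>i. if i \<in> S then \<tau> i else 0) [0..<N]"
    have hA': "hnd N A'" unfolding A'_def using ST gC by (intro hnd_gram) auto
    have AA': "A = A' + gram N Tb ?g"
    proof -
      have "A = gram N (S \<union> Tb) ?g" using Aeq ST by simp
      also have "\<dots> = A' + gram N Tb ?g"
        unfolding A'_def by (intro eq_matI) (simp_all add: gram_def sum.union_disjoint[OF ST(2,3,4)])
      finally show ?thesis .
    qed
    \<comment> \<open>The kernel bound is \<open>b / x\<close>, since no eigenvalue of
      \<open>A'\<close> exceeds \<open>b\<close>.\<close>
    interpret column_core N L Q C3 x "b / x" A'
    proof unfold_locales
      fix v :: "complex vec" assume v: "v \<in> carrier_vec N"
      show "qform A' v \<le> x * (b / x) * vnorm2 v"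
        using spectral_truncation_le[of N u \<tau>, OF uC \<tau>0 on ST(1) _ _ v, of b] b x unfolding A'_def by (auto simp: S_def)
    qed (use x b hA' in auto)
    have cp': "char_poly A' = (\<Prod>a\<leftarrow>map complex_of_real ls'. [:- a, 1:])"
      unfolding A'_def ls'_def by (rule spectral_truncation_char_poly[OF uC \<tau>0 on ST(1)])
    have ls'0: "0 \<le> l" if "l \<in> set ls'" for l using that \<tau>0 by (auto simp: ls'_def)
    from approximate_fixed_point[OF cp' ls'0] obtain v where v: "0 < v" "v \<le> 1"
      and v1: "\<bar>1 - real N / real L + x * (\<integral>C. Re (mtrace (RR {..<L} C)) \<partial>PP) / real L - v\<bar> \<le> sqrt D"
      and v2: "\<bar>v + (\<Sum>l\<leftarrow>ls'. v * l / (x + v * l)) / real L - 1\<bar> \<le> (b / x)\<^sup>2 / real L + sqrt D * (G + 1) / 2"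
      by blast
    have DD: "D = err_D C3 (b / x) N L" and GG: "G = err_G C3 (b / x) N L"
      by (simp_all add: D_def G_def err_D_def err_G_def)
    have v1': "\<bar>mean_v x A' - v\<bar> \<le> sqrt D" using v1 by (simp add: mean_v_def tr_rsv_def RR_def)
    have d: "0 \<le> tr_rsv x A' C - tr_rsv x A C" "tr_rsv x A' C - tr_rsv x A C \<le> real (card Tb) / x" for C
      using mtrace_rsv_add_outers[OF x hA' hnd_WW ST(3), of "{..<L}" ?g C] gC ST(5)
      unfolding tr_rsv_def AA' by (auto simp: Tb_def)
    have dint: "integral\<^sup>L PP (tr_rsv x A') - integral\<^sup>L PP (tr_rsv x A) = (\<integral>C. tr_rsv x A' C - tr_rsv x A C \<partial>PP)"
      by (rule Bochner_Integration.integral_diff[OF tr_rsv_integrable[OF x hA'] tr_rsv_integrable[OF x hA], symmetric])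
    have d0: "0 \<le> (\<integral>C. tr_rsv x A' C - tr_rsv x A C \<partial>PP)" using d by simp
    have "(\<integral>C. tr_rsv x A' C - tr_rsv x A C \<partial>PP) \<le> (\<integral>C. real (card Tb) / x \<partial>PP)"
      using d tr_rsv_integrable[OF x hA] tr_rsv_integrable[OF x hA']
      by (intro integral_mono Bochner_Integration.integrable_diff) auto
    then have d1: "(\<integral>C. tr_rsv x A' C - tr_rsv x A C \<partial>PP) \<le> real (card Tb) / x" by simp
    have "mean_v x A' - mean_v x A = x * (\<integral>C. tr_rsv x A' C - tr_rsv x A C \<partial>PP) / real L"
      unfolding dint[symmetric] mean_v_def by (simp add: algebra_simps diff_divide_distrib)
    moreover have "x * (\<integral>C. tr_rsv x A' C - tr_rsv x A C \<partial>PP) / real L \<le> x * (real (card Tb) / x) / real L"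
      using d1 x by (intro divide_right_mono mult_left_mono) auto
    moreover have "0 \<le> x * (\<integral>C. tr_rsv x A' C - tr_rsv x A C \<partial>PP) / real L"
      using d0 x by simp
    ultimately have "\<bar>mean_v x A' - mean_v x A\<bar> \<le> real (card Tb) / real L" using x by simp
    then have r1: "\<bar>mean_v x A - v\<bar> \<le> sqrt D + real (card Tb) / real L" using v1' by linarith
    have sum_ls: "(\<Sum>l\<leftarrow>map f [0..<N]. h l) = (\<Sum>i<N. h (f i))" for f :: "nat \<Rightarrow> real" and h :: "real \<Rightarrow> real"
      by (simp add: interv_sum_list_conv_sum_set_nat atLeast0LessThan o_def)
    have "(\<Sum>l\<leftarrow>ls. v * l / (x + v * l)) - (\<Sum>l\<leftarrow>ls'. v * l / (x + v * l)) =
        (\<Sum>i<N. if i \<in> Tb then v * \<tau> i / (x + v * \<tau> i) else 0)"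
      unfolding ls_def ls'_def sum_ls sum_subtractf[symmetric]
    proof (rule sum.cong[OF refl])
      fix i assume "i \<in> {..<N}"
      then have "i \<in> S \<longleftrightarrow> i \<notin> Tb" by (auto simp: S_def Tb_def)
      then show "v * \<tau> i / (x + v * \<tau> i) - v * (if i \<in> S then \<tau> i else 0) / (x + v * (if i \<in> S then \<tau> i else 0)) =
          (if i \<in> Tb then v * \<tau> i / (x + v * \<tau> i) else 0)"
        by simp
    qed
    also have "\<dots> = (\<Sum>i\<in>Tb. v * \<tau> i / (x + v * \<tau> i))"
      using ST by (subst sum.inter_restrict[symmetric]) (auto simp: Tb_def intro!: sum.cong)
    finally have sd: "(\<Sum>l\<leftarrow>ls. v * l / (x + v * l)) - (\<Sum>l\<leftarrow>ls'. v * l / (x + v * l)) = (\<Sum>i\<in>Tb. v * \<tau> i / (x + v * \<tau> i))" .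
    \<comment> \<open>A discarded eigenvalue contributes at most \<open>1\<close>, however large it
      is.\<close>
    have t01: "0 \<le> v * \<tau> i / (x + v * \<tau> i)" "v * \<tau> i / (x + v * \<tau> i) \<le> 1" if "i \<in> Tb" for i
      using that v x b by (auto simp: Tb_def add_pos_nonneg divide_le_eq_1)
    have "0 \<le> (\<Sum>i\<in>Tb. v * \<tau> i / (x + v * \<tau> i))" by (intro sum_nonneg t01(1))
    moreover have "(\<Sum>i\<in>Tb. v * \<tau> i / (x + v * \<tau> i)) \<le> (\<Sum>i\<in>Tb. 1)" by (intro sum_mono t01(2))
    ultimately have sd': "\<bar>(\<Sum>l\<leftarrow>ls. v * l / (x + v * l)) - (\<Sum>l\<leftarrow>ls'. v * l / (x + v * l))\<bar> \<le> real (card Tb)"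
      unfolding sd by simp
    have "\<bar>(\<Sum>l\<leftarrow>ls. v * l / (x + v * l)) / real L - (\<Sum>l\<leftarrow>ls'. v * l / (x + v * l)) / real L\<bar> \<le> real (card Tb) / real L"
      using sd' L by (simp add: diff_divide_distrib[symmetric] abs_divide divide_right_mono)
    then have r2: "\<bar>v + (\<Sum>l\<leftarrow>ls. v * l / (x + v * l)) / real L - 1\<bar> \<le>
        (b / x)\<^sup>2 / real L + sqrt D * (G + 1) / 2 + real (card Tb) / real L"
      using v2 by linarith
    show ?thesis using v r1 r2 unfolding kT DD GG by blast
  qed
  show ?thesis
    by (rule that[of ls]) (use cp main \<tau>0 in \<open>auto simp: ls_def\<close>)
qed

end

section \<open>Weak convergence on the half-line\<close>

text \<open>The truncation \<open>max l 0\<close> only serves to make \<open>tfn y\<close> continuous and bounded on the whole line.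
  For \<open>\<mu>\<close> carried by the half-line, \<open>1 - gam \<mu> y\<close> is \<open>y\<close> times the Stieltjes transform at \<open>- y\<close>.\<close>

definition tfn :: "real \<Rightarrow> real \<Rightarrow> real" where
  "tfn y l = max l 0 / (y + max l 0)"

definition gam :: "real measure \<Rightarrow> real \<Rightarrow> real" where
  "gam \<mu> y = (\<integral>l. tfn y l \<partial>\<mu>)"

lemma tfn_bounds: "0 < y \<Longrightarrow> 0 \<le> tfn y l" "0 < y \<Longrightarrow> tfn y l \<le> 1"
  by (auto simp: tfn_def divide_le_eq_1)

lemma isCont_tfn: "0 < y \<Longrightarrow> isCont (tfn y) l"
  unfolding tfn_def by (intro continuous_intros) (auto simp: add_pos_nonneg intro: less_imp_neq[symmetric])

lemma tfn_measurable [measurable]: "tfn y \<in> borel_measurable borel"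
  unfolding tfn_def by measurable

lemma tfn_antimono: "0 < y \<Longrightarrow> y \<le> z \<Longrightarrow> tfn z l \<le> tfn y l"
  unfolding tfn_def by (intro divide_left_mono) (auto intro!: mult_pos_pos add_pos_nonneg)

lemma tfn_lipschitz:
  assumes "0 < y" "0 < z"
  shows "\<bar>tfn y l - tfn z l\<bar> \<le> \<bar>y - z\<bar> / z"
proof -
  define m where "m = max l 0"
  have m: "0 \<le> m" by (simp add: m_def)
  have "tfn y l - tfn z l = (m / (y + m)) * ((z - y) / (z + m))"
    unfolding tfn_def m_def[symmetric] using assms m by (simp add: field_simps add_pos_nonneg)
  then have "\<bar>tfn y l - tfn z l\<bar> = (m / (y + m)) * (\<bar>y - z\<bar> / (z + m))"
    using assms m by (simp add: abs_mult abs_minus_commute)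
  also have "\<dots> \<le> 1 * (\<bar>y - z\<bar> / z)"
    using assms m by (intro mult_mono divide_left_mono) (auto simp: divide_le_eq_1)
  finally show ?thesis by simp
qed

context real_distribution
begin

lemma prob_UNIV [simp]: "prob UNIV = 1"
  using prob_space by simp

lemma tfn_integrable: "0 < y \<Longrightarrow> integrable M (tfn y)"
  using tfn_bounds by (intro integrable_const_bound[of _ 1]) (auto simp: abs_le_iff)

lemma gam_bounds: assumes "0 < y" shows "0 \<le> gam M y" "gam M y \<le> 1"
proof -
  show "0 \<le> gam M y" unfolding gam_def using tfn_bounds(1)[OF assms] by simp
  have "gam M y \<le> (\<integral>l. 1 \<partial>M)"
    unfolding gam_def using tfn_integrable[OF assms] tfn_bounds(2)[OF assms] by (intro integral_mono) auto
  then show "gam M y \<le> 1" by (simp add: prob_space)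
qed

lemma gam_antimono: "0 < y \<Longrightarrow> y \<le> z \<Longrightarrow> gam M z \<le> gam M y"
  unfolding gam_def using tfn_antimono tfn_integrable by (intro integral_mono) auto

lemma gam_lipschitz:
  assumes "0 < y" "0 < z"
  shows "\<bar>gam M y - gam M z\<bar> \<le> \<bar>y - z\<bar> / z"
proof -
  have "gam M y - gam M z = (\<integral>l. tfn y l - tfn z l \<partial>M)"
    unfolding gam_def using assms by (simp add: Bochner_Integration.integral_diff tfn_integrable)
  also have "\<bar>\<dots>\<bar> \<le> (\<integral>l. \<bar>tfn y l - tfn z l\<bar> \<partial>M)" by (rule integral_abs_bound)
  also have "\<dots> \<le> (\<integral>l. \<bar>y - z\<bar> / z \<partial>M)"
    using assms tfn_integrable tfn_lipschitz by (intro integral_mono) auto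
  finally show ?thesis by (simp add: prob_space)
qed

lemma isCont_gam:
  assumes "0 < z"
  shows "isCont (gam M) z"
proof -
  have "((\<lambda>y. gam M y - gam M z) \<longlongrightarrow> 0) (at z)"
  proof (rule Lim_null_comparison)
    show "((\<lambda>y. \<bar>y - z\<bar> / z) \<longlongrightarrow> 0) (at z)"
      using assms by (auto intro!: tendsto_eq_intros)
    show "\<forall>\<^sub>F y in at z. norm (gam M y - gam M z) \<le> \<bar>y - z\<bar> / z"
      using eventually_at_in_open'[of "{0<..}" z] assms
      by (auto elim!: eventually_mono simp: gam_lipschitz)
  qed
  then show ?thesis unfolding isCont_def using LIM_zero_cancel by blast
qed

lemma gam_tendsto_0: "(gam M \<longlongrightarrow> 0) at_top"
proof -
  have "((\<lambda>y. \<integral>l. tfn y l \<partial>M) \<longlongrightarrow> (\<integral>l. 0 \<partial>M)) at_top"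
  proof (rule integral_dominated_convergence_at_top[where w = "\<lambda>_. 1"])
    show "AE l in M. ((\<lambda>y. tfn y l) \<longlongrightarrow> 0) at_top"
      unfolding tfn_def by (intro AE_I2) real_asymp
    show "\<forall>\<^sub>F y in at_top. AE l in M. norm (tfn y l) \<le> 1"
      using eventually_gt_at_top[of 0] by eventually_elim (auto simp: tfn_bounds abs_le_iff intro: order_trans[OF _ tfn_bounds(1)])
  qed auto
  then show ?thesis by (simp add: gam_def[abs_def])
qed

lemma gam_small:
  assumes "0 < e"
  shows "\<exists>y0>0. \<forall>y\<ge>y0. gam M y < e"
proof -
  have "\<forall>\<^sub>F y in at_top. gam M y < e"
    using order_tendstoD(2)[OF gam_tendsto_0 assms] .
  then obtain y1 where "\<forall>y\<ge>y1. gam M y < e" by (auto simp: eventually_at_top_linorder)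
  then show ?thesis by (intro exI[of _ "max y1 1"]) auto
qed

text \<open>Beyond \<open>b\<close> the integrand \<open>tfn b\<close> is at least
  \<open>1 / 2\<close>.\<close>

lemma tail_le_gam:
  assumes "0 < b"
  shows "measure M {b<..} \<le> 2 * gam M b"
proof -
  have "measure M {b<..} = (\<integral>l. indicator {b<..} l \<partial>M)" by simp
  also have "\<dots> \<le> (\<integral>l. 2 * tfn b l \<partial>M)"
  proof (rule integral_mono)
    show "indicator {b<..} l \<le> 2 * tfn b l" for l
      using assms tfn_bounds(1)[OF assms, of l] by (auto simp: indicator_def tfn_def field_simps)
    show "integrable M (indicat_real {b<..})"
      by (rule integrable_real_indicator) (auto simp: emeasure_eq_measure)
    show "integrable M (\<lambda>l. 2 * tfn b l)" using tfn_integrable[OF assms] by simp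
  qed
  finally show ?thesis by (simp add: gam_def)
qed

end

lemma weak_conv_gam:
  assumes "\<And>n. real_distribution (\<mu> n)" "real_distribution M" "weak_conv_m \<mu> M" "0 < y"
  shows "(\<lambda>n. gam (\<mu> n) y) \<longlonglongrightarrow> gam M y"
  unfolding gam_def using assms tfn_bounds isCont_tfn
  by (intro weak_conv_imp_integral_bdd_continuous_conv[where B = 1]) (auto simp: abs_le_iff intro: order_trans[OF _ tfn_bounds(1)])

text \<open>With \<open>v = x * m\<close>, where \<open>m\<close> is the companion Stieltjes transform at \<open>- x\<close>, this is the
  Marchenko--Pastur equation.\<close>

lemma fixed_point_exists:
  assumes \<mu>: "real_distribution \<mu>" and c: "0 < c" and x: "0 < x"
  shows "\<exists>v. 0 < v \<and> v \<le> 1 \<and> v + c * gam \<mu> (x / v) = 1"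
proof -
  interpret real_distribution \<mu> by fact
  obtain y0 where y0: "0 < y0" "\<And>y. y \<ge> y0 \<Longrightarrow> gam \<mu> y < 1 / (2 * c)"
    using gam_small[of "1 / (2 * c)"] c by auto
  \<comment> \<open>The bound \<open>x / y0\<close> puts \<open>x / v0\<close> where
    \<open>c * gam \<mu>\<close> is below \<open>1 / 2\<close>, and \<open>1 / 2\<close> bounds the
    other summand, so the left-hand side is at most \<open>1\<close> at \<open>v0\<close>. At
    \<open>v = 1\<close> it is at least \<open>1\<close>.\<close>
  define v0 where "v0 = min (1 / 2) (x / y0)"
  have v0: "0 < v0" using x y0 by (simp add: v0_def)
  have v0': "v0 \<le> 1 / 2" unfolding v0_def by (rule min.cobounded1)
  have "v0 \<le> x / y0" by (simp add: v0_def)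
  then have "x / v0 \<ge> y0" using v0 y0 by (simp add: field_simps)
  then have "gam \<mu> (x / v0) < 1 / (2 * c)" by (rule y0(2))
  then have "c * gam \<mu> (x / v0) < 1 / 2" using c by (simp add: field_simps)
  then have lo: "v0 + c * gam \<mu> (x / v0) \<le> 1" using v0' by linarith
  have hi: "1 \<le> 1 + c * gam \<mu> (x / 1)" using gam_bounds(1)[of x] c x by simp
  have "\<exists>v\<ge>v0. v \<le> 1 \<and> v + c * gam \<mu> (x / v) = 1"
  proof (rule IVT)
    show "\<forall>v. v0 \<le> v \<and> v \<le> 1 \<longrightarrow> isCont (\<lambda>v. v + c * gam \<mu> (x / v)) v"
      using v0 x by (auto intro!: continuous_intros isCont_o2[where g = "gam \<mu>"] isCont_gam)
  qed (use lo hi v0' in auto)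
  then show ?thesis using v0 by (meson less_le_trans)
qed

text \<open>\<open>gam M\<close> is nonincreasing, so \<open>c * gam M (x / v)\<close> is
  nondecreasing in \<open>v\<close> and can only enlarge the difference
  \<open>v - w\<close>.\<close>

lemma (in real_distribution) fixed_point_expanding:
  assumes "0 < v" "0 < w" "0 < x" "0 \<le> c"
  shows "\<bar>v - w\<bar> \<le> \<bar>(v + c * gam M (x / v)) - (w + c * gam M (x / w))\<bar>"
proof -
  have mono: "gam M (x / v) \<le> gam M (x / w)" if "0 < v" "v \<le> w" for v w
    using that assms(3) by (intro gam_antimono) (auto simp: frac_le)
  show ?thesis
  proof (cases "v \<le> w")
    case True
    then have "c * gam M (x / v) \<le> c * gam M (x / w)" using mono[of v w] assms by (intro mult_left_mono) auto
    then show ?thesis using True by linarith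
  next
    case False
    then have "c * gam M (x / w) \<le> c * gam M (x / v)" using mono[of w v] assms by (intro mult_left_mono) auto
    then show ?thesis using False by linarith
  qed
qed

section \<open>Determination of a measure by its transform\<close>

text \<open>A power series with a nonzero coefficient has no zeros near \<open>0\<close> except
  possibly \<open>0\<close> itself, whereas the difference of the two series vanishes
  identically.\<close>

lemma power_series_unique:
  fixes a b :: "nat \<Rightarrow> real"
  assumes "\<And>h. \<bar>h\<bar> < 1 \<Longrightarrow> (\<lambda>k. a k * h ^ k) sums f h" "\<And>h. \<bar>h\<bar> < 1 \<Longrightarrow> (\<lambda>k. b k * h ^ k) sums f h"
  shows "a = b"
proof
  fix m
  have z: "(\<lambda>k. (a k - b k) * (h - 0) ^ k) sums 0" if "norm (h - 0) < 1" for h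
    using sums_diff[OF assms(1)[of h] assms(2)[of h]] that by (simp add: left_diff_distrib)
  show "a m = b m"
  proof (cases "m = 0")
    case True
    have "(\<lambda>k. (a k - b k) * 0 ^ k) sums 0" using z[of 0] by simp
    then have "a 0 - b 0 = 0" by (simp add: sums_iff)
    then show ?thesis using True by simp
  next
    case False
    show ?thesis
    proof (rule ccontr)
      assume "a m \<noteq> b m"
      then have "a m - b m \<noteq> 0" by simp
      obtain s :: real where s: "0 < s" "\<And>w::real. w \<in> cball 0 s - {0} \<Longrightarrow> (0::real) \<noteq> 0"
        by (rule powser_0_nonzero[of 1 0 "\<lambda>k. a k - b k" "\<lambda>_. 0" m, OF _ z _ \<open>a m - b m \<noteq> 0\<close>])
          (use False in auto)
      from s(2)[of s] s(1) show False by auto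
    qed
  qed
qed

text \<open>For measures on \<open>[-1, 1]\<close> the exponential series can be integrated term by
  term, so the moments determine the characteristic function.\<close>

lemma moments_determine:
  assumes \<mu>: "real_distribution \<mu>" and \<nu>: "real_distribution \<nu>"
    and b\<mu>: "AE t in \<mu>. \<bar>t\<bar> \<le> 1" and b\<nu>: "AE t in \<nu>. \<bar>t\<bar> \<le> 1"
    and mom: "\<And>k. (\<integral>t. t ^ k \<partial>\<mu>) = (\<integral>t. t ^ k \<partial>\<nu>)"
  shows "\<mu> = \<nu>"
proof (rule Levy_uniqueness[OF \<mu> \<nu>])
  have ch: "(\<lambda>k. (\<i> * complex_of_real s) ^ k / of_nat (fact k) * complex_of_real (\<integral>t. t ^ k \<partial>\<mu>)) sums char \<mu> s"
    if \<mu>: "real_distribution \<mu>" and b: "AE t in \<mu>. \<bar>t\<bar> \<le> 1" for \<mu> s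
  proof -
    interpret real_distribution \<mu> by fact
    let ?f = "\<lambda>k t. (\<i> * complex_of_real s) ^ k / of_nat (fact k) * complex_of_real (t ^ k)"
    have nb: "AE t in \<mu>. norm (?f k t) \<le> \<bar>s\<bar> ^ k / fact k" for k
      using b
    proof eventually_elim
      case (elim t)
      have "norm (?f k t) = \<bar>s\<bar> ^ k / fact k * \<bar>t\<bar> ^ k"
        by (simp add: norm_mult norm_divide norm_power power_abs)
      also have "\<dots> \<le> \<bar>s\<bar> ^ k / fact k * 1" using elim by (intro mult_left_mono power_le_one) auto
      finally show ?case by simp
    qed
    have fi: "integrable \<mu> (?f k)" for k
      using nb[of k] by (intro integrable_const_bound) auto
    have se: "summable (\<lambda>k. \<bar>s\<bar> ^ k / fact k :: real)"
      using summable_exp[of "\<bar>s\<bar>"] by (simp add: field_simps)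
    have "(\<lambda>k. integral\<^sup>L \<mu> (?f k)) sums (\<integral>t. (\<Sum>k. ?f k t) \<partial>\<mu>)"
    proof (rule sums_integral[OF fi])
      have "AE t in \<mu>. \<forall>k. norm (?f k t) \<le> \<bar>s\<bar> ^ k / fact k" using nb by (simp add: AE_all_countable)
      then show "AE t in \<mu>. summable (\<lambda>k. norm (?f k t))"
        by eventually_elim (rule summable_comparison_test'[OF se], auto)
      show "summable (\<lambda>k. \<integral>t. norm (?f k t) \<partial>\<mu>)"
      proof (rule summable_comparison_test'[OF se])
        fix k
        have "(\<integral>t. norm (?f k t) \<partial>\<mu>) \<le> (\<integral>t. \<bar>s\<bar> ^ k / fact k \<partial>\<mu>)"
          using nb[of k] fi[of k] by (intro integral_mono_AE) auto
        then show "norm (\<integral>t. norm (?f k t) \<partial>\<mu>) \<le> \<bar>s\<bar> ^ k / fact k" by (simp add: prob_space)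
      qed
    qed
    also have "(\<integral>t. (\<Sum>k. ?f k t) \<partial>\<mu>) = char \<mu> s"
    proof -
      have "(\<Sum>k. ?f k t) = iexp (s * t)" for t
      proof -
        have "(\<lambda>k. (\<i> * complex_of_real (s * t)) ^ k /\<^sub>R fact k) sums iexp (s * t)" by (rule exp_converges)
        moreover have "(\<i> * complex_of_real (s * t)) ^ k /\<^sub>R fact k = ?f k t" for k
          by (simp add: scaleR_conv_of_real power_mult_distrib field_simps)
        ultimately show ?thesis by (simp add: sums_iff)
      qed
      then show ?thesis by (simp add: char_def)
    qed
    finally have sums: "(\<lambda>k. integral\<^sup>L \<mu> (?f k)) sums char \<mu> s" .
    have c: "integral\<^sup>L \<mu> (?f k) = (\<i> * complex_of_real s) ^ k / of_nat (fact k) * complex_of_real (\<integral>t. t ^ k \<partial>\<mu>)" for k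
      by (simp only: integral_mult_right_zero integral_complex_of_real)
    show ?thesis using sums unfolding c .
  qed
  show "char \<mu> = char \<nu>"
  proof
    fix s
    show "char \<mu> s = char \<nu> s" using ch[OF \<mu> b\<mu>, of s] ch[OF \<nu> b\<nu>, of s] unfolding mom by (rule sums_unique2)
  qed
qed

text \<open>Expanding \<open>gam \<mu>\<close> around \<open>1\<close> gives the moments of the bounded function \<open>rfn\<close>, which
  determine \<open>\<mu>\<close>.\<close>

definition rfn :: "real \<Rightarrow> real" where
  "rfn l = 1 / (1 + max l 0)"

lemma rfn_bounds: "0 < rfn l" "rfn l \<le> 1"
  by (auto simp: rfn_def)

lemma rfn_measurable [measurable]: "rfn \<in> borel_measurable borel"
  unfolding rfn_def by measurable

text \<open>With \<open>m = max l 0\<close>, both sides are integrals of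
  \<open>1 / (1 + m - h)\<close>: it is \<open>rfn l\<close> times a geometric series in
  \<open>h * rfn l\<close>, and it equals \<open>(1 - tfn (1 - h) l) / (1 - h)\<close>.\<close>

lemma (in real_distribution) rfn_moment_series:
  assumes h: "\<bar>h\<bar> < 1"
  shows "(\<lambda>k. (\<integral>l. rfn l ^ Suc k \<partial>M) * h ^ k) sums ((1 - gam M (1 - h)) / (1 - h))"
proof -
  let ?f = "\<lambda>k l. rfn l ^ Suc k * h ^ k"
  have nb: "norm (?f k l) \<le> \<bar>h\<bar> ^ k" for k l
    using rfn_bounds[of l] by (simp add: abs_mult power_abs mult_left_le_one_le power_le_one mult_le_one del: power_Suc)
  have fi: "integrable M (?f k)" for k
    using nb by (intro integrable_const_bound[of _ "\<bar>h\<bar> ^ k"]) auto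
  have se: "summable (\<lambda>k. \<bar>h\<bar> ^ k)" using h by (intro summable_geometric) auto
  have "(\<lambda>k. integral\<^sup>L M (?f k)) sums (\<integral>l. (\<Sum>k. ?f k l) \<partial>M)"
  proof (rule sums_integral[OF fi])
    show "AE l in M. summable (\<lambda>k. norm (?f k l))"
      using nb by (intro AE_I2 summable_comparison_test'[OF se]) auto
    show "summable (\<lambda>k. \<integral>l. norm (?f k l) \<partial>M)"
    proof (rule summable_comparison_test'[OF se])
      fix k
      have "(\<integral>l. norm (?f k l) \<partial>M) \<le> (\<integral>l. \<bar>h\<bar> ^ k \<partial>M)"
        using nb fi[of k] by (intro integral_mono) auto
      then show "norm (\<integral>l. norm (?f k l) \<partial>M) \<le> \<bar>h\<bar> ^ k" by (simp add: prob_space)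
    qed
  qed
  also have "(\<lambda>l. \<Sum>k. ?f k l) = (\<lambda>l. (1 - tfn (1 - h) l) / (1 - h))"
  proof
    fix l :: real
    define m where "m = max l 0"
    have m: "0 \<le> m" by (simp add: m_def)
    have r: "rfn l = 1 / (1 + m)" by (simp add: rfn_def m_def)
    have "\<bar>rfn l * h\<bar> < 1"
      using rfn_bounds[of l] h by (simp add: abs_mult) (metis abs_ge_zero abs_of_pos mult_left_le_one_le order_le_less_trans less_imp_le)
    then have "(\<lambda>k. rfn l * (rfn l * h) ^ k) sums (rfn l * (1 / (1 - rfn l * h)))"
      by (intro sums_mult geometric_sums) auto
    then have "(\<Sum>k. ?f k l) = rfn l * (1 / (1 - rfn l * h))"
      by (simp add: sums_iff power_mult_distrib mult.assoc)
    also have "\<dots> = 1 / (1 + m - h)"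
      unfolding r using m h by (simp add: field_simps)
    also have "\<dots> = (1 - tfn (1 - h) l) / (1 - h)"
    proof -
      have p: "0 < 1 - h + m" "0 < 1 - h" using m h by auto
      have "1 - m / (1 - h + m) = (1 - h) / (1 - h + m)" using p by (simp add: field_simps)
      moreover have "1 + m - h = 1 - h + m" by simp
      ultimately show ?thesis unfolding tfn_def m_def[symmetric] using p by simp
    qed
    finally show "(\<Sum>k. ?f k l) = (1 - tfn (1 - h) l) / (1 - h)" .
  qed
  also have "(\<integral>l. (1 - tfn (1 - h) l) / (1 - h) \<partial>M) = (1 - gam M (1 - h)) / (1 - h)"
    using h tfn_integrable[of "1 - h"] by (simp add: gam_def prob_space Bochner_Integration.integral_diff)
  finally show ?thesis by simp
qed

text \<open>Equality at the positive rationals extends to all positive reals by continuity. The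
  power series then identifies all moments of \<open>rfn\<close> under the two measures, and
  \<open>rfn\<close> is injective on the half-line that carries them.\<close>

lemma gam_determines:
  assumes \<mu>: "real_distribution \<mu>" and \<nu>: "real_distribution \<nu>"
    and s\<mu>: "measure \<mu> {..<0} = 0" and s\<nu>: "measure \<nu> {..<0} = 0"
    and eq: "\<And>r. r \<in> \<rat> \<Longrightarrow> 0 < r \<Longrightarrow> gam \<mu> r = gam \<nu> r"
  shows "\<mu> = \<nu>"
proof -
  interpret \<mu>: real_distribution \<mu> by fact
  interpret \<nu>: real_distribution \<nu> by fact
  have geq: "gam \<mu> y = gam \<nu> y" if y: "0 < y" for y
  proof -
    have "\<forall>n. \<exists>q. q \<in> \<rat> \<and> y < q \<and> q < y + 1 / real (Suc n)"
    proof
      fix n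
      have "y < y + 1 / real (Suc n)" by simp
      from Rats_dense_in_real[OF this] show "\<exists>q. q \<in> \<rat> \<and> y < q \<and> q < y + 1 / real (Suc n)" by blast
    qed
    then obtain r where r: "\<And>n. r n \<in> \<rat>" "\<And>n. y < r n" "\<And>n. r n < y + 1 / real (Suc n)" by metis
    have lim: "r \<longlonglongrightarrow> y"
    proof (rule tendsto_sandwich[where f = "\<lambda>_. y" and h = "\<lambda>n. y + 1 / real (Suc n)"])
      show "(\<lambda>n. y + 1 / real (Suc n)) \<longlonglongrightarrow> y"
        using tendsto_add[OF tendsto_const LIMSEQ_inverse_real_of_nat, of y] by (simp add: inverse_eq_divide)
      show "\<forall>\<^sub>F n in sequentially. y \<le> r n" "\<forall>\<^sub>F n in sequentially. r n \<le> y + 1 / real (Suc n)"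
        using r by (auto intro!: always_eventually less_imp_le simp del: of_nat_Suc)
    qed auto
    have "(\<lambda>n. gam \<mu> (r n)) \<longlonglongrightarrow> gam \<mu> y" using isCont_tendsto_compose[OF \<mu>.isCont_gam[OF y] lim] .
    moreover have "(\<lambda>n. gam \<nu> (r n)) \<longlonglongrightarrow> gam \<nu> y" using isCont_tendsto_compose[OF \<nu>.isCont_gam[OF y] lim] .
    moreover have "gam \<mu> (r n) = gam \<nu> (r n)" for n using r[of n] y by (intro eq) auto
    ultimately show ?thesis by (simp add: LIMSEQ_unique)
  qed
  have momS: "(\<lambda>k. \<integral>l. rfn l ^ Suc k \<partial>\<mu>) = (\<lambda>k. \<integral>l. rfn l ^ Suc k \<partial>\<nu>)"
  proof (rule power_series_unique)
    show "(\<lambda>k. (\<integral>l. rfn l ^ Suc k \<partial>\<mu>) * h ^ k) sums ((1 - gam \<mu> (1 - h)) / (1 - h))" if "\<bar>h\<bar> < 1" for h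
      by (rule \<mu>.rfn_moment_series[OF that])
    show "(\<lambda>k. (\<integral>l. rfn l ^ Suc k \<partial>\<nu>) * h ^ k) sums ((1 - gam \<mu> (1 - h)) / (1 - h))" if "\<bar>h\<bar> < 1" for h
      using \<nu>.rfn_moment_series[OF that] geq[of "1 - h"] that by simp
  qed
  \<comment> \<open>The series provides the moments from the first on; the zeroth is the total
    mass.\<close>
  have mom: "(\<integral>l. rfn l ^ k \<partial>\<mu>) = (\<integral>l. rfn l ^ k \<partial>\<nu>)" for k
    using fun_cong[OF momS, of "k - 1"] by (cases k) (auto simp: \<mu>.prob_space \<nu>.prob_space)
  have deq: "distr \<mu> borel rfn = distr \<nu> borel rfn"
  proof (rule moments_determine)
    show "real_distribution (distr \<mu> borel rfn)" "real_distribution (distr \<nu> borel rfn)"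
      by (auto intro!: \<mu>.real_distribution_distr \<nu>.real_distribution_distr)
    show "AE t in distr \<mu> borel rfn. \<bar>t\<bar> \<le> 1" "AE t in distr \<nu> borel rfn. \<bar>t\<bar> \<le> 1"
      using rfn_bounds by (auto simp: AE_distr_iff abs_of_pos)
    show "(\<integral>t. t ^ k \<partial>distr \<mu> borel rfn) = (\<integral>t. t ^ k \<partial>distr \<nu> borel rfn)" for k
      using mom by (simp add: integral_distr)
  qed
  define ifn where "ifn u = 1 / u - 1" for u :: real
  have [measurable]: "ifn \<in> borel_measurable borel" unfolding ifn_def by measurable
  have inv: "distr (distr M borel rfn) borel ifn = M" if "real_distribution M" "measure M {..<0} = 0" for M
  proof -
    interpret real_distribution M by fact
    have "{x \<in> space M. \<not> 0 \<le> x} = {..<0}" by auto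
    then have ae: "AE x in M. 0 \<le> x" using that(2) by (intro AE_I[of _ _ "{..<0}"]) (auto simp: emeasure_eq_measure)
    have "distr (distr M borel rfn) borel ifn = distr M borel (ifn \<circ> rfn)"
      by (rule distr_distr) auto
    also have "\<dots> = distr M borel (\<lambda>x. x)"
    proof (rule distr_cong_AE)
      show "AE x in M. (ifn \<circ> rfn) x = x"
        using ae by eventually_elim (simp add: ifn_def rfn_def)
    qed auto
    also have "\<dots> = distr M M (\<lambda>x. x)" by (rule distr_cong) auto
    also have "\<dots> = M" by (rule distr_id)
    finally show ?thesis .
  qed
  have "\<mu> = distr (distr \<mu> borel rfn) borel ifn" by (rule inv[OF \<mu> s\<mu>, symmetric])
  also have "\<dots> = distr (distr \<nu> borel rfn) borel ifn" unfolding deq ..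
  also have "\<dots> = \<nu>" by (rule inv[OF \<nu> s\<nu>])
  finally show ?thesis .
qed

text \<open>Convergence is known only at continuity points of the limit. These are dense, as a
  distribution function has countably many jumps, and monotonicity covers the other negative
  points.\<close>

lemma weak_conv_nonneg_support:
  assumes F: "\<And>n. 0 < n \<Longrightarrow> (\<And>x. x < 0 \<Longrightarrow> F n x = 0)" and M: "real_distribution M" and w: "weak_conv F (cdf M)"
  shows "measure M {..<0} = 0"
proof -
  interpret real_distribution M by fact
  have cdf0: "cdf M x = 0" if x: "x < 0" for x
  proof -
    have "countable {y. \<not> isCont (cdf M) y}"
      using mono_ctble_discont[of "cdf M"] cdf_nondecreasing by (auto simp: mono_def)
    then obtain y where y: "x < y" "y < 0" "isCont (cdf M) y"
      using open_minus_countable[of "{y. \<not> isCont (cdf M) y}" "{x<..<0}"] x by (auto simp: open_greaterThanLessThan)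
    have "(\<lambda>n. F n y) \<longlonglongrightarrow> cdf M y" using w y by (auto simp: weak_conv_def)
    moreover have "(\<lambda>n. F n y) \<longlonglongrightarrow> 0"
      using F y by (intro tendsto_eventually) (auto simp: eventually_sequentially intro!: exI[of _ 1])
    ultimately have "cdf M y = 0" by (rule LIMSEQ_unique)
    moreover have "cdf M x \<le> cdf M y" using y by (intro cdf_nondecreasing) auto
    moreover have "0 \<le> cdf M x" by (simp add: cdf_def)
    ultimately show ?thesis by simp
  qed
  have "{..<0::real} = (\<Union>n. {..- 1 / real (Suc n)})"
  proof safe
    fix x :: real assume "x < 0"
    then obtain n where "inverse (real (Suc n)) < - x" using reals_Archimedean[of "- x"] by auto
    then have "x \<le> - 1 / real (Suc n)" by (simp add: inverse_eq_divide minus_divide_left[symmetric] del: of_nat_Suc)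
    then show "x \<in> (\<Union>n. {..- 1 / real (Suc n)})" by blast
  next
    fix x :: real and n assume "x \<le> - 1 / real (Suc n)"
    moreover have "- 1 / real (Suc n) < 0" by simp
    ultimately show "x < 0" by linarith
  qed
  moreover have "emeasure M (\<Union>n. {..- 1 / real (Suc n)}) = 0"
    using cdf0 by (intro emeasure_UN_eq_0) (auto simp: cdf_def emeasure_eq_measure)
  ultimately show ?thesis by (simp add: emeasure_eq_measure)
qed

text \<open>The function \<open>m\<close> is not known in advance to be the transform of a measure.
  Its small values bound the tails through \<open>tail_le_gam\<close> and so give tightness; every
  subsequential limit has transform \<open>m\<close> at the rationals, and by
  \<open>gam_determines\<close> there is only one.\<close>

lemma gam_convergence_imp_weak:
  assumes \<mu>: "\<And>n. real_distribution (\<mu> n)" and s\<mu>: "\<And>n. measure (\<mu> n) {..<0} = 0"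
    and conv: "\<And>r. r \<in> \<rat> \<Longrightarrow> 0 < r \<Longrightarrow> (\<lambda>n. gam (\<mu> n) r) \<longlonglongrightarrow> m r"
    and small: "\<And>e. 0 < e \<Longrightarrow> \<exists>r\<in>\<rat>. 0 < r \<and> m r < e"
  shows "\<exists>M. real_distribution M \<and> measure M {..<0} = 0 \<and> weak_conv_m \<mu> M \<and> (\<forall>r\<in>\<rat>. 0 < r \<longrightarrow> gam M r = m r)"
proof -
  have tight: "tight \<mu>"
    unfolding tight_def
  proof (intro conjI allI impI \<mu>)
    fix e :: real assume e: "0 < e"
    obtain r where r: "r \<in> \<rat>" "0 < r" "m r < e / 2" using small[of "e / 2"] e by auto
    have "\<forall>\<^sub>F n in sequentially. gam (\<mu> n) r < e / 2" using order_tendstoD(2)[OF conv[OF r(1,2)] r(3)] .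
    then obtain n0 where n0: "\<And>n. n \<ge> n0 \<Longrightarrow> gam (\<mu> n) r < e / 2" by (auto simp: eventually_sequentially)
    have "\<forall>n. \<exists>y>0. gam (\<mu> n) y < e / 2"
      using real_distribution.gam_small[OF \<mu>, of "e / 2"] e by (meson half_gt_zero order_refl)
    then obtain y where y: "\<And>n. 0 < y n" "\<And>n. gam (\<mu> n) (y n) < e / 2" by metis
    \<comment> \<open>One bound for all \<open>n\<close>: \<open>r\<close> serves the indices from
      \<open>n0\<close> on, and each of the finitely many earlier measures brings its own
      \<open>y n\<close>.\<close>
    define b where "b = Max (insert r (y ` {..<n0}))"
    have bb: "gam (\<mu> n) b < e / 2" for n
    proof (cases "n < n0")
      case True
      then have "y n \<le> b" unfolding b_def by (intro Max_ge) auto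
      then show ?thesis using real_distribution.gam_antimono[OF \<mu> y(1)] y(2) by (meson order_le_less_trans)
    next
      case False
      have "r \<le> b" unfolding b_def by (intro Max_ge) auto
      then show ?thesis using real_distribution.gam_antimono[OF \<mu> r(2), of b n] n0[of n] False by (meson not_less order_le_less_trans)
    qed
    have "r \<le> b" unfolding b_def by (intro Max_ge) auto
    then have b: "0 < b" using r by simp
    show "\<exists>a b. a < b \<and> (\<forall>n. 1 - e < measure (\<mu> n) {a<..b})"
    proof (intro exI conjI allI)
      show "-1 < b" using b by simp
      fix n
      interpret real_distribution "\<mu> n" by (rule \<mu>)
      have "measure (\<mu> n) {..-1} \<le> measure (\<mu> n) {..<0}" by (intro finite_measure_mono) auto
      then have 1: "measure (\<mu> n) {..-1} = 0" using s\<mu>[of n] by (simp add: measure_le_0_iff)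
      have 2: "measure (\<mu> n) {b<..} < e" using tail_le_gam[OF b] bb[of n] by linarith
      have "UNIV = {..-1} \<union> {-1<..b} \<union> {b<..}" by auto
      then have "1 \<le> measure (\<mu> n) {..-1} + measure (\<mu> n) {-1<..b} + measure (\<mu> n) {b<..}"
        using measure_Un_le[of "{..-1} \<union> {-1<..b}" "\<mu> n" "{b<..}"] measure_Un_le[of "{..-1}" "\<mu> n" "{-1<..b}"] prob_space by simp
      then show "1 - e < measure (\<mu> n) {-1<..b}" using 1 2 by simp
    qed
  qed
  have sub: "real_distribution \<nu> \<and> measure \<nu> {..<0} = 0 \<and> (\<forall>r\<in>\<rat>. 0 < r \<longrightarrow> gam \<nu> r = m r)"
    if s: "strict_mono s" and \<nu>: "real_distribution \<nu>" and w: "weak_conv_m (\<mu> \<circ> s) \<nu>" for s \<nu>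
  proof (intro conjI ballI impI \<nu>)
    show "measure \<nu> {..<0} = 0"
    proof (rule weak_conv_nonneg_support[OF _ \<nu>])
      show "weak_conv (\<lambda>n. cdf ((\<mu> \<circ> s) n)) (cdf \<nu>)" using w by (simp add: weak_conv_m_def)
      fix n and x :: real assume "x < 0"
      interpret real_distribution "\<mu> (s n)" by (rule \<mu>)
      have "measure (\<mu> (s n)) {..x} \<le> measure (\<mu> (s n)) {..<0}" using \<open>x < 0\<close> by (intro finite_measure_mono) auto
      then show "cdf ((\<mu> \<circ> s) n) x = 0" using s\<mu>[of "s n"] by (simp add: cdf_def measure_le_0_iff)
    qed
    fix r :: real assume r: "r \<in> \<rat>" "0 < r"
    have "(\<lambda>n. gam ((\<mu> \<circ> s) n) r) \<longlonglongrightarrow> gam \<nu> r" by (intro weak_conv_gam \<nu> w r(2)) (auto intro: \<mu>)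
    moreover have "(\<lambda>n. gam ((\<mu> \<circ> s) n) r) \<longlonglongrightarrow> m r"
      using LIMSEQ_subseq_LIMSEQ[OF conv[OF r] s] by (simp add: o_def)
    ultimately show "gam \<nu> r = m r" by (rule LIMSEQ_unique)
  qed
  obtain s M where sM: "strict_mono s" "real_distribution M" "weak_conv_m (\<mu> \<circ> id \<circ> s) M"
    using tight_imp_convergent_subsubsequence[OF tight strict_mono_id] by blast
  then have M: "real_distribution M \<and> measure M {..<0} = 0 \<and> (\<forall>r\<in>\<rat>. 0 < r \<longrightarrow> gam M r = m r)"
    using sub[of s M] by simp
  have "weak_conv_m \<mu> M"
  proof (rule tight_subseq_weak_converge[OF \<mu> sM(2) tight])
    fix s \<nu> assume s: "strict_mono s" and \<nu>: "real_distribution \<nu>" and w: "weak_conv_m (\<mu> \<circ> s) \<nu>"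
    have "\<nu> = M" using sub[OF s \<nu> w] M by (intro gam_determines) auto
    then show "weak_conv_m (\<mu> \<circ> s) M" using w by simp
  qed
  then show ?thesis using M by blast
qed

section \<open>Algebraicity\<close>

text \<open>The difference quotient is estimated directly. Here \<open>d\<close> bounds the distance
  of \<open>z\<close> from the mass of \<open>\<mu>\<close> from below; stating this almost
  everywhere covers negative \<open>z\<close> for measures carried by the half-line as well as
  nonreal \<open>z\<close>.\<close>

lemma stieltjes_derivative:
  assumes \<mu>: "real_distribution \<mu>" and d: "0 < d" "AE x in \<mu>. d \<le> cmod (complex_of_real x - z)"
  shows "stieltjes \<mu> field_differentiable (at z)"
proof -
  interpret real_distribution \<mu> by fact
  have inv_meas [measurable]: "(\<lambda>x. 1 / (complex_of_real x - w)) \<in> borel_measurable \<mu>" for w by measurable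
  have near: "AE x in \<mu>. d / 2 \<le> cmod (complex_of_real x - w)" if "dist w z < d / 2" for w
    using d(2)
  proof eventually_elim
    case (elim x)
    have "cmod (complex_of_real x - z) \<le> cmod (complex_of_real x - w) + cmod (w - z)"
      by (metis diff_add_cancel add_diff_eq norm_triangle_ineq)
    then show ?case using elim that by (simp add: dist_norm)
  qed
  have bnd: "integrable \<mu> (\<lambda>x. 1 / (complex_of_real x - w))" if "dist w z < d / 2" for w
  proof (rule integrable_const_bound)
    show "AE x in \<mu>. cmod (1 / (complex_of_real x - w)) \<le> 2 / d"
      using near[OF that]
    proof eventually_elim
      case (elim x)
      have "0 < cmod (complex_of_real x - w)" using elim d by linarith
      then have "1 / cmod (complex_of_real x - w) \<le> 1 / (d / 2)" using elim d by (intro divide_left_mono mult_pos_pos) auto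
      then show ?case by (simp add: norm_divide)
    qed
  qed measurable
  have zz: "dist z z < d / 2" using d by simp
  have sq: "integrable \<mu> (\<lambda>x. 1 / (complex_of_real x - z)\<^sup>2)"
  proof (rule integrable_const_bound)
    show "AE x in \<mu>. cmod (1 / (complex_of_real x - z)\<^sup>2) \<le> 1 / d\<^sup>2"
      using d(2)
    proof eventually_elim
      case (elim x)
      have "0 < cmod (complex_of_real x - z)" using elim d by linarith
      then have "1 / (cmod (complex_of_real x - z))\<^sup>2 \<le> 1 / d\<^sup>2" using elim d by (intro divide_left_mono power_mono mult_pos_pos) auto
      then show ?case by (simp add: norm_divide norm_power)
    qed
  qed measurable
  let ?D = "\<integral>x. 1 / (complex_of_real x - z)\<^sup>2 \<partial>\<mu>"
  have est: "norm ((stieltjes \<mu> w - stieltjes \<mu> z) / (w - z) - ?D) \<le> norm (w - z) * (2 / d ^ 3)"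
    if w: "dist w z < d / 2" "w \<noteq> z" for w
  proof -
    have nz: "AE x in \<mu>. complex_of_real x - w \<noteq> 0 \<and> complex_of_real x - z \<noteq> 0"
      using near[OF w(1)] d(2) by eventually_elim (use d in auto)
    define q where "q = (\<lambda>x. 1 / (complex_of_real x - w) - 1 / (complex_of_real x - z))"
    define h where "h = (\<lambda>x. q x / (w - z) - 1 / (complex_of_real x - z)\<^sup>2)"
    have q: "integrable \<mu> q"
      unfolding q_def by (rule Bochner_Integration.integrable_diff[OF bnd[OF w(1)] bnd[OF zz]])
    have qw: "integrable \<mu> (\<lambda>x. q x / (w - z))"
      using q by (rule Bochner_Integration.integrable_divide)
    have h: "integrable \<mu> h"
      unfolding h_def using qw sq by (rule Bochner_Integration.integrable_diff)
    have "integral\<^sup>L \<mu> h = integral\<^sup>L \<mu> q / (w - z) - ?D"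
      unfolding h_def Bochner_Integration.integral_diff[OF qw sq] integral_divide_zero ..
    moreover have "integral\<^sup>L \<mu> q = stieltjes \<mu> w - stieltjes \<mu> z"
      unfolding q_def stieltjes_def by (rule Bochner_Integration.integral_diff[OF bnd[OF w(1)] bnd[OF zz]])
    ultimately have "(stieltjes \<mu> w - stieltjes \<mu> z) / (w - z) - ?D = integral\<^sup>L \<mu> h" by (simp only:)
    also have "norm \<dots> \<le> (\<integral>x. norm (h x) \<partial>\<mu>)"
      by (rule integral_norm_bound)
    also have "\<dots> \<le> (\<integral>x. norm (w - z) * (2 / d ^ 3) \<partial>\<mu>)"
    proof (rule integral_mono_AE)
      show "integrable \<mu> (\<lambda>x. norm (h x))" using h by (rule integrable_norm)
      show "AE x in \<mu>. norm (h x) \<le> norm (w - z) * (2 / d ^ 3)"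
        using near[OF w(1)] d(2) nz
      proof eventually_elim
        case (elim x)
        define a where "a = complex_of_real x - w"
        define b where "b = complex_of_real x - z"
        have ab: "a \<noteq> 0" "b \<noteq> 0" "d / 2 \<le> cmod a" "d \<le> cmod b" using elim by (auto simp: a_def b_def)
        have wz: "w - z = b - a" by (simp add: a_def b_def)
        have ba: "b - a \<noteq> 0" using w(2) unfolding wz[symmetric] by simp
        \<comment> \<open>The remainder of the difference quotient in closed form;
          \<open>cmod a \<ge> d / 2\<close> and \<open>cmod b \<ge> d\<close> give the constant
          \<open>2 / d ^ 3\<close>.\<close>
        have "(1 / a - 1 / b) / (b - a) - 1 / b\<^sup>2 = (b - a) / (a * b\<^sup>2)"
        proof -
          have "(1 / a - 1 / b) / (b - a) = 1 / (a * b)" using ab ba by (simp add: field_simps)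
          moreover have "1 / (a * b) - 1 / b\<^sup>2 = (b - a) / (a * b\<^sup>2)" using ab by (simp add: field_simps power2_eq_square)
          ultimately show ?thesis by simp
        qed
        then have "norm ((1 / a - 1 / b) / (w - z) - 1 / b\<^sup>2) = norm (w - z) * (1 / (cmod a * (cmod b)\<^sup>2))"
          unfolding wz by (simp add: norm_divide norm_mult norm_power)
        also have "\<dots> \<le> norm (w - z) * (1 / (d / 2 * d\<^sup>2))"
          using ab d by (intro mult_left_mono divide_left_mono mult_mono power_mono mult_pos_pos) auto
        also have "1 / (d / 2 * d\<^sup>2) = 2 / d ^ 3" by (simp add: power3_eq_cube power2_eq_square)
        finally show ?case unfolding a_def b_def h_def q_def .
      qed
    qed auto
    finally show ?thesis by (simp add: prob_space)
  qed
  have "(stieltjes \<mu> has_field_derivative ?D) (at z)"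
    unfolding has_field_derivative_iff
  proof (rule LIM_zero_cancel, rule Lim_null_comparison)
    show "((\<lambda>w. norm (w - z) * (2 / d ^ 3)) \<longlongrightarrow> 0) (at z)"
      using d(1) by (auto intro!: tendsto_eq_intros)
    show "\<forall>\<^sub>F w in at z. norm ((stieltjes \<mu> w - stieltjes \<mu> z) / (w - z) - ?D) \<le> norm (w - z) * (2 / d ^ 3)"
      unfolding eventually_at
    proof (intro exI[of _ "d / 2"] conjI ballI impI)
      show "0 < d / 2" using d(1) by (rule half_gt_zero)
    qed (use est in blast)
  qed
  then show ?thesis by (auto simp: field_differentiable_def)
qed

lemma AE_nonneg_support:
  assumes \<mu>: "real_distribution \<mu>" and s: "measure \<mu> {..<0} = 0"
  shows "AE x in \<mu>. 0 \<le> x"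
proof -
  interpret real_distribution \<mu> by fact
  show ?thesis using s by (intro AE_I[of _ _ "{..<0}"]) (auto simp: emeasure_eq_measure)
qed

lemma stieltjes_holomorphic_upper:
  assumes \<mu>: "real_distribution \<mu>"
  shows "stieltjes \<mu> holomorphic_on {z. 0 < Im z}"
proof (rule holomorphic_onI, rule field_differentiable_at_within)
  fix z assume "z \<in> {z. 0 < Im z}"
  then show "stieltjes \<mu> field_differentiable at z"
    by (intro stieltjes_derivative[OF \<mu>, of "Im z"] AE_I2) (auto intro: order_trans[OF _ abs_Im_le_cmod])
qed

lemma stieltjes_holomorphic_left:
  assumes \<mu>: "real_distribution \<mu>" and s: "measure \<mu> {..<0} = 0"
  shows "stieltjes \<mu> holomorphic_on {z. Re z < 0}"
proof (rule holomorphic_onI, rule field_differentiable_at_within)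
  fix z assume z: "z \<in> {z. Re z < 0}"
  have "AE x in \<mu>. - Re z \<le> cmod (complex_of_real x - z)"
    using AE_nonneg_support[OF assms]
  proof eventually_elim
    case (elim x)
    then have "- Re z \<le> Re (complex_of_real x - z)" by simp
    then show ?case using complex_Re_le_cmod order_trans by blast
  qed
  then show "stieltjes \<mu> field_differentiable at z"
    using z by (intro stieltjes_derivative[OF \<mu>, of "- Re z"]) auto
qed

lemma stieltjes_neg_real:
  assumes \<mu>: "real_distribution \<mu>" and s: "measure \<mu> {..<0} = 0" and y: "0 < y"
  shows "stieltjes \<mu> (- complex_of_real y) = complex_of_real ((1 - gam \<mu> y) / y)"
proof -
  interpret real_distribution \<mu> by fact
  have "stieltjes \<mu> (- complex_of_real y) = (\<integral>x. complex_of_real ((1 - tfn y x) / y) \<partial>\<mu>)"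
    unfolding stieltjes_def
  proof (rule integral_cong_AE)
    show "AE x in \<mu>. 1 / (complex_of_real x - - complex_of_real y) = complex_of_real ((1 - tfn y x) / y)"
      using AE_nonneg_support[OF \<mu> s]
    proof eventually_elim
      case (elim x)
      have "(1 - tfn y x) / y = 1 / (x + y)" using elim y by (simp add: tfn_def divide_simps)
      then show ?case by simp
    qed
  qed measurable
  also have "\<dots> = complex_of_real (\<integral>x. (1 - tfn y x) / y \<partial>\<mu>)" by (rule integral_complex_of_real)
  also have "(\<integral>x. (1 - tfn y x) / y \<partial>\<mu>) = (1 - gam \<mu> y) / y"
    using tfn_integrable[OF y] by (simp add: gam_def Bochner_Integration.integral_diff)
  finally show ?thesis .
qed

section \<open>Bivariate polynomials and their transformation\<close>

definition ev :: "complex \<Rightarrow> real poly \<Rightarrow> complex" where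
  "ev z p = poly (map_poly complex_of_real p) z"

lemma ev_hom: "comm_ring_hom (ev z)"
proof -
  interpret r: comm_ring_hom complex_of_real by unfold_locales auto
  interpret m: map_poly_comm_ring_hom complex_of_real ..
  show ?thesis by unfold_locales (auto simp: ev_def hom_distribs)
qed

lemma bipoly_ev: "bipoly L m z = poly (map_poly (ev z) L) m"
  unfolding bipoly_def ev_def[abs_def] ..

text \<open>The sum runs up to \<open>degree p\<close> and not up to the degree of the mapped
  polynomial, because evaluation may annihilate leading coefficients.\<close>

lemma poly_map_poly_sum:
  assumes "h 0 = 0"
  shows "poly (map_poly h p) x = (\<Sum>i\<le>degree p. h (coeff p i) * (x :: complex) ^ i)"
proof -
  have "poly (map_poly h p) x = (\<Sum>i\<le>degree (map_poly h p). coeff (map_poly h p) i * x ^ i)"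
    by (rule poly_altdef)
  also have "\<dots> = (\<Sum>i\<le>degree p. coeff (map_poly h p) i * x ^ i)"
    by (intro sum.mono_neutral_left) (auto simp: coeff_eq_0 degree_map_poly_le intro: order_trans)
  finally show ?thesis using assms by (simp add: coeff_map_poly)
qed

lemma ev_sum: "ev z p = (\<Sum>j\<le>degree p. complex_of_real (coeff p j) * z ^ j)"
  unfolding ev_def by (rule poly_map_poly_sum) simp

lemma ev_0 [simp]: "ev z 0 = 0"
  by (simp add: ev_def)

lemma bipoly_sum: "bipoly L m z = (\<Sum>i\<le>degree L. ev z (coeff L i) * m ^ i)"
  unfolding bipoly_ev by (rule poly_map_poly_sum) simp

lemma bipoly_holomorphic:
  assumes "f holomorphic_on S"
  shows "(\<lambda>z. bipoly L (f z) z) holomorphic_on S"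
  unfolding bipoly_sum ev_sum using assms by (intro holomorphic_intros)

lemma bipoly_add: "bipoly (p + q) m z = bipoly p m z + bipoly q m z"
  and bipoly_mult: "bipoly (p * q) m z = bipoly p m z * bipoly q m z"
  and bipoly_0: "bipoly 0 m z = 0"
  and bipoly_1: "bipoly 1 m z = 1"
proof -
  interpret e: comm_ring_hom "ev z" by (rule ev_hom)
  interpret m: map_poly_comm_ring_hom "ev z" ..
  show "bipoly (p + q) m z = bipoly p m z + bipoly q m z"
    "bipoly (p * q) m z = bipoly p m z * bipoly q m z" "bipoly 0 m z = 0" "bipoly 1 m z = 1"
    by (auto simp: bipoly_ev hom_distribs)
qed

lemma bipoly_power: "bipoly (p ^ k) m z = bipoly p m z ^ k"
  by (induction k) (auto simp: bipoly_1 bipoly_mult)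

lemma bipoly_finite_sum: "bipoly (\<Sum>i\<in>I. f i) m z = (\<Sum>i\<in>I. bipoly (f i) m z)"
  by (induction I rule: infinite_finite_induct) (auto simp: bipoly_0 bipoly_add)

lemma bipoly_monom: "bipoly (monom p i) m z = ev z p * m ^ i"
  by (simp add: bipoly_ev map_poly_monom poly_monom)

lemma ev_monom: "ev z (monom a j) = complex_of_real a * z ^ j"
  by (simp add: ev_def map_poly_monom poly_monom)

text \<open>With \<open>u = 1 - c - c z m\<close>, the relation between the two limits is \<open>m\<^sub>A(z / u) = u m\<^sub>B(z)\<close>. The
  power \<open>u ^ d\<close> clears the denominators of \<open>L(u m, z / u)\<close>.\<close>

definition mp_poly :: "real \<Rightarrow> real poly poly \<Rightarrow> real poly poly" where
  "mp_poly c L = (let d = Max ((\<lambda>i. degree (coeff L i)) ` {..degree L}) in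
     \<Sum>i\<le>degree L. \<Sum>j\<le>degree (coeff L i). monom (monom (coeff (coeff L i) j) j) i * [:[:1 - c:], [:0, - c:]:] ^ (i + d - j))"

lemma bipoly_mp_poly:
  assumes u: "u = 1 - complex_of_real c - complex_of_real c * m * z" "u \<noteq> 0"
  shows "\<exists>k. bipoly (mp_poly c L) m z = u ^ k * bipoly L (m * u) (z / u)"
proof -
  define d where "d = Max ((\<lambda>i. degree (coeff L i)) ` {..degree L})"
  have d: "degree (coeff L i) \<le> d" if "i \<le> degree L" for i
    unfolding d_def using that by (intro Max_ge) auto
  have U: "bipoly [:[:1 - c:], [:0, - c:]:] m z = u"
  proof -
    interpret e: comm_ring_hom "ev z" by (rule ev_hom)
    have "[:[:1 - c:], [:0, - c:]:] = monom (monom (1 - c) 0) 0 + monom (monom (- c) 1) 1"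
      by (simp add: monom_altdef)
    then show ?thesis unfolding u(1) by (simp add: bipoly_add bipoly_monom ev_monom algebra_simps)
  qed
  have "bipoly (mp_poly c L) m z = (\<Sum>i\<le>degree L. \<Sum>j\<le>degree (coeff L i). complex_of_real (coeff (coeff L i) j) * z ^ j * m ^ i * u ^ (i + d - j))"
    unfolding mp_poly_def Let_def d_def[symmetric] bipoly_finite_sum bipoly_mult bipoly_power U bipoly_monom ev_monom by simp
  also have "\<dots> = (\<Sum>i\<le>degree L. \<Sum>j\<le>degree (coeff L i). u ^ d * (complex_of_real (coeff (coeff L i) j) * (z / u) ^ j * (m * u) ^ i))"
  proof (intro sum.cong refl)
    fix i j assume "i \<in> {..degree L}" "j \<in> {..degree (coeff L i)}"
    then have "j \<le> d" using d[of i] by auto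
    \<comment> \<open>The subtraction of natural numbers is exact because
      \<open>j \<le> d\<close>.\<close>
    then have "u ^ (i + d - j) * u ^ j = u ^ d * u ^ i" by (simp add: power_add[symmetric] add.commute)
    then have "u ^ (i + d - j) = u ^ d * u ^ i / u ^ j" using u(2) by (simp add: field_simps)
    then show "complex_of_real (coeff (coeff L i) j) * z ^ j * m ^ i * u ^ (i + d - j) =
        u ^ d * (complex_of_real (coeff (coeff L i) j) * (z / u) ^ j * (m * u) ^ i)"
      by (simp add: power_divide power_mult_distrib)
  qed
  also have "\<dots> = u ^ d * bipoly L (m * u) (z / u)"
    by (simp add: bipoly_sum ev_sum sum_distrib_left sum_distrib_right mult_ac)
  finally show ?thesis by blast
qed

text \<open>The substitution is invertible: for \<open>w = 1 - c - c * m * z \<noteq> 0\<close> the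
  point \<open>(m / w, z * w)\<close> is sent to \<open>(m, z)\<close>, because the product of the
  coordinates is preserved. If \<open>mp_poly c L\<close> vanished, so would \<open>L\<close> off
  the curve \<open>w = 0\<close>, and then all its coefficients would be zero.\<close>

lemma mp_poly_nonzero:
  assumes L: "L \<noteq> 0"
  shows "mp_poly c L \<noteq> 0"
proof
  assume P: "mp_poly c L = 0"
  have zero: "bipoly L m z = 0" if ne: "1 - complex_of_real c - complex_of_real c * m * z \<noteq> 0" for m z
  proof -
    define w where "w = 1 - complex_of_real c - complex_of_real c * m * z"
    have w: "w \<noteq> 0" using ne by (simp add: w_def)
    have "w = 1 - complex_of_real c - complex_of_real c * (m / w) * (z * w)"
      using w by (simp add: w_def)
    from bipoly_mp_poly[OF this w, of L] obtain k where "0 = w ^ k * bipoly L (m / w * w) (z * w / w)"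
      unfolding P bipoly_0 by auto
    then show ?thesis using w by simp
  qed
  have "coeff L i = 0" for i
  proof (rule ccontr)
    assume nz: "coeff L i \<noteq> 0"
    have "ev (complex_of_real x) (coeff L i) = 0" if x: "x \<noteq> 0" for x
    proof -
      let ?z = "complex_of_real x"
      \<comment> \<open>For fixed nonzero real \<open>z\<close>, only a single value of
        \<open>m\<close> has to be left out.\<close>
      have "infinite (UNIV - {(1 - complex_of_real c) / (complex_of_real c * ?z)})"
        by (simp add: infinite_UNIV_char_0)
      moreover have "UNIV - {(1 - complex_of_real c) / (complex_of_real c * ?z)} \<subseteq> {m. poly (map_poly (ev ?z) L) m = 0}"
      proof
        fix m assume "m \<in> UNIV - {(1 - complex_of_real c) / (complex_of_real c * ?z)}"
        then have m: "m \<noteq> (1 - complex_of_real c) / (complex_of_real c * ?z)" by simp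
        have "1 - complex_of_real c - complex_of_real c * m * ?z \<noteq> 0"
        proof (cases "c = 0")
          case False
          then show ?thesis using m x by (simp add: field_simps)
        qed simp
        then show "m \<in> {m. poly (map_poly (ev ?z) L) m = 0}" using zero by (simp add: bipoly_ev)
      qed
      ultimately have "map_poly (ev ?z) L = 0"
        using poly_roots_finite[of "map_poly (ev ?z) L"] by (metis Diff_empty finite_subset)
      then have "coeff (map_poly (ev ?z) L) i = 0" by simp
      then show ?thesis by (simp add: coeff_map_poly)
    qed
    then have r: "poly (coeff L i) x = 0" if "x \<noteq> 0" for x
    proof -
      have "complex_of_real (poly (coeff L i) x) = ev (complex_of_real x) (coeff L i)"
        unfolding ev_sum by (simp add: poly_altdef)
      also have "\<dots> = 0" using \<open>\<And>x. x \<noteq> 0 \<Longrightarrow> ev (complex_of_real x) (coeff L i) = 0\<close> that by blast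
      finally show ?thesis by simp
    qed
    have "infinite (UNIV - {0 :: real})" by (simp add: infinite_UNIV_char_0)
    moreover have "UNIV - {0} \<subseteq> {x. poly (coeff L i) x = 0}" using r by auto
    ultimately show False using poly_roots_finite[OF nz] finite_subset by blast
  qed
  then show False using L by (simp add: poly_eq_iff)
qed

text \<open>The upper half plane, where algebraicity is stated, contains no negative reals. Both
  Stieltjes transforms are also holomorphic on \<open>{z. Re z < 0}\<close>, which shares an open
  quadrant with the upper half plane, and the polynomial relations are continued through this
  quadrant: for \<open>FA\<close> to the left, for \<open>FB\<close> back.\<close>

lemma algebraic_transfer:
  assumes FA: "FA \<in> algebraic_distributions" and FB: "real_distribution FB"
    and sA: "measure FA {..<0} = 0" and sB: "measure FB {..<0} = 0"
    and rel: "\<And>r. r \<in> \<rat> \<Longrightarrow> 0 < r \<Longrightarrow> 0 < 1 - c * gam FB r \<and> gam FA (r / (1 - c * gam FB r)) = gam FB r"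
  shows "FB \<in> algebraic_distributions"
proof -
  obtain L where FA': "real_distribution FA" and L: "L \<noteq> 0" "\<And>z. 0 < Im z \<Longrightarrow> bipoly L (stieltjes FA z) z = 0"
    using FA by (auto simp: algebraic_distributions_def)
  have op: "open {z. Re z < 0}" "open {z. 0 < Im z}" "open ({z. Re z < 0} \<inter> {z. 0 < Im z})"
    by (auto intro!: open_Int open_halfspace_Re_lt open_halfspace_Im_gt)
  have cn: "connected {z. Re z < 0}" "connected {z. 0 < Im z}"
    by (auto intro!: convex_connected convex_halfspace_Re_lt convex_halfspace_Im_gt)
  have ne: "{z. Re z < 0} \<inter> {z. 0 < Im z} \<noteq> {}"
  proof -
    have "Complex (-1) 1 \<in> {z. Re z < 0} \<inter> {z. 0 < Im z}" by simp
    then show ?thesis by blast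
  qed
  have left: "bipoly L (stieltjes FA z) z = 0" if z: "Re z < 0" for z
  proof (rule analytic_continuation_open[of "{z. Re z < 0} \<inter> {z. 0 < Im z}" "{z. Re z < 0}" "\<lambda>z. bipoly L (stieltjes FA z) z" "\<lambda>_. 0"])
    show "(\<lambda>z. bipoly L (stieltjes FA z) z) holomorphic_on {z. Re z < 0}"
      by (intro bipoly_holomorphic stieltjes_holomorphic_left FA' sA)
  qed (use op cn ne L z in auto)
  define P where "P = mp_poly c L"
  have rat0: "bipoly P (stieltjes FB (- complex_of_real r)) (- complex_of_real r) = 0" if r: "r \<in> \<rat>" "0 < r" for r
  proof -
    define v where "v = 1 - c * gam FB r"
    have v: "0 < v" "gam FA (r / v) = gam FB r" using rel[OF r] by (auto simp: v_def)
    define s where "s = (1 - gam FB r) / r"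
    have sB': "stieltjes FB (- complex_of_real r) = complex_of_real s"
      unfolding s_def by (rule stieltjes_neg_real[OF FB sB r(2)])
    have "stieltjes FA (- complex_of_real (r / v)) = complex_of_real ((1 - gam FA (r / v)) / (r / v))"
      using v r by (intro stieltjes_neg_real[OF FA' sA]) auto
    also have "(1 - gam FA (r / v)) / (r / v) = s * v" using v r by (simp add: s_def)
    finally have sA': "stieltjes FA (- complex_of_real (r / v)) = complex_of_real (s * v)" .
    \<comment> \<open>At \<open>z = - r\<close> and \<open>m = s\<close>, where
      \<open>s * r = 1 - gam FB r\<close>, the factor \<open>u = 1 - c - c z m\<close> becomes
      \<open>1 - c * gam FB r\<close>, which is \<open>v\<close>.\<close>
    have u: "complex_of_real v = 1 - complex_of_real c - complex_of_real c * complex_of_real s * (- complex_of_real r)"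
    proof -
      have "s * r = 1 - gam FB r" using r by (simp add: s_def)
      then have "c * (s * r) = c * (1 - gam FB r)" by simp
      then have "v = 1 - c - c * s * (- r)" by (simp add: v_def algebra_simps)
      then show ?thesis by (metis of_real_1 of_real_diff of_real_minus of_real_mult)
    qed
    obtain k where "bipoly P (complex_of_real s) (- complex_of_real r) =
        complex_of_real v ^ k * bipoly L (complex_of_real s * complex_of_real v) (- complex_of_real r / complex_of_real v)"
      using bipoly_mp_poly[OF u, of L] v by (auto simp: P_def)
    also have "bipoly L (complex_of_real s * complex_of_real v) (- complex_of_real r / complex_of_real v) =
        bipoly L (stieltjes FA (- complex_of_real (r / v))) (- complex_of_real (r / v))"
      unfolding sA' by simp
    also have "\<dots> = 0" using v r by (intro left) simp
    finally show ?thesis unfolding sB' by simp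
  qed
  have leftB: "bipoly P (stieltjes FB z) z = 0" if z: "Re z < 0" for z
  proof (rule analytic_continuation[of "\<lambda>z. bipoly P (stieltjes FB z) z" "{z. Re z < 0}" "(\<lambda>r. - complex_of_real r) ` {r \<in> \<rat>. 0 < r}" "-1"])
    show "(\<lambda>z. bipoly P (stieltjes FB z) z) holomorphic_on {z. Re z < 0}"
      by (intro bipoly_holomorphic stieltjes_holomorphic_left FB sB)
    \<comment> \<open>The identity theorem asks for an accumulation point inside the domain;
      \<open>1 + 1 / (n + 1)\<close> is a rational sequence that provides it.\<close>
    show "- 1 islimpt (\<lambda>r. - complex_of_real r) ` {r \<in> \<rat>. 0 < r}"
      unfolding islimpt_sequential
    proof (intro exI[of _ "\<lambda>n. - complex_of_real (1 + 1 / real (Suc n))"] conjI allI)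
      fix n
      have "1 + 1 / real (Suc n) \<noteq> 1" by simp
      then have "complex_of_real (1 + 1 / real (Suc n)) \<noteq> 1" by (metis of_real_1 of_real_eq_iff)
      then have "- complex_of_real (1 + 1 / real (Suc n)) \<noteq> - 1" by (metis minus_minus)
      moreover have "1 + 1 / real (Suc n) \<in> {r \<in> \<rat>. 0 < r}"
        by (auto intro!: Rats_add Rats_divide Rats_of_nat add_pos_pos simp del: of_nat_Suc)
      ultimately show "- complex_of_real (1 + 1 / real (Suc n)) \<in> (\<lambda>r. - complex_of_real r) ` {r \<in> \<rat>. 0 < r} - {- 1}"
        by blast
    next
      have "(\<lambda>n. 1 + 1 / real (Suc n)) \<longlonglongrightarrow> 1"
        using tendsto_add[OF tendsto_const LIMSEQ_inverse_real_of_nat, of 1] by (simp add: inverse_eq_divide)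
      from tendsto_minus[OF tendsto_of_real[OF this]]
      show "(\<lambda>n. - complex_of_real (1 + 1 / real (Suc n))) \<longlonglongrightarrow> - 1" by (simp only: of_real_1)
    qed
  qed (use op cn z rat0 in auto)
  have up: "bipoly P (stieltjes FB z) z = 0" if z: "0 < Im z" for z
  proof (rule analytic_continuation_open[of "{z. Re z < 0} \<inter> {z. 0 < Im z}" "{z. 0 < Im z}" "\<lambda>z. bipoly P (stieltjes FB z) z" "\<lambda>_. 0"])
    show "(\<lambda>z. bipoly P (stieltjes FB z) z) holomorphic_on {z. 0 < Im z}"
      by (intro bipoly_holomorphic stieltjes_holomorphic_upper FB)
  qed (use op cn ne leftB z in auto)
  have "P \<noteq> 0" unfolding P_def by (rule mp_poly_nonzero[OF L(1)])
  then show ?thesis using up FB by (auto simp: algebraic_distributions_def)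
qed

section \<open>Concentration for Wishart-like matrices\<close>

lemma unit_variable_distr:
  fixes X :: "'w \<Rightarrow> complex"
  assumes P: "prob_space P" and X: "X \<in> borel_measurable P"
    and i: "integrable P (\<lambda>w. cmod (X w))" "integrable P (\<lambda>w. (cmod (X w))\<^sup>2)" "integrable P (\<lambda>w. cmod (X w) ^ 4)"
    and m: "(\<integral>w. X w \<partial>P) = 0" "(\<integral>w. (cmod (X w))\<^sup>2 \<partial>P) = 1" "(\<integral>w. cmod (X w) ^ 4 \<partial>P) \<le> C"
  shows "unit_variable (distr P borel X) C"
proof -
  interpret prob_space P by fact
  interpret D: prob_space "distr P borel X" using X by (rule prob_space_distr)
  show ?thesis
  proof
    show "sets (distr P borel X) = sets borel" by simp
    have iX: "integrable P X" using i(1) X by (rule integrable_norm_cancel)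
    show "integrable (distr P borel X) (\<lambda>z. z)" by (subst integrable_distr_eq[OF X]) (use iX in auto)
    show "integrable (distr P borel X) (\<lambda>z. (cmod z)\<^sup>2)" by (subst integrable_distr_eq[OF X]) (use i(2) in auto)
    show "integrable (distr P borel X) (\<lambda>z. cmod z ^ 4)" by (subst integrable_distr_eq[OF X]) (use i(3) in auto)
    show "(\<integral>z. z \<partial>distr P borel X) = 0" unfolding integral_distr[OF X measurable_ident_sets[OF refl]] by (rule m)
    show "(\<integral>z. (cmod z)\<^sup>2 \<partial>distr P borel X) = 1" by (subst integral_distr[OF X]) (measurable, rule m)
    show "(\<integral>z. cmod z ^ 4 \<partial>distr P borel X) \<le> C" by (subst integral_distr[OF X]) (measurable, rule m)
  qed
qed

lemma column_model_iid:
  assumes "N > 0" "L > 0" "unit_variable \<nu> C"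
  shows "column_model N L (\<lambda>_. PiM {..<N} (\<lambda>_. \<nu>)) (3 * (C + 1))"
proof -
  interpret unit_variables "\<lambda>_. \<nu>" C by (rule unit_variables.intro) (rule assms(3))
  show ?thesis
  proof (rule column_model.intro)
    show "prob_space (PiM {..<N} (\<lambda>_. \<nu>))" by (intro prob_space_PiM prob)
    show "sets (PiM {..<N} (\<lambda>_. \<nu>)) = sets (PiM {..<N} (\<lambda>_. borel))" by (intro sets_PiM_cong refl sets_\<nu>)
    show "integrable (PiM {..<N} (\<lambda>_. \<nu>)) (centred_form {..<N} M)" for M by (rule integrable_centred_form) simp
    show "integral\<^sup>L (PiM {..<N} (\<lambda>_. \<nu>)) (centred_form {..<N} M) = 0" for M by (rule integral_centred_form) simp
    show "(\<integral>\<^sup>+y. ennreal ((cmod (centred_form {..<N} M y))\<^sup>2) \<partial>PiM {..<N} (\<lambda>_. \<nu>)) \<le>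
      ennreal (3 * (C + 1) * (\<Sum>i<N. \<Sum>k<N. (cmod (M i k))\<^sup>2))" for M
      by (rule centred_form_second_moment) simp
    show "0 \<le> 3 * (C + 1)" using C4_nonneg by simp
  qed (rule assms)+
qed

text \<open>Disjoint blocks of independent variables are independent, so the columns are; the law of
  one column is obtained from the joint product law of the entries by reindexing.\<close>

lemma (in prob_space) distr_columns:
  fixes X :: "nat \<times> nat \<Rightarrow> 'a \<Rightarrow> complex"
  assumes ind: "indep_vars (\<lambda>_. borel) X ({..<N} \<times> {..<L})" and N: "N > 0" and L: "L > 0"
    and law: "\<And>p. p \<in> {..<N} \<times> {..<L} \<Longrightarrow> distr M borel (X p) = \<nu>"
  shows "distr M (PiM {..<L} (\<lambda>_. PiM {..<N} (\<lambda>_. borel))) (\<lambda>\<omega>. \<lambda>j\<in>{..<L}. \<lambda>i\<in>{..<N}. X (i, j) \<omega>) =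
    PiM {..<L} (\<lambda>_. PiM {..<N} (\<lambda>_. \<nu>))"
proof -
  let ?I = "{..<N} \<times> {..<L}"
  have rv: "random_variable borel (X p)" if "p \<in> ?I" for p
    using ind that by (auto simp: indep_vars_def)
  have "(0, 0) \<in> ?I" using N L by simp
  then have \<nu>: "prob_space \<nu>" using rv law by (metis prob_space_distr)
  have joint: "distr M (PiM ?I (\<lambda>_. borel)) (\<lambda>\<omega>. \<lambda>p\<in>?I. X p \<omega>) = PiM ?I (\<lambda>_. \<nu>)"
  proof -
    have "distr M (PiM ?I (\<lambda>_. borel)) (\<lambda>\<omega>. \<lambda>p\<in>?I. X p \<omega>) = PiM ?I (\<lambda>p. distr M borel (X p))"
      using ind rv \<open>(0, 0) \<in> ?I\<close> by (subst indep_vars_iff_distr_eq_PiM'[symmetric]) auto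
    also have "\<dots> = PiM ?I (\<lambda>_. \<nu>)" using law by (intro PiM_cong) auto
    finally show ?thesis .
  qed
  have sets\<nu>: "sets \<nu> = sets borel" using law[OF \<open>(0, 0) \<in> ?I\<close>] by auto
  define Z where "Z = (\<lambda>j \<omega>. \<lambda>i\<in>{..<N}. X (i, j) \<omega>)"
  have Zlaw: "distr M (PiM {..<N} (\<lambda>_. borel)) (Z j) = PiM {..<N} (\<lambda>_. \<nu>)" if j: "j < L" for j
  proof -
    have "distr M (PiM {..<N} (\<lambda>_. borel)) (Z j) =
        distr M (PiM {..<N} (\<lambda>_. borel)) ((\<lambda>g. \<lambda>i\<in>{..<N}. g (i, j)) \<circ> (\<lambda>\<omega>. \<lambda>p\<in>?I. X p \<omega>))"
      using j by (intro arg_cong[where f = "distr M _"]) (auto simp: Z_def fun_eq_iff restrict_def)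
    also have "\<dots> = distr (distr M (PiM ?I (\<lambda>_. borel)) (\<lambda>\<omega>. \<lambda>p\<in>?I. X p \<omega>)) (PiM {..<N} (\<lambda>_. borel)) (\<lambda>g. \<lambda>i\<in>{..<N}. g (i, j))"
      using j rv by (intro distr_distr[symmetric] measurable_restrict measurable_component_singleton) auto
    also have "\<dots> = distr (PiM ?I (\<lambda>_. \<nu>)) (PiM {..<N} (\<lambda>_. \<nu>)) (\<lambda>g. \<lambda>i\<in>{..<N}. g (i, j))"
      unfolding joint using sets\<nu> by (intro distr_cong sets_PiM_cong) auto
    also have "\<dots> = PiM {..<N} (\<lambda>_. \<nu>)"
      using j \<nu> by (intro distr_PiM_reindex) (auto simp: inj_on_def)
    finally show ?thesis .
  qed
  have "indep_vars (\<lambda>j. PiM ({..<N} \<times> {j}) (\<lambda>_. borel)) (\<lambda>j \<omega>. restrict (\<lambda>p. X p \<omega>) ({..<N} \<times> {j})) {..<L}"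
    by (rule indep_vars_restrict[OF ind]) (auto simp: disjoint_family_on_def)
  then have "indep_vars (\<lambda>_. PiM {..<N} (\<lambda>_. borel)) (\<lambda>j \<omega>. (\<lambda>g. \<lambda>i\<in>{..<N}. g (i, j)) (restrict (\<lambda>p. X p \<omega>) ({..<N} \<times> {j}))) {..<L}"
    by (rule indep_vars_compose2) (intro measurable_restrict measurable_component_singleton, auto)
  moreover have "(\<lambda>j \<omega>. (\<lambda>g. \<lambda>i\<in>{..<N}. g (i, j)) (restrict (\<lambda>p. X p \<omega>) ({..<N} \<times> {j}))) = Z"
    by (auto simp: Z_def fun_eq_iff restrict_def)
  ultimately have iZ: "indep_vars (\<lambda>_. PiM {..<N} (\<lambda>_. borel)) Z {..<L}" by (simp only:)
  then have rvZ: "random_variable (PiM {..<N} (\<lambda>_. borel)) (Z j)" if "j \<in> {..<L}" for j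
    using that by (auto simp: indep_vars_def)
  have "distr M (PiM {..<L} (\<lambda>_. PiM {..<N} (\<lambda>_. borel))) (\<lambda>\<omega>. \<lambda>j\<in>{..<L}. Z j \<omega>) =
      PiM {..<L} (\<lambda>j. distr M (PiM {..<N} (\<lambda>_. borel)) (Z j))"
    using iZ rvZ L by (subst indep_vars_iff_distr_eq_PiM'[symmetric]) auto
  also have "\<dots> = PiM {..<L} (\<lambda>_. PiM {..<N} (\<lambda>_. \<nu>))" using Zlaw by (intro PiM_cong) auto
  finally show ?thesis unfolding Z_def .
qed

context column_model
begin

text \<open>By independence the law of \<open>(A, W)\<close> is a product, and Fubini reduces the
  claim to a fixed value \<open>a\<close> of \<open>A\<close>. There
  \<open>tr_rsv_concentration\<close> applies, with a bound that does not depend on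
  \<open>a\<close>.\<close>

lemma joint_concentration:
  fixes A W :: "'w \<Rightarrow> complex mat"
  assumes P: "prob_space P"
    and ind: "prob_space.indep_var P (mat_borel N N) A (mat_borel N N) W"
    and law: "distr P (mat_borel N N) W = distr PP (mat_borel N N) (WW {..<L})"
    and hA: "\<And>\<omega>. \<omega> \<in> space P \<Longrightarrow> hnd N (A \<omega>)" and x: "x > 0" and \<epsilon>: "\<epsilon> > 0"
  shows "{\<omega> \<in> space P. \<epsilon> \<le> \<bar>Re (mtrace (rsv N x (A \<omega>) (W \<omega>))) - integral\<^sup>L PP (tr_rsv x (A \<omega>))\<bar>} \<in> sets P"
    "emeasure P {\<omega> \<in> space P. \<epsilon> \<le> \<bar>Re (mtrace (rsv N x (A \<omega>) (W \<omega>))) - integral\<^sup>L PP (tr_rsv x (A \<omega>))\<bar>}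
      \<le> ennreal (2 * exp (- (\<epsilon> * x)\<^sup>2 / (2 * real L)))"
proof -
  interpret Pr: prob_space P by fact
  let ?B = "mat_borel N N"
  define \<mu> where "\<mu> = distr P ?B W"
  have A: "A \<in> P \<rightarrow>\<^sub>M ?B" and W: "W \<in> P \<rightarrow>\<^sub>M ?B"
    and prod: "distr P (?B \<Otimes>\<^sub>M ?B) (\<lambda>\<omega>. (A \<omega>, W \<omega>)) = distr P ?B A \<Otimes>\<^sub>M \<mu>"
    using ind unfolding Pr.indep_var_distribution_eq \<mu>_def by auto
  have WWm: "WW {..<L} \<in> PP \<rightarrow>\<^sub>M ?B" unfolding mat_measurable_iff by (rule WW_measurable) simp
  interpret \<mu>: prob_space \<mu> unfolding \<mu>_def using W by (rule Pr.prob_space_distr)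
  have sets\<mu>: "sets \<mu> = sets ?B" by (simp add: \<mu>_def)
  define f where "f p = Re (mtrace (rsv N x (fst p) (snd p)))" for p :: "complex mat \<times> complex mat"
  have fm: "f \<in> borel_measurable (?B \<Otimes>\<^sub>M ?B)"
  proof -
    have "mat_measurable (?B \<Otimes>\<^sub>M ?B) N N fst" "mat_measurable (?B \<Otimes>\<^sub>M ?B) N N snd"
      by (simp_all add: mat_measurable_iff[symmetric])
    from mtrace_measurable[OF mat_measurable_rsv[OF this, of x]] show ?thesis
      unfolding f_def by measurable
  qed
  have fm' [measurable]: "f \<in> borel_measurable (?B \<Otimes>\<^sub>M \<mu>)"
    using fm by (simp add: measurable_cong_sets[OF sets_pair_measure_cong[OF refl sets\<mu>] refl])
  have e: "(\<integral>w. f (a, w) \<partial>\<mu>) = integral\<^sup>L PP (tr_rsv x a)" if a: "a \<in> space ?B" for a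
  proof -
    have "(\<lambda>w. f (a, w)) \<in> borel_measurable ?B" using measurable_Pair2[OF fm a] .
    from integral_distr[OF WWm this] show ?thesis
      unfolding \<mu>_def law by (simp add: f_def tr_rsv_def[abs_def])
  qed
  define g where "g a = (\<integral>w. f (a, w) \<partial>\<mu>)" for a
  have gm [measurable]: "g \<in> borel_measurable ?B"
    unfolding g_def using fm' by (intro \<mu>.borel_measurable_lebesgue_integral) simp
  define S where "S = {p \<in> space (?B \<Otimes>\<^sub>M ?B). \<epsilon> \<le> \<bar>f p - g (fst p)\<bar>}"
  have S: "S \<in> sets (?B \<Otimes>\<^sub>M ?B)" unfolding S_def using fm gm by measurable
  have AW: "(\<lambda>\<omega>. (A \<omega>, W \<omega>)) \<in> P \<rightarrow>\<^sub>M ?B \<Otimes>\<^sub>M ?B" using A W by (rule measurable_Pair)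
  have eq: "{\<omega> \<in> space P. \<epsilon> \<le> \<bar>Re (mtrace (rsv N x (A \<omega>) (W \<omega>))) - integral\<^sup>L PP (tr_rsv x (A \<omega>))\<bar>} =
      (\<lambda>\<omega>. (A \<omega>, W \<omega>)) -` S \<inter> space P"
  proof -
    have "Re (mtrace (rsv N x (A \<omega>) (W \<omega>))) - integral\<^sup>L PP (tr_rsv x (A \<omega>)) = f (A \<omega>, W \<omega>) - g (A \<omega>)"
      if "\<omega> \<in> space P" for \<omega>
      using e[OF measurable_space[OF A that]] by (simp add: f_def g_def)
    moreover have "(A \<omega>, W \<omega>) \<in> space (?B \<Otimes>\<^sub>M ?B)" if "\<omega> \<in> space P" for \<omega>
      using measurable_space[OF AW that] .
    ultimately show ?thesis by (auto simp: S_def)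
  qed
  show "{\<omega> \<in> space P. \<epsilon> \<le> \<bar>Re (mtrace (rsv N x (A \<omega>) (W \<omega>))) - integral\<^sup>L PP (tr_rsv x (A \<omega>))\<bar>} \<in> sets P"
    unfolding eq using AW S by (rule measurable_sets)
  have sec: "emeasure \<mu> (Pair a -` S) \<le> ennreal (2 * exp (- (\<epsilon> * x)\<^sup>2 / (2 * real L)))"
    if a: "a \<in> space ?B" "hnd N a" for a
  proof -
    have "Pair a -` S \<in> sets ?B" using S by (rule sets_Pair1)
    then have "emeasure \<mu> (Pair a -` S) = emeasure PP (WW {..<L} -` (Pair a -` S) \<inter> space PP)"
      unfolding \<mu>_def law using WWm by (intro emeasure_distr) auto
    also have "WW {..<L} -` (Pair a -` S) \<inter> space PP = {C \<in> space PP. \<epsilon> \<le> \<bar>tr_rsv x a C - integral\<^sup>L PP (tr_rsv x a)\<bar>}"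
    proof -
      have "(a, WW {..<L} C) \<in> space (?B \<Otimes>\<^sub>M ?B)" if "C \<in> space PP" for C
        using a(1) measurable_space[OF WWm that] by (simp add: space_pair_measure)
      then show ?thesis using e[OF a(1)] by (auto simp: S_def f_def g_def tr_rsv_def)
    qed
    also have "emeasure PP \<dots> \<le> ennreal (2 * exp (- (\<epsilon> * x)\<^sup>2 / (2 * real L)))"
      using x a(2) \<epsilon> by (rule tr_rsv_concentration)
    finally show ?thesis .
  qed
  have "sets (?B \<Otimes>\<^sub>M \<mu>) = sets (?B \<Otimes>\<^sub>M ?B)" by (intro sets_pair_measure_cong refl sets\<mu>)
  with S have S': "S \<in> sets (?B \<Otimes>\<^sub>M \<mu>)" by (simp only:)
  have "sets (distr P ?B A \<Otimes>\<^sub>M \<mu>) = sets (?B \<Otimes>\<^sub>M ?B)" by (intro sets_pair_measure_cong sets_distr sets\<mu>)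
  with S have S'': "S \<in> sets (distr P ?B A \<Otimes>\<^sub>M \<mu>)" by (simp only:)
  have "emeasure P ((\<lambda>\<omega>. (A \<omega>, W \<omega>)) -` S \<inter> space P) = emeasure (distr P ?B A \<Otimes>\<^sub>M \<mu>) S"
    unfolding prod[symmetric] using AW S by (rule emeasure_distr[symmetric])
  also have "\<dots> = (\<integral>\<^sup>+a. emeasure \<mu> (Pair a -` S) \<partial>distr P ?B A)"
    using S'' by (rule \<mu>.emeasure_pair_measure_alt)
  \<comment> \<open>The integral is moved back to \<open>P\<close> because the space of
    \<open>mat_borel\<close> also contains matrices that are not nonnegative definite, whereas every
    \<open>A \<omega>\<close> is.\<close>
  also have "\<dots> = (\<integral>\<^sup>+\<omega>. emeasure \<mu> (Pair (A \<omega>) -` S) \<partial>P)"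
    using A S' by (intro nn_integral_distr \<mu>.measurable_emeasure_Pair) auto
  also have "\<dots> \<le> (\<integral>\<^sup>+\<omega>. ennreal (2 * exp (- (\<epsilon> * x)\<^sup>2 / (2 * real L))) \<partial>P)"
    using hA measurable_space[OF A] by (intro nn_integral_mono sec) auto
  also have "\<dots> = ennreal (2 * exp (- (\<epsilon> * x)\<^sup>2 / (2 * real L)))" by (simp add: Pr.emeasure_space_1)
  finally show "emeasure P {\<omega> \<in> space P. \<epsilon> \<le> \<bar>Re (mtrace (rsv N x (A \<omega>) (W \<omega>))) - integral\<^sup>L PP (tr_rsv x (A \<omega>))\<bar>}
      \<le> ennreal (2 * exp (- (\<epsilon> * x)\<^sup>2 / (2 * real L)))"
    unfolding eq .
qed

end

text \<open>This transfers \<open>W\<close> to the product space of columns on which the estimates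
  were made; apart from nonnegativity, only its law enters the probability bounds.\<close>

lemma (in prob_space) wishart_law:
  fixes Y :: "'a \<Rightarrow> complex mat"
  assumes N: "N > 0" and L: "L > 0" and Y: "mat_measurable M N L Y"
    and ind: "indep_vars (\<lambda>_. borel) (\<lambda>p \<omega>. Y \<omega> $$ p) ({..<N} \<times> {..<L})"
    and law: "\<And>p. p \<in> {..<N} \<times> {..<L} \<Longrightarrow> distr M borel (\<lambda>\<omega>. Y \<omega> $$ p) = \<nu>"
    and \<nu>: "unit_variable \<nu> C"
    and W: "\<And>\<omega>. \<omega> \<in> space M \<Longrightarrow> W \<omega> = (complex_of_real (1 / sqrt (real L)) \<cdot>\<^sub>m Y \<omega>) * mat_adjoint (complex_of_real (1 / sqrt (real L)) \<cdot>\<^sub>m Y \<omega>)"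
  shows "distr M (mat_borel N N) W =
    distr (PiM {..<L} (\<lambda>_. PiM {..<N} (\<lambda>_. \<nu>))) (mat_borel N N) (column_model.WW N L {..<L})"
    "\<And>\<omega>. \<omega> \<in> space M \<Longrightarrow> hnd N (W \<omega>)"
proof -
  note columns = distr_columns[where X = "\<lambda>p \<omega>. Y \<omega> $$ p", OF ind N L law]
  interpret column_model N L "\<lambda>_. PiM {..<N} (\<lambda>_. \<nu>)" "3 * (C + 1)" using N L \<nu> by (rule column_model_iid)
  let ?Z = "\<lambda>\<omega>. \<lambda>j\<in>{..<L}. \<lambda>i\<in>{..<N}. Y \<omega> $$ (i, j)"
  have WZ: "W \<omega> = WW {..<L} (?Z \<omega>)" if \<omega>: "\<omega> \<in> space M" for \<omega>
  proof (rule eq_matI)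
    have YC: "Y \<omega> \<in> carrier_mat N L" using mat_measurableD(1)[OF Y \<omega>] .
    let ?s = "complex_of_real (1 / sqrt (real L))"
    have WC: "W \<omega> \<in> carrier_mat N N" unfolding W[OF \<omega>] using YC by auto
    show "dim_row (W \<omega>) = dim_row (WW {..<L} (?Z \<omega>))" "dim_col (W \<omega>) = dim_col (WW {..<L} (?Z \<omega>))"
      using WC by (auto simp: WW_def gram_def)
    fix i k assume "i < dim_row (WW {..<L} (?Z \<omega>))" "k < dim_col (WW {..<L} (?Z \<omega>))"
    then have ik: "i < N" "k < N" by (auto simp: WW_def gram_def)
    have "W \<omega> $$ (i, k) = (\<Sum>j<L. (?s * Y \<omega> $$ (i, j)) * cnj (?s * Y \<omega> $$ (k, j)))"
    proof -
      have "W \<omega> $$ (i, k) = row (?s \<cdot>\<^sub>m Y \<omega>) i \<bullet> col (mat_adjoint (?s \<cdot>\<^sub>m Y \<omega>)) k"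
        unfolding W[OF \<omega>] using YC ik by (intro index_mult_mat) auto
      also have "\<dots> = (\<Sum>j<L. (?s * Y \<omega> $$ (i, j)) * cnj (?s * Y \<omega> $$ (k, j)))"
        using YC ik unfolding scalar_prod_def lessThan_atLeast0 by (intro sum.cong) auto
      finally show ?thesis .
    qed
    also have "\<dots> = WW {..<L} (?Z \<omega>) $$ (i, k)"
      using ik by (simp add: WW_def gram_def column_def)
    finally show "W \<omega> $$ (i, k) = WW {..<L} (?Z \<omega>) $$ (i, k)" .
  qed
  show "hnd N (W \<omega>)" if "\<omega> \<in> space M" for \<omega> unfolding WZ[OF that] by (rule hnd_WW) simp
  have setsPP: "sets PP = sets (PiM {..<L} (\<lambda>_. PiM {..<N} (\<lambda>_. borel)))"
    by (intro sets_PiM_cong refl sets_Q)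
  have WWm: "WW {..<L} \<in> PP \<rightarrow>\<^sub>M mat_borel N N" unfolding mat_measurable_iff by (rule WW_measurable) simp
  have Zm: "?Z \<in> M \<rightarrow>\<^sub>M PiM {..<L} (\<lambda>_. PiM {..<N} (\<lambda>_. borel))"
    using mat_measurableD(2)[OF Y] by (intro measurable_restrict) auto
  have "distr M (mat_borel N N) W = distr M (mat_borel N N) (WW {..<L} \<circ> ?Z)"
    using WZ by (intro distr_cong) auto
  also have "\<dots> = distr (distr M (PiM {..<L} (\<lambda>_. PiM {..<N} (\<lambda>_. borel))) ?Z) (mat_borel N N) (WW {..<L})"
    using Zm WWm by (intro distr_distr[symmetric]) (auto simp: measurable_cong_sets[OF setsPP refl])
  also have "distr M (PiM {..<L} (\<lambda>_. PiM {..<N} (\<lambda>_. borel))) ?Z = PP"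
    by (rule columns)
  finally show "distr M (mat_borel N N) W = distr PP (mat_borel N N) (WW {..<L})" .
qed

section \<open>Convergence\<close>

lemma gam_emp:
  assumes "rs \<noteq> []" "0 < y" "\<And>r. r \<in> set rs \<Longrightarrow> 0 \<le> r"
  shows "gam (emp rs) y = (\<Sum>r\<leftarrow>rs. r / (y + r)) / real (length rs)"
proof -
  have "gam (emp rs) y = (\<Sum>i<length rs. tfn y (rs ! i)) /\<^sub>R real (length rs)"
    unfolding gam_def using assms(1) by (rule integral_emp) simp
  also have "(\<Sum>i<length rs. tfn y (rs ! i)) = (\<Sum>i<length rs. rs ! i / (y + rs ! i))"
  proof (intro sum.cong refl)
    fix i assume "i \<in> {..<length rs}"
    then have "0 \<le> rs ! i" using assms(3) by simp
    then show "tfn y (rs ! i) = rs ! i / (y + rs ! i)" by (simp add: tfn_def)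
  qed
  also have "(\<Sum>i<length rs. rs ! i / (y + rs ! i)) = (\<Sum>r\<leftarrow>rs. r / (y + r))"
    by (simp add: sum_list_sum_nth lessThan_atLeast0)
  finally show ?thesis by (simp add: divide_inverse mult.commute)
qed

lemma measure_emp_neg:
  assumes "rs \<noteq> []" "\<And>r. r \<in> set rs \<Longrightarrow> 0 \<le> r"
  shows "measure (emp rs) {..<0} = 0"
proof -
  have "filter (\<lambda>r. r \<in> {..<0}) rs = []" using assms(2) by (force simp: filter_empty_conv)
  then show ?thesis using assms(1) by (simp add: measure_emp)
qed

text \<open>The link between \<open>gam\<close> and the resolvent is
  \<open>r / (x + r) = 1 - x / (x + r)\<close>, summed over the eigenvalues \<open>r\<close> of
  \<open>A * W\<close>.\<close>

lemma hnd_mult_spectrum: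
  assumes A: "hnd n A" and W: "hnd n W" and n: "n > 0"
  shows "real_eigenvalues (A * W)"
    "\<exists>rs. rs \<noteq> [] \<and> (\<forall>r\<in>set rs. 0 \<le> r) \<and> cdf (emp rs) = esd (A * W) \<and>
      (\<forall>x>0. gam (emp rs) x = 1 - x * Re (mtrace (rsv n x A W)) / real n)"
proof -
  show re: "real_eigenvalues (A * W)"
    using eigenvalue_hnd_mult(1)[OF A W] by (simp add: real_eigenvalues_def)
  have AC: "A \<in> carrier_mat n n" and WC: "W \<in> carrier_mat n n" using A W by auto
  have M: "A * W \<in> carrier_mat n n" using AC WC by simp
  obtain rs where rs: "length rs = n" and cp: "char_poly (A * W) = (\<Prod>a\<leftarrow>map complex_of_real rs. [:- a, 1:])"
    using real_spectrum_list[OF M re] by blast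
  have ne: "rs \<noteq> []" using rs n by auto
  have nn: "0 \<le> r" if "r \<in> set rs" for r
  proof -
    have "complex_of_real r \<in> set (map complex_of_real rs)" using that by auto
    then have "eigenvalue (A * W) (complex_of_real r)" using eigenvalue_iff_list[OF M cp] by blast
    from eigenvalue_hnd_mult(2)[OF A W this] show ?thesis by simp
  qed
  have "gam (emp rs) x = 1 - x * Re (mtrace (rsv n x A W)) / real n" if x: "x > 0" for x
  proof -
    have "mtrace (rsv n x A W) = (\<Sum>a\<leftarrow>map complex_of_real rs. 1 / (complex_of_real x + a))"
      unfolding rsv_def
    proof (rule mtrace_minv_shift[OF M cp])
      fix a assume "a \<in> set (map complex_of_real rs)"
      then obtain r where r: "r \<in> set rs" "a = complex_of_real r" by auto
      then have "x + r \<noteq> 0" using nn[of r] x by auto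
      then show "complex_of_real x + a \<noteq> 0" unfolding r(2) of_real_add[symmetric] of_real_eq_0_iff .
    qed
    also have "\<dots> = complex_of_real (\<Sum>r\<leftarrow>rs. 1 / (x + r))" by (induction rs) auto
    finally have tr: "Re (mtrace (rsv n x A W)) = (\<Sum>r\<leftarrow>rs. 1 / (x + r))" by simp
    have "(\<Sum>r\<leftarrow>rs. r / (x + r)) = real (length rs) - x * (\<Sum>r\<leftarrow>rs. 1 / (x + r))"
      using nn
    proof (induction rs)
      case (Cons r rs)
      have "0 \<le> r" using Cons.prems by simp
      then have "x + r \<noteq> 0" using x by simp
      then have "r / (x + r) = 1 - x * (1 / (x + r))" by (simp add: field_simps)
      then show ?case using Cons by (simp add: distrib_left)
    qed simp
    then show ?thesis using gam_emp[OF ne x nn] n by (simp add: tr rs diff_divide_distrib)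
  qed
  then show "\<exists>rs. rs \<noteq> [] \<and> (\<forall>r\<in>set rs. 0 \<le> r) \<and> cdf (emp rs) = esd (A * W) \<and>
      (\<forall>x>0. gam (emp rs) x = 1 - x * Re (mtrace (rsv n x A W)) / real n)"
    using ne nn cdf_emp[OF M cp rs n] by blast
qed

text \<open>As \<open>N / L\<close> has a finite limit, \<open>1 / L = (N / L) * (1 / N)\<close>
  tends to zero, and every summand of \<open>err_D\<close> contains this factor.\<close>

lemma err_tendsto:
  fixes L :: "nat \<Rightarrow> nat"
  assumes lim: "(\<lambda>N. real N / real (L N)) \<longlonglongrightarrow> c" and L: "\<And>N. N > 0 \<Longrightarrow> L N > 0"
  shows "(\<lambda>N. err_D C3 \<kappa> N (L N)) \<longlonglongrightarrow> 0"
    "(\<lambda>N. err_G C3 \<kappa> N (L N)) \<longlonglongrightarrow> 2 * (\<kappa>\<^sup>2 * c)\<^sup>2"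
    "(\<lambda>N. 1 / real (L N)) \<longlonglongrightarrow> 0"
proof -
  have "(\<lambda>N. (real N / real (L N)) * (1 / real N)) \<longlonglongrightarrow> c * 0"
    by (intro tendsto_mult lim lim_1_over_n)
  moreover have "\<forall>\<^sub>F N in sequentially. (real N / real (L N)) * (1 / real N) = 1 / real (L N)"
    using eventually_gt_at_top[of 0] by eventually_elim simp
  ultimately show iL: "(\<lambda>N. 1 / real (L N)) \<longlonglongrightarrow> 0" by (simp add: tendsto_cong)
  have "(\<lambda>N. 3 * (C3 * \<kappa>\<^sup>2 * (real N / real (L N)) * (1 / real (L N)) + \<kappa>\<^sup>2 * (1 / real (L N))\<^sup>2 + 8 * \<kappa>\<^sup>2 * (1 / real (L N))))
      \<longlonglongrightarrow> 3 * (C3 * \<kappa>\<^sup>2 * c * 0 + \<kappa>\<^sup>2 * 0\<^sup>2 + 8 * \<kappa>\<^sup>2 * 0)"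
    by (intro tendsto_intros lim iL)
  moreover have "err_D C3 \<kappa> N (L N) = 3 * (C3 * \<kappa>\<^sup>2 * (real N / real (L N)) * (1 / real (L N)) + \<kappa>\<^sup>2 * (1 / real (L N))\<^sup>2 + 8 * \<kappa>\<^sup>2 * (1 / real (L N)))" for N
    by (simp add: err_D_def power2_eq_square)
  ultimately show "(\<lambda>N. err_D C3 \<kappa> N (L N)) \<longlonglongrightarrow> 0"
    by (simp only: mult_zero_right add_0_left zero_power2)
  have "(\<lambda>N. 2 * (C3 * \<kappa>\<^sup>2 * \<kappa>\<^sup>2 * (real N / real (L N)) * (1 / real (L N)) + (\<kappa>\<^sup>2 * (real N / real (L N)))\<^sup>2))
      \<longlonglongrightarrow> 2 * (C3 * \<kappa>\<^sup>2 * \<kappa>\<^sup>2 * c * 0 + (\<kappa>\<^sup>2 * c)\<^sup>2)"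
    by (intro tendsto_intros lim iL)
  moreover have "err_G C3 \<kappa> N (L N) = 2 * (C3 * \<kappa>\<^sup>2 * \<kappa>\<^sup>2 * (real N / real (L N)) * (1 / real (L N)) + (\<kappa>\<^sup>2 * (real N / real (L N)))\<^sup>2)" for N
    by (simp add: err_G_def power2_eq_square mult_ac)
  ultimately show "(\<lambda>N. err_G C3 \<kappa> N (L N)) \<longlonglongrightarrow> 2 * (\<kappa>\<^sup>2 * c)\<^sup>2"
    by (simp only: mult_zero_right add_0_left)
qed

text \<open>A deterministic statement about one realisation of \<open>A\<close>. For a fixed cutoff
  \<open>b\<close> all errors vanish as \<open>N\<close> grows, except those due to the discarded
  eigenvalues, whose proportion is controlled by \<open>gam FA b\<close>; afterwards
  \<open>b\<close> is taken large.\<close>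

lemma mean_v_tendsto:
  fixes L :: "nat \<Rightarrow> nat" and A :: "nat \<Rightarrow> complex mat"
  assumes cm: "\<And>N. N > 0 \<Longrightarrow> column_model N (L N) (Q N) C3"
    and hA: "\<And>N. N > 0 \<Longrightarrow> hnd N (A N)"
    and FA: "real_distribution FA" and wc: "weak_conv (\<lambda>N. esd (A N)) (cdf FA)"
    and lim: "(\<lambda>N. real N / real (L N)) \<longlonglongrightarrow> c" and x: "x > 0"
    and v: "0 < v" "v + c * gam FA (x / v) = 1"
  shows "(\<lambda>N. column_model.mean_v N (L N) (Q N) x (A N)) \<longlonglongrightarrow> v"
proof -
  have L: "L N > 0" if "N > 0" for N using cm[OF that] by (rule column_model.L)
  let ?mv = "\<lambda>N. column_model.mean_v N (L N) (Q N) x (A N)"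
  \<comment> \<open>The list of eigenvalues is chosen once for all \<open>b\<close>, so that the
    empirical measures \<open>\<mu> N\<close> do not depend on the cutoff.\<close>
  define good where "good N ls \<longleftrightarrow> length ls = N \<and> char_poly (A N) = (\<Prod>a\<leftarrow>map complex_of_real ls. [:- a, 1:]) \<and>
    (\<forall>l\<in>set ls. 0 \<le> l) \<and> (\<forall>b>0. \<exists>w. 0 < w \<and> w \<le> 1 \<and>
      \<bar>?mv N - w\<bar> \<le> sqrt (err_D C3 (b / x) N (L N)) + real (length (filter (\<lambda>l. b < l) ls)) / real (L N) \<and>
      \<bar>w + (\<Sum>l\<leftarrow>ls. w * l / (x + w * l)) / real (L N) - 1\<bar> \<le>
        (b / x)\<^sup>2 / real (L N) + sqrt (err_D C3 (b / x) N (L N)) * (err_G C3 (b / x) N (L N) + 1) / 2 +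
        real (length (filter (\<lambda>l. b < l) ls)) / real (L N))" for N ls
  have "\<exists>ls. good N ls" if N: "N > 0" for N
  proof -
    obtain ls where ls: "length ls = N" "char_poly (A N) = (\<Prod>a\<leftarrow>map complex_of_real ls. [:- a, 1:])"
      "\<And>l. l \<in> set ls \<Longrightarrow> 0 \<le> l"
      "\<And>x b. x > 0 \<Longrightarrow> b > 0 \<Longrightarrow> \<exists>v. 0 < v \<and> v \<le> 1 \<and>
        \<bar>column_model.mean_v N (L N) (Q N) x (A N) - v\<bar> \<le> sqrt (err_D C3 (b / x) N (L N)) + real (length (filter (\<lambda>l. b < l) ls)) / real (L N) \<and>
        \<bar>v + (\<Sum>l\<leftarrow>ls. v * l / (x + v * l)) / real (L N) - 1\<bar> \<le>
        (b / x)\<^sup>2 / real (L N) + sqrt (err_D C3 (b / x) N (L N)) * (err_G C3 (b / x) N (L N) + 1) / 2 +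
        real (length (filter (\<lambda>l. b < l) ls)) / real (L N)"
      by (rule column_model.truncated_fixed_point[OF cm[OF N] hA[OF N]]) blast
    show ?thesis
      unfolding good_def
      by (rule exI[of _ ls], intro conjI ballI allI impI ls(1,2), erule ls(3), rule ls(4)[OF x])
  qed
  then obtain ls where "\<forall>N>0. good N (ls N)" by metis
  then have ls: "\<And>N. N > 0 \<Longrightarrow> length (ls N) = N"
    "\<And>N. N > 0 \<Longrightarrow> char_poly (A N) = (\<Prod>a\<leftarrow>map complex_of_real (ls N). [:- a, 1:])"
    "\<And>N l. N > 0 \<Longrightarrow> l \<in> set (ls N) \<Longrightarrow> 0 \<le> l"
    "\<And>N b. N > 0 \<Longrightarrow> b > 0 \<Longrightarrow> \<exists>w. 0 < w \<and> w \<le> 1 \<and>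
      \<bar>?mv N - w\<bar> \<le> sqrt (err_D C3 (b / x) N (L N)) + real (length (filter (\<lambda>l. b < l) (ls N))) / real (L N) \<and>
      \<bar>w + (\<Sum>l\<leftarrow>ls N. w * l / (x + w * l)) / real (L N) - 1\<bar> \<le>
        (b / x)\<^sup>2 / real (L N) + sqrt (err_D C3 (b / x) N (L N)) * (err_G C3 (b / x) N (L N) + 1) / 2 +
        real (length (filter (\<lambda>l. b < l) (ls N))) / real (L N)"
    unfolding good_def by blast+
  define \<mu> where "\<mu> N = emp (ls N)" for N
  have rd: "real_distribution (\<mu> N)" for N unfolding \<mu>_def by (rule real_distribution_emp)
  have ne: "ls N \<noteq> []" if "N > 0" for N using ls(1)[OF that] that by auto
  have cdf: "cdf (\<mu> N) = esd (A N)" if N: "N > 0" for N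
  proof -
    have "A N \<in> carrier_mat N N" using hA[OF N] by auto
    from cdf_emp[OF this ls(2)[OF N] ls(1)[OF N] N] show ?thesis by (simp add: \<mu>_def)
  qed
  have "weak_conv_m \<mu> FA"
    unfolding weak_conv_m_def weak_conv_def
  proof (intro allI impI)
    fix t assume "isCont (cdf FA) t"
    then have "(\<lambda>N. esd (A N) t) \<longlonglongrightarrow> cdf FA t" using wc by (simp add: weak_conv_def)
    then show "(\<lambda>N. cdf (\<mu> N) t) \<longlonglongrightarrow> cdf FA t"
    proof (rule Lim_transform_eventually)
      show "\<forall>\<^sub>F N in sequentially. esd (A N) t = cdf (\<mu> N) t"
        using eventually_gt_at_top[of 0] by eventually_elim (simp add: cdf)
    qed
  qed
  then have gl: "(\<lambda>N. gam (\<mu> N) y) \<longlonglongrightarrow> gam FA y" if "0 < y" for y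
    using rd FA that by (intro weak_conv_gam)
  have tailb: "real (length (filter (\<lambda>l. b < l) (ls N))) / real (L N) \<le> (real N / real (L N)) * (2 * gam (\<mu> N) b)"
    if N: "N > 0" and b: "0 < b" for N b
  proof -
    have "real (length (filter (\<lambda>l. b < l) (ls N))) / real N = measure (\<mu> N) {b<..}"
      unfolding \<mu>_def by (subst measure_emp[OF ne[OF N]]) (auto simp: ls(1)[OF N])
    also have "\<dots> \<le> 2 * gam (\<mu> N) b" using real_distribution.tail_le_gam[OF rd b] .
    finally have "(real N / real (L N)) * (real (length (filter (\<lambda>l. b < l) (ls N))) / real N) \<le> (real N / real (L N)) * (2 * gam (\<mu> N) b)"
      by (intro mult_left_mono) auto
    then show ?thesis using N by simp
  qed
  have phi: "(\<Sum>l\<leftarrow>ls N. w * l / (x + w * l)) / real (L N) = (real N / real (L N)) * gam (\<mu> N) (x / w)"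
    if N: "N > 0" and w: "0 < w" for N w
  proof -
    have "gam (\<mu> N) (x / w) = (\<Sum>l\<leftarrow>ls N. l / (x / w + l)) / real N"
      unfolding \<mu>_def using gam_emp[OF ne[OF N], of "x / w"] ls(3)[OF N] x w by (simp add: ls(1)[OF N])
    moreover have "l / (x / w + l) = w * l / (x + w * l)" for l
    proof -
      have "x / w + l = (x + w * l) / w" using w by (simp add: field_simps)
      then show ?thesis by (simp add: mult.commute)
    qed
    ultimately show ?thesis using N by simp
  qed
  \<comment> \<open>The tail term is counted twice because truncation disturbs both
    \<open>mean_v\<close> and the equation. The last summand is the defect of \<open>v\<close> in
    the equation at level \<open>N\<close>.\<close>
  define U where "U b N = sqrt (err_D C3 (b / x) N (L N)) + (b / x)\<^sup>2 * (1 / real (L N)) +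
    sqrt (err_D C3 (b / x) N (L N)) * (err_G C3 (b / x) N (L N) + 1) / 2 +
    2 * ((real N / real (L N)) * (2 * gam (\<mu> N) b)) + \<bar>v + (real N / real (L N)) * gam (\<mu> N) (x / v) - 1\<bar>" for b N
  have main: "\<bar>?mv N - v\<bar> \<le> U b N" if N: "N > 0" and b: "0 < b" for N b
  proof -
    obtain w where w: "0 < w"
      "\<bar>?mv N - w\<bar> \<le> sqrt (err_D C3 (b / x) N (L N)) + real (length (filter (\<lambda>l. b < l) (ls N))) / real (L N)"
      "\<bar>w + (\<Sum>l\<leftarrow>ls N. w * l / (x + w * l)) / real (L N) - 1\<bar> \<le>
        (b / x)\<^sup>2 / real (L N) + sqrt (err_D C3 (b / x) N (L N)) * (err_G C3 (b / x) N (L N) + 1) / 2 +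
        real (length (filter (\<lambda>l. b < l) (ls N))) / real (L N)"
      using ls(4)[OF N b] by blast
    \<comment> \<open>The expansion property is used for the equation at level \<open>N\<close>,
      with \<open>\<mu> N\<close> and \<open>N / L\<close>. Thus \<open>gam (\<mu> N)\<close> has to
      converge only at the fixed points \<open>x / v\<close> and \<open>b\<close>, not at the
      varying point \<open>x / w\<close>.\<close>
    have "\<bar>w - v\<bar> \<le> \<bar>(w + (real N / real (L N)) * gam (\<mu> N) (x / w)) - (v + (real N / real (L N)) * gam (\<mu> N) (x / v))\<bar>"
      using w(1) v(1) x by (intro real_distribution.fixed_point_expanding[OF rd]) auto
    moreover note w(2) w(3)[unfolded phi[OF N w(1)]] tailb[OF N b]
    moreover have "(b / x)\<^sup>2 / real (L N) = (b / x)\<^sup>2 * (1 / real (L N))" by simp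
    ultimately show ?thesis unfolding U_def by linarith
  qed
  have Ulim: "U b \<longlonglongrightarrow> 4 * (c * gam FA b)" if b: "0 < b" for b
  proof -
    have "(\<lambda>N. U b N) \<longlonglongrightarrow> sqrt 0 + (b / x)\<^sup>2 * 0 + sqrt 0 * (2 * ((b / x)\<^sup>2 * c)\<^sup>2 + 1) / 2 +
        2 * (c * (2 * gam FA b)) + \<bar>v + c * gam FA (x / v) - 1\<bar>"
      unfolding U_def using b x v by (intro tendsto_intros err_tendsto[OF lim L] lim gl) auto
    then show ?thesis using v by simp
  qed
  have c0: "0 \<le> c" by (rule tendsto_lowerbound[OF lim]) auto
  show ?thesis
  proof (rule LIMSEQ_I)
    fix e :: real assume e: "0 < e"
    obtain b where b: "0 < b" "gam FA b < e / (4 * (c + 1))"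
      using real_distribution.gam_small[OF FA, of "e / (4 * (c + 1))"] e c0 by (auto intro!: divide_pos_pos)
    have g0: "0 \<le> gam FA b" using real_distribution.gam_bounds(1)[OF FA b(1)] .
    have "4 * (c * gam FA b) \<le> 4 * (c + 1) * gam FA b" using g0 by (simp add: algebra_simps)
    also have "\<dots> < e" using b(2) c0 by (simp add: field_simps)
    finally have "\<forall>\<^sub>F N in sequentially. U b N < e" by (rule order_tendstoD(2)[OF Ulim[OF b(1)]])
    then have "\<forall>\<^sub>F N in sequentially. norm (?mv N - v) < e"
      using eventually_gt_at_top[of 0]
    proof eventually_elim
      case (elim N)
      show ?case unfolding real_norm_def using main[OF elim(2) b(1)] elim(1) by (rule le_less_trans)
    qed
    then show "\<exists>no. \<forall>n\<ge>no. norm (?mv n - v) < e" by (simp add: eventually_sequentially)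
  qed
qed

text \<open>For deviations of size \<open>N / Suc k\<close> the tail bound decays exponentially in
  \<open>N\<close>, because \<open>N / L\<close> stays away from zero. Borel-Cantelli then applies
  for each \<open>k\<close>, and countably many \<open>k\<close> express convergence to
  zero.\<close>

lemma trace_concentration_AE:
  fixes L :: "nat \<Rightarrow> nat" and A W :: "nat \<Rightarrow> 'w \<Rightarrow> complex mat"
  assumes P: "prob_space P" and cm: "\<And>N. N > 0 \<Longrightarrow> column_model N (L N) (Q N) C3"
    and ind: "\<And>N. N > 0 \<Longrightarrow> prob_space.indep_var P (mat_borel N N) (A N) (mat_borel N N) (W N)"
    and law: "\<And>N. N > 0 \<Longrightarrow> distr P (mat_borel N N) (W N) =
      distr (PiM {..<L N} (Q N)) (mat_borel N N) (column_model.WW N (L N) {..<L N})"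
    and hA: "\<And>N \<omega>. N > 0 \<Longrightarrow> \<omega> \<in> space P \<Longrightarrow> hnd N (A N \<omega>)"
    and lim: "(\<lambda>N. real N / real (L N)) \<longlonglongrightarrow> c" and c: "c > 0" and x: "x > 0"
  shows "AE \<omega> in P. (\<lambda>N. (Re (mtrace (rsv N x (A N \<omega>) (W N \<omega>))) -
    integral\<^sup>L (PiM {..<L N} (Q N)) (column_model.tr_rsv N (L N) x (A N \<omega>))) / real N) \<longlonglongrightarrow> 0"
proof -
  interpret prob_space P by fact
  define D where "D N \<omega> = Re (mtrace (rsv N x (A N \<omega>) (W N \<omega>))) -
    integral\<^sup>L (PiM {..<L N} (Q N)) (column_model.tr_rsv N (L N) x (A N \<omega>))" for N \<omega>
  have "AE \<omega> in P. \<forall>\<^sub>F N in sequentially. \<bar>D N \<omega>\<bar> < real N / real (Suc k)" for k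
  proof -
    \<comment> \<open>Index \<open>0\<close>, about which nothing is known, receives the empty
      event.\<close>
    define S where "S N = (if N = 0 then {} else {\<omega> \<in> space P. real N / real (Suc k) \<le> \<bar>D N \<omega>\<bar>})" for N
    \<comment> \<open>The exponential rate; \<open>c / 2\<close> is a lower bound for
      \<open>N / L\<close> when \<open>N\<close> is large.\<close>
    define a where "a = (x / real (Suc k))\<^sup>2 / 2 * (c / 2)"
    have a: "0 < a" using x c by (simp add: a_def)
    have S: "S N \<in> sets P" and bnd: "N > 0 \<Longrightarrow> emeasure P (S N) \<le> ennreal (2 * exp (- (real N / real (Suc k) * x)\<^sup>2 / (2 * real (L N))))" for N
    proof -
      have *: "S N \<in> sets P \<and> emeasure P (S N) \<le> ennreal (2 * exp (- (real N / real (Suc k) * x)\<^sup>2 / (2 * real (L N))))" if N: "N > 0"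
        using column_model.joint_concentration[OF cm[OF N] P ind[OF N] law[OF N] hA[OF N] x, of "real N / real (Suc k)"] N
        unfolding S_def D_def by (auto simp del: of_nat_Suc)
      show "S N \<in> sets P" by (cases "N = 0") (use * in \<open>auto simp: S_def\<close>)
      show "N > 0 \<Longrightarrow> emeasure P (S N) \<le> ennreal (2 * exp (- (real N / real (Suc k) * x)\<^sup>2 / (2 * real (L N))))" using * by blast
    qed
    have "summable (\<lambda>N. measure P (S N))"
    proof (rule summable_comparison_test_ev)
      show "summable (\<lambda>N. 2 * exp (- a) ^ N)" using a by (intro summable_mult summable_geometric) simp
      have "\<forall>\<^sub>F N in sequentially. c / 2 < real N / real (L N)" using c by (intro order_tendstoD(1)[OF lim]) simp
      then show "\<forall>\<^sub>F N in sequentially. norm (measure P (S N)) \<le> 2 * exp (- a) ^ N"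
        using eventually_gt_at_top[of 0]
      proof eventually_elim
        case (elim N)
        have "a * real N \<le> (x / real (Suc k))\<^sup>2 / 2 * (real N / real (L N)) * real N"
          unfolding a_def using elim by (intro mult_right_mono mult_left_mono) auto
        also have "\<dots> = (real N / real (Suc k) * x)\<^sup>2 / (2 * real (L N))"
          by (simp add: power2_eq_square mult_ac del: of_nat_Suc)
        finally have "exp (- (real N / real (Suc k) * x)\<^sup>2 / (2 * real (L N))) \<le> exp (- (a * real N))" by simp
        also have "\<dots> = exp (- a) ^ N" by (simp add: exp_of_nat_mult[symmetric] mult.commute)
        finally have le: "2 * exp (- (real N / real (Suc k) * x)\<^sup>2 / (2 * real (L N))) \<le> 2 * exp (- a) ^ N" by simp
        have "measure P (S N) \<le> 2 * exp (- (real N / real (Suc k) * x)\<^sup>2 / (2 * real (L N)))"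
          using bnd[OF elim(2)] unfolding emeasure_eq_measure by (subst (asm) ennreal_le_iff) auto
        then show ?case using le by simp
      qed
    qed
    then have "AE \<omega> in P. \<forall>\<^sub>F N in sequentially. \<omega> \<in> space P - S N"
      using S by (intro borel_cantelli_AE1) (auto simp: emeasure_eq_measure)
    then show ?thesis
    proof eventually_elim
      case (elim \<omega>)
      show ?case using elim eventually_gt_at_top[of 0] by eventually_elim (auto simp: S_def)
    qed
  qed
  then have "AE \<omega> in P. \<forall>k. \<forall>\<^sub>F N in sequentially. \<bar>D N \<omega>\<bar> < real N / real (Suc k)"
    unfolding AE_all_countable by blast
  then show ?thesis
    unfolding D_def[symmetric]
  proof eventually_elim
    case (elim \<omega>)
    show ?case
    proof (rule tendstoI)
      fix e :: real assume "0 < e"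
      then obtain k where k: "1 / real (Suc k) < e" using nat_approx_posE by blast
      have "\<forall>\<^sub>F N in sequentially. \<bar>D N \<omega>\<bar> < real N / real (Suc k)" using elim by blast
      then show "\<forall>\<^sub>F N in sequentially. dist (D N \<omega> / real N) 0 < e"
        using eventually_gt_at_top[of 0]
      proof eventually_elim
        case (elim N)
        have "\<bar>D N \<omega>\<bar> / real N < 1 / real (Suc k)"
          using elim by (simp add: divide_less_eq del: of_nat_Suc)
        then show ?case using k by simp
      qed
    qed
  qed
qed

text \<open>The limit is not random, so a single outcome in the almost sure event decides its
  support.\<close>

lemma esd_limit_nonneg_support:
  assumes P: "prob_space P" and hA: "\<And>N \<omega>. N > 0 \<Longrightarrow> \<omega> \<in> space P \<Longrightarrow> hnd N (A N \<omega>)" and lim: "esd_limit P A FA"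
  shows "measure FA {..<0} = 0"
proof -
  interpret prob_space P by fact
  have FA: "real_distribution FA" and ae: "AE \<omega> in P. weak_conv (\<lambda>N. esd (A N \<omega>)) (cdf FA)"
    using lim by (auto simp: esd_limit_def)
  from ae AE_space have "AE \<omega> in P. weak_conv (\<lambda>N. esd (A N \<omega>)) (cdf FA) \<and> \<omega> \<in> space P"
    by eventually_elim blast
  from eventually_happens'[OF ae_filter_bot this]
  obtain \<omega> where w: "weak_conv (\<lambda>N. esd (A N \<omega>)) (cdf FA)" and \<omega>: "\<omega> \<in> space P" by blast
  show ?thesis
  proof (rule weak_conv_nonneg_support[OF _ FA w])
    fix N :: nat and t :: real assume N: "0 < N" and t: "t < 0"
    have h: "hnd N (A N \<omega>)" by (rule hA[OF N \<omega>])
    \<comment> \<open>Multiplication by the identity makes the statement about spectra of products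
      available for \<open>A\<close> itself.\<close>
    have "A N \<omega> * 1\<^sub>m N = A N \<omega>" using hnd_carrier[OF h] by simp
    with hnd_mult_spectrum(2)[OF h hnd_one N]
    obtain rs where rs: "rs \<noteq> []" "\<forall>r\<in>set rs. 0 \<le> r" "cdf (emp rs) = esd (A N \<omega>)" by auto
    interpret E: real_distribution "emp rs" by (rule real_distribution_emp)
    have "cdf (emp rs) t \<le> measure (emp rs) {..<0}"
      unfolding cdf_def using t by (intro E.finite_measure_mono) auto
    then show "esd (A N \<omega>) t = 0"
      using measure_emp_neg[OF rs(1)] rs(2) E.cdf_nonneg[of t] by (simp add: rs(3))
  qed
qed

theorem theorem5p19:
  fixes P :: "'w measure"
    and A W :: "nat \<Rightarrow> 'w \<Rightarrow> complex mat"
    and FA :: "real measure"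
    and L :: "nat \<Rightarrow> nat"
    and c :: real
  assumes "prob_space P"
    and "\<And>N \<omega>. N > 0 \<Longrightarrow> \<omega> \<in> space P \<Longrightarrow> hermitian_nonneg_definite N (A N \<omega>)"
    and "esd_limit P A FA"
    and "FA \<in> algebraic_distributions"
    and "wishart_like P L W"
    and "\<And>N. N > 0 \<Longrightarrow>
           prob_space.indep_var P (mat_borel N N) (A N) (mat_borel N N) (W N)"
    and "(\<lambda>N. real N / real (L N)) \<longlonglongrightarrow> c"
    and "c > 0"
  shows "\<exists>FB\<in>algebraic_distributions. esd_limit P (\<lambda>N \<omega>. A N \<omega> * W N \<omega>) FB"
proof -
  note P = assms(1) and hA = assms(2) and ind = assms(6) and lim = assms(7) and c = assms(8)
  interpret prob_space P by fact
  have FA: "real_distribution FA" and wA: "AE \<omega> in P. weak_conv (\<lambda>N. esd (A N \<omega>)) (cdf FA)"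
    using assms(3) by (auto simp: esd_limit_def)
  interpret FA: real_distribution FA by (rule FA)
  have sA: "measure FA {..<0} = 0" using P hA assms(3) by (rule esd_limit_nonneg_support)
  obtain G where G: "gaussian_like P L G" and WG: "\<And>N \<omega>. N > 0 \<Longrightarrow> \<omega> \<in> space P \<Longrightarrow> W N \<omega> = G N \<omega> * mat_adjoint (G N \<omega>)"
    using assms(5) by (auto simp: wishart_like_def)
  obtain Y where Y: "\<And>N. N > 0 \<Longrightarrow> L N > 0 \<and> random_matrix P N (L N) (Y N) \<and>
        indep_vars (\<lambda>_. borel) (\<lambda>p \<omega>. Y N \<omega> $$ p) ({..<N} \<times> {..<L N}) \<and>
        (\<forall>p\<in>{..<N} \<times> {..<L N}. \<forall>q\<in>{..<N} \<times> {..<L N}.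
           distr P borel (\<lambda>\<omega>. Y N \<omega> $$ p) = distr P borel (\<lambda>\<omega>. Y N \<omega> $$ q)) \<and>
        (\<forall>p\<in>{..<N} \<times> {..<L N}. (\<integral>\<omega>. Y N \<omega> $$ p \<partial>P) = 0 \<and> (\<integral>\<omega>. (cmod (Y N \<omega> $$ p))\<^sup>2 \<partial>P) = 1) \<and>
        (\<forall>\<omega>\<in>space P. G N \<omega> = complex_of_real (1 / sqrt (real (L N))) \<cdot>\<^sub>m Y N \<omega>)"
    and mom: "\<And>k :: nat. \<exists>C. \<forall>N>0. \<forall>p\<in>{..<N} \<times> {..<L N}.
        integrable P (\<lambda>\<omega>. cmod (Y N \<omega> $$ p) ^ k) \<and> (\<integral>\<omega>. cmod (Y N \<omega> $$ p) ^ k \<partial>P) \<le> C"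
    using G unfolding gaussian_like_def by blast
  obtain C where C: "\<And>N p. N > 0 \<Longrightarrow> p \<in> {..<N} \<times> {..<L N} \<Longrightarrow> (\<integral>\<omega>. cmod (Y N \<omega> $$ p) ^ 4 \<partial>P) \<le> C"
    using mom[of 4] by blast
  have int: "integrable P (\<lambda>\<omega>. cmod (Y N \<omega> $$ p) ^ k)" if "N > 0" "p \<in> {..<N} \<times> {..<L N}" for N p k
    using mom[of k] that by blast
  \<comment> \<open>For given \<open>N\<close> all entries share one law, so that of the entry
    \<open>(0, 0)\<close> represents it.\<close>
  define \<nu> where "\<nu> N = distr P borel (\<lambda>\<omega>. Y N \<omega> $$ (0, 0))" for N
  define Q where "Q N = (\<lambda>_ :: nat. PiM {..<N} (\<lambda>_ :: nat. \<nu> N))" for N :: nat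
  have L: "L N > 0" if "N > 0" for N using Y[OF that] by blast
  have Ym: "mat_measurable P N (L N) (Y N)" if "N > 0" for N
    using Y[OF that] unfolding random_matrix_def mat_measurable_iff by blast
  have uv: "unit_variable (\<nu> N) C" if N: "N > 0" for N
  proof -
    have p: "(0, 0) \<in> {..<N} \<times> {..<L N}" using N L[OF N] by simp
    show ?thesis
      unfolding \<nu>_def
    proof (rule unit_variable_distr[OF P])
      show "(\<lambda>\<omega>. Y N \<omega> $$ (0, 0)) \<in> borel_measurable P" using mat_measurableD(2)[OF Ym[OF N]] N L[OF N] by blast
      show "integrable P (\<lambda>\<omega>. cmod (Y N \<omega> $$ (0, 0)))" using int[OF N p, of 1] by (simp only: power_one_right)
    qed (use int[OF N p] C[OF N p] Y[OF N] p in blast)+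
  qed
  have cm: "column_model N (L N) (Q N) (3 * (C + 1))" if N: "N > 0" for N
    unfolding Q_def using N L[OF N] uv[OF N] by (rule column_model_iid)
  have lawW: "distr P (mat_borel N N) (W N) = distr (PiM {..<L N} (Q N)) (mat_borel N N) (column_model.WW N (L N) {..<L N})"
    and hW: "\<And>\<omega>. \<omega> \<in> space P \<Longrightarrow> hnd N (W N \<omega>)" if N: "N > 0" for N
  proof -
    have law: "distr P borel (\<lambda>\<omega>. Y N \<omega> $$ p) = \<nu> N" if "p \<in> {..<N} \<times> {..<L N}" for p
      unfolding \<nu>_def using Y[OF N] that N L[OF N] by blast
    have W: "W N \<omega> = (complex_of_real (1 / sqrt (real (L N))) \<cdot>\<^sub>m Y N \<omega>) * mat_adjoint (complex_of_real (1 / sqrt (real (L N))) \<cdot>\<^sub>m Y N \<omega>)"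
      if "\<omega> \<in> space P" for \<omega>
      using WG[OF N that] Y[OF N] that by metis
    have iv: "indep_vars (\<lambda>_. borel) (\<lambda>p \<omega>. Y N \<omega> $$ p) ({..<N} \<times> {..<L N})" using Y[OF N] by blast
    note * = wishart_law[OF N L[OF N] Ym[OF N] iv law uv[OF N] W]
    show "distr P (mat_borel N N) (W N) = distr (PiM {..<L N} (Q N)) (mat_borel N N) (column_model.WW N (L N) {..<L N})"
      unfolding Q_def by (rule *(1))
    show "\<And>\<omega>. \<omega> \<in> space P \<Longrightarrow> hnd N (W N \<omega>)" by (rule *(2))
  qed
  have "\<exists>v. 0 < v \<and> v \<le> 1 \<and> v + c * gam FA (x / v) = 1" if "0 < x" for x
    using FA c that by (rule fixed_point_exists)
  then obtain v where v: "\<And>x. 0 < x \<Longrightarrow> 0 < v x" "\<And>x. 0 < x \<Longrightarrow> v x \<le> 1" "\<And>x. 0 < x \<Longrightarrow> v x + c * gam FA (x / v x) = 1"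
    by metis
  \<comment> \<open>The candidate for the transform of the limit law, obtained by solving the
    equation for \<open>gam FA (x / v x)\<close>.\<close>
  define m where "m x = (1 - v x) / c" for x
  have m: "gam FA (x / v x) = m x" if "0 < x" for x
    using v(3)[OF that] c by (simp add: m_def eq_divide_eq algebra_simps)
  \<comment> \<open>This supplies tightness: as \<open>v x \<le> 1\<close> and \<open>gam FA\<close>
    is nonincreasing, \<open>m x = gam FA (x / v x)\<close> is at most
    \<open>gam FA x\<close>.\<close>
  have msmall: "\<exists>r\<in>\<rat>. 0 < r \<and> m r < e" if e: "0 < e" for e
  proof -
    obtain y0 where y0: "0 < y0" "\<And>y. y \<ge> y0 \<Longrightarrow> gam FA y < e" using FA.gam_small[OF e] by blast
    obtain k :: nat where k: "y0 \<le> real k" using real_arch_simple by blast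
    have k0: "0 < real k" using k y0 by linarith
    have "m (real k) = gam FA (real k / v (real k))" using m[OF k0] by simp
    also have "\<dots> \<le> gam FA (real k)"
      using v(1,2)[OF k0] k0 by (intro FA.gam_antimono) (auto simp: le_divide_eq)
    also have "\<dots> < e" using k by (rule y0)
    finally show ?thesis using k0 by (intro bexI[of _ "real k"]) auto
  qed
  define T where "T N x \<omega> = Re (mtrace (rsv N x (A N \<omega>) (W N \<omega>)))" for N x \<omega>
  \<comment> \<open>Rational points only, so that the exceptional set is a countable union of null
    sets.\<close>
  have trlim: "AE \<omega> in P. \<forall>r\<in>{r\<in>\<rat>. 0 < r}. (\<lambda>N. (T N r \<omega> -
    integral\<^sup>L (PiM {..<L N} (Q N)) (column_model.tr_rsv N (L N) r (A N \<omega>))) / real N) \<longlonglongrightarrow> 0"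
  proof (subst AE_ball_countable)
    show "countable {r\<in>\<rat>. 0 < r}" by (rule countable_subset[OF _ countable_rat]) auto
    show "\<forall>r\<in>{r\<in>\<rat>. 0 < r}. AE \<omega> in P. (\<lambda>N. (T N r \<omega> -
      integral\<^sup>L (PiM {..<L N} (Q N)) (column_model.tr_rsv N (L N) r (A N \<omega>))) / real N) \<longlonglongrightarrow> 0"
      unfolding T_def using trace_concentration_AE[OF P cm ind lawW hA lim c] by blast
  qed
  \<comment> \<open>At this stage the limit may depend on the outcome \<open>\<omega>\<close>. Its
    transform at the rationals does not, and \<open>gam_determines\<close> will show that there is
    only one limit.\<close>
  define good where "good \<omega> F \<longleftrightarrow> real_distribution F \<and> measure F {..<0} = 0 \<and>
    weak_conv (\<lambda>N. esd (A N \<omega> * W N \<omega>)) (cdf F) \<and> (\<forall>r\<in>\<rat>. 0 < r \<longrightarrow> gam F r = m r)" for \<omega> F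
  have ae: "AE \<omega> in P. \<exists>F. good \<omega> F"
    using wA trlim AE_space
  proof eventually_elim
    case (elim \<omega>)
    have \<omega>: "\<omega> \<in> space P" using elim by blast
    have "\<exists>rs. rs \<noteq> [] \<and> (\<forall>r\<in>set rs. 0 \<le> r) \<and> (0 < N \<longrightarrow> cdf (emp rs) = esd (A N \<omega> * W N \<omega>) \<and>
      (\<forall>x>0. gam (emp rs) x = 1 - x * T N x \<omega> / real N))" for N
    proof (cases "N = 0")
      case True
      \<comment> \<open>A dummy spectrum at \<open>N = 0\<close>; any nonempty list of nonnegative
        numbers would do.\<close>
      then show ?thesis by (intro exI[of _ "[1]"]) auto
    next
      case False
      then have N: "N > 0" by simp
      from hnd_mult_spectrum(2)[OF hA[OF N \<omega>] hW[OF N \<omega>] N] show ?thesis unfolding T_def by blast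
    qed
    then obtain rs where rs: "\<And>N. rs N \<noteq> []" "\<And>N r. r \<in> set (rs N) \<Longrightarrow> 0 \<le> r"
      "\<And>N. 0 < N \<Longrightarrow> cdf (emp (rs N)) = esd (A N \<omega> * W N \<omega>)"
      "\<And>N x. 0 < N \<Longrightarrow> 0 < x \<Longrightarrow> gam (emp (rs N)) x = 1 - x * T N x \<omega> / real N"
      by metis
    have gl: "(\<lambda>N. gam (emp (rs N)) r) \<longlonglongrightarrow> m r" if r: "r \<in> \<rat>" "0 < r" for r
    proof -
      define e where "e N = integral\<^sup>L (PiM {..<L N} (Q N)) (column_model.tr_rsv N (L N) r (A N \<omega>))" for N
      define mv where "mv N = column_model.mean_v N (L N) (Q N) r (A N \<omega>)" for N
      have conc: "(\<lambda>N. (T N r \<omega> - e N) / real N) \<longlonglongrightarrow> 0" using elim(2) r unfolding e_def by blast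
      have mv: "mv \<longlonglongrightarrow> v r"
        unfolding mv_def using elim(1) by (intro mean_v_tendsto[OF cm hA[OF _ \<omega>] FA _ lim r(2) v(1)[OF r(2)] v(3)[OF r(2)]]) auto
      \<comment> \<open>The trace is split into its deviation from the mean over \<open>W\<close>,
        which vanishes in the limit, and that mean, which is recovered from \<open>mean_v\<close> by
        inverting its definition.\<close>
      have "(\<lambda>N. 1 - (r * ((T N r \<omega> - e N) / real N) + (mv N - 1 + real N / real (L N)) / (real N / real (L N)))) \<longlonglongrightarrow>
          1 - (r * 0 + (v r - 1 + c) / c)"
        using c by (intro tendsto_intros conc mv lim) auto
      also have "1 - (r * 0 + (v r - 1 + c) / c) = m r" using c by (simp add: m_def field_simps)
      finally show ?thesis
      proof (rule Lim_transform_eventually)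
        show "\<forall>\<^sub>F N in sequentially. 1 - (r * ((T N r \<omega> - e N) / real N) + (mv N - 1 + real N / real (L N)) / (real N / real (L N))) = gam (emp (rs N)) r"
          using eventually_gt_at_top[of 0]
        proof eventually_elim
          case (elim N)
          have "mv N - 1 + real N / real (L N) = r * e N / real (L N)"
            unfolding mv_def e_def column_model.mean_v_def[OF cm[OF elim]] by simp
          then have "(mv N - 1 + real N / real (L N)) / (real N / real (L N)) = r * e N / real N"
            using elim L[OF elim] by simp
          moreover have "r * ((T N r \<omega> - e N) / real N) + r * e N / real N = r * T N r \<omega> / real N"
            by (simp add: right_diff_distrib diff_divide_distrib)
          ultimately show ?case unfolding rs(4)[OF elim r(2)] by (simp only:)
        qed
      qed
    qed
    have neg: "measure (emp (rs N)) {..<0} = 0" for N using rs(1,2) by (rule measure_emp_neg)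
    have "\<exists>F. real_distribution F \<and> measure F {..<0} = 0 \<and> weak_conv_m (\<lambda>N. emp (rs N)) F \<and> (\<forall>r\<in>\<rat>. 0 < r \<longrightarrow> gam F r = m r)"
      using real_distribution_emp neg gl msmall by (rule gam_convergence_imp_weak)
    then obtain F where F: "real_distribution F" "measure F {..<0} = 0" "weak_conv_m (\<lambda>N. emp (rs N)) F" "\<forall>r\<in>\<rat>. 0 < r \<longrightarrow> gam F r = m r"
      by blast
    have "weak_conv (\<lambda>N. esd (A N \<omega> * W N \<omega>)) (cdf F)"
      unfolding weak_conv_def
    proof (intro allI impI)
      fix t assume "isCont (cdf F) t"
      then have "(\<lambda>N. cdf (emp (rs N)) t) \<longlonglongrightarrow> cdf F t" using F(3) by (simp add: weak_conv_m_def weak_conv_def)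
      then show "(\<lambda>N. esd (A N \<omega> * W N \<omega>) t) \<longlonglongrightarrow> cdf F t"
      proof (rule Lim_transform_eventually)
        show "\<forall>\<^sub>F N in sequentially. cdf (emp (rs N)) t = esd (A N \<omega> * W N \<omega>) t"
          using eventually_gt_at_top[of 0] by eventually_elim (simp add: rs(3))
      qed
    qed
    then show ?case using F unfolding good_def by blast
  qed
  \<comment> \<open>An almost sure event in a probability space is nonempty, so some outcome
    provides \<open>FB\<close>.\<close>
  obtain \<omega>0 FB where FB: "good \<omega>0 FB" using eventually_happens'[OF ae_filter_bot ae] by blast
  have uniq: "F = FB" if "good \<omega> F" for \<omega> F
    using that FB unfolding good_def by (intro gam_determines) auto
  have "FB \<in> algebraic_distributions"
  proof (rule algebraic_transfer[OF assms(4) _ sA])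
    show "real_distribution FB" "measure FB {..<0} = 0" using FB by (auto simp: good_def)
    fix r :: real assume r: "r \<in> \<rat>" "0 < r"
    have g: "gam FB r = m r" using FB r by (auto simp: good_def)
    have "1 - c * gam FB r = v r" using c by (simp add: g m_def)
    then show "0 < 1 - c * gam FB r \<and> gam FA (r / (1 - c * gam FB r)) = gam FB r"
      using v(1)[OF r(2)] m[OF r(2)] g by simp
  qed
  moreover have "esd_limit P (\<lambda>N \<omega>. A N \<omega> * W N \<omega>) FB"
    unfolding esd_limit_def
  proof (intro conjI allI impI ballI)
    fix N :: nat assume N: "0 < N"
    have "mat_measurable P N N (A N)" "mat_measurable P N N (W N)"
      using ind[OF N] by (auto simp: mat_measurable_iff[symmetric] dest: indep_var_rv1 indep_var_rv2)
    then show "random_matrix P N N (\<lambda>\<omega>. A N \<omega> * W N \<omega>)"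
      unfolding random_matrix_def mat_measurable_iff by (rule mat_measurable_mult)
    show "real_eigenvalues (A N \<omega> * W N \<omega>)" if "\<omega> \<in> space P" for \<omega>
      using hA[OF N that] hW[OF N that] N by (rule hnd_mult_spectrum(1))
  next
    show "real_distribution FB" using FB by (simp add: good_def)
    show "AE \<omega> in P. weak_conv (\<lambda>N. esd (A N \<omega> * W N \<omega>)) (cdf FB)"
      using ae
    proof eventually_elim
      case (elim \<omega>)
      then obtain F where "good \<omega> F" by blast
      then show ?case using uniq[of \<omega> F] by (simp add: good_def)
    qed
  qed
  ultimately show ?thesis by blast
qed

end
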